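(* Let $D$ be a finite set, $T$ a complex torus of rank $|D|$, and $(\mathfrak X,\phi,X)$ a homogeneously suitable for $D$-lifting scheme, with $\phi:T\times Y\to\mathfrak X$. Let $t$ be a seed of $\mathbb C(Y)$ of maximal rank such that $\overline{\mathcal A}(t)=\mathcal O_Y(Y)$, such that for all distinct $i,j\in I_{uf}$ the functions $x_i,x_j$ are coprime on $Y$, and such that for all $k\in I_{uf}$ the functions $x_k$ and $\mu_k(x_k)$ are coprime on $Y$. Let ${\uparrow}t^D$ be the minimal monomial lifting of $t$ with respect to $(\mathfrak X,\phi,X)$, and let $s:\mathcal O_{\mathfrak X}(\mathfrak X)\to\mathcal O_Y(Y)$ be the restriction map, i.e. the pullback along $Y\to\mathfrak X$, $y\mapsto\phi(e,y)$. Let $\widetilde t$ be a $D$-pointed seed extension of $t$, in the field $\mathbb C(\mathfrak X)$, such that (1) for every $i\in I$, $s(\widetilde x_i)=x_i$ and $\widetilde x_i$ is $X(T)$-homogeneous with respect to the $T$-action on $\mathfrak X$; (2) for every $k\in I_{uf}$, $s(\mu_k(\widetilde x_k))=\mu_k(x_k)$ and $\mu_k(\widetilde x_k)$ is $X(T)$-homogeneous; (3) $\overline{\mathcal A}(\widetilde t)=\mathcal O_{\mathfrak X}(\mathfrak X)$. Then $\widetilde t={\uparrow}t^D$. Moreover, if $\widetilde t$ is endowed with an $X(T)$-degree configuration $\widetilde\sigma$ such that the equality in (3) is an equality of $X(T)$-graded algebras, then $\widetilde t={\uparrow}t^D$ as graded seeds, where ${\uparrow}t^D$ is graded by ${\u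parrow}0$.
   Context: Cluster conventions. A seed $t$ of a field extension $\mathbb K$ of $\mathbb C$ is a tuple $(I_{uf},I_{sf},I_{hf},B,x)$: disjoint finite sets of unfrozen (mutable), semi-frozen and highly-frozen vertices, $I=I_{uf}\sqcup I_{sf}\sqcup I_{hf}$, $I_f=I_{sf}\sqcup I_{hf}$; an integer matrix $B=(b_{i,j})\in\mathbb Z^{I\times I_{uf}}$ whose restriction to $I_{uf}\times I_{uf}$ is skew-symmetrizable; and $x=(x_i)_{i\in I}\in(\mathbb K^* )^I$ a transcendence basis of $\mathbb K$ over $\mathbb C$. Write $b^+=\max(b,0)$, $b^-=\max(-b,0)$. For $k\in I_{uf}$, the mutation $\mu_k(t)$ has the same vertex sets, matrix $b'_{i,j}=-b_{i,j}$ if $i=k$ or $j=k$, $b'_{i,j}=b_{i,j}+b_{i,k}^+b_{k,j}^+-b_{i,k}^-b_{k,j}^-$ otherwise, and cluster $x'_i=x_i$ for $i\neq k$, $x_k'=\mu_k(x_k)=x_k^{-1}\bigl(\prod_ix_i^{b_{i,k}^+}+\prod_ix_i^{b_{i,k}^-}\bigr)$. Seeds related by finitely many mutations are equivalent ($\sim$). $\mathcal L(t)=\mathbb C[x_i]_{i\in I_{hf}}[x_i^{\pm1}]_{i\in I_{sf}\sqcup I_{uf}}$ and $\overline{\mathcal A}(t)=\bigcap_{t'\sim t}\mathcal L(t')$. The seed is of maximal rank if $B$ is. For an abelian group $H$, an $H$-degree configuration on $t$ is $\sigma\in H^I$ with $\sum_ib_{i,k}^+\sigma_i=\sum_ib_{i,k}^-\sigma_i$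 for all $k\in I_{uf}$; it grades $\mathcal L(t)$ by $\deg x_i=\sigma_i$, and $\overline{\mathcal A}(t)$ is a graded subalgebra. Geometric conventions. $V(f)$ is the zero locus of a global function $f$. On a normal integral scheme, a closed irreducible subset of codimension one gives a discrete valuation of the function field. Functions $f,g$ on $Z$ are coprime on $Z$ if no codimension-one point of $Z$ lies in $V(f)\cap V(g)$. An open subset is big if it contains all codimension-one points. Suitable for $D$-lifting: a triple $(\mathfrak X,\phi,X)$ such that (1) $\mathfrak X$ is a noetherian normal integral $\mathbb C$-scheme; (2) $X=(X_d)_{d\in D}\in\mathcal O_{\mathfrak X}(\mathfrak X)^D$, each $V(X_d)$ is irreducible and, if $\mathcal V_d$ is the associated valuation on $\mathbb C(\mathfrak X)$, then $\mathcal V_{d_1}(X_{d_2})=\delta_{d_1,d_2}$; (3) $\phi:T\times Y\to\mathfrak X\setminus\bigcup_dV(X_d)$ is an open embedding with big image and $\phi^*(X_d)=x_d\otimes1$, where $(x_d)_d$ is a basis of the character group $X(T)$; here $Y$ is an irreducible $\mathbb C$-scheme. One identifies $T\times Y$ with an open subset of $\mathfrak X$ via $\phi$, and $\mathbb C(Y)$ with $1\otimes\mathbb C(Y)\subseteq\mathbb C(\mathfrak X)$. It is homogeneously suitable for $D$-lifting if the $T$-action on $T\times Y$ by multiplication on the first factor extends to an action on $\mathfrak X$. A function $f$ is $X(T)$-homogeneous of degree $\lambda\in X(T)$ if its pullback under the action map $T\times\mathfrak X\to\mathfrak X$ is $\lambda\otimes f$. $\mathbb Z^D$ is identified with $X(T)$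 by $e_d\mapsto x_d$. Minimal monomial lifting. (Assume $I\cap D=\emptyset$.) The minimal lifting matrix is $\nu\in\mathbb Z^{D\times I}$, $\nu_{d,i}=-\mathcal V_d(1\otimes x_i)$. The minimal monomial lifting ${\uparrow}t^D$ is the seed of $\mathbb C(\mathfrak X)$ with mutable vertices $I_{uf}$, semi-frozen vertices $I_{sf}$, highly-frozen vertices $I_{hf}\sqcup D$, exchange matrix $\begin{pmatrix}B\\-\nu B\end{pmatrix}$, cluster ${\uparrow}x_i=(1\otimes x_i)\prod_dX_d^{\nu_{d,i}}$ ($i\in I$), ${\uparrow}x_d=X_d$ ($d\in D$). Its canonical $\mathbb Z^D=X(T)$-degree configuration ${\uparrow}0$ is ${\uparrow}0_i=\nu_{\bullet,i}=(\nu_{d,i})_{d}$ for $i\in I$, ${\uparrow}0_d=e_d$ for $d\in D$. A $D$-pointed seed extension of $t$ in $\mathbb C(\mathfrak X)$ is a seed $\widetilde t$ of $\mathbb C(\mathfrak X)$ with $\widetilde I_{uf}=I_{uf}$, $I_{sf}\subseteq\widetilde I_{sf}$, $I_{hf}\subseteq\widetilde I_{hf}$, $\widetilde I_f\setminus I_f=D$, $\widetilde B_{I\times I_{uf}}=B$ and $\widetilde x_d=X_d$ for $d\in D$. *)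

theory Defs
  imports
    "HOL-Analysis.Abstract_Topology"
    "HOL-Algebra.Algebra"
    Complex_Main
begin

section \<open>Algebra over the complex numbers\<close>

definition complex_ring :: "complex ring" where
  "complex_ring = \<lparr>carrier = UNIV, monoid.mult = (*), one = 1, ring.zero = 0, add = (+)\<rparr>"

text \<open>A complex algebra is a ring \<open>R\<close> together with a homomorphism \<open>c\<close> from the complex numbers.\<close>

definition lin_indep :: "'r ring \<Rightarrow> (complex \<Rightarrow> 'r) \<Rightarrow> 'i set \<Rightarrow> ('i \<Rightarrow> 'r) \<Rightarrow> bool" where
  "lin_indep R c J f \<longleftrightarrow>
     (\<forall>M a. finite M \<and> M \<subseteq> J \<and> (\<Oplus>\<^bsub>R\<^esub>m\<in>M. c (a m) \<otimes>\<^bsub>R\<^esub> f m) = \<zero>\<^bsub>R\<^esub> \<longrightarrow> (\<forall>m\<in>M. a m = 0))"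

definition lin_span :: "'r ring \<Rightarrow> (complex \<Rightarrow> 'r) \<Rightarrow> 'i set \<Rightarrow> ('i \<Rightarrow> 'r) \<Rightarrow> 'r set" where
  "lin_span R c J f = {\<Oplus>\<^bsub>R\<^esub>m\<in>M. c (a m) \<otimes>\<^bsub>R\<^esub> f m | M a. finite M \<and> M \<subseteq> J}"

definition monomial :: "'r ring \<Rightarrow> 'v set \<Rightarrow> ('v \<Rightarrow> 'r) \<Rightarrow> ('v \<Rightarrow> int) \<Rightarrow> 'r" where
  "monomial R I x m = (\<Otimes>\<^bsub>R\<^esub>i\<in>I. x i [^]\<^bsub>R\<^esub> m i)"

text \<open>The group \<open>\<int>\<^sup>J\<close>, as integer functions vanishing off \<open>J\<close>.\<close>

definition lattice_on :: "'v set \<Rightarrow> ('v \<Rightarrow> int) set" where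
  "lattice_on J = {m. \<forall>j. j \<notin> J \<longrightarrow> m j = 0}"

text \<open>\<open>h : A \<rightarrow> B\<close> exhibits \<open>B\<close> as the localization of \<open>A\<close> at the multiplicative set \<open>S\<close>.\<close>

definition is_localization :: "'a ring \<Rightarrow> 'a set \<Rightarrow> 'b ring \<Rightarrow> ('a \<Rightarrow> 'b) \<Rightarrow> bool" where
  "is_localization A S B h \<longleftrightarrow>
     h \<in> ring_hom A B \<and> h ` S \<subseteq> Units B \<and>
     (\<forall>b\<in>carrier B. \<exists>a\<in>carrier A. \<exists>s\<in>S. b \<otimes>\<^bsub>B\<^esub> h s = h a) \<and>
     (\<forall>a\<in>carrier A. h a = \<zero>\<^bsub>B\<^esub> \<longrightarrow> (\<exists>s\<in>S. s \<otimes>\<^bsub>A\<^esub> a = \<zero>\<^bsub>A\<^esub>))"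

text \<open>
  \<open>\<alpha> : A \<rightarrow> R\<close> and \<open>\<beta> : B \<rightarrow> R\<close> exhibit \<open>R\<close> as the tensor product of \<open>A\<close> and \<open>B\<close> over the complex
  numbers: the map \<open>a \<otimes> b \<mapsto> \<alpha> a \<cdot> \<beta> b\<close> is surjective (first conjunct) and injective (second
  conjunct: every tensor can be written with linearly independent left factors, and it is then
  zero only if all right factors are zero).
\<close>

definition is_tensor_product ::
  "'a ring \<Rightarrow> (complex \<Rightarrow> 'a) \<Rightarrow> 'b ring \<Rightarrow> 'r ring \<Rightarrow> ('a \<Rightarrow> 'r) \<Rightarrow> ('b \<Rightarrow> 'r) \<Rightarrow> bool" where
  "is_tensor_product A c B R \<alpha> \<beta> \<longleftrightarrow>
     (\<forall>r\<in>carrier R. \<exists>(n::nat) a b. a \<in> {..<n} \<rightarrow> carrier A \<and> b \<in> {..<n} \<rightarrow> carrier B \<and>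
        r = (\<Oplus>\<^bsub>R\<^esub>i\<in>{..<n}. \<alpha> (a i) \<otimes>\<^bsub>R\<^esub> \<beta> (b i))) \<and>
     (\<forall>(n::nat) a b. a \<in> {..<n} \<rightarrow> carrier A \<and> b \<in> {..<n} \<rightarrow> carrier B \<and> lin_indep A c {..<n} a \<and>
        (\<Oplus>\<^bsub>R\<^esub>i\<in>{..<n}. \<alpha> (a i) \<otimes>\<^bsub>R\<^esub> \<beta> (b i)) = \<zero>\<^bsub>R\<^esub> \<longrightarrow> (\<forall>i<n. b i = \<zero>\<^bsub>B\<^esub>))"

definition local_ring :: "'r ring \<Rightarrow> bool" where
  "local_ring R \<longleftrightarrow> cring R \<and> (\<exists>!m. maximalideal m R)"

text \<open>
  A domain is integrally closed if every fraction \<open>a / b\<close> that is a root of a monic polynomial of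
  degree \<open>n > 0\<close> with coefficients \<open>r i\<close> lies in it; the equation is multiplied by \<open>b\<^sup>n\<close>.
\<close>

definition integrally_closed :: "'r ring \<Rightarrow> bool" where
  "integrally_closed R \<longleftrightarrow> domain R \<and>
     (\<forall>a\<in>carrier R. \<forall>b\<in>carrier R - {\<zero>\<^bsub>R\<^esub>}. \<forall>n>0. \<forall>r\<in>{..<n} \<rightarrow> carrier R.
        a [^]\<^bsub>R\<^esub> (n::nat) \<oplus>\<^bsub>R\<^esub> (\<Oplus>\<^bsub>R\<^esub>i\<in>{..<n}. r i \<otimes>\<^bsub>R\<^esub> (a [^]\<^bsub>R\<^esub> i \<otimes>\<^bsub>R\<^esub> b [^]\<^bsub>R\<^esub> (n - i))) = \<zero>\<^bsub>R\<^esub>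
        \<longrightarrow> (\<exists>q\<in>carrier R. a = q \<otimes>\<^bsub>R\<^esub> b))"


section \<open>Ringed spaces over the complex numbers\<close>

record ('p, 's) ringed_space =
  Sp :: "'p topology"
  Sec :: "'p set \<Rightarrow> 's ring"
  Res :: "'p set \<Rightarrow> 'p set \<Rightarrow> 's \<Rightarrow> 's"  \<comment> \<open>\<open>Res U V\<close> restricts from \<open>U\<close> to \<open>V\<close>\<close>
  Cst :: "'p set \<Rightarrow> complex \<Rightarrow> 's"

abbreviation points :: "('p, 's) ringed_space \<Rightarrow> 'p set" where
  "points \<XX> \<equiv> topspace (Sp \<XX>)"

abbreviation glob :: "('p, 's) ringed_space \<Rightarrow> 's ring" where
  "glob \<XX> \<equiv> Sec \<XX> (points \<XX>)"

definition presheaf :: "('p, 's) ringed_space \<Rightarrow> bool" where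
  "presheaf \<XX> \<longleftrightarrow>
     (\<forall>U. openin (Sp \<XX>) U \<longrightarrow>
        cring (Sec \<XX> U) \<and> Cst \<XX> U \<in> ring_hom complex_ring (Sec \<XX> U) \<and>
        (\<forall>s\<in>carrier (Sec \<XX> U). Res \<XX> U U s = s)) \<and>
     (\<forall>U V. openin (Sp \<XX>) U \<and> openin (Sp \<XX>) V \<and> V \<subseteq> U \<longrightarrow>
        Res \<XX> U V \<in> ring_hom (Sec \<XX> U) (Sec \<XX> V) \<and> (\<forall>z. Res \<XX> U V (Cst \<XX> U z) = Cst \<XX> V z)) \<and>
     (\<forall>U V W. openin (Sp \<XX>) U \<and> openin (Sp \<XX>) V \<and> openin (Sp \<XX>) W \<and> W \<subseteq> V \<and> V \<subseteq> U \<longrightarrow>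
        (\<forall>s\<in>carrier (Sec \<XX> U). Res \<XX> V W (Res \<XX> U V s) = Res \<XX> U W s))"

definition sheaf :: "('p, 's) ringed_space \<Rightarrow> bool" where
  "sheaf \<XX> \<longleftrightarrow> presheaf \<XX> \<and>
     (\<forall>\<U> s. (\<forall>V\<in>\<U>. openin (Sp \<XX>) V \<and> s V \<in> carrier (Sec \<XX> V)) \<and>
            (\<forall>V\<in>\<U>. \<forall>W\<in>\<U>. Res \<XX> V (V \<inter> W) (s V) = Res \<XX> W (V \<inter> W) (s W)) \<longrightarrow>
        (\<exists>!t. t \<in> carrier (Sec \<XX> (\<Union>\<U>)) \<and> (\<forall>V\<in>\<U>. Res \<XX> (\<Union>\<U>) V t = s V)))"

text \<open>Germs of sections as equivalence classes, and the stalk (direct limit) at a point.\<close>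

definition germ :: "('p, 's) ringed_space \<Rightarrow> 'p \<Rightarrow> 'p set \<Rightarrow> 's \<Rightarrow> ('p set \<times> 's) set" where
  "germ \<XX> x U s = {(V, t). openin (Sp \<XX>) V \<and> x \<in> V \<and> t \<in> carrier (Sec \<XX> V) \<and>
     (\<exists>W. openin (Sp \<XX>) W \<and> x \<in> W \<and> W \<subseteq> U \<inter> V \<and> Res \<XX> U W s = Res \<XX> V W t)}"

definition stalk :: "('p, 's) ringed_space \<Rightarrow> 'p \<Rightarrow> ('p set \<times> 's) set ring" where
  "stalk \<XX> x =
    \<lparr>carrier = {germ \<XX> x U s | U s. openin (Sp \<XX>) U \<and> x \<in> U \<and> s \<in> carrier (Sec \<XX> U)},
     monoid.mult = (\<lambda>a b. THE g. \<exists>U s t. openin (Sp \<XX>) U \<and> x \<in> U \<and> s \<in> carrier (Sec \<XX> U) \<and>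
        t \<in> carrier (Sec \<XX> U) \<and> a = germ \<XX> x U s \<and> b = germ \<XX> x U t \<and>
        g = germ \<XX> x U (s \<otimes>\<^bsub>Sec \<XX> U\<^esub> t)),
     one = germ \<XX> x (points \<XX>) \<one>\<^bsub>glob \<XX>\<^esub>,
     ring.zero = germ \<XX> x (points \<XX>) \<zero>\<^bsub>glob \<XX>\<^esub>,
     add = (\<lambda>a b. THE g. \<exists>U s t. openin (Sp \<XX>) U \<and> x \<in> U \<and> s \<in> carrier (Sec \<XX> U) \<and>
        t \<in> carrier (Sec \<XX> U) \<and> a = germ \<XX> x U s \<and> b = germ \<XX> x U t \<and>
        g = germ \<XX> x U (s \<oplus>\<^bsub>Sec \<XX> U\<^esub> t))\<rparr>"

definition locally_ringed :: "('p, 's) ringed_space \<Rightarrow> bool" where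
  "locally_ringed \<XX> \<longleftrightarrow> sheaf \<XX> \<and> (\<forall>x\<in>points \<XX>. local_ring (stalk \<XX> x))"

text \<open>The zero locus of a global function: the points at which its germ lies in the maximal ideal.\<close>

definition zero_locus :: "('p, 's) ringed_space \<Rightarrow> 's \<Rightarrow> 'p set" where
  "zero_locus \<XX> f = {x \<in> points \<XX>. germ \<XX> x (points \<XX>) f \<notin> Units (stalk \<XX> x)}"

record ('p, 's, 'q, 'r) morph =
  pt :: "'p \<Rightarrow> 'q"
  pull :: "'q set \<Rightarrow> 'r \<Rightarrow> 's"  \<comment> \<open>\<open>pull f V\<close> maps sections on \<open>V\<close> to sections on the preimage\<close>

definition preim :: "('p, 's) ringed_space \<Rightarrow> ('p, 's, 'q, 'r) morph \<Rightarrow> 'q set \<Rightarrow> 'p set" where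
  "preim \<XX> f V = {x \<in> points \<XX>. pt f x \<in> V}"

definition mor :: "('p, 's) ringed_space \<Rightarrow> ('q, 'r) ringed_space \<Rightarrow> ('p, 's, 'q, 'r) morph \<Rightarrow> bool" where
  "mor \<XX> Y f \<longleftrightarrow> continuous_map (Sp \<XX>) (Sp Y) (pt f) \<and>
     (\<forall>V. openin (Sp Y) V \<longrightarrow>
        pull f V \<in> ring_hom (Sec Y V) (Sec \<XX> (preim \<XX> f V)) \<and>
        (\<forall>z. pull f V (Cst Y V z) = Cst \<XX> (preim \<XX> f V) z)) \<and>
     (\<forall>V W. openin (Sp Y) V \<and> openin (Sp Y) W \<and> W \<subseteq> V \<longrightarrow>
        (\<forall>s\<in>carrier (Sec Y V).
           pull f W (Res Y V W s) = Res \<XX> (preim \<XX> f V) (preim \<XX> f W) (pull f V s))) \<and>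
     (\<forall>x\<in>points \<XX>. \<forall>V. openin (Sp Y) V \<and> pt f x \<in> V \<longrightarrow>
        (\<forall>s\<in>carrier (Sec Y V).
           germ \<XX> x (preim \<XX> f V) (pull f V s) \<in> Units (stalk \<XX> x) \<longrightarrow>
           germ Y (pt f x) V s \<in> Units (stalk Y (pt f x))))"

text \<open>Equality of morphisms, disregarding values outside the spaces and the section rings.\<close>

definition mor_eq ::
  "('p, 's) ringed_space \<Rightarrow> ('q, 'r) ringed_space \<Rightarrow>
   ('p, 's, 'q, 'r) morph \<Rightarrow> ('p, 's, 'q, 'r) morph \<Rightarrow> bool" where
  "mor_eq \<XX> Y f g \<longleftrightarrow> (\<forall>x\<in>points \<XX>. pt f x = pt g x) \<and>
     (\<forall>V. openin (Sp Y) V \<longrightarrow> (\<forall>s\<in>carrier (Sec Y V). pull f V s = pull g V s))"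

definition mor_id :: "('p, 's, 'p, 's) morph" where
  "mor_id = \<lparr>pt = (\<lambda>x. x), pull = (\<lambda>V s. s)\<rparr>"

text \<open>The composite \<open>g \<circ> f\<close> of \<open>f : \<XX> \<rightarrow> Y\<close> and \<open>g : Y \<rightarrow> Z\<close>; the first argument is \<open>Y\<close>.\<close>

definition mor_comp ::
  "('q, 'r) ringed_space \<Rightarrow> ('q, 'r, 'z, 'w) morph \<Rightarrow> ('p, 's, 'q, 'r) morph \<Rightarrow> ('p, 's, 'z, 'w) morph" where
  "mor_comp Y g f = \<lparr>pt = pt g \<circ> pt f, pull = (\<lambda>V s. pull f (preim Y g V) (pull g V s))\<rparr>"

abbreviation gpull :: "('q, 'r) ringed_space \<Rightarrow> ('p, 's, 'q, 'r) morph \<Rightarrow> 'r \<Rightarrow> 's" where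
  "gpull Y f \<equiv> pull f (points Y)"

definition open_immersion ::
  "('p, 's) ringed_space \<Rightarrow> ('q, 'r) ringed_space \<Rightarrow> ('p, 's, 'q, 'r) morph \<Rightarrow> bool" where
  "open_immersion \<XX> Y f \<longleftrightarrow> mor \<XX> Y f \<and> openin (Sp Y) (pt f ` points \<XX>) \<and>
     homeomorphic_map (Sp \<XX>) (subtopology (Sp Y) (pt f ` points \<XX>)) (pt f) \<and>
     (\<forall>V. openin (Sp Y) V \<and> V \<subseteq> pt f ` points \<XX> \<longrightarrow>
        bij_betw (pull f V) (carrier (Sec Y V)) (carrier (Sec \<XX> (preim \<XX> f V))))"


section \<open>Schemes over the complex numbers\<close>

definition prime_spectrum :: "'r ring \<Rightarrow> 'r set set" where
  "prime_spectrum A = {p. primeideal p A}"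

definition spec_topology :: "'r ring \<Rightarrow> 'r set topology" where
  "spec_topology A = topology_generated_by ((\<lambda>f. {p \<in> prime_spectrum A. f \<notin> p}) ` carrier A)"

text \<open>
  An open subset \<open>U\<close> is affine if it is isomorphic to the spectrum of \<open>A = \<O>(U)\<close>; the structure sheaf
  of the spectrum is determined by its values on the distinguished open subsets, where it is the
  localization of \<open>A\<close> at the powers of \<open>f\<close>.
\<close>

definition affine_open :: "('p, 's) ringed_space \<Rightarrow> 'p set \<Rightarrow> bool" where
  "affine_open \<XX> U \<longleftrightarrow> openin (Sp \<XX>) U \<and>
     (\<exists>\<pi>. homeomorphic_map (subtopology (Sp \<XX>) U) (spec_topology (Sec \<XX> U)) \<pi> \<and>
        (\<forall>f\<in>carrier (Sec \<XX> U).
           is_localization (Sec \<XX> U) {f [^]\<^bsub>Sec \<XX> U\<^esub> n | n::nat. True}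
             (Sec \<XX> {x \<in> U. f \<notin> \<pi> x}) (Res \<XX> U {x \<in> U. f \<notin> \<pi> x})))"

definition cscheme :: "('p, 's) ringed_space \<Rightarrow> bool" where
  "cscheme \<XX> \<longleftrightarrow> locally_ringed \<XX> \<and> (\<forall>x\<in>points \<XX>. \<exists>U. affine_open \<XX> U \<and> x \<in> U)"

definition noetherian_scheme :: "('p, 's) ringed_space \<Rightarrow> bool" where
  "noetherian_scheme \<XX> \<longleftrightarrow> cscheme \<XX> \<and> compact_space (Sp \<XX>) \<and>
     (\<forall>x\<in>points \<XX>. \<exists>U. affine_open \<XX> U \<and> x \<in> U \<and> noetherian_ring (Sec \<XX> U))"

definition normal_scheme :: "('p, 's) ringed_space \<Rightarrow> bool" where
  "normal_scheme \<XX> \<longleftrightarrow> cscheme \<XX> \<and> (\<forall>x\<in>points \<XX>. integrally_closed (stalk \<XX> x))"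

definition integral_scheme :: "('p, 's) ringed_space \<Rightarrow> bool" where
  "integral_scheme \<XX> \<longleftrightarrow> cscheme \<XX> \<and> points \<XX> \<noteq> {} \<and>
     (\<forall>U. openin (Sp \<XX>) U \<and> U \<noteq> {} \<longrightarrow> domain (Sec \<XX> U))"

definition irreducible_subset :: "('p, 's) ringed_space \<Rightarrow> 'p set \<Rightarrow> bool" where
  "irreducible_subset \<XX> Z \<longleftrightarrow> Z \<subseteq> points \<XX> \<and> Z \<noteq> {} \<and>
     (\<forall>C C'. closedin (Sp \<XX>) C \<and> closedin (Sp \<XX>) C' \<and> Z \<subseteq> C \<union> C' \<longrightarrow> Z \<subseteq> C \<or> Z \<subseteq> C')"

definition irreducible_scheme :: "('p, 's) ringed_space \<Rightarrow> bool" where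
  "irreducible_scheme \<XX> \<longleftrightarrow> cscheme \<XX> \<and> irreducible_subset \<XX> (points \<XX>)"

definition generic_point :: "('p, 's) ringed_space \<Rightarrow> 'p set \<Rightarrow> 'p" where
  "generic_point \<XX> Z = (THE x. x \<in> points \<XX> \<and> Sp \<XX> closure_of {x} = Z)"

text \<open>On an irreducible scheme: the only proper generization of \<open>x\<close> is the generic point.\<close>

definition codim_one_point :: "('p, 's) ringed_space \<Rightarrow> 'p \<Rightarrow> bool" where
  "codim_one_point \<XX> x \<longleftrightarrow> x \<in> points \<XX> \<and> x \<noteq> generic_point \<XX> (points \<XX>) \<and>
     (\<forall>y\<in>points \<XX>. x \<in> Sp \<XX> closure_of {y} \<longrightarrow> y = x \<or> y = generic_point \<XX> (points \<XX>))"

definition coprime_on :: "('p, 's) ringed_space \<Rightarrow> 's \<Rightarrow> 's \<Rightarrow> bool" where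
  "coprime_on \<XX> f g \<longleftrightarrow> (\<forall>x. codim_one_point \<XX> x \<longrightarrow> x \<notin> zero_locus \<XX> f \<inter> zero_locus \<XX> g)"

text \<open>
  \<open>U\<close> is a big open subset of the open subset \<open>W\<close>; the codimension-one points of \<open>W\<close> are those of
  the ambient scheme that lie in \<open>W\<close>.
\<close>

definition big_open_in :: "('p, 's) ringed_space \<Rightarrow> 'p set \<Rightarrow> 'p set \<Rightarrow> bool" where
  "big_open_in \<XX> W U \<longleftrightarrow> openin (Sp \<XX>) U \<and> U \<subseteq> W \<and> (\<forall>x\<in>W. codim_one_point \<XX> x \<longrightarrow> x \<in> U)"

definition function_field :: "('p, 's) ringed_space \<Rightarrow> ('p set \<times> 's) set ring" where
  "function_field \<XX> = stalk \<XX> (generic_point \<XX> (points \<XX>))"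

abbreviation ff_germ :: "('p, 's) ringed_space \<Rightarrow> 'p set \<Rightarrow> 's \<Rightarrow> ('p set \<times> 's) set" where
  "ff_germ \<XX> \<equiv> germ \<XX> (generic_point \<XX> (points \<XX>))"

abbreviation ff_of :: "('p, 's) ringed_space \<Rightarrow> 's \<Rightarrow> ('p set \<times> 's) set" where
  "ff_of \<XX> \<equiv> ff_germ \<XX> (points \<XX>)"

definition ff_const :: "('p, 's) ringed_space \<Rightarrow> complex \<Rightarrow> ('p set \<times> 's) set" where
  "ff_const \<XX> z = ff_of \<XX> (Cst \<XX> (points \<XX>) z)"

text \<open>The map induced on function fields by a dominant morphism \<open>f : \<XX> \<rightarrow> Y\<close>.\<close>

definition ff_pull ::
  "('p, 's) ringed_space \<Rightarrow> ('q, 'r) ringed_space \<Rightarrow> ('p, 's, 'q, 'r) morph \<Rightarrow>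
   ('q set \<times> 'r) set \<Rightarrow> ('p set \<times> 's) set" where
  "ff_pull \<XX> Y f g = (THE h. \<exists>V s. openin (Sp Y) V \<and> generic_point Y (points Y) \<in> V \<and>
      s \<in> carrier (Sec Y V) \<and> g = ff_germ Y V s \<and> h = ff_germ \<XX> (preim \<XX> f V) (pull f V s))"

text \<open>The local ring at \<open>x\<close>, as a subring of the function field.\<close>

definition local_subring :: "('p, 's) ringed_space \<Rightarrow> 'p \<Rightarrow> ('p set \<times> 's) set ring" where
  "local_subring \<XX> x = (function_field \<XX>)
     \<lparr>carrier := {ff_germ \<XX> U s | U s. openin (Sp \<XX>) U \<and> x \<in> U \<and> s \<in> carrier (Sec \<XX> U)}\<rparr>"

definition uniformizer :: "'r ring \<Rightarrow> 'r \<Rightarrow> bool" where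
  "uniformizer R \<pi> \<longleftrightarrow> \<pi> \<in> carrier R - {\<zero>\<^bsub>R\<^esub>} \<and> carrier R - Units R = PIdl\<^bsub>R\<^esub> \<pi>"

text \<open>The discrete valuation at a codimension-one point, meaningful on nonzero rational functions.\<close>

definition valuation_at :: "('p, 's) ringed_space \<Rightarrow> 'p \<Rightarrow> ('p set \<times> 's) set \<Rightarrow> int" where
  "valuation_at \<XX> x f = (THE n. \<exists>\<pi> u. uniformizer (local_subring \<XX> x) \<pi> \<and>
     u \<in> Units (local_subring \<XX> x) \<and>
     f = u \<otimes>\<^bsub>function_field \<XX>\<^esub> \<pi> [^]\<^bsub>function_field \<XX>\<^esub> n)"


section \<open>Products, tori and torus actions\<close>

record ('p, 's, 'q, 'r, 'z, 'w) product_data =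
  tot :: "('z, 'w) ringed_space"
  pr1 :: "('z, 'w, 'p, 's) morph"
  pr2 :: "('z, 'w, 'q, 'r) morph"

text \<open>
  A product of schemes over the complex numbers, glued from the spectra of the tensor products of
  coordinate rings of affine open subsets of the factors.
\<close>

definition is_product ::
  "('p, 's) ringed_space \<Rightarrow> ('q, 'r) ringed_space \<Rightarrow> ('p, 's, 'q, 'r, 'z, 'w) product_data \<Rightarrow> bool" where
  "is_product \<XX> Y P \<longleftrightarrow> cscheme \<XX> \<and> cscheme Y \<and> cscheme (tot P) \<and>
     mor (tot P) \<XX> (pr1 P) \<and> mor (tot P) Y (pr2 P) \<and>
     (\<forall>U V. affine_open \<XX> U \<and> affine_open Y V \<longrightarrow>
        (let U' = preim (tot P) (pr1 P) U; V' = preim (tot P) (pr2 P) V in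
          affine_open (tot P) (U' \<inter> V') \<and>
          is_tensor_product (Sec \<XX> U) (Cst \<XX> U) (Sec Y V) (Sec (tot P) (U' \<inter> V'))
            (Res (tot P) U' (U' \<inter> V') \<circ> pull (pr1 P) U)
            (Res (tot P) V' (U' \<inter> V') \<circ> pull (pr2 P) V)))"

text \<open>\<open>k = (g, h) : S \<rightarrow> \<XX> \<times> Y\<close>.\<close>

definition is_pair ::
  "('i, 'j) ringed_space \<Rightarrow> ('p, 's) ringed_space \<Rightarrow> ('q, 'r) ringed_space \<Rightarrow>
   ('p, 's, 'q, 'r, 'z, 'w) product_data \<Rightarrow>
   ('i, 'j, 'p, 's) morph \<Rightarrow> ('i, 'j, 'q, 'r) morph \<Rightarrow> ('i, 'j, 'z, 'w) morph \<Rightarrow> bool" where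
  "is_pair S \<XX> Y P g h k \<longleftrightarrow> mor S (tot P) k \<and>
     mor_eq S \<XX> (mor_comp (tot P) (pr1 P) k) g \<and> mor_eq S Y (mor_comp (tot P) (pr2 P) k) h"

text \<open>
  \<open>T\<close> is the torus whose character group is free with basis \<open>x d\<close> (\<open>d \<in> D\<close>): it is affine, and its
  coordinate ring has the Laurent monomials in the \<open>x d\<close> as a basis.
\<close>

definition torus :: "'v set \<Rightarrow> ('t, 'u) ringed_space \<Rightarrow> ('v \<Rightarrow> 'u) \<Rightarrow> bool" where
  "torus D T x \<longleftrightarrow> finite D \<and> cscheme T \<and> affine_open T (points T) \<and>
     (\<forall>d\<in>D. x d \<in> Units (glob T)) \<and>
     lin_indep (glob T) (Cst T (points T)) (lattice_on D) (monomial (glob T) D x) \<and>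
     lin_span (glob T) (Cst T (points T)) (lattice_on D) (monomial (glob T) D x) = carrier (glob T)"

text \<open>
  The group structure of the torus, on its \<open>S\<close>-valued points: the \<open>x d\<close> are characters, so \<open>k = g h\<close>
  iff \<open>k\<^sup>* x d = g\<^sup>* x d \<cdot> h\<^sup>* x d\<close> for all \<open>d\<close>.
\<close>

definition torus_mult ::
  "'v set \<Rightarrow> ('t, 'u) ringed_space \<Rightarrow> ('v \<Rightarrow> 'u) \<Rightarrow> ('i, 'j) ringed_space \<Rightarrow>
   ('i, 'j, 't, 'u) morph \<Rightarrow> ('i, 'j, 't, 'u) morph \<Rightarrow> ('i, 'j, 't, 'u) morph \<Rightarrow> bool" where
  "torus_mult D T x S g h k \<longleftrightarrow> mor S T k \<and>
     (\<forall>d\<in>D. gpull T k (x d) = gpull T g (x d) \<otimes>\<^bsub>glob S\<^esub> gpull T h (x d))"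

definition torus_unit ::
  "'v set \<Rightarrow> ('t, 'u) ringed_space \<Rightarrow> ('v \<Rightarrow> 'u) \<Rightarrow> ('i, 'j) ringed_space \<Rightarrow> ('i, 'j, 't, 'u) morph \<Rightarrow> bool" where
  "torus_unit D T x S k \<longleftrightarrow> mor S T k \<and> (\<forall>d\<in>D. gpull T k (x d) = \<one>\<^bsub>glob S\<^esub>)"

text \<open>The morphism \<open>(e, id) : \<XX> \<rightarrow> T \<times> \<XX>\<close>.\<close>

definition is_unit_section ::
  "'v set \<Rightarrow> ('t, 'u) ringed_space \<Rightarrow> ('v \<Rightarrow> 'u) \<Rightarrow> ('p, 's) ringed_space \<Rightarrow>
   ('t, 'u, 'p, 's, 'z, 'w) product_data \<Rightarrow> ('p, 's, 'z, 'w) morph \<Rightarrow> bool" where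
  "is_unit_section D T x \<XX> Q \<epsilon> \<longleftrightarrow>
     (\<exists>e. torus_unit D T x \<XX> e \<and> is_pair \<XX> T \<XX> Q e mor_id \<epsilon>)"

text \<open>
  The morphism \<open>T \<times> (T \<times> \<XX>) \<rightarrow> T \<times> \<XX>\<close> multiplying the two torus components;
  \<open>Q = T \<times> \<XX>\<close> and \<open>QQ = T \<times> Q\<close>.
\<close>

definition is_mult_first ::
  "'v set \<Rightarrow> ('t, 'u) ringed_space \<Rightarrow> ('v \<Rightarrow> 'u) \<Rightarrow> ('p, 's) ringed_space \<Rightarrow>
   ('t, 'u, 'p, 's, 'z, 'w) product_data \<Rightarrow> ('t, 'u, 'z, 'w, 'm, 'n) product_data \<Rightarrow>
   ('m, 'n, 'z, 'w) morph \<Rightarrow> bool" where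
  "is_mult_first D T x \<XX> Q QQ k \<longleftrightarrow>
     (\<exists>\<mu>. torus_mult D T x (tot QQ) (pr1 QQ) (mor_comp (tot Q) (pr1 Q) (pr2 QQ)) \<mu> \<and>
        is_pair (tot QQ) T \<XX> Q \<mu> (mor_comp (tot Q) (pr2 Q) (pr2 QQ)) k)"

text \<open>The morphism \<open>id \<times> f : T \<times> Z \<rightarrow> T \<times> \<XX>\<close> for \<open>f : Z \<rightarrow> \<XX>\<close>; here \<open>R = T \<times> Z\<close> and \<open>Q = T \<times> \<XX>\<close>.\<close>

definition is_id_times ::
  "('t, 'u) ringed_space \<Rightarrow> ('i, 'j) ringed_space \<Rightarrow> ('p, 's) ringed_space \<Rightarrow>
   ('t, 'u, 'i, 'j, 'm, 'n) product_data \<Rightarrow> ('t, 'u, 'p, 's, 'z, 'w) product_data \<Rightarrow>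
   ('i, 'j, 'p, 's) morph \<Rightarrow> ('m, 'n, 'z, 'w) morph \<Rightarrow> bool" where
  "is_id_times T Z \<XX> R Q f k \<longleftrightarrow> is_pair (tot R) T \<XX> Q (pr1 R) (mor_comp Z f (pr2 R)) k"

definition torus_action ::
  "'v set \<Rightarrow> ('t, 'u) ringed_space \<Rightarrow> ('v \<Rightarrow> 'u) \<Rightarrow> ('p, 's) ringed_space \<Rightarrow>
   ('t, 'u, 'p, 's, 'z, 'w) product_data \<Rightarrow> ('t, 'u, 'z, 'w, 'm, 'n) product_data \<Rightarrow>
   ('z, 'w, 'p, 's) morph \<Rightarrow> bool" where
  "torus_action D T x \<XX> Q QQ a \<longleftrightarrow> mor (tot Q) \<XX> a \<and>
     (\<exists>\<epsilon>. is_unit_section D T x \<XX> Q \<epsilon> \<and> mor_eq \<XX> \<XX> (mor_comp (tot Q) a \<epsilon>) mor_id) \<and>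
     (\<exists>k l. is_mult_first D T x \<XX> Q QQ k \<and> is_id_times T (tot Q) \<XX> QQ Q a l \<and>
        mor_eq (tot QQ) \<XX> (mor_comp (tot Q) a k) (mor_comp (tot Q) a l))"

text \<open>The pullback of \<open>f\<close> under the action \<open>a : T \<times> \<XX> \<rightarrow> \<XX>\<close> is \<open>w \<otimes> f\<close>.\<close>

definition homogeneous ::
  "'v set \<Rightarrow> ('t, 'u) ringed_space \<Rightarrow> ('v \<Rightarrow> 'u) \<Rightarrow> ('p, 's) ringed_space \<Rightarrow>
   ('t, 'u, 'p, 's, 'z, 'w) product_data \<Rightarrow> ('z, 'w, 'p, 's) morph \<Rightarrow> ('v \<Rightarrow> int) \<Rightarrow> 's \<Rightarrow> bool" where
  "homogeneous D T x \<XX> Q a w f \<longleftrightarrow>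
     gpull \<XX> a f =
       gpull T (pr1 Q) (monomial (glob T) D x w) \<otimes>\<^bsub>glob (tot Q)\<^esub> gpull \<XX> (pr2 Q) f"


section \<open>Schemes suitable for lifting\<close>

definition lifting_valuation :: "('p, 's) ringed_space \<Rightarrow> ('v \<Rightarrow> 's) \<Rightarrow> 'v \<Rightarrow> ('p set \<times> 's) set \<Rightarrow> int" where
  "lifting_valuation \<XX> Xf d = valuation_at \<XX> (generic_point \<XX> (zero_locus \<XX> (Xf d)))"

text \<open>Here \<open>P = T \<times> Y\<close>; the valuation at \<open>Xf d\<close> presupposes codimension one.\<close>

definition suitable_for_lifting ::
  "'v set \<Rightarrow> ('t, 'u) ringed_space \<Rightarrow> ('v \<Rightarrow> 'u) \<Rightarrow> ('q, 'r) ringed_space \<Rightarrow>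
   ('t, 'u, 'q, 'r, 'z, 'w) product_data \<Rightarrow> ('p, 's) ringed_space \<Rightarrow>
   ('z, 'w, 'p, 's) morph \<Rightarrow> ('v \<Rightarrow> 's) \<Rightarrow> bool" where
  "suitable_for_lifting D T x Y P \<XX> \<phi> Xf \<longleftrightarrow>
     torus D T x \<and> irreducible_scheme Y \<and> is_product T Y P \<and>
     noetherian_scheme \<XX> \<and> normal_scheme \<XX> \<and> integral_scheme \<XX> \<and>
     (\<forall>d\<in>D. Xf d \<in> carrier (glob \<XX>) \<and> irreducible_subset \<XX> (zero_locus \<XX> (Xf d)) \<and>
        codim_one_point \<XX> (generic_point \<XX> (zero_locus \<XX> (Xf d)))) \<and>
     (\<forall>d1\<in>D. \<forall>d2\<in>D. lifting_valuation \<XX> Xf d1 (ff_of \<XX> (Xf d2)) = (if d1 = d2 then 1 else 0)) \<and>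
     open_immersion (tot P) \<XX> \<phi> \<and>
     big_open_in \<XX> (points \<XX> - (\<Union>d\<in>D. zero_locus \<XX> (Xf d))) (pt \<phi> ` points (tot P)) \<and>
     (\<forall>d\<in>D. gpull \<XX> \<phi> (Xf d) = gpull T (pr1 P) (x d))"

text \<open>
  The translation action of \<open>T\<close> on \<open>P = T \<times> Y\<close> extends to the action \<open>a\<close> on \<open>\<XX>\<close>. The products are
  \<open>PP = T \<times> P\<close>, \<open>Q = T \<times> \<XX>\<close> and \<open>QQ = T \<times> Q\<close>.
\<close>

definition homogeneously_suitable ::
  "'v set \<Rightarrow> ('t, 'u) ringed_space \<Rightarrow> ('v \<Rightarrow> 'u) \<Rightarrow> ('q, 'r) ringed_space \<Rightarrow>
   ('t, 'u, 'q, 'r, 'z, 'w) product_data \<Rightarrow> ('p, 's) ringed_space \<Rightarrow>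
   ('z, 'w, 'p, 's) morph \<Rightarrow> ('v \<Rightarrow> 's) \<Rightarrow>
   ('t, 'u, 'z, 'w, 'i, 'j) product_data \<Rightarrow>
   ('t, 'u, 'p, 's, 'k, 'l) product_data \<Rightarrow> ('t, 'u, 'k, 'l, 'm, 'n) product_data \<Rightarrow>
   ('k, 'l, 'p, 's) morph \<Rightarrow> bool" where
  "homogeneously_suitable D T x Y P \<XX> \<phi> Xf PP Q QQ a \<longleftrightarrow>
     suitable_for_lifting D T x Y P \<XX> \<phi> Xf \<and>
     is_product T (tot P) PP \<and> is_product T \<XX> Q \<and> is_product T (tot Q) QQ \<and>
     torus_action D T x \<XX> Q QQ a \<and>
     (\<exists>k l. is_mult_first D T x Y P PP k \<and> is_id_times T (tot P) \<XX> PP Q \<phi> l \<and>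
        mor_eq (tot PP) \<XX> (mor_comp (tot P) \<phi> k) (mor_comp (tot Q) a l))"

text \<open>\<open>1 \<otimes> g \<in> \<complex>(\<XX>)\<close> for \<open>g \<in> \<complex>(Y)\<close>, using the identification of \<open>\<complex>(\<XX>)\<close> and \<open>\<complex>(T \<times> Y)\<close> through \<open>\<phi>\<close>.\<close>

definition one_tensor ::
  "('q, 'r) ringed_space \<Rightarrow> ('t, 'u, 'q, 'r, 'z, 'w) product_data \<Rightarrow> ('p, 's) ringed_space \<Rightarrow>
   ('z, 'w, 'p, 's) morph \<Rightarrow> ('q set \<times> 'r) set \<Rightarrow> ('p set \<times> 's) set" where
  "one_tensor Y P \<XX> \<phi> g = (THE h. h \<in> carrier (function_field \<XX>) \<and>
     ff_pull (tot P) \<XX> \<phi> h = ff_pull (tot P) Y (pr2 P) g)"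

text \<open>The restriction map, for \<open>\<iota> : Y \<rightarrow> T \<times> Y\<close> the morphism \<open>y \<mapsto> (e, y)\<close>.\<close>

definition restriction ::
  "('t, 'u, 'q, 'r, 'z, 'w) product_data \<Rightarrow> ('p, 's) ringed_space \<Rightarrow>
   ('z, 'w, 'p, 's) morph \<Rightarrow> ('q, 'r, 'z, 'w) morph \<Rightarrow> 's \<Rightarrow> 'r" where
  "restriction P \<XX> \<phi> \<iota> = gpull \<XX> (mor_comp (tot P) \<phi> \<iota>)"


section \<open>Seeds and upper cluster algebras\<close>

text \<open>\<open>bmat\<close> and \<open>cl\<close> are only relevant on \<open>I \<times> uf\<close> and on \<open>I\<close>, where \<open>I\<close> is the set of vertices.\<close>

record ('v, 'k) seed =
  uf :: "'v set"
  sf :: "'v set"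
  hf :: "'v set"
  bmat :: "'v \<Rightarrow> 'v \<Rightarrow> int"
  cl :: "'v \<Rightarrow> 'k"

definition vertices :: "('v, 'k) seed \<Rightarrow> 'v set" where
  "vertices t = uf t \<union> sf t \<union> hf t"

definition seed_eq :: "('v, 'k) seed \<Rightarrow> ('v, 'k) seed \<Rightarrow> bool" where
  "seed_eq t t' \<longleftrightarrow> uf t = uf t' \<and> sf t = sf t' \<and> hf t = hf t' \<and>
     (\<forall>i\<in>vertices t. \<forall>k\<in>uf t. bmat t i k = bmat t' i k) \<and> (\<forall>i\<in>vertices t. cl t i = cl t' i)"

definition transcendence_basis :: "'k ring \<Rightarrow> (complex \<Rightarrow> 'k) \<Rightarrow> 'v set \<Rightarrow> ('v \<Rightarrow> 'k) \<Rightarrow> bool" where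
  "transcendence_basis K c I x \<longleftrightarrow>
     lin_indep K c {m \<in> lattice_on I. \<forall>i. m i \<ge> 0} (monomial K I x) \<and>
     (\<forall>f\<in>carrier K. \<not> (ring.transcendental K over generate_field K (range c \<union> x ` I)) f)"

definition is_seed :: "'k ring \<Rightarrow> (complex \<Rightarrow> 'k) \<Rightarrow> ('v, 'k) seed \<Rightarrow> bool" where
  "is_seed K c t \<longleftrightarrow> field K \<and> c \<in> ring_hom complex_ring K \<and>
     finite (vertices t) \<and> uf t \<inter> sf t = {} \<and> uf t \<inter> hf t = {} \<and> sf t \<inter> hf t = {} \<and>
     (\<exists>\<delta>::'v \<Rightarrow> int. (\<forall>i\<in>uf t. \<delta> i > 0) \<and>
        (\<forall>i\<in>uf t. \<forall>j\<in>uf t. \<delta> i * bmat t i j = - (\<delta> j * bmat t j i))) \<and>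
     cl t \<in> vertices t \<rightarrow> carrier K - {\<zero>\<^bsub>K\<^esub>} \<and>
     transcendence_basis K c (vertices t) (cl t)"

definition columns_independent :: "'v set \<Rightarrow> 'v set \<Rightarrow> ('v \<Rightarrow> 'v \<Rightarrow> int) \<Rightarrow> bool" where
  "columns_independent I S b \<longleftrightarrow>
     (\<forall>q::'v \<Rightarrow> rat. (\<forall>i\<in>I. (\<Sum>k\<in>S. q k * of_int (b i k)) = 0) \<longrightarrow> (\<forall>k\<in>S. q k = 0))"

definition matrix_rank :: "'v set \<Rightarrow> 'v set \<Rightarrow> ('v \<Rightarrow> 'v \<Rightarrow> int) \<Rightarrow> nat" where
  "matrix_rank I J b = Max {card S | S. S \<subseteq> J \<and> columns_independent I S b}"

definition maximal_rank :: "('v, 'k) seed \<Rightarrow> bool" where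
  "maximal_rank t \<longleftrightarrow>
     matrix_rank (vertices t) (uf t) (bmat t) = min (card (vertices t)) (card (uf t))"

definition pos_part :: "int \<Rightarrow> int" where
  "pos_part b = max b 0"

definition neg_part :: "int \<Rightarrow> int" where
  "neg_part b = max (- b) 0"

definition mut_var :: "'k ring \<Rightarrow> ('v, 'k) seed \<Rightarrow> 'v \<Rightarrow> 'k" where
  "mut_var K t k = inv\<^bsub>K\<^esub> (cl t k) \<otimes>\<^bsub>K\<^esub>
     (monomial K (vertices t) (cl t) (\<lambda>i. pos_part (bmat t i k)) \<oplus>\<^bsub>K\<^esub>
      monomial K (vertices t) (cl t) (\<lambda>i. neg_part (bmat t i k)))"

definition mutate :: "'k ring \<Rightarrow> 'v \<Rightarrow> ('v, 'k) seed \<Rightarrow> ('v, 'k) seed" where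
  "mutate K k t = t
     \<lparr>bmat := (\<lambda>i j. if i = k \<or> j = k then - bmat t i j
        else bmat t i j + pos_part (bmat t i k) * pos_part (bmat t k j)
          - neg_part (bmat t i k) * neg_part (bmat t k j)),
      cl := (cl t)(k := mut_var K t k)\<rparr>"

inductive mutation_equiv :: "'k ring \<Rightarrow> ('v, 'k) seed \<Rightarrow> ('v, 'k) seed \<Rightarrow> bool"
  for K :: "'k ring" and t :: "('v, 'k) seed" where
  base: "mutation_equiv K t t"
| step: "mutation_equiv K t t' \<Longrightarrow> k \<in> uf t' \<Longrightarrow> mutation_equiv K t (mutate K k t')"

definition laurent_exponents :: "('v, 'k) seed \<Rightarrow> ('v \<Rightarrow> int) set" where
  "laurent_exponents t = {m \<in> lattice_on (vertices t). \<forall>i\<in>hf t. m i \<ge> 0}"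

definition laurent_ring :: "'k ring \<Rightarrow> (complex \<Rightarrow> 'k) \<Rightarrow> ('v, 'k) seed \<Rightarrow> 'k set" where
  "laurent_ring K c t = lin_span K c (laurent_exponents t) (monomial K (vertices t) (cl t))"

definition upper_cluster :: "'k ring \<Rightarrow> (complex \<Rightarrow> 'k) \<Rightarrow> ('v, 'k) seed \<Rightarrow> 'k set" where
  "upper_cluster K c t = (\<Inter>t'\<in>{t'. mutation_equiv K t t'}. laurent_ring K c t')"

text \<open>
  Degree configurations with values in \<open>\<int>\<^sup>D\<close>; \<open>\<sigma> i d\<close> is the \<open>d\<close>-coordinate of the degree of the
  cluster variable at \<open>i\<close>.
\<close>

definition degree_configuration :: "'v set \<Rightarrow> ('v, 'k) seed \<Rightarrow> ('v \<Rightarrow> 'v \<Rightarrow> int) \<Rightarrow> bool" where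
  "degree_configuration D t \<sigma> \<longleftrightarrow> \<sigma> \<in> vertices t \<rightarrow> lattice_on D \<and>
     (\<forall>k\<in>uf t. \<forall>d. (\<Sum>i\<in>vertices t. pos_part (bmat t i k) * \<sigma> i d) =
                     (\<Sum>i\<in>vertices t. neg_part (bmat t i k) * \<sigma> i d))"

definition laurent_component ::
  "'k ring \<Rightarrow> (complex \<Rightarrow> 'k) \<Rightarrow> ('v, 'k) seed \<Rightarrow> ('v \<Rightarrow> 'v \<Rightarrow> int) \<Rightarrow> ('v \<Rightarrow> int) \<Rightarrow> 'k set" where
  "laurent_component K c t \<sigma> w =
     lin_span K c {m \<in> laurent_exponents t. \<forall>d. (\<Sum>i\<in>vertices t. m i * \<sigma> i d) = w d}
       (monomial K (vertices t) (cl t))"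

definition upper_component ::
  "'k ring \<Rightarrow> (complex \<Rightarrow> 'k) \<Rightarrow> ('v, 'k) seed \<Rightarrow> ('v \<Rightarrow> 'v \<Rightarrow> int) \<Rightarrow> ('v \<Rightarrow> int) \<Rightarrow> 'k set" where
  "upper_component K c t \<sigma> w = upper_cluster K c t \<inter> laurent_component K c t \<sigma> w"


section \<open>Seeds in function fields and the minimal monomial lifting\<close>

text \<open>The image of the ring of global functions in the function field.\<close>

definition regular_functions :: "('p, 's) ringed_space \<Rightarrow> ('p set \<times> 's) set set" where
  "regular_functions \<XX> = ff_of \<XX> ` carrier (glob \<XX>)"

definition ff_coprime_on :: "('p, 's) ringed_space \<Rightarrow> ('p set \<times> 's) set \<Rightarrow> ('p set \<times> 's) set \<Rightarrow> bool" where
  "ff_coprime_on \<XX> f g \<longleftrightarrow>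
     (\<exists>f'\<in>carrier (glob \<XX>). \<exists>g'\<in>carrier (glob \<XX>). f = ff_of \<XX> f' \<and> g = ff_of \<XX> g' \<and> coprime_on \<XX> f' g')"

definition lifting_matrix ::
  "('q, 'r) ringed_space \<Rightarrow> ('t, 'u, 'q, 'r, 'z, 'w) product_data \<Rightarrow> ('p, 's) ringed_space \<Rightarrow>
   ('z, 'w, 'p, 's) morph \<Rightarrow> ('v \<Rightarrow> 's) \<Rightarrow> ('v, ('q set \<times> 'r) set) seed \<Rightarrow> 'v \<Rightarrow> 'v \<Rightarrow> int" where
  "lifting_matrix Y P \<XX> \<phi> Xf t d i = - lifting_valuation \<XX> Xf d (one_tensor Y P \<XX> \<phi> (cl t i))"

definition minimal_lifting ::
  "'v set \<Rightarrow> ('q, 'r) ringed_space \<Rightarrow> ('t, 'u, 'q, 'r, 'z, 'w) product_data \<Rightarrow> ('p, 's) ringed_space \<Rightarrow>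
   ('z, 'w, 'p, 's) morph \<Rightarrow> ('v \<Rightarrow> 's) \<Rightarrow> ('v, ('q set \<times> 'r) set) seed \<Rightarrow> ('v, ('p set \<times> 's) set) seed" where
  "minimal_lifting D Y P \<XX> \<phi> Xf t =
    \<lparr>uf = uf t, sf = sf t, hf = hf t \<union> D,
     bmat = (\<lambda>i k. if i \<in> D then - (\<Sum>l\<in>vertices t. lifting_matrix Y P \<XX> \<phi> Xf t i l * bmat t l k)
                   else bmat t i k),
     cl = (\<lambda>i. if i \<in> D then ff_of \<XX> (Xf i)
               else one_tensor Y P \<XX> \<phi> (cl t i) \<otimes>\<^bsub>function_field \<XX>\<^esub>
                 monomial (function_field \<XX>) D (\<lambda>d. ff_of \<XX> (Xf d))
                   (\<lambda>d. lifting_matrix Y P \<XX> \<phi> Xf t d i))\<rparr>"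

definition lifting_degree ::
  "'v set \<Rightarrow> ('q, 'r) ringed_space \<Rightarrow> ('t, 'u, 'q, 'r, 'z, 'w) product_data \<Rightarrow> ('p, 's) ringed_space \<Rightarrow>
   ('z, 'w, 'p, 's) morph \<Rightarrow> ('v \<Rightarrow> 's) \<Rightarrow> ('v, ('q set \<times> 'r) set) seed \<Rightarrow> 'v \<Rightarrow> 'v \<Rightarrow> int" where
  "lifting_degree D Y P \<XX> \<phi> Xf t i =
     (\<lambda>d. if d \<notin> D then 0
          else if i \<in> D then (if d = i then 1 else 0)
          else lifting_matrix Y P \<XX> \<phi> Xf t d i)"

definition pointed_seed_extension ::
  "'v set \<Rightarrow> ('p, 's) ringed_space \<Rightarrow> ('v \<Rightarrow> 's) \<Rightarrow> ('v, 'k) seed \<Rightarrow> ('v, ('p set \<times> 's) set) seed \<Rightarrow> bool" where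
  "pointed_seed_extension D \<XX> Xf t t' \<longleftrightarrow>
     is_seed (function_field \<XX>) (ff_const \<XX>) t' \<and>
     uf t' = uf t \<and> sf t \<subseteq> sf t' \<and> hf t \<subseteq> hf t' \<and> (sf t' \<union> hf t') - (sf t \<union> hf t) = D \<and>
     (\<forall>i\<in>vertices t. \<forall>k\<in>uf t. bmat t' i k = bmat t i k) \<and>
     (\<forall>d\<in>D. cl t' d = ff_of \<XX> (Xf d))"

text \<open>
  The rational function \<open>f\<close> on \<open>\<XX>\<close> is regular, homogeneous for the action \<open>a\<close>, and its restriction
  to \<open>Y\<close> is \<open>g\<close>.
\<close>

definition homogeneous_lift ::
  "'v set \<Rightarrow> ('t, 'u) ringed_space \<Rightarrow> ('v \<Rightarrow> 'u) \<Rightarrow> ('q, 'r) ringed_space \<Rightarrow>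
   ('t, 'u, 'q, 'r, 'z, 'w) product_data \<Rightarrow> ('p, 's) ringed_space \<Rightarrow>
   ('z, 'w, 'p, 's) morph \<Rightarrow> ('q, 'r, 'z, 'w) morph \<Rightarrow>
   ('t, 'u, 'p, 's, 'k, 'l) product_data \<Rightarrow> ('k, 'l, 'p, 's) morph \<Rightarrow>
   ('p set \<times> 's) set \<Rightarrow> ('q set \<times> 'r) set \<Rightarrow> bool" where
  "homogeneous_lift D T x Y P \<XX> \<phi> \<iota> Q a f g \<longleftrightarrow>
     (\<exists>f'\<in>carrier (glob \<XX>). f = ff_of \<XX> f' \<and> ff_of Y (restriction P \<XX> \<phi> \<iota> f') = g \<and>
        (\<exists>w\<in>lattice_on D. homogeneous D T x \<XX> Q a w f'))"

end

theory Submission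
  imports Defs
begin

text \<open>
  A homogeneous regular function on \<open>\<XX>\<close> is determined by its restriction to \<open>Y\<close> and its degree. Over an
  affine open \<open>V\<close> of \<open>Y\<close>, the sections on \<open>T \<times> V\<close> are Laurent polynomials in the characters \<open>x d\<close> with
  coefficients on \<open>V\<close>, and the translation action scales each Laurent monomial by its own character. So a
  function \<open>f\<close> of degree \<open>w\<close> pulls back to \<open>x\<^sup>w \<otimes> g\<close>, where \<open>g\<close> is the restriction of \<open>f\<close>
  (\<open>homogeneous_pullback\<close>). As \<open>Xf d\<close> pulls back to \<open>x d\<close>, this reads \<open>f = (1 \<otimes> g) \<cdot> \<Prod> Xf d ^ w d\<close> in the
  function field of \<open>\<XX>\<close> (\<open>one_tensor_restriction\<close>). Each cluster variable of \<open>t'\<close> is therefore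
  \<open>1 \<otimes> x i\<close> times a monomial in the \<open>Xf d\<close>, whose exponents form the degree of that variable, and it
  remains to see that this degree is the column \<open>i\<close> of the minimal lifting matrix.

  That is the statement that no cluster variable of \<open>t'\<close> at a vertex of \<open>t\<close> vanishes along a divisor
  \<open>Xf d = 0\<close> (\<open>valuation_cl\<close>). The functions \<open>Xf d\<close> are not invertible on \<open>\<XX>\<close>, whereas
  semi-frozen variables are invertible in the upper cluster algebra, which is the ring of regular functions;
  so the vertices in \<open>D\<close> are highly frozen. If a cluster variable vanished along \<open>Xf d = 0\<close>, its quotient by
  \<open>Xf d\<close> would be a regular function, hence a Laurent polynomial without negative powers of the highly frozen
  variable \<open>Xf d\<close>. But it is a Laurent monomial in which \<open>Xf d\<close> has exponent \<open>-1\<close>, and Laurent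
  monomials of a seed are linearly independent.

  The algebraic geometry needed here is that a regular function of positive valuation along \<open>Xf d = 0\<close> is
  divisible by \<open>Xf d\<close> (\<open>valuation_regular\<close>). It comes from a local argument: in a noetherian normal domain,
  the obstruction to divisibility by \<open>x\<close> is supported at primes that are minimal over \<open>x\<close> and have
  principal localization (\<open>associated_prime_height_one\<close>). The zero locus of \<open>Xf d\<close> is irreducible, so only
  its generic point can occur.

  The rows of the exchange matrix at \<open>D\<close> follow from the exchange relations: a homogeneous function is
  the sum of two nonzero monomials, and distinct characters are independent, so the two monomials have
  the same degree (\<open>exchange_degrees\<close>). The same independence identifies any compatible grading with the
  degrees of the cluster variables (\<open>degrees_eq_lifting_degree\<close>).
\<close>

section \<open>Noetherian integrally closed domains\<close>

text \<open>
  The ideals spanned by the initial segments of the sequence form an ascending chain. Both finiteness arguments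
  below, integrality of a fraction and termination of divisions, apply this to a sequence of iterated quotients.
\<close>

lemma (in noetherian_ring) noetherian_sequence:
  fixes b :: "nat \<Rightarrow> 'a"
  assumes cr: "cring R" and b: "\<And>n. b n \<in> carrier R"
  obtains n r where "r \<in> {..<n} \<rightarrow> carrier R" and "b n = (\<Oplus>i\<in>{..<n}. r i \<otimes> b i)"
proof -
  interpret cring R by (rule cr)
  define J where "J n = {\<Oplus>i\<in>{..<n}. r i \<otimes> b i | r. r \<in> {..<n} \<rightarrow> carrier R}" for n
  have ideal_J: "ideal (J n) R" for n
  proof (rule idealI)
    show "ring R" by (rule local.ring_axioms)
    show "subgroup (J n) (add_monoid R)"
    proof (rule add.subgroupI)
      show "J n \<subseteq> carrier R"
        unfolding J_def using b by (auto intro!: finsum_closed simp: Pi_def)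
      have "(\<Oplus>i\<in>{..<n}. \<zero> \<otimes> b i) \<in> J n"
        unfolding J_def by (rule CollectI, rule exI[of _ "\<lambda>_. \<zero>"]) auto
      then show "J n \<noteq> {}" by blast
    next
      fix a assume "a \<in> J n"
      then obtain r where r: "r \<in> {..<n} \<rightarrow> carrier R" and a: "a = (\<Oplus>i\<in>{..<n}. r i \<otimes> b i)"
        unfolding J_def by blast
      have "\<ominus> a = (\<ominus> \<one>) \<otimes> a"
        using a r b by (subst l_minus) (auto intro!: finsum_closed simp: Pi_def)
      also have "\<dots> = (\<Oplus>i\<in>{..<n}. (\<ominus> \<one>) \<otimes> (r i \<otimes> b i))"
        unfolding a by (rule finsum_rdistr) (use r b in \<open>auto simp: Pi_def\<close>)
      also have "\<dots> = (\<Oplus>i\<in>{..<n}. (\<ominus> (r i)) \<otimes> b i)"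
        by (rule finsum_cong') (use r b in \<open>auto simp: Pi_def l_minus\<close>)
      finally show "\<ominus> a \<in> J n"
        unfolding J_def using r by (auto intro!: exI[of _ "\<lambda>i. \<ominus> (r i)"] simp: Pi_def)
    next
      fix a a' assume "a \<in> J n" "a' \<in> J n"
      then obtain r r' where r: "r \<in> {..<n} \<rightarrow> carrier R" and a: "a = (\<Oplus>i\<in>{..<n}. r i \<otimes> b i)"
        and r': "r' \<in> {..<n} \<rightarrow> carrier R" and a': "a' = (\<Oplus>i\<in>{..<n}. r' i \<otimes> b i)"
        unfolding J_def by blast
      have "a \<oplus> a' = (\<Oplus>i\<in>{..<n}. r i \<otimes> b i \<oplus> r' i \<otimes> b i)"
        unfolding a a' by (rule finsum_addf[symmetric]) (use r r' b in \<open>auto simp: Pi_def\<close>)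
      also have "\<dots> = (\<Oplus>i\<in>{..<n}. (r i \<oplus> r' i) \<otimes> b i)"
        by (rule finsum_cong') (use r r' b in \<open>auto simp: Pi_def l_distr\<close>)
      finally show "a \<oplus> a' \<in> J n"
        unfolding J_def using r r' by (auto intro!: exI[of _ "\<lambda>i. r i \<oplus> r' i"] simp: Pi_def)
    qed
  next
    fix a y assume "a \<in> J n" and y: "y \<in> carrier R"
    then obtain r where r: "r \<in> {..<n} \<rightarrow> carrier R" and a: "a = (\<Oplus>i\<in>{..<n}. r i \<otimes> b i)"
      unfolding J_def by blast
    have "y \<otimes> a = (\<Oplus>i\<in>{..<n}. y \<otimes> (r i \<otimes> b i))"
      unfolding a by (rule finsum_rdistr) (use r b y in \<open>auto simp: Pi_def\<close>)
    also have "\<dots> = (\<Oplus>i\<in>{..<n}. (y \<otimes> r i) \<otimes> b i)"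
      by (rule finsum_cong') (use r b y in \<open>auto simp: Pi_def m_assoc\<close>)
    finally show *: "y \<otimes> a \<in> J n"
      unfolding J_def using r y by (auto intro!: exI[of _ "\<lambda>i. y \<otimes> r i"] simp: Pi_def)
    have "a \<in> carrier R"
      unfolding a using r b by (auto intro!: finsum_closed simp: Pi_def)
    then show "a \<otimes> y \<in> J n" using * y by (simp add: m_comm)
  qed
  have b_in: "b n \<in> J (Suc n)" for n
  proof -
    let ?r = "\<lambda>i. if i = n then \<one> else \<zero>"
    have "(\<Oplus>i\<in>{..<Suc n}. ?r i \<otimes> b i) = (\<Oplus>i\<in>{..<Suc n}. if n = i then b i else \<zero>)"
      by (rule finsum_cong') (use b in auto)
    also have "\<dots> = b n"
      by (rule finsum_singleton) (use b in auto)
    finally show ?thesis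
      unfolding J_def by (auto intro!: exI[of _ ?r])
  qed
  have J_Suc: "J n \<subseteq> J (Suc n)" for n
  proof
    fix a assume "a \<in> J n"
    then obtain r where r: "r \<in> {..<n} \<rightarrow> carrier R" and a: "a = (\<Oplus>i\<in>{..<n}. r i \<otimes> b i)"
      unfolding J_def by blast
    let ?r = "r(n := \<zero>)"
    have "(\<Oplus>i\<in>{..<Suc n}. ?r i \<otimes> b i) = ?r n \<otimes> b n \<oplus> (\<Oplus>i\<in>{..<n}. ?r i \<otimes> b i)"
      unfolding lessThan_Suc by (rule finsum_insert) (use r b in \<open>auto simp: Pi_def\<close>)
    also have "(\<Oplus>i\<in>{..<n}. ?r i \<otimes> b i) = a"
      unfolding a by (rule finsum_cong') (use r b in \<open>auto simp: Pi_def\<close>)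
    also have "?r n \<otimes> b n \<oplus> a = a"
      using a b r by (simp add: Pi_def finsum_closed)
    finally have "a = (\<Oplus>i\<in>{..<Suc n}. ?r i \<otimes> b i)" ..
    moreover have "?r \<in> {..<Suc n} \<rightarrow> carrier R" using r by (auto simp: Pi_def less_Suc_eq)
    ultimately show "a \<in> J (Suc n)" unfolding J_def by blast
  qed
  have J_mono: "J m \<subseteq> J n" if "m \<le> n" for m n
    using lift_Suc_mono_le[of J, OF J_Suc that] .
  have "\<Union>(range J) \<in> range J"
  proof (rule ideal_chain_is_trivial)
    show "subset.chain {I. ideal I R} (range J)"
      unfolding subset_chain_def using ideal_J J_mono nat_le_linear by blast
  qed simp
  then obtain n where "\<Union>(range J) = J n" by blast
  then have "b n \<in> J n" using b_in by blast
  then show ?thesis using that unfolding J_def by blast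
qed

text \<open>
  The hypothesis on \<open>c\<close> says that \<open>c\<close> generates the maximal ideal of the localization at \<open>P\<close>.
  Dividing repeatedly by \<open>c\<close> must stop, since a sequence of quotients is eventually dependent on its
  predecessors, which would make a power of \<open>u\<close> a multiple of \<open>c\<close>.
\<close>

lemma (in noetherian_domain) factor_by_uniformizer:
  assumes P: "primeideal P R" and c: "c \<in> P" and u: "u \<in> carrier R - P"
    and gen: "\<And>b. b \<in> P \<Longrightarrow> \<exists>v\<in>carrier R. u \<otimes> b = v \<otimes> c"
    and b: "b \<in> carrier R" "b \<noteq> \<zero>"
  obtains n :: nat and s t where "s \<in> carrier R - P" "t \<in> carrier R - P" "s \<otimes> b = t \<otimes> c [^] n"
proof -
  interpret P: primeideal P R by (rule P)
  have cc: "c \<in> carrier R" using c P.Icarr by blast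
  have uc: "u \<in> carrier R" using u by blast
  have prime_pow: "u [^] (k::nat) \<in> carrier R - P" for k
  proof (induction k)
    case 0
    then show ?case using P.I_notcarr P.one_imp_carrier by auto
  next
    case (Suc k)
    then show ?case using uc u P.I_prime[of "u [^] k" u] by auto
  qed
  define next_b where "next_b y = (SOME v. v \<in> carrier R \<and> u \<otimes> y = v \<otimes> c)" for y
  have next_b: "next_b y \<in> carrier R" "u \<otimes> y = next_b y \<otimes> c" if "y \<in> P" for y
    using someI_ex[of "\<lambda>v. v \<in> carrier R \<and> u \<otimes> y = v \<otimes> c"] gen[OF that] unfolding next_b_def by auto
  define q where "q n = (next_b ^^ n) b" for n
  have q_Suc: "q (Suc n) = next_b (q n)" for n by (simp add: q_def)
  show thesis
  proof (cases "\<forall>n. q n \<in> P")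
    case True
    have q: "q n \<in> carrier R" for n using True P.Icarr by blast
    have step: "u \<otimes> q n = q (Suc n) \<otimes> c" for n using next_b True q_Suc by simp
    have pow: "u [^] k \<otimes> q n = c [^] k \<otimes> q (n + k)" for n k :: nat
    proof (induction k)
      case 0
      then show ?case using q by simp
    next
      case (Suc k)
      have "u [^] Suc k \<otimes> q n = u \<otimes> (u [^] k \<otimes> q n)"
        using uc q by (simp add: m_ac)
      also have "\<dots> = c [^] k \<otimes> (u \<otimes> q (n + k))"
        unfolding Suc using uc q cc by (simp add: m_ac)
      also have "\<dots> = c [^] Suc k \<otimes> q (n + Suc k)"
        unfolding step using uc q cc by (simp add: m_ac)
      finally show ?case .
    qed
    have q_nz: "q n \<noteq> \<zero>" for n
      using pow[of n 0] b u prime_pow[of n] P.zero_closed q[of n] cc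
      by (auto simp: q_def integral_iff)
    obtain n r where r: "r \<in> {..<n} \<rightarrow> carrier R" and qn: "q n = (\<Oplus>i\<in>{..<n}. r i \<otimes> q i)"
      by (rule noetherian_sequence[OF is_cring, of q, OF q])
    let ?s = "\<lambda>i. r i \<otimes> (u [^] i \<otimes> c [^] (n - i))"
    have "u [^] n \<otimes> q n = (\<Oplus>i\<in>{..<n}. u [^] n \<otimes> (r i \<otimes> q i))"
      unfolding qn by (rule finsum_rdistr) (use r q uc in \<open>auto simp: Pi_def\<close>)
    also have "\<dots> = (\<Oplus>i\<in>{..<n}. ?s i \<otimes> q n)"
    proof (rule finsum_cong')
      fix i assume i: "i \<in> {..<n}"
      then have ri: "r i \<in> carrier R" using r by blast
      have "u [^] n \<otimes> (r i \<otimes> q i) = r i \<otimes> (u [^] i \<otimes> (u [^] (n - i) \<otimes> q i))"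
        using i ri uc q nat_pow_mult[OF uc, of i "n - i"] by (simp add: m_ac)
      also have "\<dots> = ?s i \<otimes> q n"
        using i ri uc q cc pow[of "n - i" i] by (simp add: m_ac)
      finally show "u [^] n \<otimes> (r i \<otimes> q i) = ?s i \<otimes> q n" .
    qed (use r q uc cc in \<open>auto simp: Pi_def\<close>)
    also have "\<dots> = (\<Oplus>i\<in>{..<n}. ?s i) \<otimes> q n"
      by (rule finsum_ldistr[symmetric]) (use r q uc cc in \<open>auto simp: Pi_def\<close>)
    finally have "u [^] n = (\<Oplus>i\<in>{..<n}. ?s i)"
      using q q_nz r uc cc by (subst (asm) m_rcancel) (auto intro!: finsum_closed simp: Pi_def)
    also have "\<dots> \<in> P"
    proof -
      have s: "?s i \<in> P" if "i \<in> {..<n}" for i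
      proof -
        have "c [^] (n - i) \<in> P"
        proof -
          have "n - i = Suc (n - i - 1)" using that by auto
          then have "c [^] (n - i) = c [^] (n - i - 1) \<otimes> c" by (metis nat_pow_Suc)
          then show ?thesis using c cc P.I_l_closed by simp
        qed
        then show ?thesis using that r uc cc by (auto intro!: P.I_l_closed simp: Pi_def)
      qed
      have "(\<Oplus>i\<in>A. ?s i) \<in> P" if "finite A" "A \<subseteq> {..<n}" for A
        using that
      proof (induction A)
        case (insert i A)
        have "(\<Oplus>i\<in>insert i A. ?s i) = ?s i \<oplus> (\<Oplus>i\<in>A. ?s i)"
          by (rule finsum_insert) (use insert s P.Icarr in \<open>auto\<close>)
        then show ?case using insert s by auto
      qed simp
      then show ?thesis by simp
    qed
    finally show ?thesis using prime_pow by auto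
  next
    case False
    define n where "n = (LEAST n. q n \<notin> P)"
    have n: "q n \<notin> P" and lt: "\<And>m. m < n \<Longrightarrow> q m \<in> P"
      using LeastI_ex[of "\<lambda>n. q n \<notin> P"] False not_less_Least unfolding n_def by blast+
    have pow: "u [^] k \<otimes> b = q k \<otimes> c [^] k \<and> q k \<in> carrier R" if "k \<le> n" for k
      using that
    proof (induction k)
      case 0
      then show ?case using b by (simp add: q_def)
    next
      case (Suc k)
      then have k: "q k \<in> P" and IH: "u [^] k \<otimes> b = q k \<otimes> c [^] k" and qk: "q k \<in> carrier R"
        using lt by auto
      have 1: "q (Suc k) \<in> carrier R" "u \<otimes> q k = q (Suc k) \<otimes> c" using next_b k q_Suc by auto
      have "u [^] Suc k \<otimes> b = u \<otimes> (u [^] k \<otimes> b)" using uc b by (simp add: m_ac)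
      also have "\<dots> = (u \<otimes> q k) \<otimes> c [^] k" unfolding IH using uc qk cc by (simp add: m_ac)
      also have "\<dots> = q (Suc k) \<otimes> c [^] Suc k" unfolding 1 using 1(1) cc by (simp add: m_ac)
      finally show ?case using 1 by simp
    qed
    show ?thesis
      using that[OF prime_pow[of n], of "q n" n] pow[of n] n by auto
  qed
qed

text \<open>
  \<open>P\<close> is an ideal \<open>(x : y)\<close> that is maximal among those with \<open>y\<close> a multiple of \<open>f\<close> but not of \<open>x\<close>.
  If \<open>y / x\<close> mapped \<open>P\<close> into itself, it would be integral; hence it maps some \<open>c \<in> P\<close> to an element
  \<open>u\<close> outside \<open>P\<close>, and then \<open>c\<close> generates \<open>P\<close> locally. Since \<open>x\<close> is a power of \<open>c\<close> up to elements
  outside \<open>P\<close>, a prime below \<open>P\<close> that contains \<open>x\<close> contains \<open>c\<close> and equals \<open>P\<close>.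

  Integral equations need to be solvable only up to a denominator outside a given prime, because the normality
  of a scheme is a condition on its stalks.
\<close>

lemma associated_prime_height_one:
  fixes R :: "'a ring" (structure)
  assumes noeth: "noetherian_domain R"
    and closed: "\<And>P y n r. primeideal P R \<Longrightarrow> y \<in> carrier R \<Longrightarrow> n > 0 \<Longrightarrow> r \<in> {..<n::nat} \<rightarrow> carrier R \<Longrightarrow>
        y [^] n \<oplus> (\<Oplus>i\<in>{..<n}. r i \<otimes> (y [^] i \<otimes> x [^] (n - i))) = \<zero> \<Longrightarrow>
        \<exists>s\<in>carrier R - P. \<exists>q\<in>carrier R. s \<otimes> y = q \<otimes> x"
    and x: "x \<in> carrier R" "x \<noteq> \<zero>" and f: "f \<in> carrier R"
    and not_dvd: "\<not> (\<exists>q\<in>carrier R. f = q \<otimes> x)"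
  obtains P c u where "primeideal P R" "x \<in> P"
    "\<forall>s\<in>carrier R. (\<exists>q\<in>carrier R. s \<otimes> f = q \<otimes> x) \<longrightarrow> s \<in> P"
    "\<forall>p. primeideal p R \<and> p \<subseteq> P \<and> x \<in> p \<longrightarrow> p = P"
    "c \<in> P" "u \<in> carrier R - P" "\<forall>b\<in>P. \<exists>v\<in>carrier R. u \<otimes> b = v \<otimes> c"
proof -
  interpret noetherian_domain R by (rule noeth)
  define mult where "mult y \<longleftrightarrow> (\<exists>q\<in>carrier R. y = q \<otimes> x)" for y
  define ann where "ann y = {s \<in> carrier R. mult (s \<otimes> y)}" for y
  have mult_add: "mult (a \<oplus> b)" if "mult a" "mult b" for a b
    using that x unfolding mult_def by (metis a_closed l_distr)
  have mult_mult: "mult (a \<otimes> b)" if "mult b" "a \<in> carrier R" for a b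
    using that x unfolding mult_def by (metis m_assoc m_closed)
  have ideal_ann: "ideal (ann y) R" if y: "y \<in> carrier R" for y
  proof (rule idealI)
    show "ring R" by (rule local.ring_axioms)
    show "subgroup (ann y) (add_monoid R)"
    proof (rule add.subgroupI)
      show "ann y \<subseteq> carrier R" by (auto simp: ann_def)
      have "\<zero> \<in> ann y" using x y by (auto simp: ann_def mult_def intro!: bexI[of _ \<zero>])
      then show "ann y \<noteq> {}" by blast
      fix a assume a: "a \<in> ann y"
      have "mult ((\<ominus> \<one>) \<otimes> (a \<otimes> y))" using a mult_mult[of "a \<otimes> y" "\<ominus> \<one>"] by (auto simp: ann_def)
      then show "\<ominus> a \<in> ann y" using a y by (auto simp: ann_def l_minus)
      fix b assume b: "b \<in> ann y"
      then show "a \<oplus> b \<in> ann y" using a y mult_add by (auto simp: ann_def l_distr)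
    qed
    fix a b assume a: "a \<in> ann y" and b: "b \<in> carrier R"
    then show "b \<otimes> a \<in> ann y" using y mult_mult[of "a \<otimes> y" b] by (auto simp: ann_def m_assoc)
    then show "a \<otimes> b \<in> ann y" using a b by (simp add: m_comm ann_def)
  qed
  define \<A> where "\<A> = {ann (g \<otimes> f) | g. g \<in> carrier R \<and> \<not> mult (g \<otimes> f)}"
  have "ann (\<one> \<otimes> f) \<in> \<A>"
    using not_dvd f by (auto simp: \<A>_def mult_def intro!: exI[of _ \<one>])
  have \<A>_ideal: "\<A> \<subseteq> {I. ideal I R}" using ideal_ann f by (auto simp: \<A>_def)
  have "\<exists>M\<in>\<A>. \<forall>N\<in>\<A>. M \<subseteq> N \<longrightarrow> N = M"
  proof (rule subset_Zorn_nonempty)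
    show "\<A> \<noteq> {}" using \<open>ann (\<one> \<otimes> f) \<in> \<A>\<close> by blast
    fix \<C> assume \<C>: "\<C> \<noteq> {}" "subset.chain \<A> \<C>"
    then have "subset.chain {I. ideal I R} \<C>" using \<A>_ideal by (auto simp: subset_chain_def)
    then have "\<Union>\<C> \<in> \<C>" using ideal_chain_is_trivial \<C>(1) by blast
    then show "\<Union>\<C> \<in> \<A>" using \<C>(2) by (auto simp: subset_chain_def)
  qed
  then obtain g where g: "g \<in> carrier R" and ng: "\<not> mult (g \<otimes> f)"
    and max: "\<And>h. h \<in> carrier R \<Longrightarrow> \<not> mult (h \<otimes> f) \<Longrightarrow> ann (g \<otimes> f) \<subseteq> ann (h \<otimes> f) \<Longrightarrow> ann (h \<otimes> f) = ann (g \<otimes> f)"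
    by (auto simp: \<A>_def)
  define y where "y = g \<otimes> f"
  define P where "P = ann y"
  have y: "y \<in> carrier R" using g f by (simp add: y_def)
  have P: "primeideal P R"
  proof (rule primeidealI)
    show "ideal P R" unfolding P_def using ideal_ann y by simp
    show "cring R" by (rule is_cring)
    have "\<one> \<notin> P" using ng y by (simp add: P_def ann_def y_def[symmetric])
    then show "carrier R \<noteq> P" by auto
    fix a b assume a: "a \<in> carrier R" and b: "b \<in> carrier R" and ab: "a \<otimes> b \<in> P"
    show "a \<in> P \<or> b \<in> P"
    proof (rule disjCI)
      assume nb: "b \<notin> P"
      have eq: "(b \<otimes> g) \<otimes> f = b \<otimes> y" using b g f by (simp add: y_def m_assoc)
      have nm: "\<not> mult ((b \<otimes> g) \<otimes> f)" using nb b unfolding eq by (simp add: P_def ann_def)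
      have "P \<subseteq> ann ((b \<otimes> g) \<otimes> f)"
      proof
        fix s assume "s \<in> P"
        then have "s \<in> carrier R" "mult (b \<otimes> (s \<otimes> y))" using mult_mult b by (auto simp: P_def ann_def)
        then show "s \<in> ann ((b \<otimes> g) \<otimes> f)" unfolding eq ann_def using b y by (simp add: m_lcomm)
      qed
      then have "ann (b \<otimes> y) = P" using max[of "b \<otimes> g"] nm b g eq by (simp add: P_def y_def)
      moreover have "a \<in> ann (b \<otimes> y)" using ab a b y by (simp add: P_def ann_def m_assoc)
      ultimately show "a \<in> P" by simp
    qed
  qed
  interpret P: primeideal P R by (rule P)
  have "mult (x \<otimes> y)" unfolding mult_def using m_comm[OF x(1) y] y by blast
  then have xP: "x \<in> P" unfolding P_def ann_def using x by blast
  have P_contains: "s \<in> P" if s: "s \<in> carrier R" and "\<exists>q\<in>carrier R. s \<otimes> f = q \<otimes> x" for s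
  proof -
    have "mult (s \<otimes> f)" using that(2) unfolding mult_def .
    then have "mult (g \<otimes> (s \<otimes> f))" using g by (rule mult_mult)
    then have "mult (s \<otimes> y)" unfolding y_def using m_lcomm[OF s g f] by argo
    then show ?thesis unfolding P_def ann_def using s by blast
  qed
  \<comment> \<open>the fraction \<open>y / x\<close> as a map from \<open>P\<close> to \<open>R\<close>\<close>
  define z where "z b = (SOME q. q \<in> carrier R \<and> b \<otimes> y = q \<otimes> x)" for b
  have z: "z b \<in> carrier R" "b \<otimes> y = z b \<otimes> x" if "b \<in> P" for b
    using someI_ex[of "\<lambda>q. q \<in> carrier R \<and> b \<otimes> y = q \<otimes> x"] that
    unfolding z_def P_def ann_def mult_def by auto
  obtain c where c: "c \<in> P" "z c \<notin> P"
  proof -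
    have False if stable: "\<forall>b\<in>P. z b \<in> P"
    proof -
      define q where "q n = (z ^^ n) x" for n
      have qP: "q n \<in> P" for n by (induction n) (use xP stable in \<open>auto simp: q_def\<close>)
      then have q: "q n \<in> carrier R" for n using P.Icarr by blast
      have step: "y \<otimes> q n = x \<otimes> q (Suc n)" for n
        using z[OF qP[of n]] y q x by (simp add: q_def m_comm)
      \<comment> \<open>if \<open>y / x\<close> preserves \<open>P\<close>, the sequence \<open>(y / x)\<^sup>k x\<close> stays in \<open>R\<close>, and a linear relation in it is an integral equation for \<open>y / x\<close>\<close>
      have pow: "y [^] k \<otimes> x = x [^] k \<otimes> q k" for k :: nat
      proof (induction k)
        case 0
        then show ?case using x by (simp add: q_def)
      next
        case (Suc k)
        have "y [^] Suc k \<otimes> x = y \<otimes> (y [^] k \<otimes> x)" using x y by (simp add: m_ac)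
        also have "\<dots> = x [^] k \<otimes> (y \<otimes> q k)" unfolding Suc using x y q by (simp add: m_ac)
        also have "\<dots> = x [^] Suc k \<otimes> q (Suc k)" unfolding step using x y q by (simp add: m_ac)
        finally show ?case .
      qed
      obtain n r where r: "r \<in> {..<n} \<rightarrow> carrier R" and qn: "q n = (\<Oplus>i\<in>{..<n}. r i \<otimes> q i)"
        by (rule noetherian_sequence[OF is_cring, of q, OF q])
      let ?t = "\<lambda>i. y [^] i \<otimes> x [^] (n - i)"
      have "y [^] n \<otimes> x = (\<Oplus>i\<in>{..<n}. x [^] n \<otimes> (r i \<otimes> q i))"
        unfolding pow qn by (rule finsum_rdistr) (use r q x in \<open>auto simp: Pi_def\<close>)
      also have "\<dots> = (\<Oplus>i\<in>{..<n}. (r i \<otimes> ?t i) \<otimes> x)"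
      proof (rule finsum_cong')
        fix i assume i: "i \<in> {..<n}"
        then have ri: "r i \<in> carrier R" using r by blast
        have "x [^] n \<otimes> (r i \<otimes> q i) = r i \<otimes> (x [^] (n - i) \<otimes> (x [^] i \<otimes> q i))"
          using i ri x q nat_pow_mult[OF x(1), of "n - i" i] by (simp add: m_ac)
        also have "\<dots> = (r i \<otimes> ?t i) \<otimes> x"
          unfolding pow[symmetric] using i ri x y q by (simp add: m_ac)
        finally show "x [^] n \<otimes> (r i \<otimes> q i) = (r i \<otimes> ?t i) \<otimes> x" .
      qed (use r q x y in \<open>auto simp: Pi_def\<close>)
      also have "\<dots> = (\<Oplus>i\<in>{..<n}. r i \<otimes> ?t i) \<otimes> x"
        by (rule finsum_ldistr[symmetric]) (use r q x y in \<open>auto simp: Pi_def\<close>)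
      finally have yn: "y [^] n = (\<Oplus>i\<in>{..<n}. r i \<otimes> ?t i)"
        using x y r by (subst (asm) m_rcancel) (auto intro!: finsum_closed simp: Pi_def)
      have "n > 0"
      proof (rule ccontr)
        assume "\<not> n > 0"
        then show False using yn by simp
      qed
      have "(\<Oplus>i\<in>{..<n}. (\<ominus> (r i)) \<otimes> ?t i) = (\<Oplus>i\<in>{..<n}. (\<ominus> \<one>) \<otimes> (r i \<otimes> ?t i))"
        by (rule finsum_cong') (use r x y in \<open>auto simp: Pi_def l_minus\<close>)
      also have "\<dots> = (\<ominus> \<one>) \<otimes> (\<Oplus>i\<in>{..<n}. r i \<otimes> ?t i)"
        by (rule finsum_rdistr[symmetric]) (use r x y in \<open>auto simp: Pi_def\<close>)
      finally have "(\<Oplus>i\<in>{..<n}. (\<ominus> (r i)) \<otimes> ?t i) = \<ominus> (y [^] n)"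
        using y by (simp add: yn[symmetric] l_minus)
      then have "y [^] n \<oplus> (\<Oplus>i\<in>{..<n}. (\<ominus> (r i)) \<otimes> ?t i) = \<zero>"
        using y by (simp add: r_neg)
      moreover have "(\<lambda>i. \<ominus> (r i)) \<in> {..<n} \<rightarrow> carrier R" using r by (auto simp: Pi_def)
      ultimately have "\<exists>s\<in>carrier R - P. \<exists>q\<in>carrier R. s \<otimes> y = q \<otimes> x"
        using closed[OF P y \<open>n > 0\<close>] by blast
      then show False unfolding P_def ann_def mult_def by blast
    qed
    then show ?thesis using that by blast
  qed
  have cc: "c \<in> carrier R" using c P.Icarr by blast
  have u: "z c \<in> carrier R - P" using c z by blast
  have gen: "\<exists>v\<in>carrier R. z c \<otimes> b = v \<otimes> c" if b: "b \<in> P" for b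
  proof
    have bc: "b \<in> carrier R" using b P.Icarr by blast
    have "x \<otimes> (z c \<otimes> b) = (z c \<otimes> x) \<otimes> b" using x u bc by (simp add: m_ac)
    also have "\<dots> = (b \<otimes> y) \<otimes> c" unfolding z(2)[OF c(1), symmetric] using cc bc y by (simp add: m_ac)
    also have "\<dots> = x \<otimes> (z b \<otimes> c)" unfolding z(2)[OF b] using cc x z(1)[OF b] by (simp add: m_ac)
    finally show "z c \<otimes> b = z b \<otimes> c"
      using x u bc cc z(1)[OF b] by (simp add: m_lcancel)
    show "z b \<in> carrier R" using z b by blast
  qed
  have minimal: "p = P" if p: "primeideal p R" and sub: "p \<subseteq> P" and xp: "x \<in> p" for p
  proof -
    interpret p: primeideal p R by (rule p)
    obtain n :: nat and s t where st: "s \<in> carrier R - P" "t \<in> carrier R - P" "s \<otimes> x = t \<otimes> c [^] n"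
      by (rule factor_by_uniformizer[OF P c(1) u gen x])
    have cp: "c \<in> p"
    proof (rule ccontr)
      assume nc: "c \<notin> p"
      have "c [^] n \<notin> p" for n :: nat
      proof (induction n)
        case 0
        then show ?case using p.I_notcarr p.one_imp_carrier by auto
      next
        case (Suc n)
        then show ?case using nc cc p.I_prime[of "c [^] n" c] by auto
      qed
      moreover have "t \<otimes> c [^] n \<in> p" using st xp p.I_l_closed[of x s] by auto
      ultimately show False using p.I_prime[of t "c [^] n"] st cc sub by auto
    qed
    show ?thesis
    proof
      show "P \<subseteq> p"
      proof
        fix b assume b: "b \<in> P"
        then obtain v where v: "v \<in> carrier R" "z c \<otimes> b = v \<otimes> c" using gen by blast
        then have "z c \<otimes> b \<in> p" using cp p.I_l_closed by simp
        then show "b \<in> p" using p.I_prime[of "z c" b] u b P.Icarr sub by blast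
      qed
    qed (rule sub)
  qed
  show thesis
    by (rule that[OF P xP _ _ c(1) u]) (use P_contains minimal gen in blast)+
qed

section \<open>Ring homomorphisms\<close>

lemma ring_hom_Units:
  assumes "h \<in> ring_hom R S" "u \<in> Units R"
  shows "h u \<in> Units S"
proof -
  from assms(2) obtain v where u: "u \<in> carrier R" and v: "v \<in> carrier R"
    and e: "v \<otimes>\<^bsub>R\<^esub> u = \<one>\<^bsub>R\<^esub>" "u \<otimes>\<^bsub>R\<^esub> v = \<one>\<^bsub>R\<^esub>" unfolding Units_def by blast
  have "h v \<otimes>\<^bsub>S\<^esub> h u = \<one>\<^bsub>S\<^esub>" "h u \<otimes>\<^bsub>S\<^esub> h v = \<one>\<^bsub>S\<^esub>"
    using ring_hom_mult[OF assms(1) v u] ring_hom_mult[OF assms(1) u v] e ring_hom_one[OF assms(1)] by auto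
  then show ?thesis using ring_hom_closed[OF assms(1)] u v unfolding Units_def by blast
qed

lemma cring_UnitsI:
  assumes "cring R" "u \<in> carrier R" "v \<in> carrier R" "u \<otimes>\<^bsub>R\<^esub> v = \<one>\<^bsub>R\<^esub>"
  shows "u \<in> Units R"
  using assms cring.cring_simprules(14)[OF assms(1)] unfolding Units_def by fastforce

lemma ring_hom_nat_pow:
  assumes "h \<in> ring_hom R S" "ring R" "ring S" "a \<in> carrier R"
  shows "h (a [^]\<^bsub>R\<^esub> (n::nat)) = h a [^]\<^bsub>S\<^esub> n"
  by (rule ring_hom_ring.hom_nat_pow[OF ring_hom_ringI2[OF assms(2,3,1)] assms(4)])

lemma ring_hom_minus:
  assumes "h \<in> ring_hom R S" "cring R" "cring S" "a \<in> carrier R" "b \<in> carrier R"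
  shows "h (a \<ominus>\<^bsub>R\<^esub> b) = h a \<ominus>\<^bsub>S\<^esub> h b"
proof -
  interpret ring_hom_cring R S h
    by (rule ring_hom_cring.intro[OF assms(2,3)]) (unfold_locales, rule assms(1))
  show ?thesis using assms(4,5) by (simp add: a_minus_def)
qed

lemma ring_hom_finsum:
  assumes "h \<in> ring_hom R S" "cring R" "cring S" "f \<in> M \<rightarrow> carrier R"
  shows "h (\<Oplus>\<^bsub>R\<^esub>i\<in>M. f i) = (\<Oplus>\<^bsub>S\<^esub>i\<in>M. h (f i))"
proof -
  have "ring_hom_cring R S h"
    by (rule ring_hom_cring.intro[OF assms(2,3)]) (rule ring_hom_cring_axioms.intro[OF assms(1)])
  from ring_hom_cring.hom_finsum[OF this assms(4)] show ?thesis by (simp add: o_def)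
qed


section \<open>Stalks\<close>

locale presheaf_space =
  fixes \<XX> :: "('p, 's) ringed_space"
  assumes presheaf: "presheaf \<XX>"
begin

lemmas presheaf_objects = presheaf[unfolded presheaf_def, THEN conjunct1, rule_format]
lemmas presheaf_maps = presheaf[unfolded presheaf_def, THEN conjunct2, THEN conjunct1, rule_format, OF conjI, OF _ conjI]

lemma sec_cring: "openin (Sp \<XX>) U \<Longrightarrow> cring (Sec \<XX> U)"
  and Cst_hom: "openin (Sp \<XX>) U \<Longrightarrow> Cst \<XX> U \<in> ring_hom complex_ring (Sec \<XX> U)"
  and res_id: "openin (Sp \<XX>) U \<Longrightarrow> s \<in> carrier (Sec \<XX> U) \<Longrightarrow> Res \<XX> U U s = s"
  by (rule presheaf_objects[THEN conjunct1] presheaf_objects[THEN conjunct2, THEN conjunct1]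
    presheaf_objects[THEN conjunct2, THEN conjunct2, rule_format]; assumption)+

lemma sec_ring: "openin (Sp \<XX>) U \<Longrightarrow> ring (Sec \<XX> U)"
  using sec_cring cring.axioms(1) by blast

lemma res_hom: "openin (Sp \<XX>) U \<Longrightarrow> openin (Sp \<XX>) V \<Longrightarrow> V \<subseteq> U \<Longrightarrow> Res \<XX> U V \<in> ring_hom (Sec \<XX> U) (Sec \<XX> V)"
  and res_Cst: "openin (Sp \<XX>) U \<Longrightarrow> openin (Sp \<XX>) V \<Longrightarrow> V \<subseteq> U \<Longrightarrow> Res \<XX> U V (Cst \<XX> U z) = Cst \<XX> V z"
  by (rule presheaf_maps[THEN conjunct1] presheaf_maps[THEN conjunct2, rule_format]; assumption)+

lemma res_res: "openin (Sp \<XX>) U \<Longrightarrow> openin (Sp \<XX>) V \<Longrightarrow> openin (Sp \<XX>) W \<Longrightarrow> W \<subseteq> V \<Longrightarrow> V \<subseteq> U \<Longrightarrow>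
    s \<in> carrier (Sec \<XX> U) \<Longrightarrow> Res \<XX> V W (Res \<XX> U V s) = Res \<XX> U W s"
  by (rule presheaf[unfolded presheaf_def, THEN conjunct2, THEN conjunct2, rule_format]) auto

lemma res_closed: "openin (Sp \<XX>) U \<Longrightarrow> openin (Sp \<XX>) V \<Longrightarrow> V \<subseteq> U \<Longrightarrow> s \<in> carrier (Sec \<XX> U) \<Longrightarrow>
    Res \<XX> U V s \<in> carrier (Sec \<XX> V)"
  by (rule ring_hom_closed[OF res_hom])

lemma germ_eqI:
  assumes op: "openin (Sp \<XX>) U" "openin (Sp \<XX>) V" "openin (Sp \<XX>) W" and sub: "W \<subseteq> U" "W \<subseteq> V" and x: "x \<in> W"
    and s: "s \<in> carrier (Sec \<XX> U)" "t \<in> carrier (Sec \<XX> V)" and eq: "Res \<XX> U W s = Res \<XX> V W t"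
  shows "germ \<XX> x U s = germ \<XX> x V t"
proof -
  have *: "germ \<XX> x U s \<subseteq> germ \<XX> x V t"
    if op: "openin (Sp \<XX>) U" "openin (Sp \<XX>) V" and sub: "W \<subseteq> U" "W \<subseteq> V"
      and s: "s \<in> carrier (Sec \<XX> U)" "t \<in> carrier (Sec \<XX> V)" and eq: "Res \<XX> U W s = Res \<XX> V W t" for U V s t
  proof
    fix g assume "g \<in> germ \<XX> x U s"
    then obtain V' t' W' where g: "g = (V', t')" and V': "openin (Sp \<XX>) V'" "x \<in> V'" "t' \<in> carrier (Sec \<XX> V')"
      and W': "openin (Sp \<XX>) W'" "x \<in> W'" "W' \<subseteq> U \<inter> V'" and eq': "Res \<XX> U W' s = Res \<XX> V' W' t'"
      unfolding germ_def by blast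
    have o: "openin (Sp \<XX>) (W \<inter> W')" using assms(3) W'(1) by (rule openin_Int)
    have "Res \<XX> V (W \<inter> W') t = Res \<XX> W (W \<inter> W') (Res \<XX> V W t)"
      using res_res[OF op(2) assms(3) o _ sub(2) s(2)] by simp
    also have "\<dots> = Res \<XX> U (W \<inter> W') s"
      unfolding eq[symmetric] using res_res[OF op(1) assms(3) o _ sub(1) s(1)] by simp
    also have "\<dots> = Res \<XX> W' (W \<inter> W') (Res \<XX> U W' s)"
      using res_res[OF op(1) W'(1) o _ _ s(1)] W'(3) by simp
    also have "\<dots> = Res \<XX> V' (W \<inter> W') t'"
      unfolding eq' using res_res[OF V'(1) W'(1) o _ _ V'(3)] W'(3) by simp
    finally have "Res \<XX> V (W \<inter> W') t = Res \<XX> V' (W \<inter> W') t'" .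
    moreover have "x \<in> W \<inter> W'" "W \<inter> W' \<subseteq> V \<inter> V'" using x W'(2,3) sub(2) by auto
    ultimately show "g \<in> germ \<XX> x V t" unfolding g germ_def using V' o by blast
  qed
  show ?thesis using *[OF op(1,2) sub s eq] *[OF op(2,1) sub(2,1) s(2,1) eq[symmetric]] by blast
qed

lemma germ_eqD:
  assumes "germ \<XX> x U s = germ \<XX> x V t" "openin (Sp \<XX>) V" "x \<in> V" "t \<in> carrier (Sec \<XX> V)"
  obtains W where "openin (Sp \<XX>) W" "x \<in> W" "W \<subseteq> U" "W \<subseteq> V" "Res \<XX> U W s = Res \<XX> V W t"
proof -
  have "(V, t) \<in> germ \<XX> x V t" unfolding germ_def using assms(2-4) by blast
  then have "(V, t) \<in> germ \<XX> x U s" using assms(1) by simp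
  then obtain W where "openin (Sp \<XX>) W" "x \<in> W" "W \<subseteq> U \<inter> V" "Res \<XX> U W s = Res \<XX> V W t"
    unfolding germ_def by blast
  then show ?thesis using that by blast
qed

lemma germ_res:
  assumes "openin (Sp \<XX>) U" "openin (Sp \<XX>) W" "W \<subseteq> U" "x \<in> W" "s \<in> carrier (Sec \<XX> U)"
  shows "germ \<XX> x W (Res \<XX> U W s) = germ \<XX> x U s"
  using assms res_id[OF assms(2) res_closed[OF assms(1-3,5)]]
  by (intro germ_eqI[of W U W]) (auto intro: res_closed)

lemma openin_points: "openin (Sp \<XX>) (points \<XX>)"
  by simp

lemma stalk_carrierE:
  assumes "g \<in> carrier (stalk \<XX> x)"
  obtains U s where "openin (Sp \<XX>) U" "x \<in> U" "s \<in> carrier (Sec \<XX> U)" "g = germ \<XX> x U s"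
  using assms unfolding stalk_def by auto

lemma germ_closed:
  "openin (Sp \<XX>) U \<Longrightarrow> x \<in> U \<Longrightarrow> s \<in> carrier (Sec \<XX> U) \<Longrightarrow> germ \<XX> x U s \<in> carrier (stalk \<XX> x)"
  unfolding stalk_def by auto

text \<open>
  The operations of the stalk are definite descriptions over representatives on a common neighbourhood. Any two
  choices agree on a smaller neighbourhood when \<open>f\<close> is compatible with restriction.
\<close>

lemma germ_op_unique:
  assumes op: "\<And>U W s t. openin (Sp \<XX>) U \<Longrightarrow> openin (Sp \<XX>) W \<Longrightarrow> W \<subseteq> U \<Longrightarrow> s \<in> carrier (Sec \<XX> U) \<Longrightarrow>
        t \<in> carrier (Sec \<XX> U) \<Longrightarrow> f U s t \<in> carrier (Sec \<XX> U) \<and> Res \<XX> U W (f U s t) = f W (Res \<XX> U W s) (Res \<XX> U W t)"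
    and U: "openin (Sp \<XX>) U" "x \<in> U" "s \<in> carrier (Sec \<XX> U)" "t \<in> carrier (Sec \<XX> U)"
  shows "(THE g. \<exists>U' s' t'. openin (Sp \<XX>) U' \<and> x \<in> U' \<and> s' \<in> carrier (Sec \<XX> U') \<and>
        t' \<in> carrier (Sec \<XX> U') \<and> germ \<XX> x U s = germ \<XX> x U' s' \<and> germ \<XX> x U t = germ \<XX> x U' t' \<and>
        g = germ \<XX> x U' (f U' s' t')) = germ \<XX> x U (f U s t)"
proof (rule the_equality)
  show "\<exists>U' s' t'. openin (Sp \<XX>) U' \<and> x \<in> U' \<and> s' \<in> carrier (Sec \<XX> U') \<and>
        t' \<in> carrier (Sec \<XX> U') \<and> germ \<XX> x U s = germ \<XX> x U' s' \<and> germ \<XX> x U t = germ \<XX> x U' t' \<and>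
        germ \<XX> x U (f U s t) = germ \<XX> x U' (f U' s' t')" using U by blast
next
  fix g assume "\<exists>U' s' t'. openin (Sp \<XX>) U' \<and> x \<in> U' \<and> s' \<in> carrier (Sec \<XX> U') \<and>
        t' \<in> carrier (Sec \<XX> U') \<and> germ \<XX> x U s = germ \<XX> x U' s' \<and> germ \<XX> x U t = germ \<XX> x U' t' \<and>
        g = germ \<XX> x U' (f U' s' t')"
  then obtain U' s' t' where U': "openin (Sp \<XX>) U'" "x \<in> U'" "s' \<in> carrier (Sec \<XX> U')" "t' \<in> carrier (Sec \<XX> U')"
    and e1: "germ \<XX> x U s = germ \<XX> x U' s'" and e2: "germ \<XX> x U t = germ \<XX> x U' t'"
    and g: "g = germ \<XX> x U' (f U' s' t')" by blast
  obtain W1 where W1: "openin (Sp \<XX>) W1" "x \<in> W1" "W1 \<subseteq> U" "W1 \<subseteq> U'" "Res \<XX> U W1 s = Res \<XX> U' W1 s'"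
    by (rule germ_eqD[OF e1 U'(1,2,3)])
  obtain W2 where W2: "openin (Sp \<XX>) W2" "x \<in> W2" "W2 \<subseteq> U" "W2 \<subseteq> U'" "Res \<XX> U W2 t = Res \<XX> U' W2 t'"
    by (rule germ_eqD[OF e2 U'(1,2,4)])
  let ?W = "W1 \<inter> W2"
  have W: "openin (Sp \<XX>) ?W" using W1(1) W2(1) by (rule openin_Int)
  have "Res \<XX> U ?W s = Res \<XX> U' ?W s'"
    using res_res[OF U(1) W1(1) W _ W1(3) U(3)] res_res[OF U'(1) W1(1) W _ W1(4) U'(3)] W1(5) by simp
  moreover have "Res \<XX> U ?W t = Res \<XX> U' ?W t'"
    using res_res[OF U(1) W2(1) W _ W2(3) U(4)] res_res[OF U'(1) W2(1) W _ W2(4) U'(4)] W2(5) by simp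
  moreover have sub: "?W \<subseteq> U" "?W \<subseteq> U'" "x \<in> ?W" using W1 W2 by auto
  ultimately have "Res \<XX> U ?W (f U s t) = Res \<XX> U' ?W (f U' s' t')"
    using op[OF U(1) W sub(1) U(3,4)] op[OF U'(1) W sub(2) U'(3,4)] by simp
  then show "g = germ \<XX> x U (f U s t)"
    unfolding g using sub U U' W op[OF U(1) W sub(1) U(3,4)] op[OF U'(1) W sub(2) U'(3,4)]
    by (intro germ_eqI[of U' U ?W]) auto
qed

lemma germ_mult:
  assumes U: "openin (Sp \<XX>) U" "x \<in> U" "s \<in> carrier (Sec \<XX> U)" "t \<in> carrier (Sec \<XX> U)"
  shows "germ \<XX> x U (s \<otimes>\<^bsub>Sec \<XX> U\<^esub> t) = germ \<XX> x U s \<otimes>\<^bsub>stalk \<XX> x\<^esub> germ \<XX> x U t"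
  using germ_op_unique[of "\<lambda>U s t. s \<otimes>\<^bsub>Sec \<XX> U\<^esub> t", OF _ U] sec_cring res_hom
  by (simp add: stalk_def cring.cring_simprules ring_hom_mult)

lemma germ_add:
  assumes U: "openin (Sp \<XX>) U" "x \<in> U" "s \<in> carrier (Sec \<XX> U)" "t \<in> carrier (Sec \<XX> U)"
  shows "germ \<XX> x U (s \<oplus>\<^bsub>Sec \<XX> U\<^esub> t) = germ \<XX> x U s \<oplus>\<^bsub>stalk \<XX> x\<^esub> germ \<XX> x U t"
  using germ_op_unique[of "\<lambda>U s t. s \<oplus>\<^bsub>Sec \<XX> U\<^esub> t", OF _ U] sec_cring res_hom
  by (simp add: stalk_def cring.cring_simprules ring_hom_add)

lemma germ_one:
  assumes U: "openin (Sp \<XX>) U" "x \<in> U"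
  shows "germ \<XX> x U \<one>\<^bsub>Sec \<XX> U\<^esub> = \<one>\<^bsub>stalk \<XX> x\<^esub>"
proof -
  have sub: "U \<subseteq> points \<XX>" using openin_subset[OF U(1)] .
  have "germ \<XX> x U \<one>\<^bsub>Sec \<XX> U\<^esub> = germ \<XX> x (points \<XX>) \<one>\<^bsub>glob \<XX>\<^esub>"
    using U sub sec_cring[OF U(1)] sec_cring[OF openin_points] ring_hom_one[OF res_hom[OF openin_points U(1) sub]]
      res_id[OF U(1)]
    by (intro germ_eqI[of U "points \<XX>" U]) (auto simp: cring.cring_simprules)
  then show ?thesis by (simp add: stalk_def)
qed

lemma germ_zero:
  assumes U: "openin (Sp \<XX>) U" "x \<in> U"
  shows "germ \<XX> x U \<zero>\<^bsub>Sec \<XX> U\<^esub> = \<zero>\<^bsub>stalk \<XX> x\<^esub>"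
proof -
  have sub: "U \<subseteq> points \<XX>" using openin_subset[OF U(1)] .
  have "germ \<XX> x U \<zero>\<^bsub>Sec \<XX> U\<^esub> = germ \<XX> x (points \<XX>) \<zero>\<^bsub>glob \<XX>\<^esub>"
    using U sub sec_cring[OF U(1)] sec_cring[OF openin_points]
      ring_hom_zero[OF res_hom[OF openin_points U(1) sub] sec_ring[OF openin_points] sec_ring[OF U(1)]]
      res_id[OF U(1)]
    by (intro germ_eqI[of U "points \<XX>" U]) (auto simp: cring.cring_simprules)
  then show ?thesis by (simp add: stalk_def)
qed

lemma germ_hom:
  assumes U: "openin (Sp \<XX>) U" "x \<in> U"
  shows "germ \<XX> x U \<in> ring_hom (Sec \<XX> U) (stalk \<XX> x)"
  using U by (intro ring_hom_memI) (auto simp: germ_closed germ_mult germ_add germ_one)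

text \<open>
  A germ inverse to \<open>s\<close> is represented by a section near \<open>x\<close>, and the product becomes one after shrinking the
  neighbourhood again. In particular invertibility of a germ is an open condition.
\<close>

lemma germ_Units_iff:
  assumes U: "openin (Sp \<XX>) U" "x \<in> U" "s \<in> carrier (Sec \<XX> U)"
  shows "germ \<XX> x U s \<in> Units (stalk \<XX> x) \<longleftrightarrow>
    (\<exists>W. openin (Sp \<XX>) W \<and> x \<in> W \<and> W \<subseteq> U \<and> Res \<XX> U W s \<in> Units (Sec \<XX> W))"
proof
  assume "germ \<XX> x U s \<in> Units (stalk \<XX> x)"
  then obtain g where g: "g \<in> carrier (stalk \<XX> x)" "germ \<XX> x U s \<otimes>\<^bsub>stalk \<XX> x\<^esub> g = \<one>\<^bsub>stalk \<XX> x\<^esub>"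
    unfolding Units_def by blast
  obtain V t where V: "openin (Sp \<XX>) V" "x \<in> V" "t \<in> carrier (Sec \<XX> V)" and gt: "g = germ \<XX> x V t"
    using stalk_carrierE[OF g(1)] by blast
  let ?N = "U \<inter> V"
  have N: "openin (Sp \<XX>) ?N" "x \<in> ?N" "?N \<subseteq> U" "?N \<subseteq> V" using U V by auto
  let ?s = "Res \<XX> U ?N s" and ?t = "Res \<XX> V ?N t"
  have s: "?s \<in> carrier (Sec \<XX> ?N)" and t: "?t \<in> carrier (Sec \<XX> ?N)"
    using res_closed U V N by auto
  have "germ \<XX> x ?N (?s \<otimes>\<^bsub>Sec \<XX> ?N\<^esub> ?t) = germ \<XX> x U s \<otimes>\<^bsub>stalk \<XX> x\<^esub> germ \<XX> x V t"
    using germ_mult[OF N(1,2) s t] germ_res U V N by simp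
  also have "\<dots> = germ \<XX> x ?N \<one>\<^bsub>Sec \<XX> ?N\<^esub>" using g(2) gt germ_one[OF N(1,2)] by simp
  finally have e: "germ \<XX> x ?N (?s \<otimes>\<^bsub>Sec \<XX> ?N\<^esub> ?t) = germ \<XX> x ?N \<one>\<^bsub>Sec \<XX> ?N\<^esub>" .
  obtain W where W: "openin (Sp \<XX>) W" "x \<in> W" "W \<subseteq> ?N"
    and eW: "Res \<XX> ?N W (?s \<otimes>\<^bsub>Sec \<XX> ?N\<^esub> ?t) = Res \<XX> ?N W \<one>\<^bsub>Sec \<XX> ?N\<^esub>"
    by (rule germ_eqD[OF e N(1,2) cring.cring_simprules(6)[OF sec_cring[OF N(1)]]])
  have h: "Res \<XX> ?N W \<in> ring_hom (Sec \<XX> ?N) (Sec \<XX> W)" using res_hom N(1) W by blast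
  have "Res \<XX> ?N W ?s \<otimes>\<^bsub>Sec \<XX> W\<^esub> Res \<XX> ?N W ?t = \<one>\<^bsub>Sec \<XX> W\<^esub>"
    using eW ring_hom_mult[OF h s t] ring_hom_one[OF h] by simp
  then have "Res \<XX> ?N W ?s \<in> Units (Sec \<XX> W)"
    using cring_UnitsI[OF sec_cring[OF W(1)]] ring_hom_closed[OF h] s t by blast
  moreover have "Res \<XX> ?N W ?s = Res \<XX> U W s" using res_res[OF U(1) N(1) W(1,3) N(3) U(3)] .
  ultimately show "\<exists>W. openin (Sp \<XX>) W \<and> x \<in> W \<and> W \<subseteq> U \<and> Res \<XX> U W s \<in> Units (Sec \<XX> W)"
    using W N(3) by (intro exI[of _ W]) auto
next
  assume "\<exists>W. openin (Sp \<XX>) W \<and> x \<in> W \<and> W \<subseteq> U \<and> Res \<XX> U W s \<in> Units (Sec \<XX> W)"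
  then obtain W where W: "openin (Sp \<XX>) W" "x \<in> W" "W \<subseteq> U" "Res \<XX> U W s \<in> Units (Sec \<XX> W)" by blast
  then have "germ \<XX> x W (Res \<XX> U W s) \<in> Units (stalk \<XX> x)" using ring_hom_Units[OF germ_hom[OF W(1,2)]] by blast
  then show "germ \<XX> x U s \<in> Units (stalk \<XX> x)" using germ_res[OF U(1) W(1,3,2) U(3)] by simp
qed

end


section \<open>Affine charts\<close>

text \<open>
  The distinguished open subsets, given as a subbasis, form a basis: the intersection of two of them is the one
  defined by the product, because the points are prime ideals.
\<close>

lemma spec_topology_basis:
  assumes A: "cring A" and "openin (spec_topology A) N" "p \<in> N"
  shows "\<exists>f\<in>carrier A. f \<notin> p \<and> {q \<in> prime_spectrum A. f \<notin> q} \<subseteq> N \<and> p \<in> prime_spectrum A"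
proof -
  interpret cring A by (rule A)
  let ?B = "(\<lambda>f. {p \<in> prime_spectrum A. f \<notin> p}) ` carrier A"
  have "generate_topology_on ?B N"
    using assms(2) unfolding spec_topology_def by (rule openin_topology_generated_by)
  then show ?thesis using assms(3)
  proof (induction arbitrary: p)
    case Empty
    then show ?case by simp
  next
    case (Int a b)
    obtain f where f: "f \<in> carrier A" "f \<notin> p" "{q \<in> prime_spectrum A. f \<notin> q} \<subseteq> a" "p \<in> prime_spectrum A"
      using Int.IH(1)[of p] Int.prems by auto
    obtain g where g: "g \<in> carrier A" "g \<notin> p" "{q \<in> prime_spectrum A. g \<notin> q} \<subseteq> b"
      using Int.IH(2)[of p] Int.prems by auto
    have pr: "primeideal q A" if "q \<in> prime_spectrum A" for q using that by (simp add: prime_spectrum_def)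
    have "f \<otimes>\<^bsub>A\<^esub> g \<notin> p" using f g primeideal.I_prime[OF pr[OF f(4)]] by blast
    moreover have "{q \<in> prime_spectrum A. f \<otimes>\<^bsub>A\<^esub> g \<notin> q} \<subseteq> a \<inter> b"
    proof
      fix q assume "q \<in> {q \<in> prime_spectrum A. f \<otimes>\<^bsub>A\<^esub> g \<notin> q}"
      then have q: "q \<in> prime_spectrum A" and n: "f \<otimes>\<^bsub>A\<^esub> g \<notin> q" by auto
      interpret q: primeideal q A by (rule pr[OF q])
      have "f \<notin> q" "g \<notin> q" using n q.I_l_closed q.I_r_closed f(1) g(1) by blast+
      then show "q \<in> a \<inter> b" using f(3) g(3) q by blast
    qed
    ultimately show ?case using f g by (intro bexI[of _ "f \<otimes>\<^bsub>A\<^esub> g"]) auto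
  next
    case (UN K)
    then obtain k where k: "k \<in> K" "p \<in> k" by blast
    then show ?case using UN.IH[OF k] by blast
  next
    case (Basis s)
    then show ?case by blast
  qed
qed

text \<open>
  With the isomorphism \<open>\<pi>\<close> to the spectrum fixed, a point of \<open>U\<close> is a prime ideal, specialization is inclusion
  of primes, and germs at a point are fractions of sections on \<open>U\<close>.
\<close>

locale affine_chart = presheaf_space +
  fixes U :: "'p set" and \<pi> :: "'p \<Rightarrow> 's set"
  assumes U_open: "openin (Sp \<XX>) U"
    and homeo: "homeomorphic_map (subtopology (Sp \<XX>) U) (spec_topology (Sec \<XX> U)) \<pi>"
    and loc: "f \<in> carrier (Sec \<XX> U) \<Longrightarrow>
           is_localization (Sec \<XX> U) {f [^]\<^bsub>Sec \<XX> U\<^esub> n | n::nat. True}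
             (Sec \<XX> {x \<in> U. f \<notin> \<pi> x}) (Res \<XX> U {x \<in> U. f \<notin> \<pi> x})"
begin

abbreviation A where "A \<equiv> Sec \<XX> U"
abbreviation Dist where "Dist f \<equiv> {x \<in> U. f \<notin> \<pi> x}"

sublocale A: cring A using sec_cring U_open .

lemma top_U: "topspace (subtopology (Sp \<XX>) U) = U"
  using openin_subset[OF U_open] by (simp add: topspace_subtopology Int_absorb1)

lemma top_spec: "topspace (spec_topology A) = prime_spectrum A"
proof -
  have "\<one>\<^bsub>A\<^esub> \<notin> p" if "p \<in> prime_spectrum A" for p
    using that primeideal.I_notcarr[of p A] ideal.one_imp_carrier[of p A] primeideal.axioms(1)
    unfolding prime_spectrum_def by blast
  then have "p \<in> topspace (spec_topology A)" if "p \<in> prime_spectrum A" for p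
    using that by (auto simp: spec_topology_def intro!: bexI[of _ "\<one>\<^bsub>A\<^esub>"])
  then show ?thesis by (auto simp: spec_topology_def)
qed

lemma pi_image: "\<pi> ` U = prime_spectrum A"
  using homeomorphic_imp_surjective_map[OF homeo] top_U top_spec by simp

lemma pi_prime: "x \<in> U \<Longrightarrow> primeideal (\<pi> x) A"
  using pi_image unfolding prime_spectrum_def by blast

lemma pi_surj: assumes "primeideal p A" obtains x where "x \<in> U" "\<pi> x = p"
proof -
  have "p \<in> \<pi> ` U" using assms pi_image unfolding prime_spectrum_def by blast
  then show ?thesis using that by blast
qed

lemma pi_inj: "x \<in> U \<Longrightarrow> y \<in> U \<Longrightarrow> \<pi> x = \<pi> y \<Longrightarrow> x = y"
  using homeomorphic_imp_injective_map[OF homeo] top_U inj_onD by fastforce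

lemma Dist_open: assumes "f \<in> carrier A" shows "openin (Sp \<XX>) (Dist f)"
proof -
  have "openin (spec_topology A) {p \<in> prime_spectrum A. f \<notin> p}"
    unfolding spec_topology_def by (rule topology_generated_by_Basis) (use assms in blast)
  from openin_continuous_map_preimage[OF homeomorphic_imp_continuous_map[OF homeo] this]
  have "openin (subtopology (Sp \<XX>) U) {x \<in> U. \<pi> x \<in> {p \<in> prime_spectrum A. f \<notin> p}}"
    unfolding top_U .
  moreover have "{x \<in> U. \<pi> x \<in> {p \<in> prime_spectrum A. f \<notin> p}} = Dist f" using pi_image by blast
  ultimately show ?thesis using openin_open_subtopology[OF U_open] by simp
qed

lemma Dist_basis:
  assumes W: "openin (Sp \<XX>) W" and x: "x \<in> W" "x \<in> U"
  obtains f where "f \<in> carrier A" "x \<in> Dist f" "Dist f \<subseteq> W"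
proof -
  have "openin (subtopology (Sp \<XX>) U) (W \<inter> U)"
    using openin_open_subtopology[OF U_open] openin_Int[OF W U_open] by simp
  then have "openin (spec_topology A) (\<pi> ` (W \<inter> U))"
    using homeomorphic_imp_open_map[OF homeo] unfolding open_map_def by blast
  moreover have "\<pi> x \<in> \<pi> ` (W \<inter> U)" using x by blast
  ultimately obtain f where f: "f \<in> carrier A" "f \<notin> \<pi> x" "{q \<in> prime_spectrum A. f \<notin> q} \<subseteq> \<pi> ` (W \<inter> U)"
    using spec_topology_basis[OF A.is_cring, of "\<pi> ` (W \<inter> U)" "\<pi> x"] by blast
  have "Dist f \<subseteq> W"
  proof
    fix y assume y: "y \<in> Dist f"
    then have "\<pi> y \<in> {q \<in> prime_spectrum A. f \<notin> q}" using pi_image by blast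
    then obtain z where "z \<in> W \<inter> U" "\<pi> y = \<pi> z" using f(3) by blast
    then show "y \<in> W" using pi_inj y by blast
  qed
  then show ?thesis using that f x by blast
qed

lemma closure_iff:
  assumes "x \<in> U" "y \<in> U"
  shows "x \<in> Sp \<XX> closure_of {y} \<longleftrightarrow> \<pi> y \<subseteq> \<pi> x"
proof
  assume c: "x \<in> Sp \<XX> closure_of {y}"
  show "\<pi> y \<subseteq> \<pi> x"
  proof
    fix f assume f: "f \<in> \<pi> y"
    then have fc: "f \<in> carrier A"
      using ideal.Icarr[OF primeideal.axioms(1)[OF pi_prime[OF assms(2)]]] by blast
    show "f \<in> \<pi> x"
    proof (rule ccontr)
      assume "f \<notin> \<pi> x"
      then have "x \<in> Dist f" using assms by blast
      then obtain z where "z \<in> {y}" "z \<in> Dist f"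
        using c[unfolded in_closure_of, THEN conjunct2, rule_format, of "Dist f"] Dist_open[OF fc] by blast
      then show False using f by simp
    qed
  qed
next
  assume sub: "\<pi> y \<subseteq> \<pi> x"
  show "x \<in> Sp \<XX> closure_of {y}"
    unfolding in_closure_of
  proof (intro conjI allI impI)
    show "x \<in> points \<XX>" using assms openin_subset[OF U_open] by blast
    fix N assume N: "x \<in> N \<and> openin (Sp \<XX>) N"
    then obtain f where "f \<in> carrier A" "x \<in> Dist f" "Dist f \<subseteq> N" using Dist_basis assms(1) by blast
    then show "\<exists>z. z \<in> {y} \<and> z \<in> N" using sub assms(2) by blast
  qed
qed

lemma Dist_subset: "Dist f \<subseteq> U" by blast

lemma Dist_hom: "f \<in> carrier A \<Longrightarrow> Res \<XX> U (Dist f) \<in> ring_hom A (Sec \<XX> (Dist f))"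
  using res_hom[OF U_open Dist_open Dist_subset] .

lemma Dist_unit: assumes "f \<in> carrier A" shows "Res \<XX> U (Dist f) (f [^]\<^bsub>A\<^esub> (n::nat)) \<in> Units (Sec \<XX> (Dist f))"
  using loc[OF assms] unfolding is_localization_def by blast

lemma Dist_fraction:
  assumes "f \<in> carrier A" "b \<in> carrier (Sec \<XX> (Dist f))"
  obtains a n where "a \<in> carrier A" "b \<otimes>\<^bsub>Sec \<XX> (Dist f)\<^esub> Res \<XX> U (Dist f) (f [^]\<^bsub>A\<^esub> (n::nat)) = Res \<XX> U (Dist f) a"
  using loc[OF assms(1)] assms(2) unfolding is_localization_def by blast

lemma Dist_zero:
  assumes "f \<in> carrier A" "a \<in> carrier A" "Res \<XX> U (Dist f) a = \<zero>\<^bsub>Sec \<XX> (Dist f)\<^esub>"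
  obtains n :: nat where "f [^]\<^bsub>A\<^esub> n \<otimes>\<^bsub>A\<^esub> a = \<zero>\<^bsub>A\<^esub>"
  using loc[OF assms(1)] assms(2,3) unfolding is_localization_def by blast

lemma pow_notin: assumes "x \<in> U" "f \<in> carrier A" "f \<notin> \<pi> x" shows "f [^]\<^bsub>A\<^esub> (n::nat) \<notin> \<pi> x"
proof -
  interpret p: primeideal "\<pi> x" A by (rule pi_prime[OF assms(1)])
  show ?thesis
  proof (induction n)
    case 0
    then show ?case using p.I_notcarr p.one_imp_carrier by auto
  next
    case (Suc n)
    then show ?case using p.I_prime[of "f [^]\<^bsub>A\<^esub> n" f] assms by auto
  qed
qed

text \<open>
  If the germ of \<open>a\<close> is invertible, \<open>a\<close> is invertible on some \<open>Dist f\<close> containing \<open>x\<close>. By the description of the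
  sections on \<open>Dist f\<close>, a power of \<open>f\<close> is then a multiple of \<open>a\<close>, so \<open>a \<in> \<pi> x\<close> would force \<open>f \<in> \<pi> x\<close>.
\<close>

lemma germ_unit_iff:
  assumes x: "x \<in> U" and a: "a \<in> carrier A"
  shows "germ \<XX> x U a \<in> Units (stalk \<XX> x) \<longleftrightarrow> a \<notin> \<pi> x"
proof
  assume na: "a \<notin> \<pi> x"
  have "Res \<XX> U (Dist a) (a [^]\<^bsub>A\<^esub> (1::nat)) \<in> Units (Sec \<XX> (Dist a))" by (rule Dist_unit[OF a])
  then have "Res \<XX> U (Dist a) a \<in> Units (Sec \<XX> (Dist a))" using a by simp
  then show "germ \<XX> x U a \<in> Units (stalk \<XX> x)"
    unfolding germ_Units_iff[OF U_open x a] using Dist_open[OF a] x na by blast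
next
  assume "germ \<XX> x U a \<in> Units (stalk \<XX> x)"
  then obtain W where W: "openin (Sp \<XX>) W" "x \<in> W" "W \<subseteq> U" "Res \<XX> U W a \<in> Units (Sec \<XX> W)"
    unfolding germ_Units_iff[OF U_open x a] by blast
  obtain f where f: "f \<in> carrier A" "x \<in> Dist f" "Dist f \<subseteq> W" using Dist_basis[OF W(1,2) x] .
  let ?h = "Res \<XX> U (Dist f)" and ?S = "Sec \<XX> (Dist f)"
  interpret S: cring ?S using sec_cring Dist_open f(1) by blast
  have h: "?h \<in> ring_hom A ?S" using Dist_hom f(1) .
  have "Res \<XX> W (Dist f) (Res \<XX> U W a) \<in> Units ?S"
    using ring_hom_Units[OF res_hom[OF W(1) Dist_open[OF f(1)] f(3)] W(4)] .
  then have "?h a \<in> Units ?S"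
    using res_res[OF U_open W(1) Dist_open[OF f(1)] f(3) W(3) a] by simp
  then obtain b where b: "b \<in> carrier ?S" "?h a \<otimes>\<^bsub>?S\<^esub> b = \<one>\<^bsub>?S\<^esub>" unfolding Units_def by blast
  obtain c n where c: "c \<in> carrier A" "b \<otimes>\<^bsub>?S\<^esub> ?h (f [^]\<^bsub>A\<^esub> (n::nat)) = ?h c"
    using Dist_fraction[OF f(1) b(1)] .
  have ha: "?h a \<in> carrier ?S" using ring_hom_closed[OF h a] .
  have hf: "?h (f [^]\<^bsub>A\<^esub> n) \<in> carrier ?S" using ring_hom_closed[OF h] f(1) by simp
  have "?h (a \<otimes>\<^bsub>A\<^esub> c) = ?h a \<otimes>\<^bsub>?S\<^esub> (b \<otimes>\<^bsub>?S\<^esub> ?h (f [^]\<^bsub>A\<^esub> n))"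
    using ring_hom_mult[OF h a c(1)] c(2) by simp
  also have "\<dots> = ?h (f [^]\<^bsub>A\<^esub> n)"
    using S.m_assoc[OF ha b(1) hf] b(2) hf by simp
  finally have e: "?h (a \<otimes>\<^bsub>A\<^esub> c) = ?h (f [^]\<^bsub>A\<^esub> n)" .
  let ?d = "f [^]\<^bsub>A\<^esub> n \<ominus>\<^bsub>A\<^esub> a \<otimes>\<^bsub>A\<^esub> c"
  have "?h ?d = \<zero>\<^bsub>?S\<^esub>"
    using ring_hom_minus[OF h A.is_cring S.is_cring, of "f [^]\<^bsub>A\<^esub> n" "a \<otimes>\<^bsub>A\<^esub> c"] e f(1) a c(1) hf
    by (simp add: a_minus_def S.r_neg)
  moreover have "?d \<in> carrier A" using f(1) a c(1) by simp
  ultimately obtain m :: nat where m: "f [^]\<^bsub>A\<^esub> m \<otimes>\<^bsub>A\<^esub> ?d = \<zero>\<^bsub>A\<^esub>"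
    using Dist_zero[OF f(1)] by blast
  show "a \<notin> \<pi> x"
  proof
    assume aP: "a \<in> \<pi> x"
    interpret p: primeideal "\<pi> x" A by (rule pi_prime[OF x])
    have "?d \<in> \<pi> x"
      using p.I_prime[of "f [^]\<^bsub>A\<^esub> m" ?d] m pow_notin[OF x f(1), of m] f a c(1) by auto
    moreover have "a \<otimes>\<^bsub>A\<^esub> c \<in> \<pi> x" using aP c(1) p.I_r_closed by blast
    ultimately have "?d \<oplus>\<^bsub>A\<^esub> a \<otimes>\<^bsub>A\<^esub> c \<in> \<pi> x" by (rule p.a_closed)
    moreover have "?d \<oplus>\<^bsub>A\<^esub> a \<otimes>\<^bsub>A\<^esub> c = f [^]\<^bsub>A\<^esub> n"
      using f(1) a c(1) by (simp add: a_minus_def A.a_assoc A.l_neg)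
    ultimately show False using pow_notin[OF x f(1), of n] f(2) by simp
  qed
qed

text \<open>
  Surjectivity of the map from the localization of the sections on \<open>U\<close> at the prime \<open>\<pi> x\<close> to the stalk; its
  injectivity is \<open>germ_zeroD\<close>.
\<close>

lemma stalk_fraction:
  assumes x: "x \<in> U" and g: "g \<in> carrier (stalk \<XX> x)"
  obtains a s where "a \<in> carrier A" "s \<in> carrier A - \<pi> x" "g \<otimes>\<^bsub>stalk \<XX> x\<^esub> germ \<XX> x U s = germ \<XX> x U a"
proof -
  obtain V t where V: "openin (Sp \<XX>) V" "x \<in> V" "t \<in> carrier (Sec \<XX> V)" and gt: "g = germ \<XX> x V t"
    using stalk_carrierE[OF g] by blast
  obtain f where f: "f \<in> carrier A" "x \<in> Dist f" "Dist f \<subseteq> V" using Dist_basis[OF V(1,2) x] .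
  let ?h = "Res \<XX> U (Dist f)" and ?S = "Sec \<XX> (Dist f)"
  have o: "openin (Sp \<XX>) (Dist f)" using Dist_open f(1) .
  let ?b = "Res \<XX> V (Dist f) t"
  have b: "?b \<in> carrier ?S" using res_closed[OF V(1) o f(3) V(3)] .
  obtain a n where a: "a \<in> carrier A" "?b \<otimes>\<^bsub>?S\<^esub> ?h (f [^]\<^bsub>A\<^esub> (n::nat)) = ?h a"
    using Dist_fraction[OF f(1) b] .
  have fn: "f [^]\<^bsub>A\<^esub> n \<in> carrier A" using f(1) by simp
  have "germ \<XX> x (Dist f) ?b \<otimes>\<^bsub>stalk \<XX> x\<^esub> germ \<XX> x (Dist f) (?h (f [^]\<^bsub>A\<^esub> n)) = germ \<XX> x (Dist f) (?h a)"
    using germ_mult[OF o f(2) b res_closed[OF U_open o Dist_subset fn]] a(2) by simp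
  then have "g \<otimes>\<^bsub>stalk \<XX> x\<^esub> germ \<XX> x U (f [^]\<^bsub>A\<^esub> n) = germ \<XX> x U a"
    unfolding gt using germ_res[OF V(1) o f(3,2) V(3)] germ_res[OF U_open o Dist_subset f(2) fn]
      germ_res[OF U_open o Dist_subset f(2) a(1)] by simp
  then show ?thesis using that[OF a(1), of "f [^]\<^bsub>A\<^esub> n"] fn pow_notin[OF x f(1), of n] f(2) by simp
qed

lemma germ_zeroD:
  assumes x: "x \<in> U" and a: "a \<in> carrier A" and z: "germ \<XX> x U a = \<zero>\<^bsub>stalk \<XX> x\<^esub>"
  obtains s where "s \<in> carrier A - \<pi> x" "s \<otimes>\<^bsub>A\<^esub> a = \<zero>\<^bsub>A\<^esub>"
proof -
  have "germ \<XX> x U a = germ \<XX> x U \<zero>\<^bsub>A\<^esub>" using z germ_zero[OF U_open x] by simp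
  then obtain W where W: "openin (Sp \<XX>) W" "x \<in> W" "W \<subseteq> U" "Res \<XX> U W a = Res \<XX> U W \<zero>\<^bsub>A\<^esub>"
    using germ_eqD[OF _ U_open x A.zero_closed] by metis
  obtain f where f: "f \<in> carrier A" "x \<in> Dist f" "Dist f \<subseteq> W" using Dist_basis[OF W(1,2) x] .
  have o: "openin (Sp \<XX>) (Dist f)" using Dist_open f(1) .
  have "Res \<XX> U (Dist f) a = Res \<XX> U (Dist f) \<zero>\<^bsub>A\<^esub>"
    using res_res[OF U_open W(1) o f(3) W(3) a] res_res[OF U_open W(1) o f(3) W(3) A.zero_closed] W(4) by simp
  then have "Res \<XX> U (Dist f) a = \<zero>\<^bsub>Sec \<XX> (Dist f)\<^esub>"
    using ring_hom_zero[OF Dist_hom[OF f(1)] sec_ring[OF U_open] sec_ring[OF o]] by simp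
  then obtain n :: nat where "f [^]\<^bsub>A\<^esub> n \<otimes>\<^bsub>A\<^esub> a = \<zero>\<^bsub>A\<^esub>" by (rule Dist_zero[OF f(1) a])
  then show ?thesis using that[of "f [^]\<^bsub>A\<^esub> n"] f pow_notin[OF x f(1), of n] by simp
qed

end

lemma (in presheaf_space) affine_openE:
  assumes "affine_open \<XX> U"
  obtains \<pi> where "affine_chart \<XX> U \<pi>"
proof -
  from assms obtain \<pi> where "openin (Sp \<XX>) U"
    and "homeomorphic_map (subtopology (Sp \<XX>) U) (spec_topology (Sec \<XX> U)) \<pi>"
    and "\<forall>f\<in>carrier (Sec \<XX> U).
           is_localization (Sec \<XX> U) {f [^]\<^bsub>Sec \<XX> U\<^esub> n | n::nat. True}
             (Sec \<XX> {x \<in> U. f \<notin> \<pi> x}) (Res \<XX> U {x \<in> U. f \<notin> \<pi> x})"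
    unfolding affine_open_def by (elim conjE exE)
  then have "affine_chart \<XX> U \<pi>"
    by (intro affine_chart.intro affine_chart_axioms.intro presheaf_space_axioms) (simp_all only: Ball_def mp)
  then show ?thesis by (rule that)
qed


section \<open>Generic points\<close>

locale scheme_space =
  fixes \<XX> :: "('p, 's) ringed_space"
  assumes cscheme: "cscheme \<XX>"
begin

lemma sheaf_space: "sheaf \<XX>"
  using cscheme unfolding cscheme_def locally_ringed_def by blast

sublocale presheaf_space \<XX>
  using sheaf_space unfolding sheaf_def by unfold_locales blast

lemma stalk_local: "x \<in> points \<XX> \<Longrightarrow> local_ring (stalk \<XX> x)"
  using cscheme unfolding cscheme_def locally_ringed_def by blast

lemma stalk_cring: "x \<in> points \<XX> \<Longrightarrow> cring (stalk \<XX> x)"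
  using stalk_local unfolding local_ring_def by blast

lemma affine_nbhd_open:
  assumes "x \<in> points \<XX>"
  obtains U \<pi> where "affine_open \<XX> U" "affine_chart \<XX> U \<pi>" "x \<in> U"
proof -
  obtain U where U: "affine_open \<XX> U" "x \<in> U" using cscheme assms unfolding cscheme_def by blast
  obtain \<pi> where "affine_chart \<XX> U \<pi>" using affine_openE[OF U(1)] .
  then show ?thesis using that U by blast
qed

lemma affine_nbhd:
  assumes "x \<in> points \<XX>"
  obtains U \<pi> where "affine_chart \<XX> U \<pi>" "x \<in> U"
  using affine_nbhd_open[OF assms] by metis

text \<open>
  In a chart that meets \<open>Z\<close>, the functions vanishing on \<open>Z\<close> form a prime ideal, because \<open>Z\<close> is irreducible. The
  corresponding point is dense in the part of \<open>Z\<close> inside the chart, and by irreducibility in all of \<open>Z\<close>.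
\<close>

lemma generic_point_exists:
  assumes irr: "irreducible_subset \<XX> Z" and cl: "closedin (Sp \<XX>) Z"
  obtains x where "x \<in> points \<XX>" "Sp \<XX> closure_of {x} = Z"
proof -
  obtain z where z: "z \<in> Z" "z \<in> points \<XX>" using irr unfolding irreducible_subset_def by blast
  obtain U \<pi> where U: "affine_chart \<XX> U \<pi>" "z \<in> U" using affine_nbhd[OF z(2)] .
  interpret U: affine_chart \<XX> U \<pi> by (rule U(1))
  define p where "p = \<Inter>(\<pi> ` (Z \<inter> U))"
  have split: "Z \<subseteq> C \<or> Z \<subseteq> C'" if "closedin (Sp \<XX>) C" "closedin (Sp \<XX>) C'" "Z \<subseteq> C \<union> C'" for C C'
    using irr that unfolding irreducible_subset_def by blast
  have Zp: "Z \<subseteq> points \<XX>" using irr unfolding irreducible_subset_def by blast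
  have closed: "closedin (Sp \<XX>) (points \<XX> - N)" if "openin (Sp \<XX>) N" for N
    using that by (rule openin_closedin_eq[THEN iffD1, THEN conjunct2])
  have p: "primeideal p U.A"
  proof (rule primeidealI)
    show "cring U.A" by (rule U.A.is_cring)
    show "ideal p U.A" unfolding p_def
    proof (rule U.A.i_Intersect)
      fix I assume "I \<in> \<pi> ` (Z \<inter> U)"
      then show "ideal I U.A" using U.pi_prime primeideal.axioms(1) by blast
    qed (use z U in blast)
    have "\<one>\<^bsub>U.A\<^esub> \<notin> \<pi> z"
      using primeideal.I_notcarr[OF U.pi_prime[OF U(2)]]
        ideal.one_imp_carrier[OF primeideal.axioms(1)[OF U.pi_prime[OF U(2)]]] by blast
    then show "carrier U.A \<noteq> p" unfolding p_def using z U(2) U.A.one_closed by blast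
    fix a b assume a: "a \<in> carrier U.A" and b: "b \<in> carrier U.A" and ab: "a \<otimes>\<^bsub>U.A\<^esub> b \<in> p"
    have "Z \<subseteq> (points \<XX> - U.Dist a) \<union> (points \<XX> - U.Dist b)"
    proof
      fix y assume y: "y \<in> Z"
      have "a \<in> \<pi> y \<or> b \<in> \<pi> y" if "y \<in> U"
        using ab y that primeideal.I_prime[OF U.pi_prime[OF that] a b] unfolding p_def by blast
      then show "y \<in> (points \<XX> - U.Dist a) \<union> (points \<XX> - U.Dist b)" using y Zp by blast
    qed
    then have "Z \<subseteq> points \<XX> - U.Dist a \<or> Z \<subseteq> points \<XX> - U.Dist b"
      using split closed U.Dist_open a b by blast
    then show "a \<in> p \<or> b \<in> p" unfolding p_def by blast
  qed
  obtain x where x: "x \<in> U" "\<pi> x = p" using U.pi_surj[OF p] .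
  have xp: "x \<in> points \<XX>" using x(1) openin_subset[OF U.U_open] by blast
  have "x \<in> Z"
  proof (rule ccontr)
    assume "x \<notin> Z"
    then have xZ: "x \<in> points \<XX> - Z" using xp by blast
    have "openin (Sp \<XX>) (points \<XX> - Z)" using cl by (simp add: closedin_def)
    from this xZ x(1) obtain f where "f \<in> carrier U.A" "x \<in> U.Dist f" "U.Dist f \<subseteq> points \<XX> - Z"
      by (rule U.Dist_basis)
    then show False using x(2) unfolding p_def by blast
  qed
  then have "Sp \<XX> closure_of {x} \<subseteq> Z" using closure_of_minimal[OF _ cl] by blast
  moreover have "Z \<subseteq> Sp \<XX> closure_of {x}"
  proof -
    have "Z \<subseteq> (Sp \<XX> closure_of {x}) \<union> (points \<XX> - U)"
    proof
      fix y assume y: "y \<in> Z"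
      have "y \<in> Sp \<XX> closure_of {x}" if "y \<in> U"
        unfolding U.closure_iff[OF that x(1)] x(2) p_def using y that by blast
      then show "y \<in> (Sp \<XX> closure_of {x}) \<union> (points \<XX> - U)" using y Zp by blast
    qed
    then show ?thesis using split closed[OF U.U_open] z U(2) by (metis DiffD2 closedin_closure_of subsetD)
  qed
  ultimately show ?thesis using that[OF xp] by blast
qed

lemma closure_point_inj:
  assumes "x \<in> points \<XX>" "y \<in> points \<XX>" and eq: "Sp \<XX> closure_of {x} = Sp \<XX> closure_of {y}"
  shows "x = y"
proof -
  obtain U \<pi> where U: "affine_chart \<XX> U \<pi>" "x \<in> U" using affine_nbhd[OF assms(1)] .
  interpret U: affine_chart \<XX> U \<pi> by (rule U(1))
  have xy: "x \<in> Sp \<XX> closure_of {y}" "y \<in> Sp \<XX> closure_of {x}"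
    using closure_of_subset[of "{x}" "Sp \<XX>"] closure_of_subset[of "{y}" "Sp \<XX>"] assms by auto
  then have y: "y \<in> U" using U(2) U.U_open unfolding in_closure_of by blast
  show ?thesis using U.closure_iff[OF U(2) y] U.closure_iff[OF y U(2)] xy U.pi_inj[OF U(2) y] by blast
qed

lemma generic_point:
  assumes irr: "irreducible_subset \<XX> Z" and cl: "closedin (Sp \<XX>) Z"
  shows "generic_point \<XX> Z \<in> Z" "generic_point \<XX> Z \<in> points \<XX>"
    "Sp \<XX> closure_of {generic_point \<XX> Z} = Z"
proof -
  have "\<exists>!x. x \<in> points \<XX> \<and> Sp \<XX> closure_of {x} = Z"
    using generic_point_exists[OF irr cl] closure_point_inj by metis
  from theI'[OF this] show *: "generic_point \<XX> Z \<in> points \<XX>" "Sp \<XX> closure_of {generic_point \<XX> Z} = Z"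
    unfolding generic_point_def by blast+
  then show "generic_point \<XX> Z \<in> Z" using closure_of_subset[of "{generic_point \<XX> Z}" "Sp \<XX>"] by auto
qed

lemma generic_point_in_open:
  assumes irr: "irreducible_subset \<XX> Z" and cl: "closedin (Sp \<XX>) Z"
    and W: "openin (Sp \<XX>) W" "W \<inter> Z \<noteq> {}"
  shows "generic_point \<XX> Z \<in> W"
proof -
  obtain y where "y \<in> W" "y \<in> Sp \<XX> closure_of {generic_point \<XX> Z}"
    using W(2) generic_point(3)[OF irr cl] by blast
  then show ?thesis using W(1) unfolding in_closure_of by blast
qed

end

section \<open>Powers of units\<close>

context cring
begin

lemma unit_int_pow:
  assumes "u \<in> Units R"
  shows "u [^]\<^bsub>units_of R\<^esub> (n::int) = u [^] n"
  unfolding int_pow_def2 units_of_pow[OF assms] units_of_inv[OF Units_pow_closed[OF assms]] by (rule refl)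

lemma unit_int_pow_closed [simp, intro]: "u \<in> Units R \<Longrightarrow> u [^] (n::int) \<in> Units R"
  using group.int_pow_closed[OF units_group, of u n] unit_int_pow[of u n] by (simp add: units_of_carrier)

lemma unit_int_pow_add: "u \<in> Units R \<Longrightarrow> u [^] (m + n::int) = u [^] m \<otimes> u [^] n"
  using group.int_pow_mult[OF units_group, of u m n] unit_int_pow[of u]
  by (simp add: units_of_carrier units_of_mult)

lemma unit_int_pow_distrib:
  "u \<in> Units R \<Longrightarrow> v \<in> Units R \<Longrightarrow> (u \<otimes> v) [^] (n::int) = u [^] n \<otimes> v [^] n"
  using comm_group.int_pow_distrib[OF units_comm_group, of u v n] unit_int_pow
  by (simp add: units_of_carrier units_of_mult)

lemma unit_int_pow_pow: "u \<in> Units R \<Longrightarrow> (u [^] (m::int)) [^] (n::int) = u [^] (m * n)"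
  using group.int_pow_pow[OF units_group, of u m n] unit_int_pow[of u] unit_int_pow[of "u [^] m"]
  by (simp add: units_of_carrier)

lemma int_pow_1: "u \<in> carrier R \<Longrightarrow> u [^] (1::int) = u"
  by (simp add: int_pow_def2)

end

lemma ring_hom_inv:
  assumes "h \<in> ring_hom R S" "cring R" "cring S" "u \<in> Units R"
  shows "h (inv\<^bsub>R\<^esub> u) = inv\<^bsub>S\<^esub> (h u)"
proof -
  interpret R: cring R by fact
  interpret S: cring S by fact
  have "h u \<otimes>\<^bsub>S\<^esub> h (inv\<^bsub>R\<^esub> u) = \<one>\<^bsub>S\<^esub>"
    using ring_hom_mult[OF assms(1) R.Units_closed[OF assms(4)] R.Units_inv_closed[OF assms(4)]]
      ring_hom_one[OF assms(1)] R.Units_r_inv[OF assms(4)] by simp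
  then show ?thesis
    using S.comm_inv_char[of "h u" "h (inv\<^bsub>R\<^esub> u)"] ring_hom_closed[OF assms(1)]
      R.Units_closed[OF assms(4)] R.Units_inv_closed[OF assms(4)] by simp
qed

lemma ring_hom_int_pow:
  assumes "h \<in> ring_hom R S" "cring R" "cring S" "u \<in> Units R"
  shows "h (u [^]\<^bsub>R\<^esub> (n::int)) = h u [^]\<^bsub>S\<^esub> n"
proof -
  interpret R: cring R by fact
  interpret S: cring S by fact
  have "h (u [^]\<^bsub>R\<^esub> k) = h u [^]\<^bsub>S\<^esub> k" for k :: nat
    using ring_hom_nat_pow[OF assms(1) R.ring_axioms S.ring_axioms R.Units_closed[OF assms(4)]] .
  then show ?thesis
    unfolding int_pow_def2 using ring_hom_inv[OF assms(1-3) R.Units_pow_closed[OF assms(4)]]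
    by (simp del: pow_nat)
qed


section \<open>Discrete valuations\<close>

text \<open>
  \<open>A\<close> is a noetherian domain with fraction field \<open>K\<close> (through \<open>g\<close>), and \<open>c\<close> generates the maximal
  ideal of the localization at the prime ideal \<open>p\<close>.
\<close>

locale localized_dvr = A?: noetherian_domain A + K?: field K
  for A :: "'a ring" (structure) and K :: "'k ring" (structure) +
  fixes g :: "'a \<Rightarrow> 'k" and p :: "'a set" and c u :: 'a
  assumes g_hom: "g \<in> ring_hom A K"
    and g_inj: "a \<in> carrier A \<Longrightarrow> g a = \<zero>\<^bsub>K\<^esub> \<Longrightarrow> a = \<zero>\<^bsub>A\<^esub>"
    and p: "primeideal p A" and c: "c \<in> p" "c \<noteq> \<zero>\<^bsub>A\<^esub>" and u: "u \<in> carrier A - p"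
    and gen: "b \<in> p \<Longrightarrow> \<exists>v\<in>carrier A. u \<otimes>\<^bsub>A\<^esub> b = v \<otimes>\<^bsub>A\<^esub> c"
    and frac: "k \<in> carrier K \<Longrightarrow> \<exists>a\<in>carrier A. \<exists>b\<in>carrier A - {\<zero>\<^bsub>A\<^esub>}. k \<otimes>\<^bsub>K\<^esub> g b = g a"
begin

text \<open>
  \<open>LC\<close> and \<open>UL\<close> are the local ring of \<open>p\<close> inside \<open>K\<close> and its group of units, described by fractions whose
  denominators are not inverted, which avoids division in \<open>K\<close>. The record \<open>L\<close> has the shape of \<open>local_subring\<close>.
\<close>

definition LC where "LC = {k \<in> carrier K. \<exists>a\<in>carrier A. \<exists>s\<in>carrier A - p. k \<otimes>\<^bsub>K\<^esub> g s = g a}"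
definition UL where "UL = {k \<in> carrier K. \<exists>a\<in>carrier A - p. \<exists>s\<in>carrier A - p. k \<otimes>\<^bsub>K\<^esub> g s = g a}"
definition L where "L = K\<lparr>carrier := LC\<rparr>"

abbreviation mK (infixl \<open>\<star>\<close> 70) where "a \<star> b \<equiv> a \<otimes>\<^bsub>K\<^esub> b"
abbreviation mA (infixl \<open>*\<^sub>A\<close> 70) where "a *\<^sub>A b \<equiv> a \<otimes>\<^bsub>A\<^esub> b"
abbreviation \<tau> where "\<tau> \<equiv> g c"

sublocale p: primeideal p A by (rule p)

lemma cA: "c \<in> carrier A" using c(1) p.Icarr by blast
lemma g_closed [simp]: "a \<in> carrier A \<Longrightarrow> g a \<in> carrier K" using g_hom by (rule ring_hom_closed)
lemma g_mult: "a \<in> carrier A \<Longrightarrow> b \<in> carrier A \<Longrightarrow> g (a *\<^sub>A b) = g a \<star> g b" using g_hom by (rule ring_hom_mult)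
lemma g_one: "g \<one>\<^bsub>A\<^esub> = \<one>\<^bsub>K\<^esub>" using g_hom by (rule ring_hom_one)
lemma g_pow: "a \<in> carrier A \<Longrightarrow> g (a [^]\<^bsub>A\<^esub> (n::nat)) = g a [^]\<^bsub>K\<^esub> n"
  using ring_hom_nat_pow[OF g_hom A.ring_axioms K.ring_axioms] .

lemma g_eq: assumes "a \<in> carrier A" "b \<in> carrier A" "g a = g b" shows "a = b"
proof -
  have "g (a \<ominus>\<^bsub>A\<^esub> b) = \<zero>\<^bsub>K\<^esub>"
    using ring_hom_minus[OF g_hom A.is_cring K.is_cring assms(1,2)] assms by simp
  then have "a \<ominus>\<^bsub>A\<^esub> b = \<zero>\<^bsub>A\<^esub>" using g_inj assms by simp
  then show ?thesis using assms by simp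
qed

lemma g_Units: assumes "a \<in> carrier A" "a \<noteq> \<zero>\<^bsub>A\<^esub>" shows "g a \<in> Units K"
  using assms g_inj K.field_Units by auto

lemma notp: "a \<in> carrier A - p \<Longrightarrow> a \<noteq> \<zero>\<^bsub>A\<^esub>" by auto

lemma notp_mult: "a \<in> carrier A - p \<Longrightarrow> b \<in> carrier A - p \<Longrightarrow> a *\<^sub>A b \<in> carrier A - p"
  using p.I_prime by auto

lemma one_notp: "\<one>\<^bsub>A\<^esub> \<in> carrier A - p"
  using p.I_notcarr p.one_imp_carrier by auto

lemma tau_Unit: "\<tau> \<in> Units K" using g_Units cA c by blast

lemma UL_Units: assumes "k \<in> UL" shows "k \<in> Units K"
proof -
  obtain a s where k: "k \<in> carrier K" and a: "a \<in> carrier A - p" and s: "s \<in> carrier A - p" and e: "k \<star> g s = g a"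
    using assms unfolding UL_def by blast
  have "k \<noteq> \<zero>\<^bsub>K\<^esub>"
  proof
    assume "k = \<zero>\<^bsub>K\<^esub>"
    then have "g a = \<zero>\<^bsub>K\<^esub>" using e s by simp
    then show False using g_inj a notp by blast
  qed
  then show ?thesis using k K.field_Units by blast
qed

lemma UL_closed: "k \<in> UL \<Longrightarrow> k \<in> carrier K" unfolding UL_def by blast

lemma UL_mult: assumes "k \<in> UL" "l \<in> UL" shows "k \<star> l \<in> UL"
proof -
  obtain a s where k: "k \<in> carrier K" and a: "a \<in> carrier A - p" and s: "s \<in> carrier A - p" and e: "k \<star> g s = g a"
    using assms unfolding UL_def by blast
  obtain a' s' where l: "l \<in> carrier K" and a': "a' \<in> carrier A - p" and s': "s' \<in> carrier A - p" and e': "l \<star> g s' = g a'"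
    using assms unfolding UL_def by blast
  have "(k \<star> l) \<star> g (s *\<^sub>A s') = (k \<star> g s) \<star> (l \<star> g s')"
    using k l s s' g_mult[of s s'] by (simp add: K.m_ac)
  also have "\<dots> = g (a *\<^sub>A a')" using e e' g_mult a a' by simp
  finally show ?thesis
    unfolding UL_def using k l notp_mult[OF a a'] notp_mult[OF s s'] by blast
qed

lemma UL_inv: assumes "k \<in> UL" shows "inv\<^bsub>K\<^esub> k \<in> UL"
proof -
  obtain a s where k: "k \<in> carrier K" and a: "a \<in> carrier A - p" and s: "s \<in> carrier A - p" and e: "k \<star> g s = g a"
    using assms unfolding UL_def by blast
  have kU: "k \<in> Units K" using UL_Units assms by blast
  have "inv\<^bsub>K\<^esub> k \<star> g a = (inv\<^bsub>K\<^esub> k \<star> k) \<star> g s"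
    unfolding e[symmetric] by (rule K.m_assoc[symmetric]) (use kU k s in auto)
  then have "inv\<^bsub>K\<^esub> k \<star> g a = g s" using kU s by simp
  then show ?thesis unfolding UL_def using kU a s by blast
qed

lemma UL_g: assumes "s \<in> carrier A - p" shows "g s \<in> UL"
  unfolding UL_def using assms one_notp g_one by (intro CollectI conjI bexI[of _ s] bexI[of _ "\<one>\<^bsub>A\<^esub>"]) auto

lemma UL_one: "\<one>\<^bsub>K\<^esub> \<in> UL" using UL_g[OF one_notp] g_one by simp

lemma UL_int_pow: assumes "k \<in> UL" shows "k [^]\<^bsub>K\<^esub> (n::int) \<in> UL"
proof -
  have "k [^]\<^bsub>K\<^esub> (n::nat) \<in> UL" for n
    by (induction n) (use assms UL_mult UL_one in auto)
  then show ?thesis using UL_inv by (simp add: int_pow_def2 del: pow_nat)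
qed

lemma LC_closed: "k \<in> LC \<Longrightarrow> k \<in> carrier K" unfolding LC_def by blast

lemma UL_LC: "UL \<subseteq> LC" unfolding UL_def LC_def by blast

lemma LC_mult: assumes "k \<in> LC" "l \<in> LC" shows "k \<star> l \<in> LC"
proof -
  obtain a s where k: "k \<in> carrier K" and a: "a \<in> carrier A" and s: "s \<in> carrier A - p" and e: "k \<star> g s = g a"
    using assms unfolding LC_def by blast
  obtain a' s' where l: "l \<in> carrier K" and a': "a' \<in> carrier A" and s': "s' \<in> carrier A - p" and e': "l \<star> g s' = g a'"
    using assms unfolding LC_def by blast
  have "(k \<star> l) \<star> g (s *\<^sub>A s') = (k \<star> g s) \<star> (l \<star> g s')"
    using k l s s' g_mult[of s s'] by (simp add: K.m_ac)
  also have "\<dots> = g (a *\<^sub>A a')" using e e' g_mult a a' by simp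
  finally show ?thesis
    unfolding LC_def using k l A.m_closed[OF a a'] notp_mult[OF s s'] by blast
qed

lemma tau_LC: "\<tau> \<in> LC"
  unfolding LC_def using one_notp g_one cA by (intro CollectI conjI bexI[of _ c] bexI[of _ "\<one>\<^bsub>A\<^esub>"]) auto

lemma Units_L: "Units L = UL"
proof (intro equalityI subsetI)
  fix k assume "k \<in> Units L"
  then obtain l where k: "k \<in> LC" and l: "l \<in> LC" and kl: "k \<star> l = \<one>\<^bsub>K\<^esub>"
    unfolding Units_def L_def by auto
  obtain a s where a: "a \<in> carrier A" and s: "s \<in> carrier A - p" and e: "k \<star> g s = g a"
    using k unfolding LC_def by blast
  obtain a' s' where a': "a' \<in> carrier A" and s': "s' \<in> carrier A - p" and e': "l \<star> g s' = g a'"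
    using l unfolding LC_def by blast
  have kc: "k \<in> carrier K" and lc: "l \<in> carrier K" using k l LC_closed by auto
  have "g (a *\<^sub>A a') = (k \<star> l) \<star> (g s \<star> g s')"
    using g_mult[OF a a'] e[symmetric] e'[symmetric] kc lc s s' by (simp add: K.m_ac)
  also have "\<dots> = g (s *\<^sub>A s')" using kl s s' g_mult by simp
  finally have "a *\<^sub>A a' = s *\<^sub>A s'" using g_eq a a' s s' by simp
  then have "a \<notin> p" using notp_mult[OF s s'] p.I_r_closed[of a a'] a' by auto
  then show "k \<in> UL" unfolding UL_def using kc a s e by blast
next
  fix k assume k: "k \<in> UL"
  then have "k \<in> LC" "inv\<^bsub>K\<^esub> k \<in> LC" using UL_inv UL_LC by auto
  then show "k \<in> Units L" unfolding Units_def L_def using UL_Units[OF k]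
    by (auto intro!: bexI[of _ "inv\<^bsub>K\<^esub> k"])
qed

lemma PIdl_L: "PIdl\<^bsub>L\<^esub> k = {l \<star> k | l. l \<in> LC}"
  unfolding cgenideal_def L_def by simp

lemma uniformizer_tau: "uniformizer L \<tau>"
proof -
  have "LC - UL = PIdl\<^bsub>L\<^esub> \<tau>"
    unfolding PIdl_L
  proof (intro equalityI subsetI)
    fix k assume k: "k \<in> LC - UL"
    then obtain a s where kc: "k \<in> carrier K" and a: "a \<in> carrier A" and s: "s \<in> carrier A - p" and e: "k \<star> g s = g a"
      unfolding LC_def by blast
    have "a \<in> p" using k kc a s e unfolding UL_def by blast
    then obtain v where v: "v \<in> carrier A" "u *\<^sub>A a = v *\<^sub>A c" using gen by blast
    let ?l = "k \<star> inv\<^bsub>K\<^esub> \<tau>"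
    have inv: "inv\<^bsub>K\<^esub> \<tau> \<in> carrier K" "\<tau> \<in> carrier K" "inv\<^bsub>K\<^esub> \<tau> \<star> \<tau> = \<one>\<^bsub>K\<^esub>" "\<tau> \<star> inv\<^bsub>K\<^esub> \<tau> = \<one>\<^bsub>K\<^esub>"
      using tau_Unit by auto
    have us: "u *\<^sub>A s \<in> carrier A - p" using notp_mult u s by blast
    have "?l \<star> g (u *\<^sub>A s) = (g u \<star> (k \<star> g s)) \<star> inv\<^bsub>K\<^esub> \<tau>"
      using g_mult[of u s] kc u s inv by (simp add: K.m_ac)
    also have "\<dots> = g (u *\<^sub>A a) \<star> inv\<^bsub>K\<^esub> \<tau>" using e g_mult[of u a] u a by simp
    also have "\<dots> = g v \<star> (\<tau> \<star> inv\<^bsub>K\<^esub> \<tau>)"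
      unfolding v(2) using g_mult[of v c] v cA inv by (simp add: K.m_assoc)
    finally have "?l \<star> g (u *\<^sub>A s) = g v" using inv v by simp
    then have "?l \<in> LC" unfolding LC_def using kc inv v us by blast
    moreover have "k = ?l \<star> \<tau>" using kc inv by (simp add: K.m_assoc)
    ultimately show "k \<in> {l \<star> \<tau> | l. l \<in> LC}" by blast
  next
    fix k assume "k \<in> {l \<star> \<tau> | l. l \<in> LC}"
    then obtain l where l: "l \<in> LC" and k: "k = l \<star> \<tau>" by blast
    obtain a s where lc: "l \<in> carrier K" and a: "a \<in> carrier A" and s: "s \<in> carrier A - p" and e: "l \<star> g s = g a"
      using l unfolding LC_def by blast
    have "k \<notin> UL"
    proof
      assume "k \<in> UL"
      then obtain a' s' where a': "a' \<in> carrier A - p" and s': "s' \<in> carrier A - p" and e': "k \<star> g s' = g a'"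
        unfolding UL_def by blast
      have "g (a' *\<^sub>A s) = (l \<star> g s) \<star> (\<tau> \<star> g s')"
        using g_mult[of a' s] e'[symmetric] a' s s' k lc cA by (simp add: K.m_ac)
      also have "\<dots> = g ((a *\<^sub>A s') *\<^sub>A c)"
        unfolding e using g_mult[of "a *\<^sub>A s'" c] g_mult[of a s'] a s' cA by (simp add: K.m_ac)
      finally have "a' *\<^sub>A s = (a *\<^sub>A s') *\<^sub>A c" using g_eq a a' s s' cA by simp
      moreover have "(a *\<^sub>A s') *\<^sub>A c \<in> p" using p.I_l_closed c(1) a s' by simp
      ultimately show False using notp_mult[OF a' s] by simp
    qed
    then show "k \<in> LC - UL" using LC_mult[OF l tau_LC] k by simp
  qed
  moreover have "\<tau> \<noteq> \<zero>\<^bsub>K\<^esub>" using g_inj cA c by blast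
  ultimately show ?thesis unfolding uniformizer_def Units_L using tau_LC by (simp add: L_def)
qed

text \<open>
  Two generators of the maximal ideal differ by a unit, so that the valuation does not depend on the uniformizer.
\<close>

lemma uniformizer_form: assumes "uniformizer L \<pi>" shows "\<exists>w\<in>UL. \<pi> = w \<star> \<tau>"
proof -
  have pi: "\<pi> \<in> LC" "\<pi> \<noteq> \<zero>\<^bsub>K\<^esub>" using assms unfolding uniformizer_def by (auto simp: L_def)
  have eq: "PIdl\<^bsub>L\<^esub> \<pi> = PIdl\<^bsub>L\<^esub> \<tau>" using assms uniformizer_tau unfolding uniformizer_def by metis
  have one: "\<one>\<^bsub>K\<^esub> \<in> LC" using UL_one UL_LC by blast
  have "\<pi> \<in> PIdl\<^bsub>L\<^esub> \<pi>" "\<tau> \<in> PIdl\<^bsub>L\<^esub> \<tau>"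
    unfolding PIdl_L using one LC_closed[OF pi(1)] LC_closed[OF tau_LC] by (auto intro!: exI[of _ "\<one>\<^bsub>K\<^esub>"])
  then have "\<pi> \<in> PIdl\<^bsub>L\<^esub> \<tau>" "\<tau> \<in> PIdl\<^bsub>L\<^esub> \<pi>" unfolding eq by auto
  then obtain l l' where l: "l \<in> LC" "\<pi> = l \<star> \<tau>" and l': "l' \<in> LC" "\<tau> = l' \<star> \<pi>" unfolding PIdl_L by blast
  have lc: "l \<in> carrier K" "l' \<in> carrier K" "\<tau> \<in> carrier K" using l l' LC_closed tau_LC by auto
  have "(l' \<star> l) \<star> \<tau> = l' \<star> \<pi>" unfolding l(2) using lc by (simp add: K.m_assoc)
  also have "\<dots> = \<one>\<^bsub>K\<^esub> \<star> \<tau>" using l'(2) lc by simp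
  finally have "l' \<star> l = \<one>\<^bsub>K\<^esub>"
    using K.m_rcancel[of \<tau> "l' \<star> l" "\<one>\<^bsub>K\<^esub>"] lc g_inj[OF cA] c(2) by auto
  then have "l \<in> Units L" unfolding Units_def L_def using l(1) l'(1) lc K.m_comm[of l l'] by auto
  then show ?thesis using l(2) Units_L by blast
qed

lemma tau_pow_notUL: assumes "n > 0" shows "\<tau> [^]\<^bsub>K\<^esub> (n::nat) \<notin> UL"
proof
  assume "\<tau> [^]\<^bsub>K\<^esub> n \<in> UL"
  then obtain a s where a: "a \<in> carrier A - p" and s: "s \<in> carrier A - p" and e: "\<tau> [^]\<^bsub>K\<^esub> n \<star> g s = g a"
    unfolding UL_def by blast
  have cn: "c [^]\<^bsub>A\<^esub> n \<in> p"
    using assms c(1) cA p.I_l_closed[of c "c [^]\<^bsub>A\<^esub> (n - 1)"] A.nat_pow_Suc[of c "n - 1"] by simp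
  have "c [^]\<^bsub>A\<^esub> n *\<^sub>A s = a" using g_eq[of "c [^]\<^bsub>A\<^esub> n *\<^sub>A s" a] e g_pow[OF cA] g_mult cA s a by simp
  then show False using cn p.I_r_closed s a by blast
qed

text \<open>
  Otherwise a positive power of \<open>\<tau>\<close> would be a unit of the local ring, although its numerator lies in \<open>p\<close>.
\<close>

lemma exponent_le:
  assumes w: "w \<in> UL" "w' \<in> UL" and e: "w \<star> \<tau> [^]\<^bsub>K\<^esub> (z::int) = w' \<star> \<tau> [^]\<^bsub>K\<^esub> (z'::int)"
  shows "z \<le> z'"
proof (rule ccontr)
  assume n: "\<not> z \<le> z'"
  let ?d = "\<tau> [^]\<^bsub>K\<^esub> (z - z')" and ?e = "\<tau> [^]\<^bsub>K\<^esub> z'"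
  have U: "?d \<in> Units K" "?e \<in> Units K" "w \<in> Units K" "w' \<in> Units K" using tau_Unit w UL_Units by auto
  then have C: "?d \<in> carrier K" "?e \<in> carrier K" "w \<in> carrier K" "w' \<in> carrier K" by auto
  have nz: "?e \<noteq> \<zero>\<^bsub>K\<^esub>" using U K.field_Units by blast
  have "\<tau> [^]\<^bsub>K\<^esub> z = ?d \<star> ?e" using K.unit_int_pow_add[OF tau_Unit, of "z - z'" z'] by simp
  then have "(w \<star> ?d) \<star> ?e = w' \<star> ?e" using e C by (simp add: K.m_assoc)
  then have wd: "w \<star> ?d = w'" using K.m_rcancel[OF nz] C by simp
  have "inv\<^bsub>K\<^esub> w \<star> w' = (inv\<^bsub>K\<^esub> w \<star> w) \<star> ?d"
    unfolding wd[symmetric] by (rule K.m_assoc[symmetric]) (use U C in auto)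
  then have "inv\<^bsub>K\<^esub> w \<star> w' = ?d" using U(3) C by simp
  then have "?d \<in> UL" using UL_mult[OF UL_inv[OF w(1)] w(2)] by simp
  then have "\<tau> [^]\<^bsub>K\<^esub> nat (z - z') \<in> UL" using n by simp
  moreover have "nat (z - z') > 0" using n by simp
  ultimately show False using tau_pow_notUL by blast
qed

lemma exponent_unique:
  assumes "w \<in> UL" "w' \<in> UL" "w \<star> \<tau> [^]\<^bsub>K\<^esub> (z::int) = w' \<star> \<tau> [^]\<^bsub>K\<^esub> (z'::int)"
  shows "z = z'"
  using exponent_le[OF assms] exponent_le[OF assms(2,1) assms(3)[symmetric]] by simp

text \<open>
  The description of \<open>valuation_at\<close> for the local ring \<open>L\<close>.
\<close>

definition val :: "'k \<Rightarrow> int" where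
  "val f = (THE n. \<exists>\<pi> w. uniformizer L \<pi> \<and> w \<in> Units L \<and> f = w \<star> \<pi> [^]\<^bsub>K\<^esub> n)"

lemma val_eq: assumes w: "w \<in> UL" shows "val (w \<star> \<tau> [^]\<^bsub>K\<^esub> z) = z"
  unfolding val_def
proof (rule the_equality)
  show "\<exists>\<pi> w'. uniformizer L \<pi> \<and> w' \<in> Units L \<and> w \<star> \<tau> [^]\<^bsub>K\<^esub> z = w' \<star> \<pi> [^]\<^bsub>K\<^esub> z"
    using uniformizer_tau w Units_L by blast
  fix n :: int assume "\<exists>\<pi> w'. uniformizer L \<pi> \<and> w' \<in> Units L \<and> w \<star> \<tau> [^]\<^bsub>K\<^esub> z = w' \<star> \<pi> [^]\<^bsub>K\<^esub> n"
  then obtain \<pi> w' where pi: "uniformizer L \<pi>" and w': "w' \<in> UL" and e: "w \<star> \<tau> [^]\<^bsub>K\<^esub> z = w' \<star> \<pi> [^]\<^bsub>K\<^esub> n"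
    unfolding Units_L by blast
  obtain v where v: "v \<in> UL" "\<pi> = v \<star> \<tau>" using uniformizer_form[OF pi] by blast
  have C: "w' \<in> carrier K" "v [^]\<^bsub>K\<^esub> n \<in> carrier K" "\<tau> [^]\<^bsub>K\<^esub> n \<in> carrier K"
    by (rule UL_closed[OF w'] UL_closed[OF UL_int_pow[OF v(1)]] K.Units_closed[OF K.unit_int_pow_closed[OF tau_Unit]])+
  have "w' \<star> \<pi> [^]\<^bsub>K\<^esub> n = (w' \<star> v [^]\<^bsub>K\<^esub> n) \<star> \<tau> [^]\<^bsub>K\<^esub> n"
    unfolding v(2) K.unit_int_pow_distrib[OF UL_Units[OF v(1)] tau_Unit] using C by (simp add: K.m_assoc)
  then have "w \<star> \<tau> [^]\<^bsub>K\<^esub> z = (w' \<star> v [^]\<^bsub>K\<^esub> n) \<star> \<tau> [^]\<^bsub>K\<^esub> n" using e by simp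
  from exponent_unique[OF w UL_mult[OF w' UL_int_pow[OF v(1)]] this] show "n = z" by simp
qed

lemma factor_A:
  assumes "a \<in> carrier A" "a \<noteq> \<zero>\<^bsub>A\<^esub>"
  obtains n :: nat and s t where "s \<in> carrier A - p" "t \<in> carrier A - p" "s *\<^sub>A a = t *\<^sub>A c [^]\<^bsub>A\<^esub> n"
    "val (g a) = int n"
proof -
  obtain n :: nat and s t where st: "s \<in> carrier A - p" "t \<in> carrier A - p" "s *\<^sub>A a = t *\<^sub>A c [^]\<^bsub>A\<^esub> n"
    by (rule A.factor_by_uniformizer[OF p c(1) u gen assms])
  let ?w = "inv\<^bsub>K\<^esub> (g s) \<star> g t"
  have sU: "g s \<in> Units K" using UL_Units[OF UL_g[OF st(1)]] .
  have "g s \<star> g a = g t \<star> \<tau> [^]\<^bsub>K\<^esub> n"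
    using arg_cong[OF st(3), of g] g_mult[of s a] g_mult[of t "c [^]\<^bsub>A\<^esub> n"] g_pow[OF cA] st(1,2) assms cA by simp
  then have "inv\<^bsub>K\<^esub> (g s) \<star> (g s \<star> g a) = inv\<^bsub>K\<^esub> (g s) \<star> (g t \<star> \<tau> [^]\<^bsub>K\<^esub> n)" by simp
  then have "g a = ?w \<star> \<tau> [^]\<^bsub>K\<^esub> n"
    using sU st assms cA K.m_assoc[of "inv\<^bsub>K\<^esub> (g s)" "g s" "g a"] K.m_assoc[of "inv\<^bsub>K\<^esub> (g s)" "g t" "\<tau> [^]\<^bsub>K\<^esub> n"] by simp
  then have "g a = ?w \<star> \<tau> [^]\<^bsub>K\<^esub> int n" by (simp add: int_pow_int)
  then have "val (g a) = int n"
    using val_eq[OF UL_mult[OF UL_inv[OF UL_g[OF st(1)]] UL_g[OF st(2)]], of "int n"] by simp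
  then show ?thesis using that st by blast
qed

lemma factor_K:
  assumes f: "f \<in> Units K"
  obtains w z where "w \<in> UL" "f = w \<star> \<tau> [^]\<^bsub>K\<^esub> (z::int)"
proof -
  have fc: "f \<in> carrier K" "f \<noteq> \<zero>\<^bsub>K\<^esub>" using f K.field_Units by auto
  obtain a b where a: "a \<in> carrier A" and b: "b \<in> carrier A - {\<zero>\<^bsub>A\<^esub>}" and e: "f \<star> g b = g a" using frac fc by blast
  have gb: "g b \<in> Units K" using g_Units b by blast
  have a0: "a \<noteq> \<zero>\<^bsub>A\<^esub>"
  proof
    assume "a = \<zero>\<^bsub>A\<^esub>"
    then have "f \<star> g b = \<zero>\<^bsub>K\<^esub>" using e ring_hom_zero[OF g_hom A.ring_axioms K.ring_axioms] by simp
    then show False using K.integral_iff[of f "g b"] fc gb K.field_Units by auto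
  qed
  obtain n :: nat and s t where st: "s \<in> carrier A - p" "t \<in> carrier A - p" "s *\<^sub>A a = t *\<^sub>A c [^]\<^bsub>A\<^esub> n"
    by (rule A.factor_by_uniformizer[OF p c(1) u gen a a0])
  have b': "b \<in> carrier A" "b \<noteq> \<zero>\<^bsub>A\<^esub>" using b by auto
  obtain m :: nat and s' t' where st': "s' \<in> carrier A - p" "t' \<in> carrier A - p" "s' *\<^sub>A b = t' *\<^sub>A c [^]\<^bsub>A\<^esub> m"
    by (rule A.factor_by_uniformizer[OF p c(1) u gen b'])
  let ?x = "g s \<star> g t'" and ?y = "g s' \<star> g t"
  have C: "g s \<in> carrier K" "g t \<in> carrier K" "g s' \<in> carrier K" "g t' \<in> carrier K" "g b \<in> carrier K" "g a \<in> carrier K"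
    using st st' a b by auto
  have x: "?x \<in> UL" and y: "?y \<in> UL" using UL_mult UL_g st st' by auto
  have xU: "?x \<in> Units K" using UL_Units x by blast
  have tp: "\<tau> [^]\<^bsub>K\<^esub> k \<in> carrier K" for k :: int using K.unit_int_pow_closed[OF tau_Unit] by blast
  have ea: "g s \<star> g a = g t \<star> \<tau> [^]\<^bsub>K\<^esub> int n"
    using arg_cong[OF st(3), of g] g_mult[of s a] g_mult[of t "c [^]\<^bsub>A\<^esub> n"] g_pow[OF cA] st(1,2) a cA
    by (simp add: int_pow_int)
  have eb: "g s' \<star> g b = g t' \<star> \<tau> [^]\<^bsub>K\<^esub> int m"
    using arg_cong[OF st'(3), of g] g_mult[of s' b] g_mult[of t' "c [^]\<^bsub>A\<^esub> m"] g_pow[OF cA] st'(1,2) b' cA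
    by (simp add: int_pow_int)
  have 1: "f \<star> (?x \<star> \<tau> [^]\<^bsub>K\<^esub> int m) = g s \<star> (f \<star> (g t' \<star> \<tau> [^]\<^bsub>K\<^esub> int m))"
    using fc C tp by (simp add: K.m_ac)
  also have "\<dots> = g s \<star> (g s' \<star> (f \<star> g b))" unfolding eb[symmetric] using fc C by (simp add: K.m_ac)
  also have "\<dots> = g s' \<star> (g s \<star> g a)" unfolding e using C by (simp add: K.m_ac)
  also have "\<dots> = ?y \<star> \<tau> [^]\<^bsub>K\<^esub> int n" unfolding ea using C tp by (simp add: K.m_ac)
  finally have l: "f \<star> (?x \<star> \<tau> [^]\<^bsub>K\<^esub> int m) = ?y \<star> \<tau> [^]\<^bsub>K\<^esub> int n" .
  let ?w = "?y \<star> inv\<^bsub>K\<^esub> ?x"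
  have w: "?w \<in> UL" using UL_mult UL_inv x y by blast
  have C2: "?x \<in> carrier K" "?y \<in> carrier K" "inv\<^bsub>K\<^esub> ?x \<in> carrier K" "inv\<^bsub>K\<^esub> ?x \<star> ?x = \<one>\<^bsub>K\<^esub>" using xU C by auto
  have "(?w \<star> \<tau> [^]\<^bsub>K\<^esub> (int n - int m)) \<star> (?x \<star> \<tau> [^]\<^bsub>K\<^esub> int m) = ?y \<star> ((inv\<^bsub>K\<^esub> ?x \<star> ?x) \<star> (\<tau> [^]\<^bsub>K\<^esub> (int n - int m) \<star> \<tau> [^]\<^bsub>K\<^esub> int m))"
    using C2(1-3) tp by (simp add: K.m_ac del: K.Units_l_inv)
  also have "\<dots> = ?y \<star> \<tau> [^]\<^bsub>K\<^esub> int n"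
    unfolding C2(4) K.unit_int_pow_add[OF tau_Unit, symmetric] using C2 tp by simp
  finally have r: "(?w \<star> \<tau> [^]\<^bsub>K\<^esub> (int n - int m)) \<star> (?x \<star> \<tau> [^]\<^bsub>K\<^esub> int m) = f \<star> (?x \<star> \<tau> [^]\<^bsub>K\<^esub> int m)" using l by simp
  have "?x \<star> \<tau> [^]\<^bsub>K\<^esub> int m \<in> Units K" using xU K.unit_int_pow_closed[OF tau_Unit] by blast
  then have nz: "?x \<star> \<tau> [^]\<^bsub>K\<^esub> int m \<noteq> \<zero>\<^bsub>K\<^esub>" using K.field_Units by blast
  have "?w \<star> \<tau> [^]\<^bsub>K\<^esub> (int n - int m) = f"
    using r K.m_rcancel[OF nz] C2 tp fc UL_closed[OF w] by simp
  then show ?thesis using that[OF w] by metis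
qed

lemma val_mult: assumes "f \<in> Units K" "h \<in> Units K" shows "val (f \<star> h) = val f + val h"
proof -
  obtain w z where w: "w \<in> UL" and f: "f = w \<star> \<tau> [^]\<^bsub>K\<^esub> (z::int)" using factor_K[OF assms(1)] .
  obtain w' z' where w': "w' \<in> UL" and h: "h = w' \<star> \<tau> [^]\<^bsub>K\<^esub> (z'::int)" using factor_K[OF assms(2)] .
  have "f \<star> h = (w \<star> w') \<star> \<tau> [^]\<^bsub>K\<^esub> (z + z')"
    unfolding f h K.unit_int_pow_add[OF tau_Unit] using UL_closed[OF w] UL_closed[OF w'] tau_Unit
    by (simp add: K.m_ac K.Units_closed)
  then show ?thesis using val_eq[OF UL_mult[OF w w']] val_eq[OF w] val_eq[OF w'] f h by simp
qed

lemma val_int_pow: assumes "f \<in> Units K" shows "val (f [^]\<^bsub>K\<^esub> (n::int)) = n * val f"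
proof -
  obtain w z where w: "w \<in> UL" and f: "f = w \<star> \<tau> [^]\<^bsub>K\<^esub> (z::int)" using factor_K[OF assms] .
  have "f [^]\<^bsub>K\<^esub> n = w [^]\<^bsub>K\<^esub> n \<star> \<tau> [^]\<^bsub>K\<^esub> (z * n)"
    unfolding f using K.unit_int_pow_distrib[OF UL_Units[OF w] K.unit_int_pow_closed[OF tau_Unit]]
      K.unit_int_pow_pow[OF tau_Unit] by simp
  then show ?thesis using val_eq[OF UL_int_pow[OF w]] val_eq[OF w] f by simp
qed

end

section \<open>Integral schemes\<close>

context scheme_space
begin

lemma sheaf_glue:
  assumes "\<And>V. V \<in> \<U> \<Longrightarrow> openin (Sp \<XX>) V" "\<And>V. V \<in> \<U> \<Longrightarrow> s V \<in> carrier (Sec \<XX> V)"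
    and "\<And>V W. V \<in> \<U> \<Longrightarrow> W \<in> \<U> \<Longrightarrow> Res \<XX> V (V \<inter> W) (s V) = Res \<XX> W (V \<inter> W) (s W)"
  shows "\<exists>!t. t \<in> carrier (Sec \<XX> (\<Union>\<U>)) \<and> (\<forall>V\<in>\<U>. Res \<XX> (\<Union>\<U>) V t = s V)"
  by (rule sheaf_space[unfolded sheaf_def, THEN conjunct2, rule_format]) (use assms in blast)

lemma sheaf_eqI:
  assumes op: "\<And>V. V \<in> \<U> \<Longrightarrow> openin (Sp \<XX>) V"
    and s: "s \<in> carrier (Sec \<XX> (\<Union>\<U>))" "t \<in> carrier (Sec \<XX> (\<Union>\<U>))"
    and eq: "\<And>V. V \<in> \<U> \<Longrightarrow> Res \<XX> (\<Union>\<U>) V s = Res \<XX> (\<Union>\<U>) V t"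
  shows "s = t"
proof -
  have oU: "openin (Sp \<XX>) (\<Union>\<U>)" using op by blast
  have "\<exists>!r. r \<in> carrier (Sec \<XX> (\<Union>\<U>)) \<and> (\<forall>V\<in>\<U>. Res \<XX> (\<Union>\<U>) V r = Res \<XX> (\<Union>\<U>) V s)"
  proof (rule sheaf_glue[OF op])
    fix V assume V: "V \<in> \<U>"
    show "Res \<XX> (\<Union>\<U>) V s \<in> carrier (Sec \<XX> V)" using res_closed[OF oU op[OF V] _ s(1)] V by blast
    fix W assume W: "W \<in> \<U>"
    have o: "openin (Sp \<XX>) (V \<inter> W)" using op V W by blast
    show "Res \<XX> V (V \<inter> W) (Res \<XX> (\<Union>\<U>) V s) = Res \<XX> W (V \<inter> W) (Res \<XX> (\<Union>\<U>) W s)"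
      using res_res[OF oU op[OF V] o _ _ s(1)] res_res[OF oU op[OF W] o _ _ s(1)] Union_upper[OF V] Union_upper[OF W]
      by simp
  qed
  moreover have "\<forall>V\<in>\<U>. Res \<XX> (\<Union>\<U>) V t = Res \<XX> (\<Union>\<U>) V s" using eq by simp
  ultimately show ?thesis using s by blast
qed

lemma sec_empty: "s \<in> carrier (Sec \<XX> {}) \<Longrightarrow> t \<in> carrier (Sec \<XX> {}) \<Longrightarrow> s = t"
  using sheaf_eqI[of "{}" s t] by simp

lemma zero_not_unit:
  assumes "x \<in> points \<XX>" shows "\<zero>\<^bsub>stalk \<XX> x\<^esub> \<notin> Units (stalk \<XX> x)"
proof
  assume z: "\<zero>\<^bsub>stalk \<XX> x\<^esub> \<in> Units (stalk \<XX> x)"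
  interpret S: cring "stalk \<XX> x" by (rule stalk_cring[OF assms])
  obtain m where m: "maximalideal m (stalk \<XX> x)" using stalk_local[OF assms] unfolding local_ring_def by blast
  interpret m: maximalideal m "stalk \<XX> x" by (rule m)
  have "\<one>\<^bsub>stalk \<XX> x\<^esub> = \<zero>\<^bsub>stalk \<XX> x\<^esub> \<otimes>\<^bsub>stalk \<XX> x\<^esub> inv\<^bsub>stalk \<XX> x\<^esub> \<zero>\<^bsub>stalk \<XX> x\<^esub>"
    using S.Units_r_inv[OF z] by simp
  also have "\<dots> = \<zero>\<^bsub>stalk \<XX> x\<^esub>" using S.Units_inv_closed[OF z] by simp
  finally have "\<one>\<^bsub>stalk \<XX> x\<^esub> \<in> m" by simp
  then show False using m.one_imp_carrier m.I_notcarr by simp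
qed

lemma sec_nontrivial:
  assumes V: "openin (Sp \<XX>) V" "V \<noteq> {}"
  shows "\<one>\<^bsub>Sec \<XX> V\<^esub> \<noteq> \<zero>\<^bsub>Sec \<XX> V\<^esub>"
proof
  assume e: "\<one>\<^bsub>Sec \<XX> V\<^esub> = \<zero>\<^bsub>Sec \<XX> V\<^esub>"
  obtain y where y: "y \<in> V" using V(2) by blast
  have yp: "y \<in> points \<XX>" using y openin_subset[OF V(1)] by blast
  interpret S: cring "stalk \<XX> y" by (rule stalk_cring[OF yp])
  have "\<one>\<^bsub>stalk \<XX> y\<^esub> = \<zero>\<^bsub>stalk \<XX> y\<^esub>"
    using germ_one[OF V(1) y] germ_zero[OF V(1) y] e by simp
  then show False using zero_not_unit[OF yp] S.Units_one_closed by metis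
qed

lemma zero_locus_closed:
  assumes f: "f \<in> carrier (glob \<XX>)"
  shows "closedin (Sp \<XX>) (zero_locus \<XX> f)"
proof -
  have "points \<XX> - zero_locus \<XX> f = \<Union>{W. openin (Sp \<XX>) W \<and> Res \<XX> (points \<XX>) W f \<in> Units (Sec \<XX> W)}" (is "_ = \<Union>?\<W>")
  proof (intro equalityI subsetI)
    fix x assume "x \<in> points \<XX> - zero_locus \<XX> f"
    then have x: "x \<in> points \<XX>" "germ \<XX> x (points \<XX>) f \<in> Units (stalk \<XX> x)" unfolding zero_locus_def by auto
    then show "x \<in> \<Union>?\<W>" unfolding germ_Units_iff[OF openin_points x(1) f] by blast
  next
    fix x assume "x \<in> \<Union>?\<W>"
    then obtain W where W: "openin (Sp \<XX>) W" "x \<in> W" "Res \<XX> (points \<XX>) W f \<in> Units (Sec \<XX> W)" by blast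
    have x: "x \<in> points \<XX>" "W \<subseteq> points \<XX>" using openin_subset[OF W(1)] W(2) by auto
    have "germ \<XX> x (points \<XX>) f \<in> Units (stalk \<XX> x)"
      unfolding germ_Units_iff[OF openin_points x(1) f] using W x(2) by blast
    then show "x \<in> points \<XX> - zero_locus \<XX> f" using x unfolding zero_locus_def by blast
  qed
  moreover have "openin (Sp \<XX>) (\<Union>?\<W>)" by (rule openin_Union) blast
  ultimately have "openin (Sp \<XX>) (points \<XX> - zero_locus \<XX> f)" by simp
  moreover have "zero_locus \<XX> f \<subseteq> points \<XX>" unfolding zero_locus_def by blast
  ultimately show ?thesis unfolding closedin_def by simp
qed

end

text \<open>
  A single pair \<open>a\<close>, \<open>s\<close> serves as a fraction for \<open>t\<close> at all points where \<open>s\<close> does not vanish. This compares the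
  germs of \<open>t\<close> at a point with those at its generizations, in particular at the generic point.
\<close>

lemma (in affine_chart) section_fraction:
  assumes W: "openin (Sp \<XX>) W" "x \<in> W" "x \<in> U" "t \<in> carrier (Sec \<XX> W)"
  obtains a s where "a \<in> carrier A" "s \<in> carrier A - \<pi> x"
    "\<And>y. y \<in> U \<Longrightarrow> s \<notin> \<pi> y \<Longrightarrow> y \<in> W \<and> germ \<XX> y W t \<otimes>\<^bsub>stalk \<XX> y\<^esub> germ \<XX> y U s = germ \<XX> y U a"
proof -
  obtain f where f: "f \<in> carrier A" "x \<in> Dist f" "Dist f \<subseteq> W" using Dist_basis[OF W(1-3)] .
  let ?h = "Res \<XX> U (Dist f)" and ?S = "Sec \<XX> (Dist f)" and ?b = "Res \<XX> W (Dist f) t"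
  have o: "openin (Sp \<XX>) (Dist f)" using Dist_open f(1) .
  interpret S: cring ?S by (rule sec_cring[OF o])
  have h: "?h \<in> ring_hom A ?S" by (rule Dist_hom[OF f(1)])
  have b: "?b \<in> carrier ?S" using res_closed[OF W(1) o f(3) W(4)] .
  obtain a n where a: "a \<in> carrier A" "?b \<otimes>\<^bsub>?S\<^esub> ?h (f [^]\<^bsub>A\<^esub> (n::nat)) = ?h a"
    using Dist_fraction[OF f(1) b] .
  let ?s = "f [^]\<^bsub>A\<^esub> n \<otimes>\<^bsub>A\<^esub> f" and ?a = "a \<otimes>\<^bsub>A\<^esub> f"
  have fn: "f [^]\<^bsub>A\<^esub> n \<in> carrier A" and s: "?s \<in> carrier A" and a': "?a \<in> carrier A" using f(1) a(1) by auto
  have hc: "?h (f [^]\<^bsub>A\<^esub> n) \<in> carrier ?S" "?h f \<in> carrier ?S" using ring_hom_closed[OF h] fn f(1) by auto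
  have "?b \<otimes>\<^bsub>?S\<^esub> ?h ?s = (?b \<otimes>\<^bsub>?S\<^esub> ?h (f [^]\<^bsub>A\<^esub> n)) \<otimes>\<^bsub>?S\<^esub> ?h f"
    unfolding ring_hom_mult[OF h fn f(1)] by (rule S.m_assoc[symmetric, OF b hc])
  then have e: "?b \<otimes>\<^bsub>?S\<^esub> ?h ?s = ?h ?a" unfolding a(2) ring_hom_mult[OF h a(1) f(1)] .
  have "y \<in> W \<and> germ \<XX> y W t \<otimes>\<^bsub>stalk \<XX> y\<^esub> germ \<XX> y U ?s = germ \<XX> y U ?a" if y: "y \<in> U" "?s \<notin> \<pi> y" for y
  proof -
    have "f \<notin> \<pi> y"
      using y(2) ideal.I_l_closed[OF primeideal.axioms(1)[OF pi_prime[OF y(1)]] _ fn, of f] by blast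
    then have yD: "y \<in> Dist f" using y by blast
    have "germ \<XX> y (Dist f) (?b \<otimes>\<^bsub>?S\<^esub> ?h ?s) = germ \<XX> y (Dist f) (?h ?a)" unfolding e ..
    then show ?thesis
      unfolding germ_mult[OF o yD b ring_hom_closed[OF h s]]
        germ_res[OF U_open o Dist_subset yD s] germ_res[OF U_open o Dist_subset yD a'] germ_res[OF W(1) o f(3) yD W(4)]
      using yD f(3) by blast
  qed
  moreover have "?s \<in> carrier A - \<pi> x"
  proof -
    have x: "x \<in> U" "f \<notin> \<pi> x" using f(2) by auto
    have "f [^]\<^bsub>A\<^esub> (Suc n) \<notin> \<pi> x" by (rule pow_notin[OF x(1) f(1) x(2)])
    then show ?thesis using s by simp
  qed
  ultimately show ?thesis using that[OF a'] by blast
qed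

locale irreducible_space = scheme_space +
  assumes irreducible: "irreducible_subset \<XX> (points \<XX>)"
begin

abbreviation \<eta> where "\<eta> \<equiv> generic_point \<XX> (points \<XX>)"

lemma generic_in: "openin (Sp \<XX>) W \<Longrightarrow> W \<noteq> {} \<Longrightarrow> \<eta> \<in> W"
  using generic_point_in_open[OF irreducible closedin_topspace, of W] openin_subset[of "Sp \<XX>" W] by blast

lemma eta_points: "\<eta> \<in> points \<XX>"
  using generic_point(2)[OF irreducible closedin_topspace] .

lemma closure_eta: "Sp \<XX> closure_of {\<eta>} = points \<XX>"
  using generic_point(3)[OF irreducible closedin_topspace] .

lemma ff_cring: "cring (function_field \<XX>)"
  unfolding function_field_def by (rule stalk_cring[OF eta_points])

lemma ff_hom: "openin (Sp \<XX>) W \<Longrightarrow> W \<noteq> {} \<Longrightarrow> ff_germ \<XX> W \<in> ring_hom (Sec \<XX> W) (function_field \<XX>)"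
  unfolding function_field_def using germ_hom generic_in by blast

lemma ff_res: "openin (Sp \<XX>) U \<Longrightarrow> openin (Sp \<XX>) W \<Longrightarrow> W \<subseteq> U \<Longrightarrow> W \<noteq> {} \<Longrightarrow> s \<in> carrier (Sec \<XX> U) \<Longrightarrow>
    ff_germ \<XX> W (Res \<XX> U W s) = ff_germ \<XX> U s"
  using germ_res generic_in by blast

end

locale integral_space = scheme_space +
  assumes integral: "integral_scheme \<XX>"
begin

lemma sec_domain: "openin (Sp \<XX>) U \<Longrightarrow> U \<noteq> {} \<Longrightarrow> domain (Sec \<XX> U)"
  using integral unfolding integral_scheme_def by blast

text \<open>Two disjoint nonempty open subsets would produce idempotents in the sections on their union.\<close>

lemma opens_meet:
  assumes N: "openin (Sp \<XX>) N" "openin (Sp \<XX>) N'" "N \<noteq> {}" "N' \<noteq> {}"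
  shows "N \<inter> N' \<noteq> {}"
proof
  assume dis: "N \<inter> N' = {}"
  have ne: "N \<noteq> N'" using dis N by blast
  let ?\<U> = "{N, N'}"
  have oU: "openin (Sp \<XX>) (\<Union>?\<U>)" using N by auto
  have oe: "openin (Sp \<XX>) {}" by simp
  interpret S: "domain" "Sec \<XX> (\<Union>?\<U>)" by (rule sec_domain[OF oU]) (use N in auto)
  interpret N: "domain" "Sec \<XX> N" by (rule sec_domain[OF N(1,3)])
  interpret N': "domain" "Sec \<XX> N'" by (rule sec_domain[OF N(2,4)])
  have glue: "\<exists>t\<in>carrier (Sec \<XX> (\<Union>?\<U>)). Res \<XX> (\<Union>?\<U>) N t = a \<and> Res \<XX> (\<Union>?\<U>) N' t = b"
    if a: "a \<in> carrier (Sec \<XX> N)" and b: "b \<in> carrier (Sec \<XX> N')" for a b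
  proof -
    let ?s = "\<lambda>V. if V = N then a else b"
    have op: "openin (Sp \<XX>) V" if "V \<in> ?\<U>" for V using that N by blast
    have cl: "?s V \<in> carrier (Sec \<XX> V)" if "V \<in> ?\<U>" for V using that a b ne by auto
    have "Res \<XX> V (V \<inter> W) (?s V) = Res \<XX> W (V \<inter> W) (?s W)" if "V \<in> ?\<U>" "W \<in> ?\<U>" for V W
    proof (cases "V = W")
      case False
      then have "V \<inter> W = {}" using that dis by auto
      then show ?thesis
        using sec_empty[OF res_closed[OF op[OF that(1)] oe _ cl[OF that(1)]] res_closed[OF op[OF that(2)] oe _ cl[OF that(2)]]]
        by simp
    qed simp
    from sheaf_glue[of ?\<U> ?s, OF op cl this]
    obtain t where t: "t \<in> carrier (Sec \<XX> (\<Union>?\<U>))" "\<forall>V\<in>?\<U>. Res \<XX> (\<Union>?\<U>) V t = ?s V" by blast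
    have "Res \<XX> (\<Union>?\<U>) N t = a" "Res \<XX> (\<Union>?\<U>) N' t = b" using t(2) ne by auto
    then show ?thesis using t(1) by blast
  qed
  obtain t where t: "t \<in> carrier (Sec \<XX> (\<Union>?\<U>))" "Res \<XX> (\<Union>?\<U>) N t = \<one>\<^bsub>Sec \<XX> N\<^esub>" "Res \<XX> (\<Union>?\<U>) N' t = \<zero>\<^bsub>Sec \<XX> N'\<^esub>"
    using glue[OF N.one_closed N'.zero_closed] by blast
  obtain t' where t': "t' \<in> carrier (Sec \<XX> (\<Union>?\<U>))" "Res \<XX> (\<Union>?\<U>) N t' = \<zero>\<^bsub>Sec \<XX> N\<^esub>" "Res \<XX> (\<Union>?\<U>) N' t' = \<one>\<^bsub>Sec \<XX> N'\<^esub>"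
    using glue[OF N.zero_closed N'.one_closed] by blast
  have h: "Res \<XX> (\<Union>?\<U>) N \<in> ring_hom (Sec \<XX> (\<Union>?\<U>)) (Sec \<XX> N)" by (rule res_hom[OF oU N(1)]) blast
  have h': "Res \<XX> (\<Union>?\<U>) N' \<in> ring_hom (Sec \<XX> (\<Union>?\<U>)) (Sec \<XX> N')" by (rule res_hom[OF oU N(2)]) blast
  have z: "Res \<XX> (\<Union>?\<U>) N \<zero>\<^bsub>Sec \<XX> (\<Union>?\<U>)\<^esub> = \<zero>\<^bsub>Sec \<XX> N\<^esub>" by (rule ring_hom_zero[OF h S.ring_axioms N.ring_axioms])
  have z': "Res \<XX> (\<Union>?\<U>) N' \<zero>\<^bsub>Sec \<XX> (\<Union>?\<U>)\<^esub> = \<zero>\<^bsub>Sec \<XX> N'\<^esub>" by (rule ring_hom_zero[OF h' S.ring_axioms N'.ring_axioms])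
  have m: "Res \<XX> (\<Union>?\<U>) N (t \<otimes>\<^bsub>Sec \<XX> (\<Union>?\<U>)\<^esub> t') = \<zero>\<^bsub>Sec \<XX> N\<^esub>"
    unfolding ring_hom_mult[OF h t(1) t'(1)] t t' by simp
  have m': "Res \<XX> (\<Union>?\<U>) N' (t \<otimes>\<^bsub>Sec \<XX> (\<Union>?\<U>)\<^esub> t') = \<zero>\<^bsub>Sec \<XX> N'\<^esub>"
    unfolding ring_hom_mult[OF h' t(1) t'(1)] t t' by simp
  have "t \<otimes>\<^bsub>Sec \<XX> (\<Union>?\<U>)\<^esub> t' = \<zero>\<^bsub>Sec \<XX> (\<Union>?\<U>)\<^esub>"
  proof (rule sheaf_eqI[of ?\<U>])
    show "openin (Sp \<XX>) V" if "V \<in> ?\<U>" for V using that N by blast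
    show "t \<otimes>\<^bsub>Sec \<XX> (\<Union>?\<U>)\<^esub> t' \<in> carrier (Sec \<XX> (\<Union>?\<U>))" by (rule S.m_closed[OF t(1) t'(1)])
    show "\<zero>\<^bsub>Sec \<XX> (\<Union>?\<U>)\<^esub> \<in> carrier (Sec \<XX> (\<Union>?\<U>))" by (rule S.zero_closed)
    show "Res \<XX> (\<Union>?\<U>) V (t \<otimes>\<^bsub>Sec \<XX> (\<Union>?\<U>)\<^esub> t') = Res \<XX> (\<Union>?\<U>) V \<zero>\<^bsub>Sec \<XX> (\<Union>?\<U>)\<^esub>" if "V \<in> ?\<U>" for V
    proof -
      from that consider "V = N" | "V = N'" by blast
      then show ?thesis by cases (simp_all only: m m' z z')
    qed
  qed
  then have "t = \<zero>\<^bsub>Sec \<XX> (\<Union>?\<U>)\<^esub> \<or> t' = \<zero>\<^bsub>Sec \<XX> (\<Union>?\<U>)\<^esub>" using S.integral t(1) t'(1) by blast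
  then show False
  proof
    assume "t = \<zero>\<^bsub>Sec \<XX> (\<Union>?\<U>)\<^esub>"
    then show False using t(2) z N.zero_not_one by metis
  next
    assume "t' = \<zero>\<^bsub>Sec \<XX> (\<Union>?\<U>)\<^esub>"
    then show False using t'(3) z' N'.zero_not_one by metis
  qed
qed

lemma irreducible_points: "irreducible_subset \<XX> (points \<XX>)"
  unfolding irreducible_subset_def
proof (intro conjI allI impI)
  show "points \<XX> \<noteq> {}" using integral unfolding integral_scheme_def by blast
  fix C C' assume C: "closedin (Sp \<XX>) C \<and> closedin (Sp \<XX>) C' \<and> points \<XX> \<subseteq> C \<union> C'"
  then have "openin (Sp \<XX>) (points \<XX> - C)" "openin (Sp \<XX>) (points \<XX> - C')" by (auto simp: closedin_def)
  moreover have "(points \<XX> - C) \<inter> (points \<XX> - C') = {}" using C by blast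
  ultimately have "points \<XX> - C = {} \<or> points \<XX> - C' = {}" using opens_meet by blast
  then show "points \<XX> \<subseteq> C \<or> points \<XX> \<subseteq> C'" by blast
qed simp

sublocale irreducible_space by unfold_locales (rule irreducible_points)

text \<open>
  Near any point, \<open>s\<close> is a fraction whose numerator has germ zero at the generic point. The sections on a chart
  form a domain, so the numerator is zero and \<open>s\<close> vanishes near every point of \<open>U\<close>.
\<close>

lemma ff_zero:
  assumes U: "openin (Sp \<XX>) U" "U \<noteq> {}" and s: "s \<in> carrier (Sec \<XX> U)"
    and z: "ff_germ \<XX> U s = \<zero>\<^bsub>function_field \<XX>\<^esub>"
  shows "s = \<zero>\<^bsub>Sec \<XX> U\<^esub>"
proof -
  define \<W> where "\<W> = {W. openin (Sp \<XX>) W \<and> W \<subseteq> U \<and> Res \<XX> U W s = Res \<XX> U W \<zero>\<^bsub>Sec \<XX> U\<^esub>}"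
  have zc: "\<zero>\<^bsub>Sec \<XX> U\<^esub> \<in> carrier (Sec \<XX> U)" by (rule cring.cring_simprules(2)[OF sec_cring[OF U(1)]])
  have "x \<in> \<Union>\<W>" if x: "x \<in> U" for x
  proof -
    have xp: "x \<in> points \<XX>" using x openin_subset[OF U(1)] by blast
    obtain V \<pi> where V: "affine_chart \<XX> V \<pi>" "x \<in> V" using affine_nbhd[OF xp] .
    interpret V: affine_chart \<XX> V \<pi> by (rule V(1))
    have Vne: "V \<noteq> {}" using V(2) by blast
    interpret A: "domain" V.A by (rule sec_domain[OF V.U_open Vne])
    obtain a s' where a: "a \<in> carrier V.A" and s': "s' \<in> carrier V.A - \<pi> x"
      and fr: "\<And>y. y \<in> V \<Longrightarrow> s' \<notin> \<pi> y \<Longrightarrow> y \<in> U \<and> germ \<XX> y U s \<otimes>\<^bsub>stalk \<XX> y\<^esub> germ \<XX> y V s' = germ \<XX> y V a"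
      using V.section_fraction[OF U(1) x V(2) s] by blast
    have eV: "\<eta> \<in> V" by (rule generic_in[OF V.U_open Vne])
    have "\<pi> \<eta> \<subseteq> \<pi> x" using V.closure_iff[OF V(2) eV] closure_eta xp by blast
    then have "s' \<notin> \<pi> \<eta>" using s' by blast
    from fr[OF eV this] have "germ \<XX> \<eta> U s \<otimes>\<^bsub>stalk \<XX> \<eta>\<^esub> germ \<XX> \<eta> V s' = germ \<XX> \<eta> V a" by blast
    moreover have "germ \<XX> \<eta> V s' \<in> carrier (stalk \<XX> \<eta>)" using germ_closed[OF V.U_open eV] s' by blast
    ultimately have "germ \<XX> \<eta> V a = \<zero>\<^bsub>stalk \<XX> \<eta>\<^esub>"
      using z cring.cring_simprules(26)[OF stalk_cring[OF eta_points]] unfolding function_field_def by simp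
    then obtain r where r: "r \<in> carrier V.A - \<pi> \<eta>" "r \<otimes>\<^bsub>V.A\<^esub> a = \<zero>\<^bsub>V.A\<^esub>" by (rule V.germ_zeroD[OF eV a])
    interpret e: primeideal "\<pi> \<eta>" V.A by (rule V.pi_prime[OF eV])
    have "r \<noteq> \<zero>\<^bsub>V.A\<^esub>" using r(1) by auto
    then have a0: "a = \<zero>\<^bsub>V.A\<^esub>" using A.integral[OF r(2)] r(1) a by blast
    interpret S: cring "stalk \<XX> x" by (rule stalk_cring[OF xp])
    have gs: "germ \<XX> x U s \<in> carrier (stalk \<XX> x)" by (rule germ_closed[OF U(1) x s])
    have un: "germ \<XX> x V s' \<in> Units (stalk \<XX> x)" using V.germ_unit_iff[OF V(2)] s' by blast
    have "germ \<XX> x U s \<otimes>\<^bsub>stalk \<XX> x\<^esub> germ \<XX> x V s' = \<zero>\<^bsub>stalk \<XX> x\<^esub>"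
      using fr[OF V(2)] s' a0 germ_zero[OF V.U_open V(2)] by simp
    then have "\<zero>\<^bsub>stalk \<XX> x\<^esub> = (germ \<XX> x U s \<otimes>\<^bsub>stalk \<XX> x\<^esub> germ \<XX> x V s') \<otimes>\<^bsub>stalk \<XX> x\<^esub> inv\<^bsub>stalk \<XX> x\<^esub> germ \<XX> x V s'"
      using S.Units_inv_closed[OF un] by simp
    also have "\<dots> = germ \<XX> x U s"
      using S.m_assoc[OF gs S.Units_closed[OF un] S.Units_inv_closed[OF un]] S.Units_r_inv[OF un] gs by simp
    finally have "germ \<XX> x U s = germ \<XX> x U \<zero>\<^bsub>Sec \<XX> U\<^esub>" using germ_zero[OF U(1) x] by simp
    then obtain W where "openin (Sp \<XX>) W" "x \<in> W" "W \<subseteq> U" "Res \<XX> U W s = Res \<XX> U W \<zero>\<^bsub>Sec \<XX> U\<^esub>"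
      by (rule germ_eqD[OF _ U(1) x zc])
    then show ?thesis unfolding \<W>_def by blast
  qed
  then have cover: "\<Union>\<W> = U" unfolding \<W>_def by blast
  show ?thesis
    by (rule sheaf_eqI[of \<W>, unfolded cover]) (use s zc in \<open>auto simp: \<W>_def\<close>)
qed

lemma ff_inj:
  assumes U: "openin (Sp \<XX>) U" "U \<noteq> {}" and s: "s \<in> carrier (Sec \<XX> U)" "t \<in> carrier (Sec \<XX> U)"
    and eq: "ff_germ \<XX> U s = ff_germ \<XX> U t"
  shows "s = t"
proof -
  interpret S: cring "Sec \<XX> U" by (rule sec_cring[OF U(1)])
  interpret K: cring "function_field \<XX>" by (rule ff_cring)
  have h: "ff_germ \<XX> U \<in> ring_hom (Sec \<XX> U) (function_field \<XX>)" by (rule ff_hom[OF U])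
  have "ff_germ \<XX> U (s \<ominus>\<^bsub>Sec \<XX> U\<^esub> t) = \<zero>\<^bsub>function_field \<XX>\<^esub>"
    unfolding ring_hom_minus[OF h S.is_cring K.is_cring s] eq using ring_hom_closed[OF h s(2)] by simp
  then have "s \<ominus>\<^bsub>Sec \<XX> U\<^esub> t = \<zero>\<^bsub>Sec \<XX> U\<^esub>" using ff_zero[OF U] s by simp
  then show ?thesis using s by simp
qed

lemma res_inj:
  assumes "openin (Sp \<XX>) U" "openin (Sp \<XX>) W" "W \<subseteq> U" "W \<noteq> {}"
    and "s \<in> carrier (Sec \<XX> U)" "t \<in> carrier (Sec \<XX> U)" "Res \<XX> U W s = Res \<XX> U W t"
  shows "s = t"
proof -
  have ne: "U \<noteq> {}" using assms by blast
  show ?thesis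
    using ff_inj[OF assms(1) ne assms(5,6)] ff_res[OF assms(1-4), of s] ff_res[OF assms(1-4), of t] assms(5-7) by metis
qed

text \<open>
  The difference of \<open>a\<close> and \<open>b\<close> is annihilated by a nonzero section, and the sections on \<open>U\<close> form a domain.
\<close>

lemma germ_inj_chart:
  assumes U: "affine_chart \<XX> U \<pi>" "x \<in> U"
    and a: "a \<in> carrier (Sec \<XX> U)" "b \<in> carrier (Sec \<XX> U)" and e: "germ \<XX> x U a = germ \<XX> x U b"
  shows "a = b"
proof -
  interpret U: affine_chart \<XX> U \<pi> by (rule U(1))
  have Une: "U \<noteq> {}" using U(2) by blast
  interpret A: "domain" U.A by (rule sec_domain[OF U.U_open Une])
  have xp: "x \<in> points \<XX>" using U(2) openin_subset[OF U.U_open] by blast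
  interpret S: cring "stalk \<XX> x" by (rule stalk_cring[OF xp])
  have h: "germ \<XX> x U \<in> ring_hom U.A (stalk \<XX> x)" by (rule germ_hom[OF U.U_open U(2)])
  have z: "germ \<XX> x U (a \<ominus>\<^bsub>U.A\<^esub> b) = \<zero>\<^bsub>stalk \<XX> x\<^esub>"
    unfolding ring_hom_minus[OF h U.A.is_cring S.is_cring a] e using ring_hom_closed[OF h a(2)] by simp
  have c: "a \<ominus>\<^bsub>U.A\<^esub> b \<in> carrier U.A" using a by simp
  obtain s where s: "s \<in> carrier U.A - \<pi> x" "s \<otimes>\<^bsub>U.A\<^esub> (a \<ominus>\<^bsub>U.A\<^esub> b) = \<zero>\<^bsub>U.A\<^esub>"
    by (rule U.germ_zeroD[OF U(2) c z])
  interpret p: primeideal "\<pi> x" U.A by (rule U.pi_prime[OF U(2)])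
  have "s \<noteq> \<zero>\<^bsub>U.A\<^esub>" using s(1) by auto
  then have "a \<ominus>\<^bsub>U.A\<^esub> b = \<zero>\<^bsub>U.A\<^esub>" using A.integral[OF s(2)] s(1) c by blast
  then show ?thesis using a by simp
qed

end

section \<open>Prime divisors on normal schemes\<close>

lemma integrally_closedD:
  assumes "integrally_closed R" "y \<in> carrier R" "x \<in> carrier R" "x \<noteq> \<zero>\<^bsub>R\<^esub>" "n > 0"
    and "r \<in> {..<n::nat} \<rightarrow> carrier R"
    and "y [^]\<^bsub>R\<^esub> n \<oplus>\<^bsub>R\<^esub> (\<Oplus>\<^bsub>R\<^esub>i\<in>{..<n}. r i \<otimes>\<^bsub>R\<^esub> (y [^]\<^bsub>R\<^esub> i \<otimes>\<^bsub>R\<^esub> x [^]\<^bsub>R\<^esub> (n - i))) = \<zero>\<^bsub>R\<^esub>"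
  shows "\<exists>q\<in>carrier R. y = q \<otimes>\<^bsub>R\<^esub> x"
  using assms(1)[unfolded integrally_closed_def, THEN conjunct2, rule_format, of y x n r]
    assms(2-) by simp

locale normal_integral_space = integral_space +
  assumes normal: "normal_scheme \<XX>"
begin

text \<open>
  The equation says that \<open>y / x\<close> is integral. It is solved in the stalk at the point \<open>P\<close>, which is integrally
  closed, and the solution is a fraction with denominator \<open>s\<close> outside \<open>P\<close>.
\<close>

lemma locally_integrally_closed:
  assumes U: "affine_chart \<XX> U \<pi>" and P: "primeideal P (Sec \<XX> U)"
    and x: "x \<in> carrier (Sec \<XX> U)" "x \<noteq> \<zero>\<^bsub>Sec \<XX> U\<^esub>" and y: "y \<in> carrier (Sec \<XX> U)" and n: "n > 0"
    and r: "r \<in> {..<n::nat} \<rightarrow> carrier (Sec \<XX> U)"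
    and eq: "y [^]\<^bsub>Sec \<XX> U\<^esub> n \<oplus>\<^bsub>Sec \<XX> U\<^esub> (\<Oplus>\<^bsub>Sec \<XX> U\<^esub>i\<in>{..<n}. r i \<otimes>\<^bsub>Sec \<XX> U\<^esub>
        (y [^]\<^bsub>Sec \<XX> U\<^esub> i \<otimes>\<^bsub>Sec \<XX> U\<^esub> x [^]\<^bsub>Sec \<XX> U\<^esub> (n - i))) = \<zero>\<^bsub>Sec \<XX> U\<^esub>"
  shows "\<exists>s\<in>carrier (Sec \<XX> U) - P. \<exists>q\<in>carrier (Sec \<XX> U). s \<otimes>\<^bsub>Sec \<XX> U\<^esub> y = q \<otimes>\<^bsub>Sec \<XX> U\<^esub> x"
proof -
  interpret U: affine_chart \<XX> U \<pi> by (rule U)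
  obtain z where z: "z \<in> U" "\<pi> z = P" using U.pi_surj[OF P] .
  have zp: "z \<in> points \<XX>" using z(1) openin_subset[OF U.U_open] by blast
  let ?S = "stalk \<XX> z" and ?g = "germ \<XX> z U"
  interpret S: cring ?S by (rule stalk_cring[OF zp])
  have h: "?g \<in> ring_hom U.A ?S" by (rule germ_hom[OF U.U_open z(1)])
  have hc: "?g b \<in> carrier ?S" if "b \<in> carrier U.A" for b by (rule ring_hom_closed[OF h that])
  have pow: "?g (b [^]\<^bsub>U.A\<^esub> k) = ?g b [^]\<^bsub>?S\<^esub> k" if "b \<in> carrier U.A" for b and k :: nat
    by (rule ring_hom_nat_pow[OF h U.A.ring_axioms S.ring_axioms that])
  let ?t = "\<lambda>i. r i \<otimes>\<^bsub>U.A\<^esub> (y [^]\<^bsub>U.A\<^esub> i \<otimes>\<^bsub>U.A\<^esub> x [^]\<^bsub>U.A\<^esub> (n - i))"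
  have tc: "?t \<in> {..<n} \<rightarrow> carrier U.A" using r x y by (auto simp: Pi_def)
  have "\<zero>\<^bsub>?S\<^esub> = ?g (y [^]\<^bsub>U.A\<^esub> n \<oplus>\<^bsub>U.A\<^esub> (\<Oplus>\<^bsub>U.A\<^esub>i\<in>{..<n}. ?t i))"
    unfolding eq using ring_hom_zero[OF h U.A.ring_axioms S.ring_axioms] by simp
  also have "\<dots> = ?g (y [^]\<^bsub>U.A\<^esub> n) \<oplus>\<^bsub>?S\<^esub> ?g (\<Oplus>\<^bsub>U.A\<^esub>i\<in>{..<n}. ?t i)"
    by (rule ring_hom_add[OF h]) (use y U.A.finsum_closed[OF tc] in auto)
  also have "?g (\<Oplus>\<^bsub>U.A\<^esub>i\<in>{..<n}. ?t i) = (\<Oplus>\<^bsub>?S\<^esub>i\<in>{..<n}. ?g (?t i))"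
    by (rule ring_hom_finsum[OF h U.A.is_cring S.is_cring tc])
  also have "\<dots> = (\<Oplus>\<^bsub>?S\<^esub>i\<in>{..<n}. ?g (r i) \<otimes>\<^bsub>?S\<^esub> (?g y [^]\<^bsub>?S\<^esub> i \<otimes>\<^bsub>?S\<^esub> ?g x [^]\<^bsub>?S\<^esub> (n - i)))"
  proof (rule S.finsum_cong')
    show "(\<lambda>i. ?g (r i) \<otimes>\<^bsub>?S\<^esub> (?g y [^]\<^bsub>?S\<^esub> i \<otimes>\<^bsub>?S\<^esub> ?g x [^]\<^bsub>?S\<^esub> (n - i))) \<in> {..<n} \<rightarrow> carrier ?S"
      using r hc x y by (auto simp: Pi_def)
    fix i assume "i \<in> {..<n}"
    then have ri: "r i \<in> carrier U.A" using r by blast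
    show "?g (?t i) = ?g (r i) \<otimes>\<^bsub>?S\<^esub> (?g y [^]\<^bsub>?S\<^esub> i \<otimes>\<^bsub>?S\<^esub> ?g x [^]\<^bsub>?S\<^esub> (n - i))"
      using ring_hom_mult[OF h ri, of "y [^]\<^bsub>U.A\<^esub> i \<otimes>\<^bsub>U.A\<^esub> x [^]\<^bsub>U.A\<^esub> (n - i)"]
        ring_hom_mult[OF h, of "y [^]\<^bsub>U.A\<^esub> i" "x [^]\<^bsub>U.A\<^esub> (n - i)"] pow x(1) y by simp
  qed simp
  finally have E: "?g y [^]\<^bsub>?S\<^esub> n \<oplus>\<^bsub>?S\<^esub> (\<Oplus>\<^bsub>?S\<^esub>i\<in>{..<n}. ?g (r i) \<otimes>\<^bsub>?S\<^esub> (?g y [^]\<^bsub>?S\<^esub> i \<otimes>\<^bsub>?S\<^esub> ?g x [^]\<^bsub>?S\<^esub> (n - i))) = \<zero>\<^bsub>?S\<^esub>"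
    unfolding pow[OF y] by simp
  have x0: "?g x \<noteq> \<zero>\<^bsub>?S\<^esub>"
    using germ_inj_chart[OF U z(1) x(1) U.A.zero_closed] germ_zero[OF U.U_open z(1)] x(2) by metis
  have rc: "(\<lambda>i. ?g (r i)) \<in> {..<n} \<rightarrow> carrier ?S" using r hc by (auto simp: Pi_def)
  have ic: "integrally_closed ?S" using normal zp unfolding normal_scheme_def by blast
  obtain q where q: "q \<in> carrier ?S" "?g y = q \<otimes>\<^bsub>?S\<^esub> ?g x"
    using integrally_closedD[OF ic hc[OF y] hc[OF x(1)] x0 n rc E] by blast
  obtain a s where a: "a \<in> carrier U.A" and s: "s \<in> carrier U.A - \<pi> z" and qs: "q \<otimes>\<^bsub>?S\<^esub> ?g s = ?g a"
    by (rule U.stalk_fraction[OF z(1) q(1)])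
  have sc: "s \<in> carrier U.A" using s by blast
  have "?g (s \<otimes>\<^bsub>U.A\<^esub> y) = (q \<otimes>\<^bsub>?S\<^esub> ?g s) \<otimes>\<^bsub>?S\<^esub> ?g x"
    unfolding ring_hom_mult[OF h sc y] q(2) using q(1) hc[OF sc] hc[OF x(1)] by (simp add: S.m_ac)
  also have "\<dots> = ?g (a \<otimes>\<^bsub>U.A\<^esub> x)" unfolding qs ring_hom_mult[OF h a x(1)] ..
  finally have "s \<otimes>\<^bsub>U.A\<^esub> y = a \<otimes>\<^bsub>U.A\<^esub> x"
    using germ_inj_chart[OF U z(1), of "s \<otimes>\<^bsub>U.A\<^esub> y" "a \<otimes>\<^bsub>U.A\<^esub> x"] sc y a x(1) by simp
  then show ?thesis using s a z(2) by blast
qed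

end

text \<open>
  The zero locus of \<open>e\<close> is a prime divisor with generic point \<open>\<delta>\<close>. That it is not all of \<open>\<XX>\<close> makes \<open>e\<close>
  nonzero.
\<close>

locale prime_divisor = normal_integral_space \<XX> for \<XX> :: "('p, 's) ringed_space" +
  fixes e :: 's
  assumes noetherian: "noetherian_scheme \<XX>"
    and e: "e \<in> carrier (glob \<XX>)"
    and e_irreducible: "irreducible_subset \<XX> (zero_locus \<XX> e)"
    and e_proper: "generic_point \<XX> (zero_locus \<XX> e) \<noteq> generic_point \<XX> (points \<XX>)"
    and field: "field (function_field \<XX>)"
begin

abbreviation \<delta> where "\<delta> \<equiv> generic_point \<XX> (zero_locus \<XX> e)"
abbreviation K where "K \<equiv> function_field \<XX>"
abbreviation eR where "eR U \<equiv> Res \<XX> (points \<XX>) U e"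

sublocale K: field K by (rule field)

lemma delta: "\<delta> \<in> zero_locus \<XX> e" "\<delta> \<in> points \<XX>" "Sp \<XX> closure_of {\<delta>} = zero_locus \<XX> e"
  using generic_point[OF e_irreducible zero_locus_closed[OF e]] .

lemma points_ne: "points \<XX> \<noteq> {}" using delta(2) by blast

lemma e_nonzero: "e \<noteq> \<zero>\<^bsub>glob \<XX>\<^esub>"
proof
  assume "e = \<zero>\<^bsub>glob \<XX>\<^esub>"
  then have "zero_locus \<XX> e = points \<XX>"
    unfolding zero_locus_def using germ_zero[OF openin_points] zero_not_unit by auto
  then show False using e_proper by simp
qed

lemma eR: assumes "openin (Sp \<XX>) U" "U \<noteq> {}" shows "eR U \<in> carrier (Sec \<XX> U)" "eR U \<noteq> \<zero>\<^bsub>Sec \<XX> U\<^esub>"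
proof -
  have sub: "U \<subseteq> points \<XX>" by (rule openin_subset[OF assms(1)])
  show "eR U \<in> carrier (Sec \<XX> U)" by (rule res_closed[OF openin_points assms(1) sub e])
  have z: "\<zero>\<^bsub>glob \<XX>\<^esub> \<in> carrier (glob \<XX>)" by (rule cring.cring_simprules(2)[OF sec_cring[OF openin_points]])
  have "Res \<XX> (points \<XX>) U \<zero>\<^bsub>glob \<XX>\<^esub> = \<zero>\<^bsub>Sec \<XX> U\<^esub>"
    by (rule ring_hom_zero[OF res_hom[OF openin_points assms(1) sub] sec_ring[OF openin_points] sec_ring[OF assms(1)]])
  then show "eR U \<noteq> \<zero>\<^bsub>Sec \<XX> U\<^esub>"
    using res_inj[OF openin_points assms(1) sub assms(2) e z] e_nonzero by metis
qed

lemma noetherian_nbhd: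
  assumes "x \<in> points \<XX>"
  obtains U \<pi> where "affine_chart \<XX> U \<pi>" "x \<in> U" "noetherian_domain (Sec \<XX> U)"
proof -
  obtain U where U: "affine_open \<XX> U" "x \<in> U" "noetherian_ring (Sec \<XX> U)"
    using noetherian assms unfolding noetherian_scheme_def by blast
  obtain \<pi> where pi: "affine_chart \<XX> U \<pi>" using affine_openE[OF U(1)] .
  then have "openin (Sp \<XX>) U" using affine_chart.U_open by blast
  then have "noetherian_domain (Sec \<XX> U)" using sec_domain U(2,3) by (intro noetherian_domain.intro) auto
  then show ?thesis using that pi U(2) by blast
qed

lemma chart_zero_locus:
  assumes "affine_chart \<XX> U \<pi>" "x \<in> U"
  shows "x \<in> zero_locus \<XX> e \<longleftrightarrow> eR U \<in> \<pi> x"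
proof -
  interpret U: affine_chart \<XX> U \<pi> by (rule assms(1))
  have sub: "U \<subseteq> points \<XX>" by (rule openin_subset[OF U.U_open])
  have ne: "U \<noteq> {}" using assms(2) by blast
  show ?thesis
    unfolding zero_locus_def
    using germ_res[OF openin_points U.U_open sub assms(2) e] U.germ_unit_iff[OF assms(2) eR(1)[OF U.U_open ne]]
      assms(2) sub by auto
qed

text \<open>
  The prime ideal associated with a section \<open>f\<close> that \<open>e\<close> does not divide has height one and
  contains \<open>e\<close>, so it is the generic point of the zero locus of \<open>e\<close>.
\<close>

lemma non_divisible:
  assumes U: "affine_chart \<XX> U \<pi>" and noeth: "noetherian_domain (Sec \<XX> U)" and ne: "U \<noteq> {}"
    and f: "f \<in> carrier (Sec \<XX> U)" and nd: "\<not> (\<exists>q\<in>carrier (Sec \<XX> U). f = q \<otimes>\<^bsub>Sec \<XX> U\<^esub> eR U)"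
  obtains c u where "\<delta> \<in> U" "c \<in> \<pi> \<delta>" "u \<in> carrier (Sec \<XX> U) - \<pi> \<delta>"
    "\<forall>b\<in>\<pi> \<delta>. \<exists>v\<in>carrier (Sec \<XX> U). u \<otimes>\<^bsub>Sec \<XX> U\<^esub> b = v \<otimes>\<^bsub>Sec \<XX> U\<^esub> c"
    "\<forall>s\<in>carrier (Sec \<XX> U). (\<exists>q\<in>carrier (Sec \<XX> U). s \<otimes>\<^bsub>Sec \<XX> U\<^esub> f = q \<otimes>\<^bsub>Sec \<XX> U\<^esub> eR U) \<longrightarrow> s \<in> \<pi> \<delta>"
proof -
  interpret U: affine_chart \<XX> U \<pi> by (rule U)
  have eR': "eR U \<in> carrier U.A" "eR U \<noteq> \<zero>\<^bsub>U.A\<^esub>" using eR[OF U.U_open ne] by auto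
  obtain P c u where P: "primeideal P U.A" "eR U \<in> P"
    and ann: "\<forall>s\<in>carrier U.A. (\<exists>q\<in>carrier U.A. s \<otimes>\<^bsub>U.A\<^esub> f = q \<otimes>\<^bsub>U.A\<^esub> eR U) \<longrightarrow> s \<in> P"
    and min: "\<forall>p. primeideal p U.A \<and> p \<subseteq> P \<and> eR U \<in> p \<longrightarrow> p = P"
    and c: "c \<in> P" and u: "u \<in> carrier U.A - P"
    and gen: "\<forall>b\<in>P. \<exists>v\<in>carrier U.A. u \<otimes>\<^bsub>U.A\<^esub> b = v \<otimes>\<^bsub>U.A\<^esub> c"
    by (rule associated_prime_height_one[OF noeth _ eR' f nd]) (rule locally_integrally_closed[OF U _ eR'], assumption+)
  obtain z where z: "z \<in> U" "\<pi> z = P" using U.pi_surj[OF P(1)] .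
  have "z \<in> zero_locus \<XX> e" using chart_zero_locus[OF U z(1)] z(2) P(2) by simp
  then have zc: "z \<in> Sp \<XX> closure_of {\<delta>}" using delta(3) by simp
  then have dU: "\<delta> \<in> U" using z(1) U.U_open unfolding in_closure_of by blast
  have "\<pi> \<delta> \<subseteq> P" using U.closure_iff[OF z(1) dU] zc z(2) by simp
  moreover have "eR U \<in> \<pi> \<delta>" using chart_zero_locus[OF U dU] delta(1) by simp
  ultimately have "\<pi> \<delta> = P" using min U.pi_prime[OF dU] by blast
  then show ?thesis using that[OF dU] c u gen ann by blast
qed

text \<open>
  On a noetherian chart where \<open>e\<close> did not divide \<open>f\<close>, the obstruction would be supported at \<open>\<delta>\<close> by
  \<open>non_divisible\<close>, but there \<open>f\<close> is a multiple of \<open>e\<close>. The quotients on the charts are unique, because \<open>e\<close> is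
  nonzero, and so they glue.
\<close>

lemma divisible_if_locally:
  assumes f: "f \<in> carrier (glob \<XX>)"
    and g: "g \<in> carrier (stalk \<XX> \<delta>)" "germ \<XX> \<delta> (points \<XX>) f = g \<otimes>\<^bsub>stalk \<XX> \<delta>\<^esub> germ \<XX> \<delta> (points \<XX>) e"
  shows "\<exists>h\<in>carrier (glob \<XX>). f = h \<otimes>\<^bsub>glob \<XX>\<^esub> e"
proof -
  let ?fR = "\<lambda>U. Res \<XX> (points \<XX>) U f"
  define \<U> where "\<U> = {U. openin (Sp \<XX>) U \<and> U \<noteq> {} \<and> (\<exists>q\<in>carrier (Sec \<XX> U). ?fR U = q \<otimes>\<^bsub>Sec \<XX> U\<^esub> eR U)}"
  have "x \<in> \<Union>\<U>" if x: "x \<in> points \<XX>" for x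
  proof -
    obtain U \<pi> where U: "affine_chart \<XX> U \<pi>" "x \<in> U" "noetherian_domain (Sec \<XX> U)" using noetherian_nbhd[OF x] .
    interpret U: affine_chart \<XX> U \<pi> by (rule U(1))
    have ne: "U \<noteq> {}" using U(2) by blast
    have sub: "U \<subseteq> points \<XX>" by (rule openin_subset[OF U.U_open])
    have fc: "?fR U \<in> carrier U.A" by (rule res_closed[OF openin_points U.U_open sub f])
    have ec: "eR U \<in> carrier U.A" by (rule eR(1)[OF U.U_open ne])
    have "\<exists>q\<in>carrier U.A. ?fR U = q \<otimes>\<^bsub>U.A\<^esub> eR U"
    proof (rule ccontr)
      assume nd: "\<not> (\<exists>q\<in>carrier U.A. ?fR U = q \<otimes>\<^bsub>U.A\<^esub> eR U)"
      obtain c u where d: "\<delta> \<in> U"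
        and ann: "\<forall>s\<in>carrier U.A. (\<exists>q\<in>carrier U.A. s \<otimes>\<^bsub>U.A\<^esub> ?fR U = q \<otimes>\<^bsub>U.A\<^esub> eR U) \<longrightarrow> s \<in> \<pi> \<delta>"
        by (rule non_divisible[OF U(1,3) ne fc nd])
      let ?S = "stalk \<XX> \<delta>" and ?g = "germ \<XX> \<delta> U"
      interpret S: cring ?S by (rule stalk_cring[OF delta(2)])
      have h: "?g \<in> ring_hom U.A ?S" by (rule germ_hom[OF U.U_open d])
      obtain a s where a: "a \<in> carrier U.A" and s: "s \<in> carrier U.A - \<pi> \<delta>" and gs: "g \<otimes>\<^bsub>?S\<^esub> ?g s = ?g a"
        by (rule U.stalk_fraction[OF d g(1)])
      have sc: "s \<in> carrier U.A" using s by blast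
      have fg: "?g (?fR U) = g \<otimes>\<^bsub>?S\<^esub> ?g (eR U)"
        using g(2) germ_res[OF openin_points U.U_open sub d f] germ_res[OF openin_points U.U_open sub d e] by simp
      have "?g (s \<otimes>\<^bsub>U.A\<^esub> ?fR U) = (g \<otimes>\<^bsub>?S\<^esub> ?g s) \<otimes>\<^bsub>?S\<^esub> ?g (eR U)"
        unfolding ring_hom_mult[OF h sc fc] fg
        using g(1) ring_hom_closed[OF h sc] ring_hom_closed[OF h ec] by (simp add: S.m_ac)
      also have "\<dots> = ?g (a \<otimes>\<^bsub>U.A\<^esub> eR U)" unfolding gs ring_hom_mult[OF h a ec] ..
      finally have "s \<otimes>\<^bsub>U.A\<^esub> ?fR U = a \<otimes>\<^bsub>U.A\<^esub> eR U"
        by (rule germ_inj_chart[OF U(1) d U.A.m_closed[OF sc fc] U.A.m_closed[OF a ec]])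
      then show False using ann sc a s by blast
    qed
    then show ?thesis unfolding \<U>_def using U.U_open U(2) by blast
  qed
  then have cover: "\<Union>\<U> = points \<XX>" unfolding \<U>_def using openin_subset by blast
  define q where "q U = (SOME q. q \<in> carrier (Sec \<XX> U) \<and> ?fR U = q \<otimes>\<^bsub>Sec \<XX> U\<^esub> eR U)" for U
  have \<U>: "openin (Sp \<XX>) U" "U \<noteq> {}" if "U \<in> \<U>" for U using that unfolding \<U>_def by auto
  have q: "q U \<in> carrier (Sec \<XX> U) \<and> ?fR U = q U \<otimes>\<^bsub>Sec \<XX> U\<^esub> eR U" if "U \<in> \<U>" for U
    unfolding q_def by (rule someI_ex) (use that in \<open>auto simp: \<U>_def\<close>)
  \<comment> \<open>on overlaps the quotients agree after multiplication by \<open>e\<close>, which can be cancelled in a domain\<close>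
  have "\<exists>!t. t \<in> carrier (Sec \<XX> (\<Union>\<U>)) \<and> (\<forall>V\<in>\<U>. Res \<XX> (\<Union>\<U>) V t = q V)"
  proof (rule sheaf_glue)
    show "openin (Sp \<XX>) V" if "V \<in> \<U>" for V using \<U> that by blast
    show "q V \<in> carrier (Sec \<XX> V)" if "V \<in> \<U>" for V using q that by blast
    fix V W assume V: "V \<in> \<U>" and W: "W \<in> \<U>"
    let ?N = "V \<inter> W"
    have o: "openin (Sp \<XX>) ?N" using \<U> V W by blast
    have ne: "?N \<noteq> {}" by (rule opens_meet[OF \<U>(1)[OF V] \<U>(1)[OF W] \<U>(2)[OF V] \<U>(2)[OF W]])
    interpret N: "domain" "Sec \<XX> ?N" by (rule sec_domain[OF o ne])
    have *: "Res \<XX> (points \<XX>) ?N f = Res \<XX> U ?N (q U) \<otimes>\<^bsub>Sec \<XX> ?N\<^esub> eR ?N \<and> Res \<XX> U ?N (q U) \<in> carrier (Sec \<XX> ?N)"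
      if U: "U \<in> \<U>" and sub: "?N \<subseteq> U" for U
    proof -
      have oU: "openin (Sp \<XX>) U" "U \<subseteq> points \<XX>" "U \<noteq> {}" using \<U>[OF U] openin_subset by auto
      have h: "Res \<XX> U ?N \<in> ring_hom (Sec \<XX> U) (Sec \<XX> ?N)" by (rule res_hom[OF oU(1) o sub])
      have "Res \<XX> U ?N (?fR U) = Res \<XX> U ?N (q U) \<otimes>\<^bsub>Sec \<XX> ?N\<^esub> Res \<XX> U ?N (eR U)"
        using ring_hom_mult[OF h, of "q U" "eR U"] q[OF U] eR(1)[OF oU(1,3)] by simp
      then show ?thesis
        using res_res[OF openin_points oU(1) o sub oU(2) f] res_res[OF openin_points oU(1) o sub oU(2) e]
          ring_hom_closed[OF h] q[OF U] by simp
    qed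
    show "Res \<XX> V ?N (q V) = Res \<XX> W ?N (q W)"
      using *[OF V] *[OF W] N.m_rcancel[OF eR(2)[OF o ne] eR(1)[OF o ne]] by auto
  qed
  then obtain t where t: "t \<in> carrier (glob \<XX>)" "\<forall>V\<in>\<U>. Res \<XX> (points \<XX>) V t = q V" unfolding cover by blast
  obtain U where U: "U \<in> \<U>" using cover points_ne by blast
  have oU: "openin (Sp \<XX>) U" "U \<subseteq> points \<XX>" "U \<noteq> {}" using \<U>[OF U] openin_subset by auto
  interpret G: cring "glob \<XX>" by (rule sec_cring[OF openin_points])
  have h: "Res \<XX> (points \<XX>) U \<in> ring_hom (glob \<XX>) (Sec \<XX> U)" by (rule res_hom[OF openin_points oU(1,2)])
  have "?fR U = Res \<XX> (points \<XX>) U (t \<otimes>\<^bsub>glob \<XX>\<^esub> e)"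
    unfolding ring_hom_mult[OF h t(1) e] using t(2) U q[OF U] by simp
  then have "f = t \<otimes>\<^bsub>glob \<XX>\<^esub> e"
    by (rule res_inj[OF openin_points oU f G.m_closed[OF t(1) e]])
  then show ?thesis using t(1) by blast
qed

text \<open>
  As \<open>e\<close> vanishes at \<open>\<delta>\<close>, it does not divide \<open>1\<close> on a chart around \<open>\<delta>\<close>; \<open>non_divisible\<close> for the section \<open>1\<close> yields
  the generator \<open>c\<close> of the maximal ideal at \<open>\<delta>\<close>.
\<close>

lemma dvr_chart:
  obtains U \<pi> c u where "affine_chart \<XX> U \<pi>" "\<delta> \<in> U"
    "localized_dvr (Sec \<XX> U) K (ff_germ \<XX> U) (\<pi> \<delta>) c u"
proof -
  obtain U \<pi> where U: "affine_chart \<XX> U \<pi>" "\<delta> \<in> U" "noetherian_domain (Sec \<XX> U)" using noetherian_nbhd[OF delta(2)] .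
  interpret U: affine_chart \<XX> U \<pi> by (rule U(1))
  interpret A: noetherian_domain U.A by (rule U(3))
  have ne: "U \<noteq> {}" using U(2) by blast
  interpret p: primeideal "\<pi> \<delta>" U.A by (rule U.pi_prime[OF U(2)])
  have ep: "eR U \<in> \<pi> \<delta>" using chart_zero_locus[OF U(1,2)] delta(1) by simp
  have nd: "\<not> (\<exists>q\<in>carrier U.A. \<one>\<^bsub>U.A\<^esub> = q \<otimes>\<^bsub>U.A\<^esub> eR U)"
  proof
    assume "\<exists>q\<in>carrier U.A. \<one>\<^bsub>U.A\<^esub> = q \<otimes>\<^bsub>U.A\<^esub> eR U"
    then have "\<one>\<^bsub>U.A\<^esub> \<in> \<pi> \<delta>" using p.I_l_closed[OF ep] by auto
    then show False using p.one_imp_carrier p.I_notcarr by simp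
  qed
  obtain c u where c: "c \<in> \<pi> \<delta>" and u: "u \<in> carrier U.A - \<pi> \<delta>"
    and gen: "\<forall>b\<in>\<pi> \<delta>. \<exists>v\<in>carrier U.A. u \<otimes>\<^bsub>U.A\<^esub> b = v \<otimes>\<^bsub>U.A\<^esub> c"
    by (rule non_divisible[OF U(1,3) ne U.A.one_closed nd])
  have eU: "\<eta> \<in> U" by (rule generic_in[OF U.U_open ne])
  have "localized_dvr U.A K (ff_germ \<XX> U) (\<pi> \<delta>) c u"
  proof (intro localized_dvr.intro localized_dvr_axioms.intro)
    show "noetherian_domain U.A" by (rule U(3))
    show "field K" by (rule field)
    show "ff_germ \<XX> U \<in> ring_hom U.A K" by (rule ff_hom[OF U.U_open ne])
    show "a = \<zero>\<^bsub>U.A\<^esub>" if "a \<in> carrier U.A" "ff_germ \<XX> U a = \<zero>\<^bsub>K\<^esub>" for a using ff_zero[OF U.U_open ne that] .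
    show "primeideal (\<pi> \<delta>) U.A" by (rule U.pi_prime[OF U(2)])
    show "c \<in> \<pi> \<delta>" by (rule c)
    show "c \<noteq> \<zero>\<^bsub>U.A\<^esub>"
    proof
      assume c0: "c = \<zero>\<^bsub>U.A\<^esub>"
      obtain v where v: "v \<in> carrier U.A" "u \<otimes>\<^bsub>U.A\<^esub> eR U = v \<otimes>\<^bsub>U.A\<^esub> c" using gen ep by blast
      then have "u \<otimes>\<^bsub>U.A\<^esub> eR U = \<zero>\<^bsub>U.A\<^esub>" using c0 by simp
      moreover have "u \<noteq> \<zero>\<^bsub>U.A\<^esub>" using u by auto
      ultimately show False using A.integral u eR[OF U.U_open ne] by blast
    qed
    show "u \<in> carrier U.A - \<pi> \<delta>" by (rule u)
    show "\<exists>v\<in>carrier U.A. u \<otimes>\<^bsub>U.A\<^esub> b = v \<otimes>\<^bsub>U.A\<^esub> c" if "b \<in> \<pi> \<delta>" for b using gen that by blast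
    fix k assume "k \<in> carrier K"
    then have k: "k \<in> carrier (stalk \<XX> \<eta>)" unfolding function_field_def .
    interpret n: primeideal "\<pi> \<eta>" U.A by (rule U.pi_prime[OF eU])
    obtain a s where "a \<in> carrier U.A" "s \<in> carrier U.A - \<pi> \<eta>" "k \<otimes>\<^bsub>stalk \<XX> \<eta>\<^esub> germ \<XX> \<eta> U s = germ \<XX> \<eta> U a"
      by (rule U.stalk_fraction[OF eU k])
    then show "\<exists>a\<in>carrier U.A. \<exists>b\<in>carrier U.A - {\<zero>\<^bsub>U.A\<^esub>}. k \<otimes>\<^bsub>K\<^esub> ff_germ \<XX> U b = ff_germ \<XX> U a"
      unfolding function_field_def using n.zero_closed by blast
  qed
  then show ?thesis using that U(1,2) by blast
qed

lemma local_subring_eq: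
  assumes U: "affine_chart \<XX> U \<pi>" "\<delta> \<in> U" and L: "localized_dvr (Sec \<XX> U) K (ff_germ \<XX> U) (\<pi> \<delta>) c u"
  shows "local_subring \<XX> \<delta> = localized_dvr.L (Sec \<XX> U) K (ff_germ \<XX> U) (\<pi> \<delta>)"
proof -
  interpret U: affine_chart \<XX> U \<pi> by (rule U(1))
  interpret L: localized_dvr U.A K "ff_germ \<XX> U" "\<pi> \<delta>" c u by (rule L)
  have ne: "U \<noteq> {}" using U(2) by blast
  have eU: "\<eta> \<in> U" by (rule generic_in[OF U.U_open ne])
  have sub: "\<pi> \<eta> \<subseteq> \<pi> \<delta>" using U.closure_iff[OF U(2) eU] closure_eta delta(2) by blast
  have "{ff_germ \<XX> W s | W s. openin (Sp \<XX>) W \<and> \<delta> \<in> W \<and> s \<in> carrier (Sec \<XX> W)} = L.LC"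
  proof (intro equalityI subsetI)
    fix k assume "k \<in> {ff_germ \<XX> W s | W s. openin (Sp \<XX>) W \<and> \<delta> \<in> W \<and> s \<in> carrier (Sec \<XX> W)}"
    then obtain W t where k: "k = ff_germ \<XX> W t" and W: "openin (Sp \<XX>) W" "\<delta> \<in> W" "t \<in> carrier (Sec \<XX> W)" by blast
    obtain a s where a: "a \<in> carrier U.A" and s: "s \<in> carrier U.A - \<pi> \<delta>"
      and fr: "\<And>y. y \<in> U \<Longrightarrow> s \<notin> \<pi> y \<Longrightarrow> y \<in> W \<and> germ \<XX> y W t \<otimes>\<^bsub>stalk \<XX> y\<^esub> germ \<XX> y U s = germ \<XX> y U a"
      using U.section_fraction[OF W(1,2) U(2) W(3)] by blast
    have "s \<notin> \<pi> \<eta>" using s sub by blast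
    from fr[OF eU this] have "k \<otimes>\<^bsub>K\<^esub> ff_germ \<XX> U s = ff_germ \<XX> U a" unfolding k function_field_def by blast
    moreover have "k \<in> carrier K" unfolding k
      using ring_hom_closed[OF ff_hom[OF W(1)] W(3)] W(2) by blast
    ultimately show "k \<in> L.LC" unfolding L.LC_def using a s by blast
  next
    fix k assume "k \<in> L.LC"
    then obtain a s where k: "k \<in> carrier K" and a: "a \<in> carrier U.A" and s: "s \<in> carrier U.A - \<pi> \<delta>"
      and e: "k \<otimes>\<^bsub>K\<^esub> ff_germ \<XX> U s = ff_germ \<XX> U a" unfolding L.LC_def by blast
    have sc: "s \<in> carrier U.A" using s by blast
    let ?D = "U.Dist s" and ?h = "Res \<XX> U (U.Dist s)"
    have o: "openin (Sp \<XX>) ?D" by (rule U.Dist_open[OF sc])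
    have dD: "\<delta> \<in> ?D" using U(2) s by blast
    have Dne: "?D \<noteq> {}" using dD by blast
    interpret S: cring "Sec \<XX> ?D" by (rule sec_cring[OF o])
    have h: "?h \<in> ring_hom U.A (Sec \<XX> ?D)" by (rule U.Dist_hom[OF sc])
    have "?h (s [^]\<^bsub>U.A\<^esub> (1::nat)) \<in> Units (Sec \<XX> ?D)" by (rule U.Dist_unit[OF sc])
    then have un: "?h s \<in> Units (Sec \<XX> ?D)" using sc by simp
    let ?t = "?h a \<otimes>\<^bsub>Sec \<XX> ?D\<^esub> inv\<^bsub>Sec \<XX> ?D\<^esub> (?h s)"
    have hc: "?h a \<in> carrier (Sec \<XX> ?D)" "?h s \<in> carrier (Sec \<XX> ?D)" "inv\<^bsub>Sec \<XX> ?D\<^esub> (?h s) \<in> carrier (Sec \<XX> ?D)"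
      using ring_hom_closed[OF h] a sc S.Units_inv_closed[OF un] by auto
    have tc: "?t \<in> carrier (Sec \<XX> ?D)" by (rule S.m_closed[OF hc(1,3)])
    have ts: "?t \<otimes>\<^bsub>Sec \<XX> ?D\<^esub> ?h s = ?h a"
      using S.m_assoc[OF hc(1,3,2)] S.Units_l_inv[OF un] hc by simp
    have fh: "ff_germ \<XX> ?D \<in> ring_hom (Sec \<XX> ?D) K" by (rule ff_hom[OF o Dne])
    have "ff_germ \<XX> ?D ?t \<otimes>\<^bsub>K\<^esub> ff_germ \<XX> U s = ff_germ \<XX> U a"
      using ring_hom_mult[OF fh tc hc(2)] ff_res[OF U.U_open o U.Dist_subset Dne sc] ff_res[OF U.U_open o U.Dist_subset Dne a] ts
      by simp
    moreover have "ff_germ \<XX> U s \<noteq> \<zero>\<^bsub>K\<^esub>"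
      using L.g_inj[OF sc] s L.p.zero_closed by blast
    ultimately have "k = ff_germ \<XX> ?D ?t"
      using K.m_rcancel[of "ff_germ \<XX> U s" k "ff_germ \<XX> ?D ?t"] e k ring_hom_closed[OF fh tc] L.g_closed[OF sc] by simp
    then show "k \<in> {ff_germ \<XX> W s | W s. openin (Sp \<XX>) W \<and> \<delta> \<in> W \<and> s \<in> carrier (Sec \<XX> W)}"
      using o dD tc by blast
  qed
  then show ?thesis unfolding local_subring_def L.L_def by simp
qed

lemma valuation_eq:
  assumes "affine_chart \<XX> U \<pi>" "\<delta> \<in> U" "localized_dvr (Sec \<XX> U) K (ff_germ \<XX> U) (\<pi> \<delta>) c u"
  shows "valuation_at \<XX> \<delta> f = localized_dvr.val (Sec \<XX> U) K (ff_germ \<XX> U) (\<pi> \<delta>) f"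
  unfolding valuation_at_def localized_dvr.val_def[OF assms(3)] local_subring_eq[OF assms] ..

lemma valuation_mult:
  assumes "f \<in> Units K" "h \<in> Units K"
  shows "valuation_at \<XX> \<delta> (f \<otimes>\<^bsub>K\<^esub> h) = valuation_at \<XX> \<delta> f + valuation_at \<XX> \<delta> h"
proof -
  obtain U \<pi> c u where U: "affine_chart \<XX> U \<pi>" "\<delta> \<in> U" "localized_dvr (Sec \<XX> U) K (ff_germ \<XX> U) (\<pi> \<delta>) c u"
    using dvr_chart .
  show ?thesis unfolding valuation_eq[OF U] by (rule localized_dvr.val_mult[OF U(3) assms])
qed

lemma valuation_int_pow:
  assumes "f \<in> Units K"
  shows "valuation_at \<XX> \<delta> (f [^]\<^bsub>K\<^esub> (n::int)) = n * valuation_at \<XX> \<delta> f"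
proof -
  obtain U \<pi> c u where U: "affine_chart \<XX> U \<pi>" "\<delta> \<in> U" "localized_dvr (Sec \<XX> U) K (ff_germ \<XX> U) (\<pi> \<delta>) c u"
    using dvr_chart .
  show ?thesis unfolding valuation_eq[OF U] by (rule localized_dvr.val_int_pow[OF U(3) assms])
qed

text \<open>
  At \<open>\<delta>\<close>, the function \<open>f\<close> is a unit times \<open>c ^ n\<close> and \<open>e\<close> is a unit times \<open>c\<close>. If \<open>n\<close> is positive, \<open>e\<close> divides \<open>f\<close>
  in the local ring at \<open>\<delta>\<close>, and then globally by \<open>divisible_if_locally\<close>.
\<close>

lemma valuation_regular:
  assumes f: "f \<in> carrier (glob \<XX>)" "f \<noteq> \<zero>\<^bsub>glob \<XX>\<^esub>" and e1: "valuation_at \<XX> \<delta> (ff_of \<XX> e) = 1"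
  shows "valuation_at \<XX> \<delta> (ff_of \<XX> f) = 0 \<or> (\<exists>h\<in>carrier (glob \<XX>). f = h \<otimes>\<^bsub>glob \<XX>\<^esub> e)"
proof -
  obtain U \<pi> c u where U: "affine_chart \<XX> U \<pi>" "\<delta> \<in> U" "localized_dvr (Sec \<XX> U) K (ff_germ \<XX> U) (\<pi> \<delta>) c u"
    using dvr_chart .
  interpret U: affine_chart \<XX> U \<pi> by (rule U(1))
  interpret L: localized_dvr U.A K "ff_germ \<XX> U" "\<pi> \<delta>" c u by (rule U(3))
  have ne: "U \<noteq> {}" using U(2) by blast
  have sub: "U \<subseteq> points \<XX>" by (rule openin_subset[OF U.U_open])
  let ?a = "Res \<XX> (points \<XX>) U f"
  have a: "?a \<in> carrier U.A" by (rule res_closed[OF openin_points U.U_open sub f(1)])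
  have z: "\<zero>\<^bsub>glob \<XX>\<^esub> \<in> carrier (glob \<XX>)" by (rule cring.cring_simprules(2)[OF sec_cring[OF openin_points]])
  have "Res \<XX> (points \<XX>) U \<zero>\<^bsub>glob \<XX>\<^esub> = \<zero>\<^bsub>U.A\<^esub>"
    by (rule ring_hom_zero[OF res_hom[OF openin_points U.U_open sub] sec_ring[OF openin_points] sec_ring[OF U.U_open]])
  then have a0: "?a \<noteq> \<zero>\<^bsub>U.A\<^esub>"
    using res_inj[OF openin_points U.U_open sub ne f(1) z] f(2) by metis
  have ffa: "ff_germ \<XX> U ?a = ff_of \<XX> f" "ff_germ \<XX> U (eR U) = ff_of \<XX> e"
    using ff_res[OF openin_points U.U_open sub ne] f e by auto
  have ec: "eR U \<in> carrier U.A" by (rule eR(1)[OF U.U_open ne])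
  obtain n :: nat and s t where st: "s \<in> carrier U.A - \<pi> \<delta>" "t \<in> carrier U.A - \<pi> \<delta>"
    "s \<otimes>\<^bsub>U.A\<^esub> ?a = t \<otimes>\<^bsub>U.A\<^esub> c [^]\<^bsub>U.A\<^esub> n" and n: "L.val (ff_germ \<XX> U ?a) = int n"
    by (rule L.factor_A[OF a a0])
  obtain m :: nat and s' t' where st': "s' \<in> carrier U.A - \<pi> \<delta>" "t' \<in> carrier U.A - \<pi> \<delta>"
    "s' \<otimes>\<^bsub>U.A\<^esub> eR U = t' \<otimes>\<^bsub>U.A\<^esub> c [^]\<^bsub>U.A\<^esub> m" and m: "L.val (ff_germ \<XX> U (eR U)) = int m"
    by (rule L.factor_A[OF eR[OF U.U_open ne]])
  have m1: "m = 1" using m e1 valuation_eq[OF U, of "ff_of \<XX> e"] ffa by simp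
  show ?thesis
  proof (cases n)
    case 0
    then show ?thesis using n valuation_eq[OF U, of "ff_of \<XX> f"] ffa by simp
  next
    case (Suc k)
    have C: "s \<in> carrier U.A" "t \<in> carrier U.A" "s' \<in> carrier U.A" "t' \<in> carrier U.A" "c \<in> carrier U.A"
      using st st' L.cA by auto
    let ?q = "(t \<otimes>\<^bsub>U.A\<^esub> s') \<otimes>\<^bsub>U.A\<^esub> c [^]\<^bsub>U.A\<^esub> k" and ?w = "s \<otimes>\<^bsub>U.A\<^esub> t'"
    have "?w \<otimes>\<^bsub>U.A\<^esub> ?a = t' \<otimes>\<^bsub>U.A\<^esub> (s \<otimes>\<^bsub>U.A\<^esub> ?a)" using C a by (simp add: U.A.m_ac)
    also have "\<dots> = (t \<otimes>\<^bsub>U.A\<^esub> c [^]\<^bsub>U.A\<^esub> k) \<otimes>\<^bsub>U.A\<^esub> (t' \<otimes>\<^bsub>U.A\<^esub> c [^]\<^bsub>U.A\<^esub> m)"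
      unfolding st(3) Suc m1 using C by (simp add: U.A.m_ac)
    also have "\<dots> = ?q \<otimes>\<^bsub>U.A\<^esub> eR U" unfolding st'(3)[symmetric] using C ec by (simp add: U.A.m_ac)
    finally have wq: "?w \<otimes>\<^bsub>U.A\<^esub> ?a = ?q \<otimes>\<^bsub>U.A\<^esub> eR U" .
    have w: "?w \<in> carrier U.A - \<pi> \<delta>" using L.notp_mult[OF st(1) st'(2)] .
    have qc: "?q \<in> carrier U.A" using C by simp
    let ?S = "stalk \<XX> \<delta>" and ?g = "germ \<XX> \<delta> U"
    interpret S: cring ?S by (rule stalk_cring[OF delta(2)])
    have h: "?g \<in> ring_hom U.A ?S" by (rule germ_hom[OF U.U_open U(2)])
    have wc: "?w \<in> carrier U.A" using w by blast
    have un: "?g ?w \<in> Units ?S" using U.germ_unit_iff[OF U(2) wc] w by blast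
    have hq: "?g ?q \<in> carrier ?S" "?g ?a \<in> carrier ?S" "?g (eR U) \<in> carrier ?S" "?g ?w \<in> carrier ?S" "inv\<^bsub>?S\<^esub> (?g ?w) \<in> carrier ?S"
      using ring_hom_closed[OF h] qc a ec wc S.Units_inv_closed[OF un] by auto
    have E: "?g ?w \<otimes>\<^bsub>?S\<^esub> ?g ?a = ?g ?q \<otimes>\<^bsub>?S\<^esub> ?g (eR U)"
      using ring_hom_mult[OF h wc a] ring_hom_mult[OF h qc ec] wq by simp
    let ?k = "inv\<^bsub>?S\<^esub> (?g ?w) \<otimes>\<^bsub>?S\<^esub> ?g ?q"
    have "?g ?a = inv\<^bsub>?S\<^esub> (?g ?w) \<otimes>\<^bsub>?S\<^esub> (?g ?w \<otimes>\<^bsub>?S\<^esub> ?g ?a)"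
      using S.m_assoc[OF hq(5,4,2)] S.Units_l_inv[OF un] hq(2) by simp
    also have "\<dots> = ?k \<otimes>\<^bsub>?S\<^esub> ?g (eR U)" unfolding E by (rule S.m_assoc[symmetric, OF hq(5,1,3)])
    finally have "germ \<XX> \<delta> (points \<XX>) f = ?k \<otimes>\<^bsub>?S\<^esub> germ \<XX> \<delta> (points \<XX>) e"
      using germ_res[OF openin_points U.U_open sub U(2) f(1)] germ_res[OF openin_points U.U_open sub U(2) e] by simp
    moreover have "?k \<in> carrier ?S" using hq by simp
    ultimately show ?thesis using divisible_if_locally[OF f(1)] by blast
  qed
qed

end

section \<open>Laurent monomials\<close>

text \<open>
  The constant \<open>monomial\<close> is typed for plain ring records; this is \<open>cring\<close> at that type.
\<close>

locale plain_cring = cring R for R :: "'a ring" (structure)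
begin

lemma monomial_unit: "v \<in> I \<rightarrow> Units R \<Longrightarrow> monomial R I v m \<in> Units R"
  unfolding monomial_def
proof (induction I rule: infinite_finite_induct)
  case (insert i I)
  have "(\<lambda>i. v i [^] m i) \<in> I \<rightarrow> carrier R" "v i [^] m i \<in> carrier R"
    using insert.prems Units_closed[OF unit_int_pow_closed] by (auto simp: Pi_def)
  then have "(\<Otimes>i\<in>insert i I. v i [^] m i) = v i [^] m i \<otimes> (\<Otimes>i\<in>I. v i [^] m i)"
    using insert.hyps by (intro finprod_insert)
  then show ?case using insert by (simp add: Pi_def)
qed simp_all

lemma monomial_power_closed: "v \<in> I \<rightarrow> Units R \<Longrightarrow> (\<lambda>i. v i [^] (m i::int)) \<in> I \<rightarrow> carrier R"
  using Units_closed[OF unit_int_pow_closed] by (auto simp: Pi_def)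

lemma monomial_add:
  assumes "v \<in> I \<rightarrow> Units R"
  shows "monomial R I v (\<lambda>i. m i + n i) = monomial R I v m \<otimes> monomial R I v n"
proof -
  have "monomial R I v (\<lambda>i. m i + n i) = (\<Otimes>i\<in>I. v i [^] m i \<otimes> v i [^] n i)"
    unfolding monomial_def
  proof (rule finprod_cong')
    show "(\<lambda>i. v i [^] m i \<otimes> v i [^] n i) \<in> I \<rightarrow> carrier R"
      using monomial_power_closed[OF assms, of m] monomial_power_closed[OF assms, of n] by (auto simp: Pi_def)
    show "v i [^] (m i + n i) = v i [^] m i \<otimes> v i [^] n i" if "i \<in> I" for i
      using unit_int_pow_add assms that by (auto simp: Pi_def)
  qed simp
  also have "\<dots> = monomial R I v m \<otimes> monomial R I v n"
    unfolding monomial_def by (rule finprod_multf[OF monomial_power_closed[OF assms] monomial_power_closed[OF assms]])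
  finally show ?thesis .
qed

lemma monomial_distrib:
  assumes "v \<in> I \<rightarrow> Units R" "w \<in> I \<rightarrow> Units R"
  shows "monomial R I (\<lambda>i. v i \<otimes> w i) m = monomial R I v m \<otimes> monomial R I w m"
proof -
  have "monomial R I (\<lambda>i. v i \<otimes> w i) m = (\<Otimes>i\<in>I. v i [^] m i \<otimes> w i [^] m i)"
    unfolding monomial_def
  proof (rule finprod_cong')
    show "(\<lambda>i. v i [^] m i \<otimes> w i [^] m i) \<in> I \<rightarrow> carrier R"
      using monomial_power_closed[OF assms(1), of m] monomial_power_closed[OF assms(2), of m] by (auto simp: Pi_def)
    show "(v i \<otimes> w i) [^] m i = v i [^] m i \<otimes> w i [^] m i" if "i \<in> I" for i
      using unit_int_pow_distrib assms that by (auto simp: Pi_def)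
  qed simp
  also have "\<dots> = monomial R I v m \<otimes> monomial R I w m"
    unfolding monomial_def by (rule finprod_multf[OF monomial_power_closed[OF assms(1)] monomial_power_closed[OF assms(2)]])
  finally show ?thesis .
qed

lemma monomial_cong:
  assumes "\<And>i. i \<in> I \<Longrightarrow> v i = w i" "\<And>i. i \<in> I \<Longrightarrow> m i = n i" "w \<in> I \<rightarrow> Units R"
  shows "monomial R I v m = monomial R I w n"
  unfolding monomial_def by (rule finprod_cong') (use assms monomial_power_closed[OF assms(3)] in auto)

lemma monomial_zero: "monomial R I v (\<lambda>i. 0) = \<one>"
  unfolding monomial_def by simp

lemma monomial_one: "monomial R I (\<lambda>i. \<one>) m = \<one>"
proof -
  have "\<one> [^] n = \<one>" for n :: int by (simp add: int_pow_def2 del: pow_nat)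
  then show ?thesis unfolding monomial_def by simp
qed

lemma monomial_power: "finite I \<Longrightarrow> d \<in> I \<Longrightarrow> v \<in> I \<rightarrow> carrier R \<Longrightarrow> monomial R I v (\<lambda>i. if i = d then 1 else 0) = v d"
proof -
  assume f: "finite I" and d: "d \<in> I" and v: "v \<in> I \<rightarrow> carrier R"
  have vd: "v d \<in> carrier R" using v d by blast
  have "monomial R I v (\<lambda>i. if i = d then 1 else 0) = (\<Otimes>i\<in>I. if d = i then v i else \<one>)"
    unfolding monomial_def by (rule finprod_cong') (use v vd int_pow_1 in \<open>auto simp: Pi_def\<close>)
  also have "\<dots> = v d" by (rule finprod_singleton[OF d f v])
  finally show ?thesis .
qed

lemma monomial_nonneg:
  assumes "\<And>i. i \<in> I \<Longrightarrow> 0 \<le> m i" "v \<in> I \<rightarrow> carrier R"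
  shows "monomial R I v m = (\<Otimes>i\<in>I. v i [^] nat (m i))" "monomial R I v m \<in> carrier R"
proof -
  have c: "(\<lambda>i. v i [^] nat (m i)) \<in> I \<rightarrow> carrier R" using assms(2) by (auto simp: Pi_def simp del: pow_nat)
  show e: "monomial R I v m = (\<Otimes>i\<in>I. v i [^] nat (m i))"
    unfolding monomial_def by (rule finprod_cong'[OF refl c]) (simp add: assms(1))
  show "monomial R I v m \<in> carrier R" unfolding e by (rule finprod_closed[OF c])
qed

lemma monomial_insert_nonneg:
  assumes "finite J" "i \<notin> J" "\<And>j. j \<in> insert i J \<Longrightarrow> 0 \<le> p j" "v \<in> insert i J \<rightarrow> carrier R"
  shows "monomial R (insert i J) v p = v i [^] nat (p i) \<otimes> monomial R J v p"
proof -
  have c: "(\<lambda>j. v j [^] nat (p j)) \<in> J \<rightarrow> carrier R" "v i [^] nat (p i) \<in> carrier R"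
    using assms(4) by (auto simp: Pi_def simp del: pow_nat)
  have e1: "monomial R (insert i J) v p = (\<Otimes>j\<in>insert i J. v j [^] nat (p j))"
    using assms(3,4) by (rule monomial_nonneg(1))
  have e2: "monomial R J v p = (\<Otimes>j\<in>J. v j [^] nat (p j))"
    by (rule monomial_nonneg(1)) (use assms(3,4) in auto)
  show ?thesis unfolding e1 e2 by (rule finprod_insert[OF assms(1,2) c])
qed

end

lemma ring_hom_finprod:
  assumes "h \<in> ring_hom R S" "cring R" "cring S" "f \<in> M \<rightarrow> carrier R"
  shows "h (\<Otimes>\<^bsub>R\<^esub>i\<in>M. f i) = (\<Otimes>\<^bsub>S\<^esub>i\<in>M. h (f i))"
proof -
  have "ring_hom_cring R S h"
    by (rule ring_hom_cring.intro[OF assms(2,3)]) (rule ring_hom_cring_axioms.intro[OF assms(1)])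
  from ring_hom_cring.hom_finprod[OF this assms(4)] show ?thesis by (simp add: o_def)
qed

lemma monomial_hom:
  assumes "h \<in> ring_hom R S" "cring R" "cring S" "v \<in> I \<rightarrow> Units R"
  shows "h (monomial R I v m) = monomial S I (\<lambda>i. h (v i)) m"
proof -
  interpret R: plain_cring R by (rule plain_cring.intro) fact
  interpret S: plain_cring S by (rule plain_cring.intro) fact
  have u: "(\<lambda>i. h (v i)) \<in> I \<rightarrow> Units S" using ring_hom_Units[OF assms(1)] assms(4) by blast
  show ?thesis
    unfolding monomial_def ring_hom_finprod[OF assms(1-3) R.monomial_power_closed[OF assms(4)]]
    by (rule S.finprod_cong'[OF refl S.monomial_power_closed[OF u]])
      (use ring_hom_int_pow[OF assms(1-3)] assms(4) in blast)
qed

lemma monomial_hom_nonneg: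
  assumes "h \<in> ring_hom R S" "cring R" "cring S" "v \<in> I \<rightarrow> carrier R" "\<And>i. i \<in> I \<Longrightarrow> 0 \<le> m i"
  shows "h (monomial R I v m) = monomial S I (\<lambda>i. h (v i)) m"
proof -
  interpret R: plain_cring R by (rule plain_cring.intro) fact
  interpret S: plain_cring S by (rule plain_cring.intro) fact
  have u: "(\<lambda>i. h (v i)) \<in> I \<rightarrow> carrier S" using ring_hom_closed[OF assms(1)] assms(4) by blast
  have c: "(\<lambda>i. v i [^]\<^bsub>R\<^esub> nat (m i)) \<in> I \<rightarrow> carrier R" using assms(4) by (auto simp: Pi_def simp del: pow_nat)
  have c': "(\<lambda>i. h (v i) [^]\<^bsub>S\<^esub> nat (m i)) \<in> I \<rightarrow> carrier S" using u by (auto simp: Pi_def simp del: pow_nat)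
  have e: "h (v i [^]\<^bsub>R\<^esub> nat (m i)) = h (v i) [^]\<^bsub>S\<^esub> nat (m i)" if "i \<in> I" for i
    by (rule ring_hom_nat_pow[OF assms(1) R.ring_axioms S.ring_axioms]) (use assms(4) that in blast)
  have "monomial R I v m = (\<Otimes>\<^bsub>R\<^esub>i\<in>I. v i [^]\<^bsub>R\<^esub> nat (m i))"
    using assms(5,4) by (rule R.monomial_nonneg(1))
  then have "h (monomial R I v m) = (\<Otimes>\<^bsub>S\<^esub>i\<in>I. h (v i [^]\<^bsub>R\<^esub> nat (m i)))"
    using ring_hom_finprod[OF assms(1-3) c] by (simp only:)
  also have "\<dots> = (\<Otimes>\<^bsub>S\<^esub>i\<in>I. h (v i) [^]\<^bsub>S\<^esub> nat (m i))"
    by (rule S.finprod_cong'[OF refl c']) (rule e)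
  also have "\<dots> = monomial S I (\<lambda>i. h (v i)) m"
    by (rule S.monomial_nonneg(1)[OF assms(5) u, symmetric])
  finally show ?thesis .
qed


section \<open>Morphisms\<close>

lemma mor_point:
  assumes "mor \<XX> Y f" "x \<in> points \<XX>" shows "pt f x \<in> points Y"
  using assms(1)[unfolded mor_def, THEN conjunct1] assms(2) unfolding continuous_map_def by blast

lemma mor_open:
  assumes "mor \<XX> Y f" "openin (Sp Y) V" shows "openin (Sp \<XX>) (preim \<XX> f V)"
  using openin_continuous_map_preimage[OF assms(1)[unfolded mor_def, THEN conjunct1] assms(2)] unfolding preim_def .

lemma mor_hom:
  assumes "mor \<XX> Y f" "openin (Sp Y) V" shows "pull f V \<in> ring_hom (Sec Y V) (Sec \<XX> (preim \<XX> f V))"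
  using assms(1)[unfolded mor_def, THEN conjunct2, THEN conjunct1, rule_format, OF assms(2)] by (rule conjunct1)

lemma mor_Cst:
  assumes "mor \<XX> Y f" "openin (Sp Y) V" shows "pull f V (Cst Y V z) = Cst \<XX> (preim \<XX> f V) z"
  using assms(1)[unfolded mor_def, THEN conjunct2, THEN conjunct1, rule_format, OF assms(2)] by simp

lemma mor_res:
  assumes "mor \<XX> Y f" "openin (Sp Y) V" "openin (Sp Y) W" "W \<subseteq> V" "s \<in> carrier (Sec Y V)"
  shows "pull f W (Res Y V W s) = Res \<XX> (preim \<XX> f V) (preim \<XX> f W) (pull f V s)"
  by (rule assms(1)[unfolded mor_def, THEN conjunct2, THEN conjunct2, THEN conjunct1, rule_format])
    (use assms(2-) in auto)

lemma mor_local: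
  assumes "mor \<XX> Y f" "x \<in> points \<XX>" "openin (Sp Y) V" "pt f x \<in> V" "s \<in> carrier (Sec Y V)"
    and "germ \<XX> x (preim \<XX> f V) (pull f V s) \<in> Units (stalk \<XX> x)"
  shows "germ Y (pt f x) V s \<in> Units (stalk Y (pt f x))"
  by (rule assms(1)[unfolded mor_def, THEN conjunct2, THEN conjunct2, THEN conjunct2, rule_format])
    (use assms(2-) in auto)

lemma preim_points:
  assumes "mor \<XX> Y f" shows "preim \<XX> f (points Y) = points \<XX>"
  using mor_point[OF assms] unfolding preim_def by blast

lemma preim_subset: "preim \<XX> f V \<subseteq> points \<XX>"
  unfolding preim_def by blast

lemma preim_mono: "V \<subseteq> V' \<Longrightarrow> preim \<XX> f V \<subseteq> preim \<XX> f V'"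
  unfolding preim_def by blast

lemma gpull_hom: "mor \<XX> Y f \<Longrightarrow> gpull Y f \<in> ring_hom (glob Y) (glob \<XX>)"
  using mor_hom[of \<XX> Y f "points Y"] preim_points[of \<XX> Y f] by simp

lemma gpull_res: "mor \<XX> Y f \<Longrightarrow> openin (Sp Y) V \<Longrightarrow> s \<in> carrier (glob Y) \<Longrightarrow>
    pull f V (Res Y (points Y) V s) = Res \<XX> (points \<XX>) (preim \<XX> f V) (gpull Y f s)"
  using mor_res[of \<XX> Y f "points Y" V s] preim_points[of \<XX> Y f] openin_subset[of "Sp Y" V] by simp

lemma mor_eq_pull: "mor_eq \<XX> Y f g \<Longrightarrow> openin (Sp Y) V \<Longrightarrow> s \<in> carrier (Sec Y V) \<Longrightarrow> pull f V s = pull g V s"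
  unfolding mor_eq_def by blast

lemma mor_eq_pt: "mor_eq \<XX> Y f g \<Longrightarrow> x \<in> points \<XX> \<Longrightarrow> pt f x = pt g x"
  unfolding mor_eq_def by blast

lemma gpull_comp:
  assumes "mor B Z h" "mor_eq A Z (mor_comp B h g) k" "s \<in> carrier (glob Z)"
  shows "gpull B g (gpull Z h s) = gpull Z k s"
proof -
  have "openin (Sp Z) (points Z)" by simp
  from mor_eq_pull[OF assms(2) this assms(3)] show ?thesis
    unfolding mor_comp_def by (simp add: preim_points[OF assms(1)])
qed

lemma pull_comp:
  assumes "mor_eq A Z (mor_comp B h g) k" "openin (Sp Z) V" "s \<in> carrier (Sec Z V)"
  shows "pull g (preim B h V) (pull h V s) = pull k V s"
  using mor_eq_pull[OF assms] unfolding mor_comp_def by simp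


section \<open>Products with a torus\<close>

locale torus_product =
  fixes D :: "'v set" and T :: "('t, 'u) ringed_space" and x :: "'v \<Rightarrow> 'u"
    and S :: "('q, 'r) ringed_space" and R :: "('t, 'u, 'q, 'r, 'z, 'w) product_data"
  assumes torus: "torus D T x" and product: "is_product T S R"
begin

sublocale T: scheme_space T using torus unfolding torus_def by unfold_locales blast
sublocale S: scheme_space S using product unfolding is_product_def by unfold_locales blast
sublocale R: scheme_space "tot R" using product unfolding is_product_def by unfold_locales blast

lemma finite_D: "finite D" using torus unfolding torus_def by blast

lemma pr1: "mor (tot R) T (pr1 R)" and pr2: "mor (tot R) S (pr2 R)"
  using product unfolding is_product_def by blast+

sublocale A: plain_cring "glob T" by (rule plain_cring.intro, rule T.sec_cring[OF T.openin_points])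

lemma x_units: "x \<in> D \<rightarrow> Units (glob T)" using torus unfolding torus_def by blast

end

locale torus_chart = torus_product D T x S R
  for D :: "'v set" and T :: "('t, 'u) ringed_space" and x :: "'v \<Rightarrow> 'u"
    and S :: "('q, 'r) ringed_space" and R :: "('t, 'u, 'q, 'r, 'z, 'w) product_data" +
  fixes V :: "'q set"
  assumes V: "affine_open S V"
begin

abbreviation W where "W \<equiv> preim (tot R) (pr2 R) V"
abbreviation C where "C \<equiv> Sec (tot R) W"
abbreviation B where "B \<equiv> Sec S V"
text \<open>
  \<open>\<alpha>\<close> and \<open>\<beta>\<close> are the pullbacks of functions on \<open>T\<close> and on \<open>V\<close> to \<open>W = T \<times> V\<close>, and \<open>\<chi> m\<close> is the character of
  exponent \<open>m\<close>. Pullbacks to \<open>W\<close> factor through \<open>\<alpha>\<close> because \<open>T\<close> is affine.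
\<close>

definition \<alpha> where "\<alpha> t = Res (tot R) (points (tot R)) W (gpull T (pr1 R) t)"
abbreviation \<beta> where "\<beta> \<equiv> pull (pr2 R) V"
definition \<chi> where "\<chi> m = \<alpha> (monomial (glob T) D x m)"

lemma V_open: "openin (Sp S) V" using V unfolding affine_open_def by blast
lemma W_open: "openin (Sp (tot R)) W" by (rule mor_open[OF pr2 V_open])

sublocale B: plain_cring B by (rule plain_cring.intro, rule S.sec_cring[OF V_open])
sublocale C: plain_cring C by (rule plain_cring.intro, rule R.sec_cring[OF W_open])

lemma product_chart:
  "affine_open (tot R) W \<and>
   is_tensor_product (glob T) (Cst T (points T)) B C \<alpha> (Res (tot R) W W \<circ> \<beta>)"
proof -
  have aT: "affine_open T (points T)" using torus unfolding torus_def by blast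
  have e: "preim (tot R) (pr1 R) (points T) \<inter> W = W"
    using preim_points[OF pr1] preim_subset[of "tot R" "pr2 R" V] by blast
  have a: "Res (tot R) (preim (tot R) (pr1 R) (points T)) W \<circ> gpull T (pr1 R) = \<alpha>"
    unfolding \<alpha>_def preim_points[OF pr1] by (simp add: o_def)
  have "\<forall>U V. affine_open T U \<and> affine_open S V \<longrightarrow>
        (let U' = preim (tot R) (pr1 R) U; V' = preim (tot R) (pr2 R) V in
          affine_open (tot R) (U' \<inter> V') \<and>
          is_tensor_product (Sec T U) (Cst T U) (Sec S V) (Sec (tot R) (U' \<inter> V'))
            (Res (tot R) U' (U' \<inter> V') \<circ> pull (pr1 R) U)
            (Res (tot R) V' (U' \<inter> V') \<circ> pull (pr2 R) V))"
    using product unfolding is_product_def by blast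
  from this[rule_format, OF conjI, OF aT V] show ?thesis unfolding Let_def e a .
qed

lemma W_affine: "affine_open (tot R) W" using product_chart by blast

lemma alpha_hom: "\<alpha> \<in> ring_hom (glob T) C"
proof -
  have "Res (tot R) (points (tot R)) W \<in> ring_hom (glob (tot R)) C"
    by (rule R.res_hom[OF R.openin_points W_open preim_subset])
  from ring_hom_trans[OF gpull_hom[OF pr1] this] show ?thesis unfolding \<alpha>_def o_def .
qed

lemma beta_hom: "\<beta> \<in> ring_hom B C" by (rule mor_hom[OF pr2 V_open])

lemma alpha_closed: "t \<in> carrier (glob T) \<Longrightarrow> \<alpha> t \<in> carrier C" by (rule ring_hom_closed[OF alpha_hom])
lemma beta_closed: "b \<in> carrier B \<Longrightarrow> \<beta> b \<in> carrier C" by (rule ring_hom_closed[OF beta_hom])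

lemma beta_zero: "\<beta> \<zero>\<^bsub>B\<^esub> = \<zero>\<^bsub>C\<^esub>" by (rule ring_hom_zero[OF beta_hom B.ring_axioms C.ring_axioms])

lemma alpha_Cst: "\<alpha> (Cst T (points T) z) = \<beta> (Cst S V z)"
  unfolding \<alpha>_def mor_Cst[OF pr1 T.openin_points] mor_Cst[OF pr2 V_open] preim_points[OF pr1]
  by (rule R.res_Cst[OF R.openin_points W_open preim_subset])

lemma alpha_x_units: "(\<lambda>d. \<alpha> (x d)) \<in> D \<rightarrow> Units C"
  using ring_hom_Units[OF alpha_hom] x_units by blast

lemma chi_monomial: "\<chi> m = monomial C D (\<lambda>d. \<alpha> (x d)) m"
  unfolding \<chi>_def by (rule monomial_hom[OF alpha_hom A.is_cring C.is_cring x_units])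

lemma chi_unit: "\<chi> m \<in> Units C"
  unfolding chi_monomial by (rule C.monomial_unit[OF alpha_x_units])

lemma chi_closed: "\<chi> m \<in> carrier C" using chi_unit C.Units_closed by blast

lemma chi_add: "\<chi> (\<lambda>d. m d + n d) = \<chi> m \<otimes>\<^bsub>C\<^esub> \<chi> n"
  unfolding chi_monomial by (rule C.monomial_add[OF alpha_x_units])

lemma term_closed: "b \<in> carrier B \<Longrightarrow> \<chi> m \<otimes>\<^bsub>C\<^esub> \<beta> b \<in> carrier C"
  using chi_closed beta_closed by simp

definition laurent_polynomial where
  "laurent_polynomial M b = (\<Oplus>\<^bsub>C\<^esub>m\<in>M. \<chi> m \<otimes>\<^bsub>C\<^esub> \<beta> (b m))"

definition laurent_polynomials where
  "laurent_polynomials = {laurent_polynomial M b | M b. finite M \<and> M \<subseteq> lattice_on D \<and> b \<in> M \<rightarrow> carrier B}"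

lemma laurent_extend:
  assumes "finite N" "M \<subseteq> N" "b \<in> M \<rightarrow> carrier B"
  shows "laurent_polynomial M b = laurent_polynomial N (\<lambda>m. if m \<in> M then b m else \<zero>\<^bsub>B\<^esub>)"
  unfolding laurent_polynomial_def
  by (rule C.add.finprod_mono_neutral_cong_left[OF assms(1,2)])
    (use assms(3) term_closed chi_closed beta_zero in \<open>auto simp: Pi_def\<close>)

lemma Laurent_add:
  assumes "r \<in> laurent_polynomials" "r' \<in> laurent_polynomials" shows "r \<oplus>\<^bsub>C\<^esub> r' \<in> laurent_polynomials"
proof -
  obtain M b where M: "finite M" "M \<subseteq> lattice_on D" "b \<in> M \<rightarrow> carrier B" and r: "r = laurent_polynomial M b"
    using assms(1) unfolding laurent_polynomials_def by blast
  obtain M' b' where M': "finite M'" "M' \<subseteq> lattice_on D" "b' \<in> M' \<rightarrow> carrier B" and r': "r' = laurent_polynomial M' b'"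
    using assms(2) unfolding laurent_polynomials_def by blast
  let ?N = "M \<union> M'" and ?b = "\<lambda>m. if m \<in> M then b m else \<zero>\<^bsub>B\<^esub>" and ?b' = "\<lambda>m. if m \<in> M' then b' m else \<zero>\<^bsub>B\<^esub>"
  have N: "finite ?N" using M M' by simp
  have c: "?b m \<in> carrier B" "?b' m \<in> carrier B" for m using M(3) M'(3) by auto
  have "r = laurent_polynomial ?N ?b" unfolding r by (rule laurent_extend[OF N _ M(3)]) blast
  moreover have "r' = laurent_polynomial ?N ?b'" unfolding r' by (rule laurent_extend[OF N _ M'(3)]) blast
  ultimately have "r \<oplus>\<^bsub>C\<^esub> r' = laurent_polynomial ?N ?b \<oplus>\<^bsub>C\<^esub> laurent_polynomial ?N ?b'" by (simp only:)
  also have "\<dots> = (\<Oplus>\<^bsub>C\<^esub>m\<in>?N. \<chi> m \<otimes>\<^bsub>C\<^esub> \<beta> (?b m) \<oplus>\<^bsub>C\<^esub> \<chi> m \<otimes>\<^bsub>C\<^esub> \<beta> (?b' m))"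
    unfolding laurent_polynomial_def by (rule C.finsum_addf[symmetric]) (use c term_closed in blast)+
  also have "\<dots> = laurent_polynomial ?N (\<lambda>m. ?b m \<oplus>\<^bsub>B\<^esub> ?b' m)"
    unfolding laurent_polynomial_def
  proof (rule C.finsum_cong')
    show "\<chi> m \<otimes>\<^bsub>C\<^esub> \<beta> (?b m) \<oplus>\<^bsub>C\<^esub> \<chi> m \<otimes>\<^bsub>C\<^esub> \<beta> (?b' m) = \<chi> m \<otimes>\<^bsub>C\<^esub> \<beta> (?b m \<oplus>\<^bsub>B\<^esub> ?b' m)" for m
      unfolding ring_hom_add[OF beta_hom c] by (rule C.r_distr[symmetric]) (use chi_closed beta_closed c in blast)+
    show "(\<lambda>m. \<chi> m \<otimes>\<^bsub>C\<^esub> \<beta> (?b m \<oplus>\<^bsub>B\<^esub> ?b' m)) \<in> ?N \<rightarrow> carrier C"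
      using term_closed[OF B.a_closed[OF c]] by blast
  qed simp
  finally show ?thesis
    unfolding laurent_polynomials_def using N M(2) M'(2) B.a_closed[OF c] by blast
qed

lemma Laurent_zero: "\<zero>\<^bsub>C\<^esub> \<in> laurent_polynomials"
proof -
  have "laurent_polynomial {} (\<lambda>_. \<zero>\<^bsub>B\<^esub>) = \<zero>\<^bsub>C\<^esub>" unfolding laurent_polynomial_def by simp
  then show ?thesis unfolding laurent_polynomials_def by (intro CollectI exI[of _ "{}"] exI[of _ "\<lambda>_. \<zero>\<^bsub>B\<^esub>"]) simp
qed

lemma Laurent_tensor:
  assumes a: "a \<in> carrier (glob T)" and b: "b \<in> carrier B"
  shows "\<alpha> a \<otimes>\<^bsub>C\<^esub> \<beta> b \<in> laurent_polynomials"
proof -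
  have "a \<in> lin_span (glob T) (Cst T (points T)) (lattice_on D) (monomial (glob T) D x)"
    using a torus unfolding torus_def by blast
  then obtain M z where M: "finite M" "M \<subseteq> lattice_on D"
    and a_eq: "a = (\<Oplus>\<^bsub>glob T\<^esub>m\<in>M. Cst T (points T) (z m) \<otimes>\<^bsub>glob T\<^esub> monomial (glob T) D x m)"
    unfolding lin_span_def by blast
  have cc: "Cst T (points T) y \<in> carrier (glob T)" for y
    using ring_hom_closed[OF T.Cst_hom[OF T.openin_points]] by (simp add: complex_ring_def)
  have cB: "Cst S V y \<in> carrier B" for y
    using ring_hom_closed[OF S.Cst_hom[OF V_open]] by (simp add: complex_ring_def)
  have mc: "monomial (glob T) D x m \<in> carrier (glob T)" for m
    using A.monomial_unit[OF x_units] by blast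
  have "\<alpha> a = (\<Oplus>\<^bsub>C\<^esub>m\<in>M. \<alpha> (Cst T (points T) (z m) \<otimes>\<^bsub>glob T\<^esub> monomial (glob T) D x m))"
    unfolding a_eq by (rule ring_hom_finsum[OF alpha_hom A.is_cring C.is_cring]) (use cc mc in auto)
  also have "\<dots> = (\<Oplus>\<^bsub>C\<^esub>m\<in>M. \<chi> m \<otimes>\<^bsub>C\<^esub> \<beta> (Cst S V (z m)))"
  proof (rule C.finsum_cong')
    show "(\<lambda>m. \<chi> m \<otimes>\<^bsub>C\<^esub> \<beta> (Cst S V (z m))) \<in> M \<rightarrow> carrier C" using term_closed[OF cB] by blast
    show "\<alpha> (Cst T (points T) (z m) \<otimes>\<^bsub>glob T\<^esub> monomial (glob T) D x m) = \<chi> m \<otimes>\<^bsub>C\<^esub> \<beta> (Cst S V (z m))" for m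
      unfolding ring_hom_mult[OF alpha_hom cc mc] alpha_Cst \<chi>_def[symmetric]
      by (rule C.m_comm[OF beta_closed[OF cB] chi_closed])
  qed simp
  finally have "\<alpha> a \<otimes>\<^bsub>C\<^esub> \<beta> b = (\<Oplus>\<^bsub>C\<^esub>m\<in>M. (\<chi> m \<otimes>\<^bsub>C\<^esub> \<beta> (Cst S V (z m))) \<otimes>\<^bsub>C\<^esub> \<beta> b)"
    using C.finsum_ldistr[OF M(1) beta_closed[OF b], of "\<lambda>m. \<chi> m \<otimes>\<^bsub>C\<^esub> \<beta> (Cst S V (z m))"] term_closed[OF cB] by simp
  also have "\<dots> = laurent_polynomial M (\<lambda>m. Cst S V (z m) \<otimes>\<^bsub>B\<^esub> b)"
    unfolding laurent_polynomial_def
  proof (rule C.finsum_cong')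
    show "(\<lambda>m. \<chi> m \<otimes>\<^bsub>C\<^esub> \<beta> (Cst S V (z m) \<otimes>\<^bsub>B\<^esub> b)) \<in> M \<rightarrow> carrier C" using term_closed[OF B.m_closed[OF cB b]] by blast
    show "\<chi> m \<otimes>\<^bsub>C\<^esub> \<beta> (Cst S V (z m)) \<otimes>\<^bsub>C\<^esub> \<beta> b = \<chi> m \<otimes>\<^bsub>C\<^esub> \<beta> (Cst S V (z m) \<otimes>\<^bsub>B\<^esub> b)" for m
      unfolding ring_hom_mult[OF beta_hom cB b] by (rule C.m_assoc[OF chi_closed beta_closed[OF cB] beta_closed[OF b]])
  qed simp
  finally show ?thesis unfolding laurent_polynomials_def using M B.m_closed[OF cB b] by blast
qed

text \<open>
  A section on \<open>T \<times> V\<close> is a sum of products \<open>\<alpha> a \<cdot> \<beta> b\<close>, and the functions \<open>a\<close> on the torus are combinations of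
  characters. So it is a Laurent polynomial in the characters with coefficients on \<open>V\<close>.
\<close>

lemma expand:
  assumes "r \<in> carrier C"
  obtains M b where "finite M" "M \<subseteq> lattice_on D" "b \<in> M \<rightarrow> carrier B" "r = laurent_polynomial M b"
proof -
  have "\<forall>r\<in>carrier C. \<exists>(n::nat) a b. a \<in> {..<n} \<rightarrow> carrier (glob T) \<and> b \<in> {..<n} \<rightarrow> carrier B \<and>
        r = (\<Oplus>\<^bsub>C\<^esub>i\<in>{..<n}. \<alpha> (a i) \<otimes>\<^bsub>C\<^esub> (Res (tot R) W W \<circ> \<beta>) (b i))"
    using product_chart unfolding is_tensor_product_def by blast
  then obtain n :: nat and a b where a: "a \<in> {..<n} \<rightarrow> carrier (glob T)" and b: "b \<in> {..<n} \<rightarrow> carrier B"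
    and r: "r = (\<Oplus>\<^bsub>C\<^esub>i\<in>{..<n}. \<alpha> (a i) \<otimes>\<^bsub>C\<^esub> (Res (tot R) W W \<circ> \<beta>) (b i))"
    using assms by blast
  have t: "\<alpha> (a i) \<otimes>\<^bsub>C\<^esub> (Res (tot R) W W \<circ> \<beta>) (b i) \<in> laurent_polynomials \<and> \<alpha> (a i) \<otimes>\<^bsub>C\<^esub> (Res (tot R) W W \<circ> \<beta>) (b i) \<in> carrier C"
    if "i \<in> {..<n}" for i
  proof -
    have ai: "a i \<in> carrier (glob T)" and bi: "b i \<in> carrier B" using a b that by auto
    have e: "(Res (tot R) W W \<circ> \<beta>) (b i) = \<beta> (b i)" using R.res_id[OF W_open beta_closed[OF bi]] by simp
    show ?thesis unfolding e using Laurent_tensor[OF ai bi] alpha_closed[OF ai] beta_closed[OF bi] by simp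
  qed
  have "(\<Oplus>\<^bsub>C\<^esub>i\<in>J. \<alpha> (a i) \<otimes>\<^bsub>C\<^esub> (Res (tot R) W W \<circ> \<beta>) (b i)) \<in> laurent_polynomials" if "finite J" "J \<subseteq> {..<n}" for J
    using that
  proof (induction J)
    case empty
    then show ?case using Laurent_zero by simp
  next
    case (insert j J)
    have "(\<Oplus>\<^bsub>C\<^esub>i\<in>insert j J. \<alpha> (a i) \<otimes>\<^bsub>C\<^esub> (Res (tot R) W W \<circ> \<beta>) (b i)) =
        \<alpha> (a j) \<otimes>\<^bsub>C\<^esub> (Res (tot R) W W \<circ> \<beta>) (b j) \<oplus>\<^bsub>C\<^esub> (\<Oplus>\<^bsub>C\<^esub>i\<in>J. \<alpha> (a i) \<otimes>\<^bsub>C\<^esub> (Res (tot R) W W \<circ> \<beta>) (b i))"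
      by (rule C.finsum_insert) (use insert t in blast)+
    then show ?case using Laurent_add t insert by auto
  qed
  then have "r \<in> laurent_polynomials" unfolding r by blast
  then show ?thesis using that unfolding laurent_polynomials_def by blast
qed

text \<open>
  Distinct characters are linearly independent on \<open>T\<close>, and the injectivity criterion for the tensor product says
  that they remain so over the sections on \<open>V\<close>.
\<close>

lemma independent:
  assumes M: "finite M" "M \<subseteq> lattice_on D" and b: "b \<in> M \<rightarrow> carrier B" and z: "laurent_polynomial M b = \<zero>\<^bsub>C\<^esub>"
    and m: "m \<in> M"
  shows "b m = \<zero>\<^bsub>B\<^esub>"
proof -
  obtain h where h: "bij_betw h {..<card M} M" using ex_bij_betw_nat_finite[OF M(1)] by (auto simp: atLeast0LessThan)
  let ?n = "card M" and ?a = "\<lambda>i. monomial (glob T) D x (h i)" and ?b = "\<lambda>i. b (h i)"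
  have hM: "h ` {..<?n} = M" and inj: "inj_on h {..<?n}" using h by (auto simp: bij_betw_def)
  have mc: "monomial (glob T) D x m \<in> carrier (glob T)" for m
    using A.monomial_unit[OF x_units] by blast
  have cc: "Cst T (points T) y \<in> carrier (glob T)" for y
    using ring_hom_closed[OF T.Cst_hom[OF T.openin_points]] by (simp add: complex_ring_def)
  have li: "lin_indep (glob T) (Cst T (points T)) (lattice_on D) (monomial (glob T) D x)"
    using torus unfolding torus_def by blast
  have "lin_indep (glob T) (Cst T (points T)) {..<?n} ?a"
    unfolding lin_indep_def
  proof (intro allI impI ballI)
    fix J z j assume J: "finite J \<and> J \<subseteq> {..<?n} \<and> (\<Oplus>\<^bsub>glob T\<^esub>i\<in>J. Cst T (points T) (z i) \<otimes>\<^bsub>glob T\<^esub> ?a i) = \<zero>\<^bsub>glob T\<^esub>"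
      and j: "j \<in> J"
    let ?g = "the_inv_into {..<?n} h"
    have injJ: "inj_on h J" using inj J inj_on_subset by blast
    have g: "?g (h i) = i" if "i \<in> J" for i using the_inv_into_f_f[OF inj] J that by blast
    have "(\<Oplus>\<^bsub>glob T\<^esub>m\<in>h ` J. Cst T (points T) (z (?g m)) \<otimes>\<^bsub>glob T\<^esub> monomial (glob T) D x m) =
        (\<Oplus>\<^bsub>glob T\<^esub>i\<in>J. Cst T (points T) (z (?g (h i))) \<otimes>\<^bsub>glob T\<^esub> monomial (glob T) D x (h i))"
      by (rule A.finsum_reindex[OF _ injJ]) (use cc mc in auto)
    also have "\<dots> = (\<Oplus>\<^bsub>glob T\<^esub>i\<in>J. Cst T (points T) (z i) \<otimes>\<^bsub>glob T\<^esub> ?a i)"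
      by (rule A.finsum_cong') (use g cc mc in auto)
    finally have "(\<Oplus>\<^bsub>glob T\<^esub>m\<in>h ` J. Cst T (points T) (z (?g m)) \<otimes>\<^bsub>glob T\<^esub> monomial (glob T) D x m) = \<zero>\<^bsub>glob T\<^esub>"
      using J by simp
    moreover have "finite (h ` J)" "h ` J \<subseteq> lattice_on D" using J hM M(2) by auto
    ultimately have "\<forall>m\<in>h ` J. z (?g m) = 0" using li[unfolded lin_indep_def, rule_format, of "h ` J" "\<lambda>m. z (?g m)"] by blast
    then show "z j = 0" using g j by force
  qed
  moreover have "?a \<in> {..<?n} \<rightarrow> carrier (glob T)" using mc by blast
  moreover have bc: "?b \<in> {..<?n} \<rightarrow> carrier B" using b hM by auto
  moreover have "(\<Oplus>\<^bsub>C\<^esub>i\<in>{..<?n}. \<alpha> (?a i) \<otimes>\<^bsub>C\<^esub> (Res (tot R) W W \<circ> \<beta>) (?b i)) = \<zero>\<^bsub>C\<^esub>"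
  proof -
    have "(\<Oplus>\<^bsub>C\<^esub>i\<in>{..<?n}. \<alpha> (?a i) \<otimes>\<^bsub>C\<^esub> (Res (tot R) W W \<circ> \<beta>) (?b i)) = (\<Oplus>\<^bsub>C\<^esub>i\<in>{..<?n}. \<chi> (h i) \<otimes>\<^bsub>C\<^esub> \<beta> (b (h i)))"
    proof (rule C.finsum_cong')
      show "(\<lambda>i. \<chi> (h i) \<otimes>\<^bsub>C\<^esub> \<beta> (b (h i))) \<in> {..<?n} \<rightarrow> carrier C" using term_closed bc by blast
      fix i assume "i \<in> {..<?n}"
      then have "b (h i) \<in> carrier B" using bc by blast
      then show "\<alpha> (?a i) \<otimes>\<^bsub>C\<^esub> (Res (tot R) W W \<circ> \<beta>) (?b i) = \<chi> (h i) \<otimes>\<^bsub>C\<^esub> \<beta> (b (h i))"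
        unfolding \<chi>_def using R.res_id[OF W_open beta_closed] by simp
    qed simp
    also have "\<dots> = laurent_polynomial (h ` {..<?n}) b"
      unfolding laurent_polynomial_def by (rule C.finsum_reindex[symmetric, OF _ inj]) (use term_closed b hM in blast)
    finally show ?thesis unfolding hM z .
  qed
  moreover have "\<forall>(n::nat) a b. a \<in> {..<n} \<rightarrow> carrier (glob T) \<and> b \<in> {..<n} \<rightarrow> carrier B \<and>
      lin_indep (glob T) (Cst T (points T)) {..<n} a \<and>
      (\<Oplus>\<^bsub>C\<^esub>i\<in>{..<n}. \<alpha> (a i) \<otimes>\<^bsub>C\<^esub> (Res (tot R) W W \<circ> \<beta>) (b i)) = \<zero>\<^bsub>C\<^esub> \<longrightarrow> (\<forall>i<n. b i = \<zero>\<^bsub>B\<^esub>)"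
    using product_chart unfolding is_tensor_product_def by blast
  ultimately have "\<forall>i<?n. ?b i = \<zero>\<^bsub>B\<^esub>" by blast
  moreover have "m \<in> h ` {..<?n}" using m hM by simp
  then obtain i where "i < ?n" "h i = m" by auto
  ultimately show ?thesis by blast
qed

lemma laurent_eqD:
  assumes M: "finite M" "M \<subseteq> lattice_on D" and b: "b \<in> M \<rightarrow> carrier B" "b' \<in> M \<rightarrow> carrier B"
    and e: "laurent_polynomial M b = laurent_polynomial M b'" and m: "m \<in> M"
  shows "b m = b' m"
proof -
  have bc: "b m \<in> carrier B" "b' m \<in> carrier B" if "m \<in> M" for m using b that by auto
  have t: "(\<lambda>m. \<chi> m \<otimes>\<^bsub>C\<^esub> \<beta> (b m \<ominus>\<^bsub>B\<^esub> b' m)) \<in> M \<rightarrow> carrier C" "(\<lambda>m. \<chi> m \<otimes>\<^bsub>C\<^esub> \<beta> (b' m)) \<in> M \<rightarrow> carrier C"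
    using term_closed bc by (auto intro!: term_closed)
  have "laurent_polynomial M b = (\<Oplus>\<^bsub>C\<^esub>m\<in>M. \<chi> m \<otimes>\<^bsub>C\<^esub> \<beta> (b m \<ominus>\<^bsub>B\<^esub> b' m) \<oplus>\<^bsub>C\<^esub> \<chi> m \<otimes>\<^bsub>C\<^esub> \<beta> (b' m))"
    unfolding laurent_polynomial_def
  proof (rule C.finsum_cong'[OF refl])
    show "(\<lambda>m. \<chi> m \<otimes>\<^bsub>C\<^esub> \<beta> (b m \<ominus>\<^bsub>B\<^esub> b' m) \<oplus>\<^bsub>C\<^esub> \<chi> m \<otimes>\<^bsub>C\<^esub> \<beta> (b' m)) \<in> M \<rightarrow> carrier C"
      using t by (auto simp: Pi_def)
    fix m assume m: "m \<in> M"
    have "b m = (b m \<ominus>\<^bsub>B\<^esub> b' m) \<oplus>\<^bsub>B\<^esub> b' m" using bc[OF m] by (simp add: a_minus_def B.a_assoc B.l_neg)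
    then have "\<beta> (b m) = \<beta> (b m \<ominus>\<^bsub>B\<^esub> b' m) \<oplus>\<^bsub>C\<^esub> \<beta> (b' m)"
      using ring_hom_add[OF beta_hom, of "b m \<ominus>\<^bsub>B\<^esub> b' m" "b' m"] bc[OF m] by simp
    then show "\<chi> m \<otimes>\<^bsub>C\<^esub> \<beta> (b m) = \<chi> m \<otimes>\<^bsub>C\<^esub> \<beta> (b m \<ominus>\<^bsub>B\<^esub> b' m) \<oplus>\<^bsub>C\<^esub> \<chi> m \<otimes>\<^bsub>C\<^esub> \<beta> (b' m)"
      using C.r_distr[OF beta_closed beta_closed chi_closed] bc[OF m] by simp
  qed
  also have "\<dots> = laurent_polynomial M (\<lambda>m. b m \<ominus>\<^bsub>B\<^esub> b' m) \<oplus>\<^bsub>C\<^esub> laurent_polynomial M b'"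
    unfolding laurent_polynomial_def by (rule C.finsum_addf[OF t])
  finally have s: "laurent_polynomial M b = laurent_polynomial M (\<lambda>m. b m \<ominus>\<^bsub>B\<^esub> b' m) \<oplus>\<^bsub>C\<^esub> laurent_polynomial M b'" .
  have c: "laurent_polynomial M (\<lambda>m. b m \<ominus>\<^bsub>B\<^esub> b' m) \<in> carrier C" "laurent_polynomial M b' \<in> carrier C"
    unfolding laurent_polynomial_def using C.finsum_closed[OF t(1)] C.finsum_closed[OF t(2)] .
  have z: "laurent_polynomial M (\<lambda>m. b m \<ominus>\<^bsub>B\<^esub> b' m) = \<zero>\<^bsub>C\<^esub>"
    using s[unfolded e] c C.add.r_cancel_one'[OF c(2,1)] by simp
  have "b m \<ominus>\<^bsub>B\<^esub> b' m = \<zero>\<^bsub>B\<^esub>"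
    by (rule independent[OF M _ z m]) (use bc in auto)
  then show ?thesis using bc[OF m] by simp
qed

lemma independent_single:
  assumes "w \<in> lattice_on D" "b \<in> carrier B" "\<chi> w \<otimes>\<^bsub>C\<^esub> \<beta> b = \<zero>\<^bsub>C\<^esub>"
  shows "b = \<zero>\<^bsub>B\<^esub>"
  using independent[of "{w}" "\<lambda>_. b" w] assms term_closed by (simp add: laurent_polynomial_def)

lemma beta_inj:
  assumes "b \<in> carrier B" "\<beta> b = \<zero>\<^bsub>C\<^esub>" shows "b = \<zero>\<^bsub>B\<^esub>"
  by (rule independent_single[of "\<lambda>_. 0"]) (use assms chi_closed in \<open>auto simp: lattice_on_def\<close>)

lemma independent_two:
  assumes w: "w \<in> lattice_on D" "w' \<in> lattice_on D" "w \<noteq> w'" and b: "b \<in> carrier B" "b' \<in> carrier B"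
    and e: "\<chi> w \<otimes>\<^bsub>C\<^esub> \<beta> b = \<chi> w' \<otimes>\<^bsub>C\<^esub> \<beta> b'"
  shows "b = \<zero>\<^bsub>B\<^esub>"
proof -
  let ?b = "\<lambda>m. if m = w then b else \<ominus>\<^bsub>B\<^esub> b'"
  interpret h: ring_hom_cring B C \<beta>
    by (rule ring_hom_cring.intro[OF B.is_cring C.is_cring]) (rule ring_hom_cring_axioms.intro[OF beta_hom])
  have t: "\<chi> m \<otimes>\<^bsub>C\<^esub> \<beta> (?b m) \<in> carrier C" for m by (rule term_closed) (use b in auto)
  have "laurent_polynomial {w, w'} ?b = \<chi> w \<otimes>\<^bsub>C\<^esub> \<beta> (?b w) \<oplus>\<^bsub>C\<^esub> (\<Oplus>\<^bsub>C\<^esub>m\<in>{w'}. \<chi> m \<otimes>\<^bsub>C\<^esub> \<beta> (?b m))"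
    unfolding laurent_polynomial_def by (rule C.finsum_insert[OF _ _ Pi_I[OF t] t]) (use w in auto)
  also have "(\<Oplus>\<^bsub>C\<^esub>m\<in>{w'}. \<chi> m \<otimes>\<^bsub>C\<^esub> \<beta> (?b m)) = \<chi> w' \<otimes>\<^bsub>C\<^esub> \<beta> (?b w')"
    using t[of w'] by simp
  also have "\<chi> w' \<otimes>\<^bsub>C\<^esub> \<beta> (?b w') = \<ominus>\<^bsub>C\<^esub> (\<chi> w' \<otimes>\<^bsub>C\<^esub> \<beta> b')"
    using w(3) b(2) C.r_minus[OF chi_closed beta_closed[OF b(2)]] by simp
  also have "\<chi> w \<otimes>\<^bsub>C\<^esub> \<beta> (?b w) \<oplus>\<^bsub>C\<^esub> \<ominus>\<^bsub>C\<^esub> (\<chi> w' \<otimes>\<^bsub>C\<^esub> \<beta> b') = \<zero>\<^bsub>C\<^esub>"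
    using e C.r_neg[OF term_closed[OF b(2)]] by simp
  finally have z: "laurent_polynomial {w, w'} ?b = \<zero>\<^bsub>C\<^esub>" .
  have "?b w = \<zero>\<^bsub>B\<^esub>" by (rule independent[OF _ _ _ z]) (use w b in auto)
  then show ?thesis by simp
qed

text \<open>
  A sum of two terms of different degrees is not homogeneous unless one of them vanishes. If \<open>w\<close> is one of the
  two degrees, moving that term to the other side leaves two terms of different degrees.
\<close>

lemma independent_three:
  assumes w: "w \<in> lattice_on D" "w1 \<in> lattice_on D" "w2 \<in> lattice_on D" "w1 \<noteq> w2"
    and b: "b \<in> carrier B" "b1 \<in> carrier B" "b2 \<in> carrier B"
    and e: "\<chi> w \<otimes>\<^bsub>C\<^esub> \<beta> b = \<chi> w1 \<otimes>\<^bsub>C\<^esub> \<beta> b1 \<oplus>\<^bsub>C\<^esub> \<chi> w2 \<otimes>\<^bsub>C\<^esub> \<beta> b2"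
  shows "b1 = \<zero>\<^bsub>B\<^esub> \<or> b2 = \<zero>\<^bsub>B\<^esub>"
proof (cases "w = w1 \<or> w = w2")
  case True
  interpret h: ring_hom_cring B C \<beta>
    by (rule ring_hom_cring.intro[OF B.is_cring C.is_cring]) (rule ring_hom_cring_axioms.intro[OF beta_hom])
  have *: "b2 = \<zero>\<^bsub>B\<^esub>" if w: "w1 \<in> lattice_on D" "w2 \<in> lattice_on D" "w1 \<noteq> w2"
    and b: "b1 \<in> carrier B" "b2 \<in> carrier B"
    and e: "\<chi> w1 \<otimes>\<^bsub>C\<^esub> \<beta> b = \<chi> w1 \<otimes>\<^bsub>C\<^esub> \<beta> b1 \<oplus>\<^bsub>C\<^esub> \<chi> w2 \<otimes>\<^bsub>C\<^esub> \<beta> b2" for w1 w2 b1 b2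
  proof -
    have "\<chi> w1 \<otimes>\<^bsub>C\<^esub> \<beta> (b \<ominus>\<^bsub>B\<^esub> b1) = \<chi> w1 \<otimes>\<^bsub>C\<^esub> \<beta> b \<ominus>\<^bsub>C\<^esub> \<chi> w1 \<otimes>\<^bsub>C\<^esub> \<beta> b1"
      unfolding ring_hom_minus[OF beta_hom B.is_cring C.is_cring assms(5) b(1)]
      using chi_closed beta_closed[OF assms(5)] beta_closed[OF b(1)] by (simp add: a_minus_def C.r_distr C.r_minus)
    also have "\<dots> = \<chi> w2 \<otimes>\<^bsub>C\<^esub> \<beta> b2"
    proof -
      let ?p = "\<chi> w1 \<otimes>\<^bsub>C\<^esub> \<beta> b1" and ?q = "\<chi> w2 \<otimes>\<^bsub>C\<^esub> \<beta> b2"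
      have pq: "?p \<in> carrier C" "?q \<in> carrier C" using term_closed b by auto
      have "?p \<oplus>\<^bsub>C\<^esub> ?q \<ominus>\<^bsub>C\<^esub> ?p = ?q \<oplus>\<^bsub>C\<^esub> (?p \<ominus>\<^bsub>C\<^esub> ?p)"
        unfolding a_minus_def C.a_comm[OF pq] by (rule C.a_assoc) (use pq in auto)
      then show ?thesis unfolding e using pq by simp
    qed
    finally have e': "\<chi> w2 \<otimes>\<^bsub>C\<^esub> \<beta> b2 = \<chi> w1 \<otimes>\<^bsub>C\<^esub> \<beta> (b \<ominus>\<^bsub>B\<^esub> b1)" ..
    show ?thesis by (rule independent_two[OF w(2,1) w(3)[symmetric] b(2) _ e']) (use assms(5) b in simp)
  qed
  from True show ?thesis
  proof
    assume "w = w1"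
    then show ?thesis using *[OF w(2,3,4) b(2,3)] e by blast
  next
    assume "w = w2"
    then show ?thesis
      using *[OF w(3,2) w(4)[symmetric] b(3,2)] e C.a_comm[OF term_closed[OF b(2)] term_closed[OF b(3)]] by simp
  qed
next
  case False
  interpret h: ring_hom_cring B C \<beta>
    by (rule ring_hom_cring.intro[OF B.is_cring C.is_cring]) (rule ring_hom_cring_axioms.intro[OF beta_hom])
  let ?b = "\<lambda>m. if m = w then \<ominus>\<^bsub>B\<^esub> b else if m = w1 then b1 else b2"
  have bc: "?b m \<in> carrier B" for m using b by auto
  have t: "\<chi> m \<otimes>\<^bsub>C\<^esub> \<beta> (?b m) \<in> carrier C" for m by (rule term_closed[OF bc])
  have "laurent_polynomial {w, w1, w2} ?b = \<chi> w \<otimes>\<^bsub>C\<^esub> \<beta> (?b w) \<oplus>\<^bsub>C\<^esub> (\<Oplus>\<^bsub>C\<^esub>m\<in>{w1, w2}. \<chi> m \<otimes>\<^bsub>C\<^esub> \<beta> (?b m))"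
    unfolding laurent_polynomial_def by (rule C.finsum_insert[OF _ _ Pi_I[OF t] t]) (use w False in auto)
  also have "(\<Oplus>\<^bsub>C\<^esub>m\<in>{w1, w2}. \<chi> m \<otimes>\<^bsub>C\<^esub> \<beta> (?b m)) = \<chi> w1 \<otimes>\<^bsub>C\<^esub> \<beta> (?b w1) \<oplus>\<^bsub>C\<^esub> (\<Oplus>\<^bsub>C\<^esub>m\<in>{w2}. \<chi> m \<otimes>\<^bsub>C\<^esub> \<beta> (?b m))"
    by (rule C.finsum_insert[OF _ _ Pi_I[OF t] t]) (use w in auto)
  also have "(\<Oplus>\<^bsub>C\<^esub>m\<in>{w2}. \<chi> m \<otimes>\<^bsub>C\<^esub> \<beta> (?b m)) = \<chi> w2 \<otimes>\<^bsub>C\<^esub> \<beta> (?b w2)" using t[of w2] by simp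
  also have "\<chi> w \<otimes>\<^bsub>C\<^esub> \<beta> (?b w) = \<ominus>\<^bsub>C\<^esub> (\<chi> w \<otimes>\<^bsub>C\<^esub> \<beta> b)"
    using b(1) C.r_minus[OF chi_closed beta_closed[OF b(1)]] by simp
  also have "\<ominus>\<^bsub>C\<^esub> (\<chi> w \<otimes>\<^bsub>C\<^esub> \<beta> b) \<oplus>\<^bsub>C\<^esub> (\<chi> w1 \<otimes>\<^bsub>C\<^esub> \<beta> (?b w1) \<oplus>\<^bsub>C\<^esub> \<chi> w2 \<otimes>\<^bsub>C\<^esub> \<beta> (?b w2)) = \<zero>\<^bsub>C\<^esub>"
  proof -
    have "w1 \<noteq> w" "w2 \<noteq> w" using False by auto
    then show ?thesis using e w(4) C.l_neg[OF term_closed[OF b(1)], of w] by simp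
  qed
  finally have z: "laurent_polynomial {w, w1, w2} ?b = \<zero>\<^bsub>C\<^esub>" .
  have "?b w1 = \<zero>\<^bsub>B\<^esub>" by (rule independent[OF _ _ _ z]) (use w b in auto)
  then show ?thesis using False by (simp split: if_splits)
qed

lemma chi_zero: "\<chi> (\<lambda>d. 0) = \<one>\<^bsub>C\<^esub>"
  unfolding chi_monomial by (rule C.monomial_zero)

lemma chi_power: "\<chi> w [^]\<^bsub>C\<^esub> n = \<chi> (\<lambda>d. int n * w d)"
proof (induction n)
  case 0
  then show ?case using chi_zero by simp
next
  case (Suc n)
  have "\<chi> w [^]\<^bsub>C\<^esub> Suc n = \<chi> (\<lambda>d. int n * w d) \<otimes>\<^bsub>C\<^esub> \<chi> w" using Suc by simp
  also have "\<dots> = \<chi> (\<lambda>d. int n * w d + w d)" by (rule chi_add[symmetric])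
  also have "(\<lambda>d. int n * w d + w d) = (\<lambda>d. int (Suc n) * w d)" by (simp add: algebra_simps)
  finally show ?case .
qed

lemma term_mult:
  assumes "b \<in> carrier B" "b' \<in> carrier B"
  shows "(\<chi> w \<otimes>\<^bsub>C\<^esub> \<beta> b) \<otimes>\<^bsub>C\<^esub> (\<chi> w' \<otimes>\<^bsub>C\<^esub> \<beta> b') = \<chi> (\<lambda>d. w d + w' d) \<otimes>\<^bsub>C\<^esub> \<beta> (b \<otimes>\<^bsub>B\<^esub> b')"
  unfolding chi_add ring_hom_mult[OF beta_hom assms]
  using chi_closed beta_closed[OF assms(1)] beta_closed[OF assms(2)] by (simp add: C.m_ac)

lemma term_monomial:
  assumes "finite J" "\<And>i. i \<in> J \<Longrightarrow> 0 \<le> p i" "b \<in> J \<rightarrow> carrier B"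
  shows "monomial C J (\<lambda>i. \<chi> (w i) \<otimes>\<^bsub>C\<^esub> \<beta> (b i)) p = \<chi> (\<lambda>d. \<Sum>i\<in>J. p i * w i d) \<otimes>\<^bsub>C\<^esub> \<beta> (monomial B J b p)"
  using assms
proof (induction J)
  case empty
  then show ?case using chi_zero ring_hom_one[OF beta_hom] by (simp add: monomial_def)
next
  case (insert i J)
  let ?v = "\<lambda>i. \<chi> (w i) \<otimes>\<^bsub>C\<^esub> \<beta> (b i)"
  have bi: "b i \<in> carrier B" using insert.prems(2) by blast
  have v: "?v \<in> insert i J \<rightarrow> carrier C" using term_closed insert.prems(2) by blast
  have mb: "monomial B J b p \<in> carrier B" by (rule B.monomial_nonneg(2)) (use insert.prems in auto)
  have pb: "b i [^]\<^bsub>B\<^esub> nat (p i) \<in> carrier B" using B.nat_pow_closed[OF bi] by (simp del: pow_nat)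
  have "?v i [^]\<^bsub>C\<^esub> nat (p i) = \<chi> (w i) [^]\<^bsub>C\<^esub> nat (p i) \<otimes>\<^bsub>C\<^esub> \<beta> (b i) [^]\<^bsub>C\<^esub> nat (p i)"
    by (rule C.nat_pow_distrib[OF chi_closed beta_closed[OF bi]])
  also have "\<dots> = \<chi> (\<lambda>d. int (nat (p i)) * w i d) \<otimes>\<^bsub>C\<^esub> \<beta> (b i [^]\<^bsub>B\<^esub> nat (p i))"
    unfolding chi_power ring_hom_nat_pow[OF beta_hom B.ring_axioms C.ring_axioms bi] ..
  finally have e: "?v i [^]\<^bsub>C\<^esub> nat (p i) = \<chi> (\<lambda>d. p i * w i d) \<otimes>\<^bsub>C\<^esub> \<beta> (b i [^]\<^bsub>B\<^esub> nat (p i))"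
    using insert.prems(1)[of i] by (simp del: pow_nat)
  have IH: "monomial C J ?v p = \<chi> (\<lambda>d. \<Sum>i\<in>J. p i * w i d) \<otimes>\<^bsub>C\<^esub> \<beta> (monomial B J b p)"
    by (rule insert.IH) (use insert.prems in auto)
  have "monomial C (insert i J) ?v p = ?v i [^]\<^bsub>C\<^esub> nat (p i) \<otimes>\<^bsub>C\<^esub> monomial C J ?v p"
    using insert.hyps insert.prems(1) v by (rule C.monomial_insert_nonneg)
  also have "\<dots> = \<chi> (\<lambda>d. p i * w i d + (\<Sum>i\<in>J. p i * w i d)) \<otimes>\<^bsub>C\<^esub> \<beta> (b i [^]\<^bsub>B\<^esub> nat (p i) \<otimes>\<^bsub>B\<^esub> monomial B J b p)"
    unfolding e IH by (rule term_mult[OF pb mb])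
  also have "b i [^]\<^bsub>B\<^esub> nat (p i) \<otimes>\<^bsub>B\<^esub> monomial B J b p = monomial B (insert i J) b p"
    using insert.hyps insert.prems by (rule B.monomial_insert_nonneg[symmetric])
  also have "(\<lambda>d. p i * w i d + (\<Sum>i\<in>J. p i * w i d)) = (\<lambda>d. \<Sum>i\<in>insert i J. p i * w i d)"
    using insert.hyps by simp
  finally show ?case .
qed

end

section \<open>Dominant morphisms and function fields\<close>

locale dominant_morphism = A: irreducible_space A + B: irreducible_space B
  for A :: "('p, 's) ringed_space" and B :: "('q, 'r) ringed_space" +
  fixes f :: "('p, 's, 'q, 'r) morph"
  assumes mor: "mor A B f"
    and dominant: "\<And>V. openin (Sp B) V \<Longrightarrow> V \<noteq> {} \<Longrightarrow> preim A f V \<noteq> {}"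
begin

text \<open>
  Two representatives of the same rational function on \<open>B\<close> agree on a smaller open subset, and by dominance its
  preimage contains the generic point of \<open>A\<close>.
\<close>

lemma ff_pull_germ:
  assumes V: "openin (Sp B) V" "V \<noteq> {}" and s: "s \<in> carrier (Sec B V)"
  shows "ff_pull A B f (ff_germ B V s) = ff_germ A (preim A f V) (pull f V s)"
  unfolding ff_pull_def
proof (rule the_equality)
  show "\<exists>V' s'. openin (Sp B) V' \<and> B.\<eta> \<in> V' \<and> s' \<in> carrier (Sec B V') \<and>
      ff_germ B V s = ff_germ B V' s' \<and> ff_germ A (preim A f V) (pull f V s) = ff_germ A (preim A f V') (pull f V' s')"
    using V s B.generic_in[OF V] by blast
  fix h assume "\<exists>V' s'. openin (Sp B) V' \<and> B.\<eta> \<in> V' \<and> s' \<in> carrier (Sec B V') \<and>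
      ff_germ B V s = ff_germ B V' s' \<and> h = ff_germ A (preim A f V') (pull f V' s')"
  then obtain V' s' where V': "openin (Sp B) V'" "B.\<eta> \<in> V'" and s': "s' \<in> carrier (Sec B V')"
    and e: "ff_germ B V s = ff_germ B V' s'" and h: "h = ff_germ A (preim A f V') (pull f V' s')" by blast
  obtain W where W: "openin (Sp B) W" "B.\<eta> \<in> W" "W \<subseteq> V" "W \<subseteq> V'" "Res B V W s = Res B V' W s'"
    by (rule B.germ_eqD[OF e V' s'])
  have Wne: "W \<noteq> {}" using W(2) by blast
  have eW: "A.\<eta> \<in> preim A f W" by (rule A.generic_in[OF mor_open[OF mor W(1)] dominant[OF W(1) Wne]])
  have "Res A (preim A f V') (preim A f W) (pull f V' s') = Res A (preim A f V) (preim A f W) (pull f V s)"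
    using mor_res[OF mor V(1) W(1,3) s] mor_res[OF mor V'(1) W(1,4) s'] W(5) by simp
  then show "h = ff_germ A (preim A f V) (pull f V s)"
    unfolding h
    by (intro A.germ_eqI[OF mor_open[OF mor V'(1)] mor_open[OF mor V(1)] mor_open[OF mor W(1)]
          preim_mono[OF W(4)] preim_mono[OF W(3)] eW])
      (use ring_hom_closed[OF mor_hom[OF mor V(1)] s] ring_hom_closed[OF mor_hom[OF mor V'(1)] s'] in auto)
qed

lemma ff_carrierE:
  assumes "k \<in> carrier (function_field B)"
  obtains V s where "openin (Sp B) V" "V \<noteq> {}" "s \<in> carrier (Sec B V)" "k = ff_germ B V s"
  using B.stalk_carrierE[OF assms[unfolded function_field_def]] by blast

lemma ff_pull_hom: "ff_pull A B f \<in> ring_hom (function_field B) (function_field A)"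
proof -
  have germ_mem: "ff_germ A (preim A f V) (pull f V s) \<in> carrier (function_field A)"
    if "openin (Sp B) V" "V \<noteq> {}" "s \<in> carrier (Sec B V)" for V s
    by (rule ring_hom_closed[OF A.ff_hom[OF mor_open[OF mor that(1)] dominant[OF that(1,2)]]
          ring_hom_closed[OF mor_hom[OF mor that(1)] that(3)]])
  have common: "\<exists>W s t. openin (Sp B) W \<and> W \<noteq> {} \<and> s \<in> carrier (Sec B W) \<and> t \<in> carrier (Sec B W) \<and>
      k = ff_germ B W s \<and> l = ff_germ B W t"
    if k: "k \<in> carrier (function_field B)" and l: "l \<in> carrier (function_field B)" for k l
  proof -
    obtain V s where V: "openin (Sp B) V" "V \<noteq> {}" and s: "s \<in> carrier (Sec B V)" "k = ff_germ B V s"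
      using ff_carrierE[OF k] .
    obtain V' t where V': "openin (Sp B) V'" "V' \<noteq> {}" and t: "t \<in> carrier (Sec B V')" "l = ff_germ B V' t"
      using ff_carrierE[OF l] .
    let ?W = "V \<inter> V'"
    have o: "openin (Sp B) ?W" using V(1) V'(1) by (rule openin_Int)
    have ne: "?W \<noteq> {}" using B.generic_in[OF V] B.generic_in[OF V'] by blast
    have "k = ff_germ B ?W (Res B V ?W s)" "l = ff_germ B ?W (Res B V' ?W t)"
      using B.ff_res[OF V(1) o _ ne s(1)] B.ff_res[OF V'(1) o _ ne t(1)] s(2) t(2) by auto
    moreover have "Res B V ?W s \<in> carrier (Sec B ?W)" by (rule B.res_closed[OF V(1) o _ s(1)]) blast
    moreover have "Res B V' ?W t \<in> carrier (Sec B ?W)" by (rule B.res_closed[OF V'(1) o _ t(1)]) blast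
    ultimately show ?thesis using o ne by blast
  qed
  show ?thesis
  proof (rule ring_hom_memI)
    fix k assume "k \<in> carrier (function_field B)"
    then obtain V s where V: "openin (Sp B) V" "V \<noteq> {}" and s: "s \<in> carrier (Sec B V)" "k = ff_germ B V s"
      using ff_carrierE by blast
    show "ff_pull A B f k \<in> carrier (function_field A)"
      unfolding s(2) ff_pull_germ[OF V s(1)] by (rule germ_mem[OF V s(1)])
    fix l assume "l \<in> carrier (function_field B)"
    then obtain W s t where W: "openin (Sp B) W" "W \<noteq> {}" and s: "s \<in> carrier (Sec B W)" and t: "t \<in> carrier (Sec B W)"
      and kl: "k = ff_germ B W s" "l = ff_germ B W t"
      using common[OF \<open>k \<in> carrier (function_field B)\<close>] by blast
    interpret R: cring "Sec B W" by (rule B.sec_cring[OF W(1)])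
    note hB = B.ff_hom[OF W] and hA = A.ff_hom[OF mor_open[OF mor W(1)] dominant[OF W]] and h = mor_hom[OF mor W(1)]
    have c: "pull f W s \<in> carrier (Sec A (preim A f W))" "pull f W t \<in> carrier (Sec A (preim A f W))"
      using ring_hom_closed[OF h] s t by auto
    show "ff_pull A B f (k \<otimes>\<^bsub>function_field B\<^esub> l) = ff_pull A B f k \<otimes>\<^bsub>function_field A\<^esub> ff_pull A B f l"
      unfolding kl ring_hom_mult[OF hB s t, symmetric] ff_pull_germ[OF W s] ff_pull_germ[OF W t]
        ff_pull_germ[OF W R.m_closed[OF s t]] ring_hom_mult[OF h s t] ring_hom_mult[OF hA c] ..
    show "ff_pull A B f (k \<oplus>\<^bsub>function_field B\<^esub> l) = ff_pull A B f k \<oplus>\<^bsub>function_field A\<^esub> ff_pull A B f l"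
      unfolding kl ring_hom_add[OF hB s t, symmetric] ff_pull_germ[OF W s] ff_pull_germ[OF W t]
        ff_pull_germ[OF W R.a_closed[OF s t]] ring_hom_add[OF h s t] ring_hom_add[OF hA c] ..
  next
    have ne: "points B \<noteq> {}" using B.eta_points by blast
    note W = B.openin_points ne
    interpret R: cring "glob B" by (rule B.sec_cring[OF W(1)])
    note hB = B.ff_hom[OF W] and hA = A.ff_hom[OF mor_open[OF mor W(1)] dominant[OF W]] and h = mor_hom[OF mor W(1)]
    show "ff_pull A B f \<one>\<^bsub>function_field B\<^esub> = \<one>\<^bsub>function_field A\<^esub>"
      unfolding ring_hom_one[OF hB, symmetric] ff_pull_germ[OF W R.one_closed] ring_hom_one[OF h] ring_hom_one[OF hA] ..
  qed
qed

lemma ff_pull_inj: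
  assumes "field (function_field B)" and k: "k \<in> carrier (function_field B)" "l \<in> carrier (function_field B)"
    and e: "ff_pull A B f k = ff_pull A B f l"
  shows "k = l"
proof (rule ccontr)
  assume "k \<noteq> l"
  interpret KB: field "function_field B" by fact
  interpret KA: cring "function_field A" by (rule A.ff_cring)
  let ?d = "k \<ominus>\<^bsub>function_field B\<^esub> l"
  have "?d \<in> Units (function_field B)" using k \<open>k \<noteq> l\<close> KB.field_Units by simp
  then have "ff_pull A B f ?d \<in> Units (function_field A)" by (rule ring_hom_Units[OF ff_pull_hom])
  moreover have "ff_pull A B f ?d = \<zero>\<^bsub>function_field A\<^esub>"
    unfolding ring_hom_minus[OF ff_pull_hom KB.is_cring KA.is_cring k] e
    using ring_hom_closed[OF ff_pull_hom k(2)] by simp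
  ultimately show False using A.zero_not_unit[OF A.eta_points] unfolding function_field_def by simp
qed

end


section \<open>Homogeneous functions\<close>

locale lifting_space =
  fixes D :: "'v set"
    and T :: "('t, 'u) ringed_space" and x :: "'v \<Rightarrow> 'u"
    and Y :: "('q, 'r) ringed_space"
    and P :: "('t, 'u, 'q, 'r, 'z, 'w) product_data"
    and \<XX> :: "('p, 's) ringed_space"
    and \<phi> :: "('z, 'w, 'p, 's) morph"
    and Xf :: "'v \<Rightarrow> 's"
    and PP :: "('t, 'u, 'z, 'w, 'i, 'j) product_data"
    and Q :: "('t, 'u, 'p, 's, 'k, 'l) product_data"
    and QQ :: "('t, 'u, 'k, 'l, 'm, 'n) product_data"
    and a :: "('k, 'l, 'p, 's) morph"
    and \<iota> :: "('q, 'r, 'z, 'w) morph"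
  assumes homog_suitable: "homogeneously_suitable D T x Y P \<XX> \<phi> Xf PP Q QQ a"
    and unit_section: "is_unit_section D T x Y P \<iota>"
begin

lemma suitable: "suitable_for_lifting D T x Y P \<XX> \<phi> Xf"
  using homog_suitable unfolding homogeneously_suitable_def by blast

lemma torus: "torus D T x" and product_P: "is_product T Y P" and irreducible_Y: "irreducible_scheme Y"
  and noetherian_X: "noetherian_scheme \<XX>" and normal_X: "normal_scheme \<XX>" and integral_X: "integral_scheme \<XX>"
  and phi_open: "open_immersion (tot P) \<XX> \<phi>"
  using suitable unfolding suitable_for_lifting_def by simp_all

lemma divisors: "d \<in> D \<Longrightarrow> Xf d \<in> carrier (glob \<XX>) \<and> irreducible_subset \<XX> (zero_locus \<XX> (Xf d)) \<and>
    codim_one_point \<XX> (generic_point \<XX> (zero_locus \<XX> (Xf d)))"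
  using suitable unfolding suitable_for_lifting_def by blast

lemma valuation_delta: "d1 \<in> D \<Longrightarrow> d2 \<in> D \<Longrightarrow>
    lifting_valuation \<XX> Xf d1 (ff_of \<XX> (Xf d2)) = (if d1 = d2 then 1 else 0)"
  using suitable unfolding suitable_for_lifting_def by blast

lemma phi_Xf: "d \<in> D \<Longrightarrow> gpull \<XX> \<phi> (Xf d) = gpull T (pr1 P) (x d)"
  using suitable unfolding suitable_for_lifting_def by blast

lemma Xf_closed: "d \<in> D \<Longrightarrow> Xf d \<in> carrier (glob \<XX>)" using divisors by blast

lemma products: "is_product T (tot P) PP" "is_product T \<XX> Q" "torus_action D T x \<XX> Q QQ a"
  using homog_suitable unfolding homogeneously_suitable_def by simp_all

sublocale P: torus_product D T x Y P by (rule torus_product.intro[OF torus product_P])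
sublocale PP: torus_product D T x "tot P" PP by (rule torus_product.intro[OF torus products(1)])
sublocale Q: torus_product D T x \<XX> Q by (rule torus_product.intro[OF torus products(2)])

lemma phi: "mor (tot P) \<XX> \<phi>" using phi_open unfolding open_immersion_def by blast
lemma action: "mor (tot Q) \<XX> a" using products(3) unfolding torus_action_def by blast

sublocale XX: integral_space \<XX> by unfold_locales (rule integral_X)
sublocale XX: normal_integral_space \<XX> by unfold_locales (rule normal_X)
sublocale YY: irreducible_space Y
  using irreducible_Y unfolding irreducible_scheme_def by unfold_locales blast

end

locale lifting_chart = lifting_space D T x Y P \<XX> \<phi> Xf PP Q QQ a \<iota>
  for D :: "'v set"
    and T :: "('t, 'u) ringed_space" and x :: "'v \<Rightarrow> 'u"
    and Y :: "('q, 'r) ringed_space"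
    and P :: "('t, 'u, 'q, 'r, 'z, 'w) product_data"
    and \<XX> :: "('p, 's) ringed_space"
    and \<phi> :: "('z, 'w, 'p, 's) morph"
    and Xf :: "'v \<Rightarrow> 's"
    and PP :: "('t, 'u, 'z, 'w, 'i, 'j) product_data"
    and Q :: "('t, 'u, 'p, 's, 'k, 'l) product_data"
    and QQ :: "('t, 'u, 'k, 'l, 'm, 'n) product_data"
    and a :: "('k, 'l, 'p, 's) morph"
    and \<iota> :: "('q, 'r, 'z, 'w) morph" +
  fixes V :: "'q set"
  assumes V: "affine_open Y V"
begin

sublocale c: torus_chart D T x Y P V
  by (rule torus_chart.intro[OF P.torus_product_axioms]) (rule torus_chart_axioms.intro[OF V])

\<comment> \<open>the chart \<open>T \<times> (T \<times> V)\<close> on which the two sides of equivariance are compared\<close>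
sublocale cc: torus_chart D T x "tot P" PP c.W
  by (rule torus_chart.intro[OF PP.torus_product_axioms]) (rule torus_chart_axioms.intro[OF c.W_affine])

abbreviation resW where "resW s \<equiv> Res (tot P) (points (tot P)) c.W s"
abbreviation resV where "resV s \<equiv> Res Y (points Y) V s"

lemma alpha_x: "c.\<alpha> t = resW (gpull T (pr1 P) t)"
  by (rule c.\<alpha>_def)

lemma restrict_unit_section:
  "mor Y (tot P) \<iota>" "preim Y \<iota> c.W = V"
  "b \<in> carrier c.B \<Longrightarrow> pull \<iota> c.W (c.\<chi> w \<otimes>\<^bsub>c.C\<^esub> c.\<beta> b) = b"
proof -
  obtain e where e: "torus_unit D T x Y e" and pair: "is_pair Y T Y P e mor_id \<iota>"
    using unit_section unfolding is_unit_section_def by blast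
  show m: "mor Y (tot P) \<iota>" using pair unfolding is_pair_def by blast
  have e1: "mor_eq Y T (mor_comp (tot P) (pr1 P) \<iota>) e" and e2: "mor_eq Y Y (mor_comp (tot P) (pr2 P) \<iota>) mor_id"
    using pair unfolding is_pair_def by blast+
  have pt: "pt (pr2 P) (pt \<iota> y) = y" if "y \<in> points Y" for y
    using mor_eq_pt[OF e2 that] unfolding mor_comp_def mor_id_def by simp
  show p: "preim Y \<iota> c.W = V"
    unfolding preim_def using pt mor_point[OF m] openin_subset[OF c.V_open] by auto
  assume b: "b \<in> carrier c.B"
  have h: "pull \<iota> c.W \<in> ring_hom c.C c.B" using mor_hom[OF m c.W_open] unfolding p .
  have x: "pull \<iota> c.W (c.\<alpha> (x d)) = \<one>\<^bsub>c.B\<^esub>" if d: "d \<in> D" for d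
  proof -
    have xc: "x d \<in> carrier (glob T)" using P.x_units d P.A.Units_closed by blast
    have pc: "gpull T (pr1 P) (x d) \<in> carrier (glob (tot P))" by (rule ring_hom_closed[OF gpull_hom[OF P.pr1] xc])
    have "gpull (tot P) \<iota> (gpull T (pr1 P) (x d)) = gpull T e (x d)" by (rule gpull_comp[OF P.pr1 e1 xc])
    also have "\<dots> = \<one>\<^bsub>glob Y\<^esub>" using e d unfolding torus_unit_def by blast
    finally have "pull \<iota> c.W (c.\<alpha> (x d)) = resV \<one>\<^bsub>glob Y\<^esub>"
      unfolding alpha_x gpull_res[OF m c.W_open pc] p by simp
    also have "\<dots> = \<one>\<^bsub>c.B\<^esub>"
      by (rule ring_hom_one[OF P.S.res_hom[OF P.S.openin_points c.V_open openin_subset[OF c.V_open]]])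
    finally show ?thesis .
  qed
  have "pull \<iota> c.W (c.\<chi> w) = monomial c.B D (\<lambda>d. pull \<iota> c.W (c.\<alpha> (x d))) w"
    unfolding c.chi_monomial by (rule monomial_hom[OF h c.C.is_cring c.B.is_cring c.alpha_x_units])
  also have "\<dots> = monomial c.B D (\<lambda>d. \<one>\<^bsub>c.B\<^esub>) w"
    by (rule c.B.monomial_cong) (use x in auto)
  also have "\<dots> = \<one>\<^bsub>c.B\<^esub>" by (rule c.B.monomial_one)
  finally have 1: "pull \<iota> c.W (c.\<chi> w) = \<one>\<^bsub>c.B\<^esub>" .
  have 2: "pull \<iota> c.W (c.\<beta> b) = b"
    using pull_comp[OF e2 c.V_open b] unfolding mor_id_def by simp
  show "pull \<iota> c.W (c.\<chi> w \<otimes>\<^bsub>c.C\<^esub> c.\<beta> b) = b"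
    unfolding ring_hom_mult[OF h c.chi_closed c.beta_closed[OF b]] 1 2 using b by simp
qed

lemma restriction_res:
  assumes f: "f \<in> carrier (glob \<XX>)"
  shows "resV (restriction P \<XX> \<phi> \<iota> f) = pull \<iota> c.W (resW (gpull \<XX> \<phi> f))"
    "restriction P \<XX> \<phi> \<iota> f \<in> carrier (glob Y)"
proof -
  have fc: "gpull \<XX> \<phi> f \<in> carrier (glob (tot P))" by (rule ring_hom_closed[OF gpull_hom[OF phi] f])
  have r: "restriction P \<XX> \<phi> \<iota> f = gpull (tot P) \<iota> (gpull \<XX> \<phi> f)"
    unfolding restriction_def mor_comp_def by (simp add: preim_points[OF phi])
  show "resV (restriction P \<XX> \<phi> \<iota> f) = pull \<iota> c.W (resW (gpull \<XX> \<phi> f))"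
    unfolding r gpull_res[OF restrict_unit_section(1) c.W_open fc] restrict_unit_section(2) ..
  show "restriction P \<XX> \<phi> \<iota> f \<in> carrier (glob Y)"
    unfolding r by (rule ring_hom_closed[OF gpull_hom[OF restrict_unit_section(1)] fc])
qed

text \<open>
  Write the pullback of \<open>f\<close> to \<open>T \<times> V\<close> as a Laurent polynomial in the \<open>x d\<close> with coefficients on
  \<open>V\<close>. The translation action multiplies the monomial of exponent \<open>m\<close> by the character \<open>m\<close>, and the
  function by the character \<open>w\<close>; so only the exponent \<open>w\<close> occurs, and its coefficient is the
  restriction of \<open>f\<close> to the unit section.
\<close>

lemma homogeneous_pullback:
  assumes f: "f \<in> carrier (glob \<XX>)" and w: "w \<in> lattice_on D" and hom: "homogeneous D T x \<XX> Q a w f"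
  shows "resW (gpull \<XX> \<phi> f) = c.\<chi> w \<otimes>\<^bsub>c.C\<^esub> c.\<beta> (resV (restriction P \<XX> \<phi> \<iota> f))"
proof -
  obtain k l where k: "is_mult_first D T x Y P PP k" and l: "is_id_times T (tot P) \<XX> PP Q \<phi> l"
    and kl: "mor_eq (tot PP) \<XX> (mor_comp (tot P) \<phi> k) (mor_comp (tot Q) a l)"
    using homog_suitable unfolding homogeneously_suitable_def by blast
  obtain \<mu> where mu: "torus_mult D T x (tot PP) (pr1 PP) (mor_comp (tot P) (pr1 P) (pr2 PP)) \<mu>"
    and pk: "is_pair (tot PP) T Y P \<mu> (mor_comp (tot P) (pr2 P) (pr2 PP)) k"
    using k unfolding is_mult_first_def by blast
  have mk: "mor (tot PP) (tot P) k" and k1: "mor_eq (tot PP) T (mor_comp (tot P) (pr1 P) k) \<mu>"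
    and k2: "mor_eq (tot PP) Y (mor_comp (tot P) (pr2 P) k) (mor_comp (tot P) (pr2 P) (pr2 PP))"
    using pk unfolding is_pair_def by blast+
  have ml: "mor (tot PP) (tot Q) l" and l1: "mor_eq (tot PP) T (mor_comp (tot Q) (pr1 Q) l) (pr1 PP)"
    and l2: "mor_eq (tot PP) \<XX> (mor_comp (tot Q) (pr2 Q) l) (mor_comp (tot P) \<phi> (pr2 PP))"
    using l unfolding is_id_times_def is_pair_def by blast+
  have self: "mor_eq (tot PP) Z g g" for Z :: "('c, 'd) ringed_space" and g unfolding mor_eq_def by blast
  have "pt (pr2 P) (pt k z) = pt (pr2 P) (pt (pr2 PP) z)" if "z \<in> points (tot PP)" for z
    using mor_eq_pt[OF k2 that] unfolding mor_comp_def by simp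
  then have pW: "preim (tot PP) k c.W = cc.W"
    unfolding preim_def using mor_point[OF mk] mor_point[OF PP.pr2] by auto
  let ?k = "pull k c.W" and ?res = "Res (tot PP) (points (tot PP)) cc.W"
  have hk: "?k \<in> ring_hom c.C cc.C" using mor_hom[OF mk c.W_open] unfolding pW .
  have hres: "?res \<in> ring_hom (glob (tot PP)) cc.C"
    by (rule PP.R.res_hom[OF PP.R.openin_points cc.W_open preim_subset])
  have k_res: "?k (resW s) = ?res (gpull (tot P) k s)" if "s \<in> carrier (glob (tot P))" for s
    using gpull_res[OF mk c.W_open that] unfolding pW .
  have b_res: "cc.\<beta> (resW s) = ?res (gpull (tot P) (pr2 PP) s)" if "s \<in> carrier (glob (tot P))" for s
    using gpull_res[OF PP.pr2 c.W_open that] .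

  \<comment> \<open>the multiplication of the torus pulls the character \<open>x d\<close> back to \<open>x d \<otimes> x d\<close>\<close>
  have alpha: "?k (c.\<alpha> (x d)) = cc.\<alpha> (x d) \<otimes>\<^bsub>cc.C\<^esub> cc.\<beta> (c.\<alpha> (x d))" if d: "d \<in> D" for d
  proof -
    have xc: "x d \<in> carrier (glob T)" using P.x_units d P.A.Units_closed by blast
    let ?\<xi> = "gpull T (pr1 P) (x d)"
    have pc: "?\<xi> \<in> carrier (glob (tot P))" by (rule ring_hom_closed[OF gpull_hom[OF P.pr1] xc])
    have c1: "gpull T (pr1 PP) (x d) \<in> carrier (glob (tot PP))" by (rule ring_hom_closed[OF gpull_hom[OF PP.pr1] xc])
    have c2: "gpull (tot P) (pr2 PP) ?\<xi> \<in> carrier (glob (tot PP))" by (rule ring_hom_closed[OF gpull_hom[OF PP.pr2] pc])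
    have "gpull (tot P) k ?\<xi> = gpull T \<mu> (x d)" by (rule gpull_comp[OF P.pr1 k1 xc])
    also have "\<dots> = gpull T (pr1 PP) (x d) \<otimes>\<^bsub>glob (tot PP)\<^esub> gpull T (mor_comp (tot P) (pr1 P) (pr2 PP)) (x d)"
      using mu d unfolding torus_mult_def by blast
    also have "gpull T (mor_comp (tot P) (pr1 P) (pr2 PP)) (x d) = gpull (tot P) (pr2 PP) ?\<xi>"
      by (rule gpull_comp[OF P.pr1 self xc, symmetric])
    finally show ?thesis
      unfolding alpha_x k_res[OF pc] b_res[OF pc] cc.\<alpha>_def using ring_hom_mult[OF hres c1 c2] by simp
  qed
  have hcb: "(\<lambda>d. cc.\<beta> (c.\<alpha> (x d))) \<in> D \<rightarrow> Units cc.C"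
    using ring_hom_Units[OF cc.beta_hom] c.alpha_x_units by blast
  have chi: "?k (c.\<chi> m) = cc.\<chi> m \<otimes>\<^bsub>cc.C\<^esub> cc.\<beta> (c.\<chi> m)" for m
  proof -
    have "?k (c.\<chi> m) = monomial cc.C D (\<lambda>d. ?k (c.\<alpha> (x d))) m"
      unfolding c.chi_monomial by (rule monomial_hom[OF hk c.C.is_cring cc.C.is_cring c.alpha_x_units])
    also have "\<dots> = monomial cc.C D (\<lambda>d. cc.\<alpha> (x d) \<otimes>\<^bsub>cc.C\<^esub> cc.\<beta> (c.\<alpha> (x d))) m"
    proof (rule cc.C.monomial_cong)
      show "(\<lambda>d. cc.\<alpha> (x d) \<otimes>\<^bsub>cc.C\<^esub> cc.\<beta> (c.\<alpha> (x d))) \<in> D \<rightarrow> Units cc.C"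
        using cc.alpha_x_units hcb cc.C.Units_m_closed by blast
    qed (use alpha in auto)
    also have "\<dots> = monomial cc.C D (\<lambda>d. cc.\<alpha> (x d)) m \<otimes>\<^bsub>cc.C\<^esub> monomial cc.C D (\<lambda>d. cc.\<beta> (c.\<alpha> (x d))) m"
      by (rule cc.C.monomial_distrib[OF cc.alpha_x_units hcb])
    also have "monomial cc.C D (\<lambda>d. cc.\<beta> (c.\<alpha> (x d))) m = cc.\<beta> (c.\<chi> m)"
      unfolding c.chi_monomial by (rule monomial_hom[OF cc.beta_hom c.C.is_cring cc.C.is_cring c.alpha_x_units, symmetric])
    finally show ?thesis unfolding cc.chi_monomial .
  qed
  have beta: "?k (c.\<beta> b) = cc.\<beta> (c.\<beta> b)" if "b \<in> carrier c.B" for b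
    using pull_comp[OF k2 c.V_open that]
      pull_comp[OF self[of Y "mor_comp (tot P) (pr2 P) (pr2 PP)"] c.V_open that] by (simp only:)
  have summand: "?k (c.\<chi> m \<otimes>\<^bsub>c.C\<^esub> c.\<beta> b) = cc.\<chi> m \<otimes>\<^bsub>cc.C\<^esub> cc.\<beta> (c.\<chi> m \<otimes>\<^bsub>c.C\<^esub> c.\<beta> b)" if b: "b \<in> carrier c.B" for m b
    unfolding ring_hom_mult[OF hk c.chi_closed c.beta_closed[OF b]] chi beta[OF b]
      ring_hom_mult[OF cc.beta_hom c.chi_closed c.beta_closed[OF b]]
    by (rule cc.C.m_assoc) (use cc.chi_closed cc.beta_closed c.chi_closed c.beta_closed b in blast)+

  let ?f = "gpull \<XX> \<phi> f" and ?\<omega> = "monomial (glob T) D x w"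
  let ?r = "resW ?f"
  have fc: "?f \<in> carrier (glob (tot P))" by (rule ring_hom_closed[OF gpull_hom[OF phi] f])
  have rc: "?r \<in> carrier c.C" by (rule P.R.res_closed[OF P.R.openin_points c.W_open preim_subset fc])
  have oc: "?\<omega> \<in> carrier (glob T)" using P.A.monomial_unit[OF P.x_units] by blast
  \<comment> \<open>equivariance of \<open>\<phi>\<close> turns the homogeneity of \<open>f\<close> into a scaling of its pullback by the character \<open>w\<close>\<close>
  have wr: "?k ?r = cc.\<chi> w \<otimes>\<^bsub>cc.C\<^esub> cc.\<beta> ?r"
  proof -
    let ?A = "gpull T (pr1 Q) ?\<omega>" and ?B = "gpull \<XX> (pr2 Q) f"
    have ab: "?A \<in> carrier (glob (tot Q))" "?B \<in> carrier (glob (tot Q))"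
      using ring_hom_closed[OF gpull_hom[OF Q.pr1] oc] ring_hom_closed[OF gpull_hom[OF Q.pr2] f] .
    have c1: "gpull T (pr1 PP) ?\<omega> \<in> carrier (glob (tot PP))" by (rule ring_hom_closed[OF gpull_hom[OF PP.pr1] oc])
    have c2: "gpull (tot P) (pr2 PP) ?f \<in> carrier (glob (tot PP))" by (rule ring_hom_closed[OF gpull_hom[OF PP.pr2] fc])
    have "gpull (tot P) k ?f = gpull \<XX> (mor_comp (tot Q) a l) f" by (rule gpull_comp[OF phi kl f])
    also have "\<dots> = gpull (tot Q) l (gpull \<XX> a f)" by (rule gpull_comp[OF action self f, symmetric])
    also have "\<dots> = gpull (tot Q) l (?A \<otimes>\<^bsub>glob (tot Q)\<^esub> ?B)" using hom unfolding homogeneous_def by simp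
    also have "\<dots> = gpull (tot Q) l ?A \<otimes>\<^bsub>glob (tot PP)\<^esub> gpull (tot Q) l ?B"
      by (rule ring_hom_mult[OF gpull_hom[OF ml] ab])
    also have "gpull (tot Q) l ?A = gpull T (pr1 PP) ?\<omega>" by (rule gpull_comp[OF Q.pr1 l1 oc])
    also have "gpull (tot Q) l ?B = gpull \<XX> (mor_comp (tot P) \<phi> (pr2 PP)) f" by (rule gpull_comp[OF Q.pr2 l2 f])
    also have "\<dots> = gpull (tot P) (pr2 PP) ?f" by (rule gpull_comp[OF phi self f, symmetric])
    finally show ?thesis
      unfolding k_res[OF fc] b_res[OF fc] cc.\<chi>_def cc.\<alpha>_def using ring_hom_mult[OF hres c1 c2] by simp
  qed

  \<comment> \<open>comparing coefficients over \<open>T \<times> V\<close>: the coefficient of the character \<open>w\<close> is the whole function\<close>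
  obtain M b where M: "finite M" "M \<subseteq> lattice_on D" and b: "b \<in> M \<rightarrow> carrier c.B" and r: "?r = c.laurent_polynomial M b"
    using c.expand[OF rc] .
  let ?N = "insert w M" and ?b = "\<lambda>m. if m \<in> M then b m else \<zero>\<^bsub>c.B\<^esub>"
  have N: "finite ?N" "?N \<subseteq> lattice_on D" using M w by auto
  have bc: "?b m \<in> carrier c.B" for m using b by auto
  have rN: "?r = c.laurent_polynomial ?N ?b" unfolding r by (rule c.laurent_extend[OF N(1) _ b]) blast
  have t: "(\<lambda>m. c.\<chi> m \<otimes>\<^bsub>c.C\<^esub> c.\<beta> (?b m)) \<in> ?N \<rightarrow> carrier c.C" using c.term_closed[OF bc] by blast
  have "cc.laurent_polynomial ?N (\<lambda>m. c.\<chi> m \<otimes>\<^bsub>c.C\<^esub> c.\<beta> (?b m)) = ?k ?r"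
  proof -
    have "?k ?r = (\<Oplus>\<^bsub>cc.C\<^esub>m\<in>?N. ?k (c.\<chi> m \<otimes>\<^bsub>c.C\<^esub> c.\<beta> (?b m)))"
      unfolding rN c.laurent_polynomial_def by (rule ring_hom_finsum[OF hk c.C.is_cring cc.C.is_cring t])
    also have "\<dots> = cc.laurent_polynomial ?N (\<lambda>m. c.\<chi> m \<otimes>\<^bsub>c.C\<^esub> c.\<beta> (?b m))"
      unfolding cc.laurent_polynomial_def
      by (rule cc.C.finsum_cong'[OF refl]) (use summand[OF bc] cc.term_closed[OF c.term_closed[OF bc]] in blast)+
    finally show ?thesis ..
  qed
  also have "\<dots> = cc.laurent_polynomial {w} (\<lambda>_. ?r)"
    unfolding wr cc.laurent_polynomial_def using cc.term_closed[OF rc] by simp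
  also have "\<dots> = cc.laurent_polynomial ?N (\<lambda>m. if m \<in> {w} then ?r else \<zero>\<^bsub>c.C\<^esub>)"
    by (rule cc.laurent_extend[OF N(1)]) (use rc in auto)
  finally have e: "cc.laurent_polynomial ?N (\<lambda>m. c.\<chi> m \<otimes>\<^bsub>c.C\<^esub> c.\<beta> (?b m)) = cc.laurent_polynomial ?N (\<lambda>m. if m \<in> {w} then ?r else \<zero>\<^bsub>c.C\<^esub>)" .
  have "c.\<chi> w \<otimes>\<^bsub>c.C\<^esub> c.\<beta> (?b w) = (if w \<in> {w} then ?r else \<zero>\<^bsub>c.C\<^esub>)"
    by (rule cc.laurent_eqD[OF N t _ e]) (use rc in auto)
  then have main: "?r = c.\<chi> w \<otimes>\<^bsub>c.C\<^esub> c.\<beta> (?b w)" by simp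
  have "resV (restriction P \<XX> \<phi> \<iota> f) = ?b w"
    unfolding restriction_res(1)[OF f] unfolding main by (rule restrict_unit_section(3)[OF bc])
  then show ?thesis using main by simp
qed

lemma Xf_pullback:
  assumes d: "d \<in> D"
  shows "resW (gpull \<XX> \<phi> (Xf d)) = c.\<chi> (\<lambda>i. if i = d then 1 else 0)"
proof -
  have "resW (gpull \<XX> \<phi> (Xf d)) = c.\<alpha> (x d)" unfolding phi_Xf[OF d] alpha_x ..
  also have "\<dots> = c.\<chi> (\<lambda>i. if i = d then 1 else 0)"
    unfolding c.chi_monomial
    by (rule c.C.monomial_power[symmetric, OF P.finite_D d]) (use c.alpha_x_units c.C.Units_closed in blast)
  finally show ?thesis .
qed

end

section \<open>Function fields of the lifting scheme\<close>

lemma bij_hom_domain: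
  assumes h: "h \<in> ring_hom R S" "bij_betw h (carrier R) (carrier S)" and R: "domain R" and S: "cring S"
  shows "domain S"
proof -
  interpret R: "domain" R by (rule R)
  interpret S: cring S by (rule S)
  have inj: "inj_on h (carrier R)" and sur: "h ` carrier R = carrier S" using h(2) by (auto simp: bij_betw_def)
  have z: "h \<zero>\<^bsub>R\<^esub> = \<zero>\<^bsub>S\<^esub>" by (rule ring_hom_zero[OF h(1) R.ring_axioms S.ring_axioms])
  show ?thesis
  proof (intro domain.intro domain_axioms.intro S)
    show "\<one>\<^bsub>S\<^esub> \<noteq> \<zero>\<^bsub>S\<^esub>"
    proof
      assume "\<one>\<^bsub>S\<^esub> = \<zero>\<^bsub>S\<^esub>"
      then have "h \<one>\<^bsub>R\<^esub> = h \<zero>\<^bsub>R\<^esub>" using z ring_hom_one[OF h(1)] by simp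
      then show False using inj_onD[OF inj] R.one_closed R.zero_closed R.one_not_zero by blast
    qed
    fix a b assume e: "a \<otimes>\<^bsub>S\<^esub> b = \<zero>\<^bsub>S\<^esub>" and a: "a \<in> carrier S" and b: "b \<in> carrier S"
    obtain a' where a': "a' \<in> carrier R" "a = h a'" using a sur by blast
    obtain b' where b': "b' \<in> carrier R" "b = h b'" using b sur by blast
    have "h (a' \<otimes>\<^bsub>R\<^esub> b') = h \<zero>\<^bsub>R\<^esub>" using ring_hom_mult[OF h(1) a'(1) b'(1)] a' b' e z by simp
    then have "a' \<otimes>\<^bsub>R\<^esub> b' = \<zero>\<^bsub>R\<^esub>" using inj_onD[OF inj] a' b' by simp
    then have "a' = \<zero>\<^bsub>R\<^esub> \<or> b' = \<zero>\<^bsub>R\<^esub>" using R.integral a'(1) b'(1) by blast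
    then show "a = \<zero>\<^bsub>S\<^esub> \<or> b = \<zero>\<^bsub>S\<^esub>" using a' b' z by blast
  qed
qed

context lifting_chart
begin

lemma W_nonempty: assumes "V \<noteq> {}" shows "c.W \<noteq> {}"
proof
  assume W: "c.W = {}"
  have "\<one>\<^bsub>c.C\<^esub> = \<zero>\<^bsub>c.C\<^esub>"
    by (rule P.R.sec_empty[folded W]) simp_all
  then have "c.\<beta> \<one>\<^bsub>c.B\<^esub> = \<zero>\<^bsub>c.C\<^esub>" using ring_hom_one[OF c.beta_hom] by simp
  then have "\<one>\<^bsub>c.B\<^esub> = \<zero>\<^bsub>c.B\<^esub>" by (rule c.beta_inj[OF c.B.one_closed])
  then show False using P.S.sec_nontrivial[OF c.V_open assms] by blast
qed

end

context lifting_space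
begin

lemma lifting_chartI: "affine_open Y V \<Longrightarrow> lifting_chart D T x Y P \<XX> \<phi> Xf PP Q QQ a \<iota> V"
  by (intro lifting_chart.intro lifting_space_axioms lifting_chart_axioms.intro)

lemma chart_exists:
  obtains V where "affine_open Y V" "V \<noteq> {}" "lifting_chart D T x Y P \<XX> \<phi> Xf PP Q QQ a \<iota> V"
proof -
  obtain V \<pi> where "affine_open Y V" "affine_chart Y V \<pi>" "YY.\<eta> \<in> V"
    using P.S.affine_nbhd_open[OF YY.eta_points] .
  then show ?thesis using that lifting_chartI by blast
qed

lemma phi_image:
  assumes N: "openin (Sp (tot P)) N"
  shows "openin (Sp \<XX>) (pt \<phi> ` N)" "preim (tot P) \<phi> (pt \<phi> ` N) = N"
proof -
  let ?O = "pt \<phi> ` points (tot P)"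
  have h: "homeomorphic_map (Sp (tot P)) (subtopology (Sp \<XX>) ?O) (pt \<phi>)" and O: "openin (Sp \<XX>) ?O"
    using phi_open unfolding open_immersion_def by blast+
  have "openin (subtopology (Sp \<XX>) ?O) (pt \<phi> ` N)"
    using homeomorphic_imp_open_map[OF h] N unfolding open_map_def by blast
  then show "openin (Sp \<XX>) (pt \<phi> ` N)" using openin_open_subtopology[OF O] by blast
  show "preim (tot P) \<phi> (pt \<phi> ` N) = N"
    using homeomorphic_imp_injective_map[OF h] openin_subset[OF N] unfolding preim_def inj_on_def by blast
qed

text \<open>
  Sections on a nonempty open subset of \<open>T \<times> Y\<close> are the sections on its open image in \<open>\<XX>\<close>, so they form a
  domain.
\<close>

lemma integral_P: "integral_scheme (tot P)"
  unfolding integral_scheme_def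
proof (intro conjI allI impI)
  show "cscheme (tot P)" by (rule P.R.cscheme)
  obtain V where V: "V \<noteq> {}" "lifting_chart D T x Y P \<XX> \<phi> Xf PP Q QQ a \<iota> V" using chart_exists .
  interpret V: lifting_chart D T x Y P \<XX> \<phi> Xf PP Q QQ a \<iota> V by (rule V(2))
  show "points (tot P) \<noteq> {}" using V.W_nonempty[OF V(1)] preim_subset[of "tot P" "pr2 P" V] by blast
  fix N assume N: "openin (Sp (tot P)) N \<and> N \<noteq> {}"
  then have o: "openin (Sp \<XX>) (pt \<phi> ` N)" and p: "preim (tot P) \<phi> (pt \<phi> ` N) = N" using phi_image by auto
  have sub: "pt \<phi> ` N \<subseteq> pt \<phi> ` points (tot P)" using openin_subset N by blast
  have "bij_betw (pull \<phi> (pt \<phi> ` N)) (carrier (Sec \<XX> (pt \<phi> ` N))) (carrier (Sec (tot P) (preim (tot P) \<phi> (pt \<phi> ` N))))"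
    using phi_open o sub unfolding open_immersion_def by blast
  then have bij: "bij_betw (pull \<phi> (pt \<phi> ` N)) (carrier (Sec \<XX> (pt \<phi> ` N))) (carrier (Sec (tot P) N))"
    unfolding p .
  show "domain (Sec (tot P) N)"
  proof (rule bij_hom_domain[OF _ bij])
    show "pull \<phi> (pt \<phi> ` N) \<in> ring_hom (Sec \<XX> (pt \<phi> ` N)) (Sec (tot P) N)" using mor_hom[OF phi o] unfolding p .
    show "domain (Sec \<XX> (pt \<phi> ` N))" by (rule XX.sec_domain[OF o]) (use N in blast)
    show "cring (Sec (tot P) N)" using P.R.sec_cring N by blast
  qed
qed

sublocale PI: integral_space "tot P" by unfold_locales (rule integral_P)

lemma points_P: "points (tot P) \<noteq> {}"
  using integral_P unfolding integral_scheme_def by blast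

sublocale phi: dominant_morphism "tot P" \<XX> \<phi>
proof (unfold_locales)
  show "mor (tot P) \<XX> \<phi>" by (rule phi)
  fix V assume V: "openin (Sp \<XX>) V" "V \<noteq> {}"
  have "openin (Sp \<XX>) (pt \<phi> ` points (tot P))" by (rule phi_image(1)) simp
  then have "V \<inter> pt \<phi> ` points (tot P) \<noteq> {}" using XX.opens_meet[OF V(1) _ V(2)] points_P by blast
  then show "preim (tot P) \<phi> V \<noteq> {}" unfolding preim_def by blast
qed

text \<open>
  A nonzero function \<open>f\<close> on an affine chart of \<open>Y\<close> pulls back to a nonzero function on the
  integral scheme \<open>T \<times> Y\<close>, so the image of the projection meets the locus where \<open>f\<close> is invertible.
\<close>

sublocale pr2: dominant_morphism "tot P" Y "pr2 P"
proof (unfold_locales)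
  show "mor (tot P) Y (pr2 P)" by (rule P.pr2)
  fix N assume N: "openin (Sp Y) N" "N \<noteq> {}"
  obtain y where y: "y \<in> N" using N(2) by blast
  have yp: "y \<in> points Y" using y openin_subset[OF N(1)] by blast
  obtain V \<pi> where V: "affine_open Y V" "affine_chart Y V \<pi>" "y \<in> V" using P.S.affine_nbhd_open[OF yp] .
  interpret U: affine_chart Y V \<pi> by (rule V(2))
  interpret V: lifting_chart D T x Y P \<XX> \<phi> Xf PP Q QQ a \<iota> V by (rule lifting_chartI[OF V(1)])
  obtain f where f: "f \<in> carrier U.A" "y \<in> U.Dist f" "U.Dist f \<subseteq> N" using U.Dist_basis[OF N(1) y V(3)] .
  interpret py: primeideal "\<pi> y" U.A by (rule U.pi_prime[OF V(3)])
  have "f \<noteq> \<zero>\<^bsub>U.A\<^esub>" using f(2) py.zero_closed by auto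
  then have bf: "V.c.\<beta> f \<noteq> \<zero>\<^bsub>V.c.C\<^esub>" using V.c.beta_inj[OF f(1)] by blast
  have Wne: "V.c.W \<noteq> {}" using V.W_nonempty V(3) by blast
  obtain \<rho> where rho: "affine_chart (tot P) V.c.W \<rho>" using P.R.affine_openE[OF V.c.W_affine] .
  interpret R: affine_chart "tot P" V.c.W \<rho> by (rule rho)
  have "primeideal {\<zero>\<^bsub>V.c.C\<^esub>} V.c.C"
    by (rule domain.zeroprimeideal[OF PI.sec_domain[OF V.c.W_open Wne]])
  then obtain z where z: "z \<in> V.c.W" "\<rho> z = {\<zero>\<^bsub>V.c.C\<^esub>}" by (rule R.pi_surj)
  have zp: "z \<in> points (tot P)" "pt (pr2 P) z \<in> V" using z(1) unfolding preim_def by auto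
  have "germ (tot P) z V.c.W (V.c.\<beta> f) \<in> Units (stalk (tot P) z)"
    using R.germ_unit_iff[OF z(1) V.c.beta_closed[OF f(1)]] z(2) bf by simp
  then have "germ Y (pt (pr2 P) z) V f \<in> Units (stalk Y (pt (pr2 P) z))"
    by (rule mor_local[OF P.pr2 zp(1) V.c.V_open zp(2) f(1)])
  then have "pt (pr2 P) z \<in> U.Dist f" using U.germ_unit_iff[OF zp(2) f(1)] zp(2) by blast
  then show "preim (tot P) (pr2 P) N \<noteq> {}" using f(3) zp(1) unfolding preim_def by blast
qed

text \<open>
  The description of \<open>1 \<otimes> g\<close> is unique because the pullback along \<open>\<phi>\<close> is injective on function fields.
\<close>

lemma one_tensorI:
  assumes "field (function_field \<XX>)" "h \<in> carrier (function_field \<XX>)"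
    and "ff_pull (tot P) \<XX> \<phi> h = ff_pull (tot P) Y (pr2 P) g"
  shows "one_tensor Y P \<XX> \<phi> g = h"
  unfolding one_tensor_def using assms phi.ff_pull_inj[OF assms(1)] by (intro the_equality) auto

lemma prime_divisorI:
  assumes "field (function_field \<XX>)" "d \<in> D"
  shows "prime_divisor \<XX> (Xf d)"
proof (intro prime_divisor.intro prime_divisor_axioms.intro)
  show "normal_integral_space \<XX>" by (rule XX.normal_integral_space_axioms)
  show "generic_point \<XX> (zero_locus \<XX> (Xf d)) \<noteq> generic_point \<XX> (points \<XX>)"
    using divisors[OF assms(2)] unfolding codim_one_point_def by blast
qed (use divisors[OF assms(2)] assms(1) noetherian_X in blast)+

lemma ff_of_unit:
  assumes "field (function_field \<XX>)" "f \<in> carrier (glob \<XX>)" "f \<noteq> \<zero>\<^bsub>glob \<XX>\<^esub>"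
  shows "ff_of \<XX> f \<in> Units (function_field \<XX>)"
proof -
  have ne: "points \<XX> \<noteq> {}" using XX.eta_points by blast
  have "ff_of \<XX> f \<in> carrier (function_field \<XX>)" by (rule ring_hom_closed[OF XX.ff_hom[OF Q.S.openin_points ne] assms(2)])
  moreover have "ff_of \<XX> f \<noteq> \<zero>\<^bsub>function_field \<XX>\<^esub>" using XX.ff_zero[OF Q.S.openin_points ne assms(2)] assms(3) by blast
  ultimately show ?thesis using field.field_Units[OF assms(1)] by blast
qed

lemma Xf_unit:
  assumes "field (function_field \<XX>)" "d \<in> D" shows "ff_of \<XX> (Xf d) \<in> Units (function_field \<XX>)"
  using ff_of_unit[OF assms(1) Xf_closed[OF assms(2)]] prime_divisor.e_nonzero[OF prime_divisorI[OF assms]] by blast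

text \<open>
  By \<open>homogeneous_pullback\<close>, the function \<open>f\<close> pulls back to \<open>x\<^sup>w\<close> times its restriction to \<open>Y\<close>, and \<open>Xf d\<close> pulls
  back to \<open>x d\<close>; so the monomial in the \<open>Xf d\<close> of exponent \<open>- w\<close> cancels the character.
\<close>

lemma one_tensor_restriction:
  assumes field: "field (function_field \<XX>)" and f: "f \<in> carrier (glob \<XX>)"
    and w: "w \<in> lattice_on D" and hom: "homogeneous D T x \<XX> Q a w f"
  shows "one_tensor Y P \<XX> \<phi> (ff_of Y (restriction P \<XX> \<phi> \<iota> f)) =
    ff_of \<XX> f \<otimes>\<^bsub>function_field \<XX>\<^esub> monomial (function_field \<XX>) D (\<lambda>d. ff_of \<XX> (Xf d)) (\<lambda>d. - w d)"
proof -
  obtain V where V: "V \<noteq> {}" "lifting_chart D T x Y P \<XX> \<phi> Xf PP Q QQ a \<iota> V" using chart_exists .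
  interpret V: lifting_chart D T x Y P \<XX> \<phi> Xf PP Q QQ a \<iota> V by (rule V(2))
  let ?KX = "function_field \<XX>" and ?KP = "function_field (tot P)"
  interpret KX: plain_cring ?KX by (rule plain_cring.intro[OF XX.ff_cring])
  interpret KP: plain_cring ?KP by (rule plain_cring.intro[OF PI.ff_cring])
  have neX: "points \<XX> \<noteq> {}" and neY: "points Y \<noteq> {}" using XX.eta_points YY.eta_points by blast+
  have Wne: "V.c.W \<noteq> {}" by (rule V.W_nonempty[OF V(1)])
  have gW: "ff_germ (tot P) V.c.W \<in> ring_hom V.c.C ?KP" by (rule PI.ff_hom[OF V.c.W_open Wne])
  let ?b = "V.resV (restriction P \<XX> \<phi> \<iota> f)"
  have rc: "restriction P \<XX> \<phi> \<iota> f \<in> carrier (glob Y)" by (rule V.restriction_res(2)[OF f])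
  have bc: "?b \<in> carrier V.c.B" by (rule P.S.res_closed[OF P.S.openin_points V.c.V_open openin_subset[OF V.c.V_open] rc])
  have pull_glob: "ff_pull (tot P) \<XX> \<phi> (ff_of \<XX> s) = ff_germ (tot P) V.c.W (V.resW (gpull \<XX> \<phi> s))" if s: "s \<in> carrier (glob \<XX>)" for s
  proof -
    have "gpull \<XX> \<phi> s \<in> carrier (glob (tot P))" by (rule ring_hom_closed[OF gpull_hom[OF phi] s])
    from PI.ff_res[OF P.R.openin_points V.c.W_open preim_subset Wne this]
    show ?thesis using phi.ff_pull_germ[OF Q.S.openin_points neX s] by (simp add: preim_points[OF phi])
  qed
  let ?y = "\<lambda>d. ff_germ (tot P) V.c.W (V.c.\<alpha> (x d))"
  have y: "?y \<in> D \<rightarrow> Units ?KP" using ring_hom_Units[OF gW] V.c.alpha_x_units by blast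
  have Xu: "(\<lambda>d. ff_of \<XX> (Xf d)) \<in> D \<rightarrow> Units ?KX" using Xf_unit[OF field] by blast
  have mc: "monomial ?KX D (\<lambda>d. ff_of \<XX> (Xf d)) (\<lambda>d. - w d) \<in> carrier ?KX" using KX.monomial_unit[OF Xu] by blast
  have fc: "ff_of \<XX> f \<in> carrier ?KX" by (rule ring_hom_closed[OF XX.ff_hom[OF Q.S.openin_points neX] f])
  have "ff_pull (tot P) \<XX> \<phi> (monomial ?KX D (\<lambda>d. ff_of \<XX> (Xf d)) (\<lambda>d. - w d)) =
      monomial ?KP D (\<lambda>d. ff_pull (tot P) \<XX> \<phi> (ff_of \<XX> (Xf d))) (\<lambda>d. - w d)"
    by (rule monomial_hom[OF phi.ff_pull_hom KX.is_cring KP.is_cring Xu])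
  also have "\<dots> = monomial ?KP D ?y (\<lambda>d. - w d)"
    by (rule KP.monomial_cong[OF _ _ y]) (use pull_glob[OF Xf_closed] phi_Xf V.alpha_x in auto)
  finally have m: "ff_pull (tot P) \<XX> \<phi> (monomial ?KX D (\<lambda>d. ff_of \<XX> (Xf d)) (\<lambda>d. - w d)) = monomial ?KP D ?y (\<lambda>d. - w d)" .
  have chi: "ff_germ (tot P) V.c.W (V.c.\<chi> w) = monomial ?KP D ?y w"
    unfolding V.c.chi_monomial by (rule monomial_hom[OF gW V.c.C.is_cring KP.is_cring V.c.alpha_x_units])
  have inv: "monomial ?KP D ?y w \<otimes>\<^bsub>?KP\<^esub> monomial ?KP D ?y (\<lambda>d. - w d) = \<one>\<^bsub>?KP\<^esub>"
    using KP.monomial_add[OF y, of w "\<lambda>d. - w d"] KP.monomial_zero[of D ?y] by simp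
  let ?\<beta> = "ff_germ (tot P) V.c.W (V.c.\<beta> ?b)"
  have bK: "?\<beta> \<in> carrier ?KP" by (rule ring_hom_closed[OF gW V.c.beta_closed[OF bc]])
  have yK: "monomial ?KP D ?y m \<in> carrier ?KP" for m using KP.monomial_unit[OF y] by blast
  have "ff_pull (tot P) \<XX> \<phi> (ff_of \<XX> f) = monomial ?KP D ?y w \<otimes>\<^bsub>?KP\<^esub> ?\<beta>"
    unfolding pull_glob[OF f] V.homogeneous_pullback[OF f w hom] chi[symmetric]
    by (rule ring_hom_mult[OF gW V.c.chi_closed V.c.beta_closed[OF bc]])
  then have "ff_pull (tot P) \<XX> \<phi> (ff_of \<XX> f \<otimes>\<^bsub>?KX\<^esub> monomial ?KX D (\<lambda>d. ff_of \<XX> (Xf d)) (\<lambda>d. - w d)) =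
      (monomial ?KP D ?y w \<otimes>\<^bsub>?KP\<^esub> ?\<beta>) \<otimes>\<^bsub>?KP\<^esub> monomial ?KP D ?y (\<lambda>d. - w d)"
    unfolding ring_hom_mult[OF phi.ff_pull_hom fc mc] m by simp
  also have "\<dots> = (monomial ?KP D ?y w \<otimes>\<^bsub>?KP\<^esub> monomial ?KP D ?y (\<lambda>d. - w d)) \<otimes>\<^bsub>?KP\<^esub> ?\<beta>"
    using bK yK by (simp add: KP.m_ac)
  also have "\<dots> = ?\<beta>" unfolding inv using bK by simp
  also have "\<dots> = ff_pull (tot P) Y (pr2 P) (ff_germ Y V ?b)"
    by (rule pr2.ff_pull_germ[OF V.c.V_open V(1) bc, symmetric])
  also have "ff_germ Y V ?b = ff_of Y (restriction P \<XX> \<phi> \<iota> f)"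
    by (rule YY.ff_res[OF P.S.openin_points V.c.V_open openin_subset[OF V.c.V_open] V(1) rc])
  finally show ?thesis using one_tensorI[OF field KX.m_closed[OF fc mc]] by blast
qed

lemma valuation_monomial:
  assumes field: "field (function_field \<XX>)" and d: "d \<in> D"
  shows "lifting_valuation \<XX> Xf d (monomial (function_field \<XX>) D (\<lambda>d. ff_of \<XX> (Xf d)) m) = m d"
proof -
  let ?K = "function_field \<XX>" and ?X = "\<lambda>d. ff_of \<XX> (Xf d)"
  interpret K: plain_cring ?K by (rule plain_cring.intro[OF XX.ff_cring])
  interpret d: prime_divisor \<XX> "Xf d" by (rule prime_divisorI[OF field d])
  have one: "lifting_valuation \<XX> Xf d \<one>\<^bsub>?K\<^esub> = 0"
    using d.valuation_int_pow[OF K.Units_one_closed, of 0] unfolding lifting_valuation_def by simp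
  have "lifting_valuation \<XX> Xf d (monomial ?K J ?X m) = (if d \<in> J then m d else 0)" if "finite J" "J \<subseteq> D" for J
    using that
  proof (induction J)
    case empty
    then show ?case unfolding monomial_def using one by simp
  next
    case (insert j J)
    have u: "?X \<in> insert j J \<rightarrow> Units ?K" using Xf_unit[OF field] insert.prems by blast
    have pw: "?X j [^]\<^bsub>?K\<^esub> m j \<in> Units ?K" using u K.unit_int_pow_closed by blast
    have mu: "monomial ?K J ?X m \<in> Units ?K" using K.monomial_unit[of ?X J m] u by blast
    have "monomial ?K (insert j J) ?X m = ?X j [^]\<^bsub>?K\<^esub> m j \<otimes>\<^bsub>?K\<^esub> monomial ?K J ?X m"
      unfolding monomial_def
      by (rule K.finprod_insert[OF insert.hyps]) (use K.monomial_power_closed[OF u, of m] in auto)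
    then have "lifting_valuation \<XX> Xf d (monomial ?K (insert j J) ?X m) =
        m j * lifting_valuation \<XX> Xf d (?X j) + lifting_valuation \<XX> Xf d (monomial ?K J ?X m)"
      using d.valuation_mult[OF pw mu] d.valuation_int_pow[of "?X j" "m j"] u unfolding lifting_valuation_def by auto
    then show ?case using valuation_delta[OF d, of j] insert by auto
  qed
  then show ?thesis using P.finite_D d by auto
qed

end

section \<open>Laurent monomials of a seed\<close>

lemma is_seedD:
  assumes "is_seed K c t"
  shows "field K" "c \<in> ring_hom complex_ring K" "finite (vertices t)" "uf t \<inter> sf t = {}" "uf t \<inter> hf t = {}"
    "sf t \<inter> hf t = {}" "cl t \<in> vertices t \<rightarrow> Units K"
    "lin_indep K c {m \<in> lattice_on (vertices t). \<forall>i. m i \<ge> 0} (monomial K (vertices t) (cl t))"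
proof -
  show 1: "field K" and "c \<in> ring_hom complex_ring K" "finite (vertices t)" "uf t \<inter> sf t = {}" "uf t \<inter> hf t = {}"
    "sf t \<inter> hf t = {}"
    using assms unfolding is_seed_def by simp_all
  show "cl t \<in> vertices t \<rightarrow> Units K"
    using assms unfolding is_seed_def field.field_Units[OF 1] by simp
  show "lin_indep K c {m \<in> lattice_on (vertices t). \<forall>i. m i \<ge> 0} (monomial K (vertices t) (cl t))"
    using assms unfolding is_seed_def transcendence_basis_def by simp
qed

lemma complex_hom:
  assumes c: "c \<in> ring_hom complex_ring K" and K: "cring K"
  shows "c z \<in> carrier K" "c 1 = \<one>\<^bsub>K\<^esub>" "c (- 1) = \<ominus>\<^bsub>K\<^esub> \<one>\<^bsub>K\<^esub>"
proof -
  interpret K: cring K by (rule K)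
  show cl: "c z \<in> carrier K" for z using ring_hom_closed[OF c, of z] by (simp add: complex_ring_def)
  show one: "c 1 = \<one>\<^bsub>K\<^esub>" using ring_hom_one[OF c] by (simp add: complex_ring_def)
  have add: "c (y + z) = c y \<oplus>\<^bsub>K\<^esub> c z" for y z using ring_hom_add[OF c, of y z] by (simp add: complex_ring_def)
  have "c 0 \<oplus>\<^bsub>K\<^esub> c 0 = c 0" using add[of 0 0] by simp
  then have "c 0 = \<zero>\<^bsub>K\<^esub>" using cl[of 0] K.add.r_cancel_one[of "c 0" "c 0"] by simp
  then have "c (- 1) \<oplus>\<^bsub>K\<^esub> \<one>\<^bsub>K\<^esub> = \<zero>\<^bsub>K\<^esub>" using add[of "- 1" 1] one by simp
  then show "c (- 1) = \<ominus>\<^bsub>K\<^esub> \<one>\<^bsub>K\<^esub>" using K.minus_equality[of "c (- 1)" "\<one>\<^bsub>K\<^esub>"] cl by simp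
qed

lemma mutation_equiv_frozen:
  assumes "mutation_equiv K t s"
  shows "uf s = uf t \<and> sf s = sf t \<and> hf s = hf t \<and> (\<forall>i. i \<notin> uf t \<longrightarrow> cl s i = cl t i)"
  using assms by induction (auto simp: mutate_def)

text \<open>
  The Laurent monomials of a seed are linearly independent: multiplication by a monomial of large
  degree makes all exponents nonnegative.
\<close>

lemma monomial_in_span:
  fixes t :: "('v, 'k) seed"
  assumes seed: "is_seed K c t" and S: "S \<subseteq> lattice_on (vertices t)" and m0: "m0 \<in> lattice_on (vertices t)"
    and span: "monomial K (vertices t) (cl t) m0 \<in> lin_span K c S (monomial K (vertices t) (cl t))"
  shows "m0 \<in> S"
proof (rule ccontr)
  assume n: "m0 \<notin> S"
  let ?J = "vertices t" and ?mono = "monomial K (vertices t) (cl t)"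
  note sd = is_seedD[OF seed]
  interpret K: plain_cring K by (rule plain_cring.intro[OF fieldE(1)[OF sd(1)]])
  note ch = complex_hom[OF sd(2) K.is_cring]
  obtain M a where M: "finite M" "M \<subseteq> S" and e: "?mono m0 = (\<Oplus>\<^bsub>K\<^esub>m\<in>M. c (a m) \<otimes>\<^bsub>K\<^esub> ?mono m)"
    using span unfolding lin_span_def by blast
  have m0M: "m0 \<notin> M" using n M by blast
  let ?N = "insert m0 M" and ?a = "a(m0 := - 1)"
  have N: "finite ?N" "?N \<subseteq> lattice_on ?J" using M S m0 by auto
  define s where "s i = (if i \<in> ?J then \<Sum>m\<in>?N. \<bar>m i\<bar> else 0)" for i
  define sh where "sh m = (\<lambda>i. m i + s i)" for m :: "'v \<Rightarrow> int"
  have monoc: "?mono m \<in> carrier K" for m using K.monomial_unit[OF sd(7)] by blast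
  have t: "c z \<otimes>\<^bsub>K\<^esub> ?mono m \<in> carrier K" for z m using ch(1) monoc by simp
  have "(\<Oplus>\<^bsub>K\<^esub>m\<in>?N. c (?a m) \<otimes>\<^bsub>K\<^esub> ?mono m) = c (?a m0) \<otimes>\<^bsub>K\<^esub> ?mono m0 \<oplus>\<^bsub>K\<^esub> (\<Oplus>\<^bsub>K\<^esub>m\<in>M. c (?a m) \<otimes>\<^bsub>K\<^esub> ?mono m)"
    by (rule K.finsum_insert[OF M(1) m0M]) (use t in blast)+
  also have "(\<Oplus>\<^bsub>K\<^esub>m\<in>M. c (?a m) \<otimes>\<^bsub>K\<^esub> ?mono m) = ?mono m0"
    unfolding e by (rule K.finsum_cong') (use m0M t in auto)
  also have "c (?a m0) \<otimes>\<^bsub>K\<^esub> ?mono m0 \<oplus>\<^bsub>K\<^esub> ?mono m0 = \<zero>\<^bsub>K\<^esub>"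
    using ch(3) monoc by (simp add: K.l_minus K.l_neg)
  finally have z: "(\<Oplus>\<^bsub>K\<^esub>m\<in>?N. c (?a m) \<otimes>\<^bsub>K\<^esub> ?mono m) = \<zero>\<^bsub>K\<^esub>" .
  have inj: "inj_on sh ?N" unfolding inj_on_def sh_def by (auto simp: fun_eq_iff)
  let ?b = "\<lambda>m'. ?a (\<lambda>i. m' i - s i)"
  have b: "?b (sh m) = ?a m" for m unfolding sh_def by simp
  have "(\<Oplus>\<^bsub>K\<^esub>m'\<in>sh ` ?N. c (?b m') \<otimes>\<^bsub>K\<^esub> ?mono m') = (\<Oplus>\<^bsub>K\<^esub>m\<in>?N. c (?b (sh m)) \<otimes>\<^bsub>K\<^esub> ?mono (sh m))"
    by (rule K.finsum_reindex[OF _ inj]) (use t in blast)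
  also have "\<dots> = (\<Oplus>\<^bsub>K\<^esub>m\<in>?N. (c (?a m) \<otimes>\<^bsub>K\<^esub> ?mono m) \<otimes>\<^bsub>K\<^esub> ?mono s)"
  proof (rule K.finsum_cong'[OF refl])
    show "(\<lambda>m. (c (?a m) \<otimes>\<^bsub>K\<^esub> ?mono m) \<otimes>\<^bsub>K\<^esub> ?mono s) \<in> ?N \<rightarrow> carrier K" using t monoc by blast
    show "c (?b (sh m)) \<otimes>\<^bsub>K\<^esub> ?mono (sh m) = (c (?a m) \<otimes>\<^bsub>K\<^esub> ?mono m) \<otimes>\<^bsub>K\<^esub> ?mono s" for m
      unfolding b unfolding sh_def K.monomial_add[OF sd(7)] by (rule K.m_assoc[symmetric]) (use ch(1) monoc in auto)
  qed
  also have "\<dots> = (\<Oplus>\<^bsub>K\<^esub>m\<in>?N. c (?a m) \<otimes>\<^bsub>K\<^esub> ?mono m) \<otimes>\<^bsub>K\<^esub> ?mono s"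
    by (rule K.finsum_ldistr[symmetric, OF N(1) monoc]) (use t in blast)
  also have "\<dots> = \<zero>\<^bsub>K\<^esub>" unfolding z using monoc by simp
  finally have zero: "(\<Oplus>\<^bsub>K\<^esub>m'\<in>sh ` ?N. c (?b m') \<otimes>\<^bsub>K\<^esub> ?mono m') = \<zero>\<^bsub>K\<^esub>" .
  have sub: "sh ` ?N \<subseteq> {m \<in> lattice_on ?J. \<forall>i. m i \<ge> 0}"
  proof
    fix m' assume "m' \<in> sh ` ?N"
    then obtain m where m: "m \<in> ?N" "m' = sh m" by blast
    have ml: "m \<in> lattice_on ?J" using m(1) N(2) by blast
    have "m' i \<ge> 0" for i
    proof (cases "i \<in> ?J")
      case True
      have "\<bar>m i\<bar> \<le> (\<Sum>m\<in>?N. \<bar>m i\<bar>)" by (rule member_le_sum[OF m(1) _ N(1)]) simp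
      then show ?thesis unfolding m(2) sh_def s_def using True by simp
    next
      case False
      then show ?thesis unfolding m(2) sh_def s_def using ml by (simp add: lattice_on_def)
    qed
    moreover have "m' \<in> lattice_on ?J" using ml unfolding m(2) sh_def s_def by (auto simp: lattice_on_def)
    ultimately show "m' \<in> {m \<in> lattice_on ?J. \<forall>i. m i \<ge> 0}" by blast
  qed
  have "finite (sh ` ?N)" using N(1) by blast
  then have "\<forall>m'\<in>sh ` ?N. ?b m' = 0"
    using sd(8)[unfolded lin_indep_def, rule_format, of "sh ` ?N" ?b] sub zero by blast
  then have "?b (sh m0) = 0" by blast
  then show False unfolding b by simp
qed

text \<open>
  Frozen variables are the same in all mutations of the seed, and semi-frozen ones are invertible in each ring of
  Laurent polynomials.
\<close>

lemma inverse_in_upper_cluster: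
  assumes seed: "is_seed K c t" and d: "d \<in> sf t"
  shows "inv\<^bsub>K\<^esub> (cl t d) \<in> upper_cluster K c t"
  unfolding upper_cluster_def
proof (rule INT_I)
  fix s assume "s \<in> {s. mutation_equiv K t s}"
  then have fr: "uf s = uf t" "sf s = sf t" "hf s = hf t" "\<And>i. i \<notin> uf t \<Longrightarrow> cl s i = cl t i"
    using mutation_equiv_frozen by blast+
  note sd = is_seedD[OF seed]
  interpret K: cring K by (rule fieldE(1)[OF sd(1)])
  have vs: "vertices s = vertices t" unfolding vertices_def fr ..
  have dv: "d \<in> vertices t" "d \<notin> uf t" "d \<notin> hf t" using d sd(4,6) by (auto simp: vertices_def)
  have dU: "cl t d \<in> Units K" using sd(7) dv(1) by blast
  have cs: "cl s d = cl t d" using fr(4) dv(2) by blast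
  let ?m = "\<lambda>i. if i = d then - 1 else (0::int)"
  have "monomial K (vertices s) (cl s) ?m = (\<Otimes>\<^bsub>K\<^esub>i\<in>vertices t. if d = i then inv\<^bsub>K\<^esub> (cl t d) else \<one>\<^bsub>K\<^esub>)"
    unfolding monomial_def vs
    by (rule K.finprod_cong'[OF refl]) (use dU cs in \<open>auto simp: int_pow_def2\<close>)
  also have "\<dots> = inv\<^bsub>K\<^esub> (cl t d)"
    by (rule K.finprod_singleton[OF dv(1) sd(3), of "\<lambda>_. inv\<^bsub>K\<^esub> (cl t d)"]) (use dU in blast)
  finally have m: "monomial K (vertices s) (cl s) ?m = inv\<^bsub>K\<^esub> (cl t d)" .
  have "?m \<in> laurent_exponents s"
    unfolding laurent_exponents_def lattice_on_def vs fr using dv by auto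
  moreover have "(\<Oplus>\<^bsub>K\<^esub>m\<in>{?m}. c ((\<lambda>_. 1) m) \<otimes>\<^bsub>K\<^esub> monomial K (vertices s) (cl s) m) = inv\<^bsub>K\<^esub> (cl t d)"
    using m complex_hom(2)[OF sd(2) K.is_cring] dU by simp
  ultimately show "inv\<^bsub>K\<^esub> (cl t d) \<in> laurent_ring K c s"
    unfolding laurent_ring_def lin_span_def by (intro CollectI exI[of _ "{?m}"] exI[of _ "\<lambda>_. 1"]) auto
qed

lemma upper_cluster_laurent: "upper_cluster K c t \<subseteq> laurent_ring K c t"
  unfolding upper_cluster_def using mutation_equiv.base by blast

lemma pos_neg_part: "0 \<le> pos_part b" "0 \<le> neg_part b" "pos_part b - neg_part b = b"
  unfolding pos_part_def neg_part_def by auto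


section \<open>The lifted seed\<close>

locale lifting_seeds = lifting_space D T x Y P \<XX> \<phi> Xf PP Q QQ a \<iota>
  for D :: "'v set"
    and T :: "('t, 'u) ringed_space" and x :: "'v \<Rightarrow> 'u"
    and Y :: "('q, 'r) ringed_space"
    and P :: "('t, 'u, 'q, 'r, 'z, 'w) product_data"
    and \<XX> :: "('p, 's) ringed_space"
    and \<phi> :: "('z, 'w, 'p, 's) morph"
    and Xf :: "'v \<Rightarrow> 's"
    and PP :: "('t, 'u, 'z, 'w, 'i, 'j) product_data"
    and Q :: "('t, 'u, 'p, 's, 'k, 'l) product_data"
    and QQ :: "('t, 'u, 'k, 'l, 'm, 'n) product_data"
    and a :: "('k, 'l, 'p, 's) morph"
    and \<iota> :: "('q, 'r, 'z, 'w) morph" +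
  fixes t :: "('v, ('q set \<times> 'r) set) seed"
    and t' :: "('v, ('p set \<times> 's) set) seed"
  assumes seed: "is_seed (function_field Y) (ff_const Y) t"
    and disjoint: "vertices t \<inter> D = {}"
    and extension: "pointed_seed_extension D \<XX> Xf t t'"
    and lift_vars: "\<And>i. i \<in> vertices t \<Longrightarrow>
      homogeneous_lift D T x Y P \<XX> \<phi> \<iota> Q a (cl t' i) (cl t i)"
    and lift_mut: "\<And>k. k \<in> uf t \<Longrightarrow>
      homogeneous_lift D T x Y P \<XX> \<phi> \<iota> Q a
        (mut_var (function_field \<XX>) t' k) (mut_var (function_field Y) t k)"
    and upper_X: "upper_cluster (function_field \<XX>) (ff_const \<XX>) t' = regular_functions \<XX>"
begin

abbreviation K where "K \<equiv> function_field \<XX>"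
abbreviation KY where "KY \<equiv> function_field Y"
abbreviation G where "G \<equiv> glob \<XX>"
abbreviation ff where "ff \<equiv> ff_of \<XX>"
abbreviation s where "s \<equiv> restriction P \<XX> \<phi> \<iota>"

lemma seed_X: "is_seed K (ff_const \<XX>) t'"
  using extension unfolding pointed_seed_extension_def by blast

lemmas seedX = is_seedD[OF seed_X] and seedY = is_seedD[OF seed]

lemma field_X: "field K" by (rule seedX(1))

sublocale K: plain_cring K by (rule plain_cring.intro[OF XX.ff_cring])
sublocale KY: plain_cring KY by (rule plain_cring.intro[OF YY.ff_cring])
sublocale G: plain_cring G by (rule plain_cring.intro[OF Q.S.sec_cring[OF Q.S.openin_points]])

lemma points_X: "points \<XX> \<noteq> {}" using XX.eta_points by blast

lemma ff_hom: "ff \<in> ring_hom G K" by (rule XX.ff_hom[OF Q.S.openin_points points_X])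
lemma ff_closed: "f \<in> carrier G \<Longrightarrow> ff f \<in> carrier K" by (rule ring_hom_closed[OF ff_hom])
lemma ff_injective: "f \<in> carrier G \<Longrightarrow> g \<in> carrier G \<Longrightarrow> ff f = ff g \<Longrightarrow> f = g"
  by (rule XX.ff_inj[OF Q.S.openin_points points_X])

lemma extension_parts: "uf t' = uf t" "sf t \<subseteq> sf t'" "hf t \<subseteq> hf t'" "(sf t' \<union> hf t') - (sf t \<union> hf t) = D"
  "i \<in> vertices t \<Longrightarrow> k \<in> uf t \<Longrightarrow> bmat t' i k = bmat t i k" "d \<in> D \<Longrightarrow> cl t' d = ff (Xf d)"
  using extension unfolding pointed_seed_extension_def by blast+

lemma vertices_ext: "vertices t' = vertices t \<union> D"
  using extension_parts(1-4) unfolding vertices_def by blast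

lemma not_unit: assumes "d \<in> D" "h \<in> carrier G" shows "Xf d \<otimes>\<^bsub>G\<^esub> h \<noteq> \<one>\<^bsub>G\<^esub>"
proof
  assume e: "Xf d \<otimes>\<^bsub>G\<^esub> h = \<one>\<^bsub>G\<^esub>"
  have u: "Xf d \<in> Units G" by (rule cring_UnitsI[OF G.is_cring Xf_closed[OF assms(1)] assms(2) e])
  have "germ \<XX> y (points \<XX>) (Xf d) \<in> Units (stalk \<XX> y)" if "y \<in> points \<XX>" for y
    by (rule ring_hom_Units[OF Q.S.germ_hom[OF Q.S.openin_points that] u])
  then have "zero_locus \<XX> (Xf d) = {}" unfolding zero_locus_def by blast
  then show False using divisors[OF assms(1)] unfolding irreducible_subset_def by blast
qed

text \<open>A semi-frozen variable would be invertible on \<open>\<XX>\<close>, but \<open>Xf d\<close> vanishes somewhere.\<close>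

lemma D_highly_frozen: assumes d: "d \<in> D" shows "d \<notin> sf t'"
proof
  assume "d \<in> sf t'"
  then have "inv\<^bsub>K\<^esub> (ff (Xf d)) \<in> regular_functions \<XX>"
    using inverse_in_upper_cluster[OF seed_X] upper_X extension_parts(6)[OF d] by metis
  then obtain h where h: "h \<in> carrier G" "inv\<^bsub>K\<^esub> (ff (Xf d)) = ff h" unfolding regular_functions_def by blast
  have u: "ff (Xf d) \<in> Units K" by (rule Xf_unit[OF field_X d])
  have "ff (Xf d \<otimes>\<^bsub>G\<^esub> h) = ff \<one>\<^bsub>G\<^esub>"
    unfolding ring_hom_mult[OF ff_hom Xf_closed[OF d] h(1)] h(2)[symmetric] ring_hom_one[OF ff_hom] using u by simp
  then have "Xf d \<otimes>\<^bsub>G\<^esub> h = \<one>\<^bsub>G\<^esub>" using ff_injective Xf_closed[OF d] h(1) by simp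
  then show False using not_unit[OF d h(1)] by blast
qed

lemma frozen: "sf t' = sf t" "hf t' = hf t \<union> D"
  using extension_parts(1-4) D_highly_frozen seedX(4-6) by blast+

text \<open>
  A homogeneous regular function that represents the cluster variable of \<open>t'\<close> at \<open>i\<close>, and its degree.
\<close>

definition lifted where
  "lifted i = (SOME f. f \<in> carrier G \<and> cl t' i = ff f \<and> ff_of Y (s f) = cl t i \<and>
      (\<exists>w\<in>lattice_on D. homogeneous D T x \<XX> Q a w f))"

definition weight where "weight i = (SOME w. w \<in> lattice_on D \<and> homogeneous D T x \<XX> Q a w (lifted i))"

lemma lifted: assumes "i \<in> vertices t"
  shows "lifted i \<in> carrier G" "cl t' i = ff (lifted i)" "ff_of Y (s (lifted i)) = cl t i"
    "weight i \<in> lattice_on D" "homogeneous D T x \<XX> Q a (weight i) (lifted i)"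
proof -
  have *: "lifted i \<in> carrier G \<and> cl t' i = ff (lifted i) \<and> ff_of Y (s (lifted i)) = cl t i \<and>
      (\<exists>w\<in>lattice_on D. homogeneous D T x \<XX> Q a w (lifted i))"
    unfolding lifted_def by (rule someI_ex) (use lift_vars[OF assms] in \<open>auto simp: homogeneous_lift_def\<close>)
  then show "lifted i \<in> carrier G" "cl t' i = ff (lifted i)" "ff_of Y (s (lifted i)) = cl t i" by blast+
  have "weight i \<in> lattice_on D \<and> homogeneous D T x \<XX> Q a (weight i) (lifted i)"
    unfolding weight_def
    by (rule someI_ex[of "\<lambda>w. w \<in> lattice_on D \<and> homogeneous D T x \<XX> Q a w (lifted i)"]) (use * in blast)
  then show "weight i \<in> lattice_on D" "homogeneous D T x \<XX> Q a (weight i) (lifted i)" by blast+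
qed

lemma cl_unit: "i \<in> vertices t' \<Longrightarrow> cl t' i \<in> Units K" using seedX(7) by blast

lemma Xunits: "(\<lambda>d. ff (Xf d)) \<in> D \<rightarrow> Units K" using Xf_unit[OF field_X] by blast

lemma monomial_single: "i \<in> vertices t' \<Longrightarrow> monomial K (vertices t') (cl t') (\<lambda>j. if j = i then 1 else 0) = cl t' i"
  by (rule K.monomial_power[OF seedX(3)]) (use seedX(7) K.Units_closed in auto)

text \<open>
  If the cluster variable at \<open>i\<close> vanished along the divisor of \<open>Xf d\<close>, its quotient by \<open>Xf d\<close> would
  be regular; but as a Laurent monomial of negative degree in a highly frozen variable it does
  not lie in the upper cluster algebra.
\<close>

lemma valuation_cl:
  assumes i: "i \<in> vertices t" and d: "d \<in> D"
  shows "lifting_valuation \<XX> Xf d (cl t' i) = 0"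
proof (rule ccontr)
  assume nz: "lifting_valuation \<XX> Xf d (cl t' i) \<noteq> 0"
  interpret d: prime_divisor \<XX> "Xf d" by (rule prime_divisorI[OF field_X d])
  have iJ: "i \<in> vertices t'" and dJ: "d \<in> vertices t'" using i d vertices_ext by auto
  have ne: "i \<noteq> d" using i d disjoint by blast
  have F0: "lifted i \<noteq> \<zero>\<^bsub>G\<^esub>"
  proof
    assume "lifted i = \<zero>\<^bsub>G\<^esub>"
    then have "cl t' i = \<zero>\<^bsub>K\<^esub>" using lifted(2)[OF i] ring_hom_zero[OF ff_hom G.ring_axioms K.ring_axioms] by simp
    then show False using cl_unit[OF iJ] field.field_Units[OF field_X] by simp
  qed
  have e1: "valuation_at \<XX> d.\<delta> (ff (Xf d)) = 1" using valuation_delta[OF d d] unfolding lifting_valuation_def by simp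
  obtain h where h: "h \<in> carrier G" "lifted i = h \<otimes>\<^bsub>G\<^esub> Xf d"
    using d.valuation_regular[OF lifted(1)[OF i] F0 e1] nz lifted(2)[OF i] unfolding lifting_valuation_def by auto
  have u: "ff (Xf d) \<in> Units K" by (rule Xf_unit[OF field_X d])
  have uc: "cl t' d = ff (Xf d)" by (rule extension_parts(6)[OF d])
  \<comment> \<open>the exponent of the quotient of the variable at \<open>i\<close> by the variable at \<open>d\<close>\<close>
  let ?e = "\<lambda>j. if j = i then 1 else (0::int)" and ?m = "\<lambda>j. (if j = i then 1 else 0) + (if j = d then - 1 else (0::int))"
  let ?mono = "monomial K (vertices t') (cl t')"
  have hc: "ff h \<in> carrier K" by (rule ff_closed[OF h(1)])
  have "ff h \<otimes>\<^bsub>K\<^esub> ff (Xf d) = cl t' i" using ring_hom_mult[OF ff_hom h(1) Xf_closed[OF d]] h(2) lifted(2)[OF i] by simp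
  also have "\<dots> = ?mono (\<lambda>j. ?m j + (if j = d then 1 else 0))"
    unfolding monomial_single[OF iJ, symmetric] by (rule K.monomial_cong[OF _ _ seedX(7)]) auto
  also have "\<dots> = ?mono ?m \<otimes>\<^bsub>K\<^esub> ff (Xf d)"
    unfolding K.monomial_add[OF seedX(7), of ?m] monomial_single[OF dJ] uc ..
  finally have hm: "ff h = ?mono ?m"
    using hc K.monomial_unit[OF seedX(7), of ?m] u
      domain.m_rcancel[OF field.axioms(1)[OF field_X], of "ff (Xf d)" "ff h" "?mono ?m"] field.field_Units[OF field_X] by auto
  have "ff h \<in> upper_cluster K (ff_const \<XX>) t'"
    unfolding upper_X regular_functions_def using h(1) by blast
  then have "?mono ?m \<in> laurent_ring K (ff_const \<XX>) t'" unfolding hm[symmetric] by (rule subsetD[OF upper_cluster_laurent])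
  moreover have "laurent_exponents t' \<subseteq> lattice_on (vertices t')" unfolding laurent_exponents_def by blast
  moreover have "?m \<in> lattice_on (vertices t')" using iJ dJ unfolding lattice_on_def by auto
  ultimately have "?m \<in> laurent_exponents t'"
    unfolding laurent_ring_def using monomial_in_span[OF seed_X] by blast
  moreover have "d \<in> hf t'" using frozen d by blast
  ultimately have "?m d \<ge> 0" unfolding laurent_exponents_def by blast
  then show False using ne by simp
qed

lemma one_tensor_cl: assumes i: "i \<in> vertices t"
  shows "one_tensor Y P \<XX> \<phi> (cl t i) = cl t' i \<otimes>\<^bsub>K\<^esub> monomial K D (\<lambda>d. ff (Xf d)) (\<lambda>d. - weight i d)"
  using one_tensor_restriction[OF field_X lifted(1,4,5)[OF i]] lifted(2,3)[OF i] by simp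

text \<open>
  The valuation of \<open>1 \<otimes> x i\<close> at \<open>Xf d\<close> is the one of \<open>cl t' i\<close>, which is zero, minus \<open>weight i d\<close>.
\<close>

lemma lifting_matrix_weight:
  assumes i: "i \<in> vertices t" and d: "d \<in> D"
  shows "lifting_matrix Y P \<XX> \<phi> Xf t d i = weight i d"
proof -
  interpret d: prime_divisor \<XX> "Xf d" by (rule prime_divisorI[OF field_X d])
  have u: "cl t' i \<in> Units K" using cl_unit i vertices_ext by blast
  show ?thesis
    unfolding lifting_matrix_def one_tensor_cl[OF i]
    using d.valuation_mult[OF u K.monomial_unit[OF Xunits]] valuation_cl[OF i d]
      valuation_monomial[OF field_X d, of "\<lambda>d. - weight i d"] unfolding lifting_valuation_def by simp
qed

lemma cl_lift:
  assumes i: "i \<in> vertices t"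
  shows "one_tensor Y P \<XX> \<phi> (cl t i) \<otimes>\<^bsub>K\<^esub>
    monomial K D (\<lambda>d. ff (Xf d)) (\<lambda>d. lifting_matrix Y P \<XX> \<phi> Xf t d i) = cl t' i"
proof -
  let ?m = "monomial K D (\<lambda>d. ff (Xf d))"
  have c: "?m w \<in> carrier K" for w using K.monomial_unit[OF Xunits] by blast
  have u: "cl t' i \<in> carrier K" using cl_unit i vertices_ext by blast
  have e: "?m (\<lambda>d. lifting_matrix Y P \<XX> \<phi> Xf t d i) = ?m (weight i)"
    by (rule K.monomial_cong[OF _ _ Xunits]) (use lifting_matrix_weight[OF i] in auto)
  have "?m (\<lambda>d. - weight i d) \<otimes>\<^bsub>K\<^esub> ?m (weight i) = \<one>\<^bsub>K\<^esub>"
    using K.monomial_add[OF Xunits, of "\<lambda>d. - weight i d" "weight i"] K.monomial_zero[of D "\<lambda>d. ff (Xf d)"] by simp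
  then show ?thesis unfolding one_tensor_cl[OF i] e using K.m_assoc[OF u c c, of "\<lambda>d. - weight i d" "weight i"] u by simp
qed

end

context lifting_seeds
begin

text \<open>
  The lifted functions and weights for all vertices of \<open>t'\<close>, where \<open>Xf i\<close> has the degree \<open>e\<^sub>i\<close> for \<open>i \<in> D\<close>.
\<close>

definition vertex_fun where "vertex_fun i = (if i \<in> D then Xf i else lifted i)"
definition vertex_weight where "vertex_weight i = (if i \<in> D then (\<lambda>d. if d = i then 1 else 0) else weight i)"

lemma vertexE:
  assumes "i \<in> vertices t'"
  obtains "i \<in> D" "i \<notin> vertices t" | "i \<in> vertices t" "i \<notin> D"
  using assms disjoint vertices_ext by blast

lemma vertex_fun: assumes "i \<in> vertices t'" shows "vertex_fun i \<in> carrier G" "cl t' i = ff (vertex_fun i)" "vertex_weight i \<in> lattice_on D"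
  using assms
  by (cases rule: vertexE; use lifted extension_parts(6) Xf_closed in \<open>auto simp: vertex_fun_def vertex_weight_def lattice_on_def\<close>)+

text \<open>
  On \<open>T \<times> V\<close>, the variable at each vertex is a character times the restriction of the variable to \<open>Y\<close>, which
  is \<open>1\<close> for the vertices in \<open>D\<close> and a cluster variable of \<open>t\<close> otherwise, and so does not vanish.
\<close>

lemma chart_terms:
  assumes V: "lifting_chart D T x Y P \<XX> \<phi> Xf PP Q QQ a \<iota> V" "V \<noteq> {}"
  obtains b where
    "\<forall>i\<in>vertices t'. b i \<in> carrier (Sec Y V)" "\<forall>i\<in>vertices t'. ff_germ Y V (b i) \<in> Units KY"
    "\<forall>i\<in>vertices t'. Res (tot P) (points (tot P)) (preim (tot P) (pr2 P) V) (gpull \<XX> \<phi> (vertex_fun i)) =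
      torus_chart.\<chi> D T x P V (vertex_weight i) \<otimes>\<^bsub>Sec (tot P) (preim (tot P) (pr2 P) V)\<^esub> pull (pr2 P) V (b i)"
proof -
  interpret V: lifting_chart D T x Y P \<XX> \<phi> Xf PP Q QQ a \<iota> V by (rule V(1))
  let ?b = "\<lambda>i. if i \<in> D then \<one>\<^bsub>V.c.B\<^esub> else V.resV (s (lifted i))"
  have sub: "V \<subseteq> points Y" by (rule openin_subset[OF V.c.V_open])
  have g: "ff_germ Y V \<in> ring_hom V.c.B KY" by (rule YY.ff_hom[OF V.c.V_open V(2)])
  have "?b i \<in> carrier V.c.B \<and> ff_germ Y V (?b i) \<in> Units KY \<and>
      V.resW (gpull \<XX> \<phi> (vertex_fun i)) = V.c.\<chi> (vertex_weight i) \<otimes>\<^bsub>V.c.C\<^esub> V.c.\<beta> (?b i)" if i: "i \<in> vertices t'" for i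
    using i
  proof (cases rule: vertexE)
    case 1
    have "V.resW (gpull \<XX> \<phi> (vertex_fun i)) = V.c.\<chi> (vertex_weight i)" using V.Xf_pullback[OF 1(1)] 1(1) by (simp add: vertex_fun_def vertex_weight_def)
    then show ?thesis using 1 ring_hom_one[OF g] ring_hom_one[OF V.c.beta_hom] V.c.chi_closed by simp
  next
    case 2
    have rc: "s (lifted i) \<in> carrier (glob Y)" by (rule V.restriction_res(2)[OF lifted(1)[OF 2(1)]])
    have "ff_germ Y V (V.resV (s (lifted i))) = cl t i"
      using YY.ff_res[OF P.S.openin_points V.c.V_open sub V(2) rc] lifted(3)[OF 2(1)] by simp
    moreover have "cl t i \<in> Units KY" using seedY(7) 2(1) by blast
    moreover have "V.resV (s (lifted i)) \<in> carrier V.c.B" by (rule P.S.res_closed[OF P.S.openin_points V.c.V_open sub rc])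
    ultimately show ?thesis
      using V.homogeneous_pullback[OF lifted(1,4,5)[OF 2(1)]] 2(2) by (simp add: vertex_fun_def vertex_weight_def)
  qed
  then show ?thesis using that[of ?b] by blast
qed

text \<open>
  The exchange relation expresses a homogeneous function as a sum of two monomials. Their
  restrictions to \<open>Y\<close> do not vanish, so by independence of characters they have the same degree;
  this determines the rows of the exchange matrix indexed by \<open>D\<close>.
\<close>

lemma exchange_degrees:
  assumes k: "k \<in> uf t"
  shows "(\<Sum>i\<in>vertices t'. bmat t' i k * vertex_weight i d) = 0"
proof -
  obtain V where V: "V \<noteq> {}" "lifting_chart D T x Y P \<XX> \<phi> Xf PP Q QQ a \<iota> V" using chart_exists .
  interpret V: lifting_chart D T x Y P \<XX> \<phi> Xf PP Q QQ a \<iota> V by (rule V(2))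
  let ?J = "vertices t'" and ?\<rho> = "\<lambda>f. V.resW (gpull \<XX> \<phi> f)" and ?g = "ff_germ Y V"
  obtain b where b: "\<forall>i\<in>?J. b i \<in> carrier V.c.B" "\<forall>i\<in>?J. ?g (b i) \<in> Units KY"
    and \<rho>b: "\<forall>i\<in>?J. ?\<rho> (vertex_fun i) = V.c.\<chi> (vertex_weight i) \<otimes>\<^bsub>V.c.C\<^esub> V.c.\<beta> (b i)"
    using chart_terms[OF V(2,1)] .
  have bJ: "b \<in> ?J \<rightarrow> carrier V.c.B" using b by blast
  have finJ: "finite ?J" by (rule seedX(3))
  have kt: "k \<in> vertices t" and kJ: "k \<in> ?J" using k vertices_ext unfolding vertices_def by blast+
  have g: "?g \<in> ring_hom V.c.B KY" by (rule YY.ff_hom[OF V.c.V_open V(1)])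
  have \<rho>_hom: "?\<rho> \<in> ring_hom G V.c.C"
    using ring_hom_trans[OF gpull_hom[OF phi] P.R.res_hom[OF P.R.openin_points V.c.W_open preim_subset]]
    by (simp add: o_def)
  have FJ: "vertex_fun \<in> ?J \<rightarrow> carrier G" using vertex_fun by blast
  \<comment> \<open>the two monomials of the exchange relation, for \<open>p\<close> the positive or the negative part of the column \<open>k\<close>\<close>
  have nz: "monomial V.c.B ?J b p \<noteq> \<zero>\<^bsub>V.c.B\<^esub> \<and> monomial V.c.B ?J b p \<in> carrier V.c.B \<and>
      monomial G ?J vertex_fun p \<in> carrier G \<and> ff (monomial G ?J vertex_fun p) = monomial K ?J (cl t') p \<and>
      ?\<rho> (monomial G ?J vertex_fun p) = V.c.\<chi> (\<lambda>d. \<Sum>i\<in>?J. p i * vertex_weight i d) \<otimes>\<^bsub>V.c.C\<^esub> V.c.\<beta> (monomial V.c.B ?J b p)"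
    if p: "\<And>i. 0 \<le> p i" for p
  proof (intro conjI)
    have "?g (monomial V.c.B ?J b p) = monomial KY ?J (\<lambda>i. ?g (b i)) p"
      by (rule monomial_hom_nonneg[OF g V.c.B.is_cring KY.is_cring bJ p])
    also have "\<dots> \<in> Units KY" by (rule KY.monomial_unit) (use b(2) in blast)
    finally show "monomial V.c.B ?J b p \<noteq> \<zero>\<^bsub>V.c.B\<^esub>"
      using P.S.zero_not_unit[OF YY.eta_points] ring_hom_zero[OF g V.c.B.ring_axioms KY.ring_axioms]
      unfolding function_field_def by metis
    show "monomial V.c.B ?J b p \<in> carrier V.c.B" using p bJ by (rule V.c.B.monomial_nonneg(2))
    show "monomial G ?J vertex_fun p \<in> carrier G" using p FJ by (rule G.monomial_nonneg(2))
    have "ff (monomial G ?J vertex_fun p) = monomial K ?J (\<lambda>i. ff (vertex_fun i)) p"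
      by (rule monomial_hom_nonneg[OF ff_hom G.is_cring K.is_cring FJ p])
    also have "\<dots> = monomial K ?J (cl t') p" by (rule K.monomial_cong[OF _ _ seedX(7)]) (use vertex_fun in auto)
    finally show "ff (monomial G ?J vertex_fun p) = monomial K ?J (cl t') p" .
    have "?\<rho> (monomial G ?J vertex_fun p) = monomial V.c.C ?J (\<lambda>i. ?\<rho> (vertex_fun i)) p"
      by (rule monomial_hom_nonneg[OF \<rho>_hom G.is_cring V.c.C.is_cring FJ p])
    also have "\<dots> = monomial V.c.C ?J (\<lambda>i. V.c.\<chi> (vertex_weight i) \<otimes>\<^bsub>V.c.C\<^esub> V.c.\<beta> (b i)) p"
    proof -
      have c: "(\<lambda>i. V.c.\<chi> (vertex_weight i) \<otimes>\<^bsub>V.c.C\<^esub> V.c.\<beta> (b i)) \<in> ?J \<rightarrow> carrier V.c.C" using V.c.term_closed bJ by blast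
      have c': "(\<lambda>i. (V.c.\<chi> (vertex_weight i) \<otimes>\<^bsub>V.c.C\<^esub> V.c.\<beta> (b i)) [^]\<^bsub>V.c.C\<^esub> p i) \<in> ?J \<rightarrow> carrier V.c.C"
      proof
        fix i assume "i \<in> ?J"
        then have "V.c.\<chi> (vertex_weight i) \<otimes>\<^bsub>V.c.C\<^esub> V.c.\<beta> (b i) \<in> carrier V.c.C" using c by blast
        then have "(V.c.\<chi> (vertex_weight i) \<otimes>\<^bsub>V.c.C\<^esub> V.c.\<beta> (b i)) [^]\<^bsub>V.c.C\<^esub> nat (p i) \<in> carrier V.c.C" by (rule V.c.C.nat_pow_closed)
        then show "(V.c.\<chi> (vertex_weight i) \<otimes>\<^bsub>V.c.C\<^esub> V.c.\<beta> (b i)) [^]\<^bsub>V.c.C\<^esub> p i \<in> carrier V.c.C" using p[of i] by simp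
      qed
      show ?thesis unfolding monomial_def by (rule V.c.C.finprod_cong'[OF refl c']) (use \<rho>b in auto)
    qed
    also have "\<dots> = V.c.\<chi> (\<lambda>d. \<Sum>i\<in>?J. p i * vertex_weight i d) \<otimes>\<^bsub>V.c.C\<^esub> V.c.\<beta> (monomial V.c.B ?J b p)"
      using finJ p bJ by (rule V.c.term_monomial)
    finally show "?\<rho> (monomial G ?J vertex_fun p) = \<dots>" .
  qed
  let ?p = "\<lambda>i. pos_part (bmat t' i k)" and ?n = "\<lambda>i. neg_part (bmat t' i k)"
  note np = nz[of ?p, OF pos_neg_part(1)] and nn = nz[of ?n, OF pos_neg_part(2)]
  let ?M = "monomial G ?J vertex_fun" and ?m = "monomial V.c.B ?J b"
  obtain h w where h: "h \<in> carrier G" "mut_var K t' k = ff h" and w: "w \<in> lattice_on D" and hom: "homogeneous D T x \<XX> Q a w h"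
    using lift_mut[OF k] unfolding homogeneous_lift_def by blast
  have kU: "cl t' k \<in> Units K" by (rule cl_unit[OF kJ])
  have MG: "?M ?p \<in> carrier G" "?M ?n \<in> carrier G" using np nn by blast+
  have MK: "ff (?M ?p) \<in> carrier K" "ff (?M ?n) \<in> carrier K" by (rule ff_closed[OF MG(1)], rule ff_closed[OF MG(2)])
  have "ff (vertex_fun k \<otimes>\<^bsub>G\<^esub> h) = cl t' k \<otimes>\<^bsub>K\<^esub> mut_var K t' k"
    unfolding ring_hom_mult[OF ff_hom vertex_fun(1)[OF kJ] h(1)] h(2) vertex_fun(2)[OF kJ] ..
  also have "\<dots> = cl t' k \<otimes>\<^bsub>K\<^esub> (inv\<^bsub>K\<^esub> (cl t' k) \<otimes>\<^bsub>K\<^esub> (ff (?M ?p) \<oplus>\<^bsub>K\<^esub> ff (?M ?n)))"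
    using np nn unfolding mut_var_def by simp
  also have "\<dots> = (cl t' k \<otimes>\<^bsub>K\<^esub> inv\<^bsub>K\<^esub> (cl t' k)) \<otimes>\<^bsub>K\<^esub> (ff (?M ?p) \<oplus>\<^bsub>K\<^esub> ff (?M ?n))"
    by (rule K.m_assoc[symmetric]) (use kU MK in auto)
  also have "\<dots> = ff (?M ?p \<oplus>\<^bsub>G\<^esub> ?M ?n)"
    using kU MK ring_hom_add[OF ff_hom, of "?M ?p" "?M ?n"] np nn by simp
  finally have "vertex_fun k \<otimes>\<^bsub>G\<^esub> h = ?M ?p \<oplus>\<^bsub>G\<^esub> ?M ?n"
    by (rule ff_injective[rotated 2]) (use vertex_fun(1)[OF kJ] h(1) np nn in auto)
  then have "?\<rho> (vertex_fun k \<otimes>\<^bsub>G\<^esub> h) = ?\<rho> (?M ?p \<oplus>\<^bsub>G\<^esub> ?M ?n)" by simp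
  then have rel: "?\<rho> (vertex_fun k) \<otimes>\<^bsub>V.c.C\<^esub> ?\<rho> h = ?\<rho> (?M ?p) \<oplus>\<^bsub>V.c.C\<^esub> ?\<rho> (?M ?n)"
    using ring_hom_mult[OF \<rho>_hom vertex_fun(1)[OF kJ] h(1)] ring_hom_add[OF \<rho>_hom, of "?M ?p" "?M ?n"] np nn by simp
  let ?c = "V.resV (s h)" and ?d = "\<lambda>p d. \<Sum>i\<in>?J. p i * vertex_weight i d"
  have cc: "?c \<in> carrier V.c.B"
    by (rule P.S.res_closed[OF P.S.openin_points V.c.V_open openin_subset[OF V.c.V_open] V.restriction_res(2)[OF h(1)]])
  have bk: "b k \<in> carrier V.c.B" using b(1) kJ by blast
  have "V.c.\<chi> (\<lambda>d. vertex_weight k d + w d) \<otimes>\<^bsub>V.c.C\<^esub> V.c.\<beta> (b k \<otimes>\<^bsub>V.c.B\<^esub> ?c) = ?\<rho> (vertex_fun k) \<otimes>\<^bsub>V.c.C\<^esub> ?\<rho> h"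
    unfolding V.homogeneous_pullback[OF h(1) w hom] V.c.term_mult[OF bk cc, symmetric] using \<rho>b kJ by simp
  then have eq: "V.c.\<chi> (\<lambda>d. vertex_weight k d + w d) \<otimes>\<^bsub>V.c.C\<^esub> V.c.\<beta> (b k \<otimes>\<^bsub>V.c.B\<^esub> ?c) =
      V.c.\<chi> (?d ?p) \<otimes>\<^bsub>V.c.C\<^esub> V.c.\<beta> (?m ?p) \<oplus>\<^bsub>V.c.C\<^esub> V.c.\<chi> (?d ?n) \<otimes>\<^bsub>V.c.C\<^esub> V.c.\<beta> (?m ?n)"
    using rel np nn by simp
  have lat: "?d p \<in> lattice_on D" for p
    using vertex_fun(3) unfolding lattice_on_def by (auto intro!: sum.neutral)
  have latk: "(\<lambda>d. vertex_weight k d + w d) \<in> lattice_on D" using vertex_fun(3)[OF kJ] w unfolding lattice_on_def by simp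
  have "?d ?p = ?d ?n"
  proof (rule ccontr)
    assume ne: "?d ?p \<noteq> ?d ?n"
    have "?m ?p = \<zero>\<^bsub>V.c.B\<^esub> \<or> ?m ?n = \<zero>\<^bsub>V.c.B\<^esub>"
      by (rule V.c.independent_three[OF latk lat lat ne _ _ _ eq]) (use bk cc np nn in auto)
    then show False using np nn by blast
  qed
  then have "?d ?p d = ?d ?n d" by (rule fun_cong)
  then have "(\<Sum>i\<in>?J. (pos_part (bmat t' i k) - neg_part (bmat t' i k)) * vertex_weight i d) = 0"
    by (simp add: left_diff_distrib sum_subtractf)
  then show ?thesis unfolding pos_neg_part(3) .
qed

lemma exchange_rows:
  assumes k: "k \<in> uf t" and d: "d \<in> D"
  shows "bmat t' d k = - (\<Sum>l\<in>vertices t. lifting_matrix Y P \<XX> \<phi> Xf t d l * bmat t l k)"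
proof -
  have fin: "finite (vertices t)" "finite D" using seedY(3) P.finite_D by auto
  have "0 = (\<Sum>i\<in>vertices t \<union> D. bmat t' i k * vertex_weight i d)"
    using exchange_degrees[OF k, of d] unfolding vertices_ext by simp
  also have "\<dots> = (\<Sum>i\<in>vertices t. bmat t' i k * vertex_weight i d) + (\<Sum>i\<in>D. bmat t' i k * vertex_weight i d)"
    by (rule sum.union_disjoint[OF fin disjoint])
  also have "(\<Sum>i\<in>D. bmat t' i k * vertex_weight i d) = (\<Sum>i\<in>D. if d = i then bmat t' i k else 0)"
    by (rule sum.cong) (auto simp: vertex_weight_def)
  also have "\<dots> = bmat t' d k" using d fin(2) by simp
  also have "(\<Sum>i\<in>vertices t. bmat t' i k * vertex_weight i d) = (\<Sum>l\<in>vertices t. lifting_matrix Y P \<XX> \<phi> Xf t d l * bmat t l k)"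
  proof (rule sum.cong[OF refl])
    fix i assume i: "i \<in> vertices t"
    then have "i \<notin> D" using disjoint by blast
    then show "bmat t' i k * vertex_weight i d = lifting_matrix Y P \<XX> \<phi> Xf t d i * bmat t i k"
      using extension_parts(5)[OF i k] lifting_matrix_weight[OF i d] by (simp add: vertex_weight_def)
  qed
  finally show ?thesis by simp
qed

lemma lifting_degree_vertex_weight:
  assumes i: "i \<in> vertices t'" shows "lifting_degree D Y P \<XX> \<phi> Xf t i = vertex_weight i"
  using i
proof (cases rule: vertexE)
  case 1
  then show ?thesis by (auto simp: lifting_degree_def vertex_weight_def fun_eq_iff)
next
  case 2
  then show ?thesis
    using lifted(4)[OF 2(1)] lifting_matrix_weight[OF 2(1)] by (auto simp: lifting_degree_def vertex_weight_def fun_eq_iff lattice_on_def)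
qed

theorem seed_eq_minimal_lifting: "seed_eq t' (minimal_lifting D Y P \<XX> \<phi> Xf t)"
  unfolding seed_eq_def
proof (intro conjI ballI)
  show "uf t' = uf (minimal_lifting D Y P \<XX> \<phi> Xf t)" "sf t' = sf (minimal_lifting D Y P \<XX> \<phi> Xf t)"
    "hf t' = hf (minimal_lifting D Y P \<XX> \<phi> Xf t)"
    unfolding minimal_lifting_def using extension_parts(1) frozen by simp_all
  show "bmat t' i k = bmat (minimal_lifting D Y P \<XX> \<phi> Xf t) i k" if i: "i \<in> vertices t'" and k: "k \<in> uf t'" for i k
    using i by (cases rule: vertexE) (use k extension_parts(1,5) exchange_rows in \<open>auto simp: minimal_lifting_def\<close>)
  show "cl t' i = cl (minimal_lifting D Y P \<XX> \<phi> Xf t) i" if i: "i \<in> vertices t'" for i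
    using i by (cases rule: vertexE) (use extension_parts(6) cl_lift in \<open>auto simp: minimal_lifting_def\<close>)
qed

text \<open>
  The cluster variable at \<open>i\<close> has degree \<open>\<sigma> i\<close> in the graded upper cluster algebra, so as a regular function it is
  homogeneous of degree \<open>\<sigma> i\<close>. On \<open>T \<times> V\<close> it is a nonzero multiple of the character \<open>vertex_weight i\<close>, and
  characters are independent.
\<close>

theorem degrees_eq_lifting_degree:
  assumes \<sigma>: "degree_configuration D t' \<sigma>"
    and graded: "\<And>w. w \<in> lattice_on D \<Longrightarrow> upper_component K (ff_const \<XX>) t' \<sigma> w =
            ff ` {f \<in> carrier G. homogeneous D T x \<XX> Q a w f}"
    and i: "i \<in> vertices t'"
  shows "\<sigma> i = lifting_degree D Y P \<XX> \<phi> Xf t i"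
proof -
  have \<sigma>i: "\<sigma> i \<in> lattice_on D" using \<sigma> i unfolding degree_configuration_def by blast
  let ?e = "\<lambda>j. if j = i then 1 else (0::int)"
  have "cl t' i \<in> upper_component K (ff_const \<XX>) t' \<sigma> (\<sigma> i)"
    unfolding upper_component_def
  proof
    show "cl t' i \<in> upper_cluster K (ff_const \<XX>) t'"
      unfolding upper_X regular_functions_def using vertex_fun(1,2)[OF i] by blast
    have "(\<Sum>j\<in>vertices t'. ?e j * \<sigma> j d) = \<sigma> i d" for d
    proof -
      have "(\<Sum>j\<in>vertices t'. ?e j * \<sigma> j d) = (\<Sum>j\<in>vertices t'. if i = j then \<sigma> j d else 0)"
        by (rule sum.cong) auto
      then show ?thesis using i seedX(3) by simp
    qed
    then have e: "?e \<in> {m \<in> laurent_exponents t'. \<forall>d. (\<Sum>j\<in>vertices t'. m j * \<sigma> j d) = \<sigma> i d}"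
      using i by (auto simp: laurent_exponents_def lattice_on_def)
    have "(\<Oplus>\<^bsub>K\<^esub>m\<in>{?e}. ff_const \<XX> ((\<lambda>_. 1) m) \<otimes>\<^bsub>K\<^esub> monomial K (vertices t') (cl t') m) = cl t' i"
      using complex_hom(2)[OF seedX(2) K.is_cring] monomial_single[OF i] K.Units_closed[OF cl_unit[OF i]] by simp
    then show "cl t' i \<in> laurent_component K (ff_const \<XX>) t' \<sigma> (\<sigma> i)"
      unfolding laurent_component_def lin_span_def
      using e by (intro CollectI exI[of _ "{?e}"] exI[of _ "\<lambda>_. 1"]) auto
  qed
  then obtain f where f: "f \<in> carrier G" "cl t' i = ff f" "homogeneous D T x \<XX> Q a (\<sigma> i) f"
    unfolding graded[OF \<sigma>i] by blast
  have fF: "f = vertex_fun i" by (rule ff_injective[OF f(1) vertex_fun(1)[OF i]]) (use f(2) vertex_fun(2)[OF i] in simp)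
  obtain V where V: "V \<noteq> {}" "lifting_chart D T x Y P \<XX> \<phi> Xf PP Q QQ a \<iota> V" using chart_exists .
  interpret V: lifting_chart D T x Y P \<XX> \<phi> Xf PP Q QQ a \<iota> V by (rule V(2))
  obtain b where b: "\<forall>i\<in>vertices t'. b i \<in> carrier V.c.B" "\<forall>i\<in>vertices t'. ff_germ Y V (b i) \<in> Units KY"
    and \<rho>b: "\<forall>i\<in>vertices t'. V.resW (gpull \<XX> \<phi> (vertex_fun i)) = V.c.\<chi> (vertex_weight i) \<otimes>\<^bsub>V.c.C\<^esub> V.c.\<beta> (b i)"
    using chart_terms[OF V(2,1)] .
  have bi: "b i \<in> carrier V.c.B" using b(1) i by blast
  let ?c = "V.resV (s f)"
  have cc: "?c \<in> carrier V.c.B"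
    by (rule P.S.res_closed[OF P.S.openin_points V.c.V_open openin_subset[OF V.c.V_open] V.restriction_res(2)[OF f(1)]])
  have e: "V.c.\<chi> (vertex_weight i) \<otimes>\<^bsub>V.c.C\<^esub> V.c.\<beta> (b i) = V.c.\<chi> (\<sigma> i) \<otimes>\<^bsub>V.c.C\<^esub> V.c.\<beta> ?c"
    using V.homogeneous_pullback[OF f(1) \<sigma>i f(3)] \<rho>b i unfolding fF by simp
  have g: "ff_germ Y V \<in> ring_hom V.c.B KY" by (rule YY.ff_hom[OF V.c.V_open V(1)])
  have "b i \<noteq> \<zero>\<^bsub>V.c.B\<^esub>"
    using b(2) i P.S.zero_not_unit[OF YY.eta_points] ring_hom_zero[OF g V.c.B.ring_axioms KY.ring_axioms]
    unfolding function_field_def by metis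
  then have "vertex_weight i = \<sigma> i" using V.c.independent_two[OF vertex_fun(3)[OF i] \<sigma>i _ bi cc e] by blast
  then show ?thesis using lifting_degree_vertex_weight[OF i] by simp
qed

end

theorem theorem1p0p7:
  fixes D :: "'v set"
    and T :: "('t, 'u) ringed_space" and x :: "'v \<Rightarrow> 'u"
    and Y :: "('q, 'r) ringed_space"
    and P :: "('t, 'u, 'q, 'r, 'z, 'w) product_data"
    and \<XX> :: "('p, 's) ringed_space"
    and \<phi> :: "('z, 'w, 'p, 's) morph"
    and Xf :: "'v \<Rightarrow> 's"
    and PP :: "('t, 'u, 'z, 'w, 'i, 'j) product_data"
    and Q :: "('t, 'u, 'p, 's, 'k, 'l) product_data"
    and QQ :: "('t, 'u, 'k, 'l, 'm, 'n) product_data"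
    and a :: "('k, 'l, 'p, 's) morph"
    and \<iota> :: "('q, 'r, 'z, 'w) morph"
    and t :: "('v, ('q set \<times> 'r) set) seed"
    and t' :: "('v, ('p set \<times> 's) set) seed"
  assumes suitable: "homogeneously_suitable D T x Y P \<XX> \<phi> Xf PP Q QQ a"
    and unit_section: "is_unit_section D T x Y P \<iota>"
    and seed: "is_seed (function_field Y) (ff_const Y) t"
    and disjoint: "vertices t \<inter> D = {}"
    and max_rank: "maximal_rank t"
    and upper_Y: "upper_cluster (function_field Y) (ff_const Y) t = regular_functions Y"
    and coprime_vars: "\<And>i j. i \<in> uf t \<Longrightarrow> j \<in> uf t \<Longrightarrow> i \<noteq> j \<Longrightarrow> ff_coprime_on Y (cl t i) (cl t j)"
    and coprime_mut: "\<And>k. k \<in> uf t \<Longrightarrow> ff_coprime_on Y (cl t k) (mut_var (function_field Y) t k)"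
    and extension: "pointed_seed_extension D \<XX> Xf t t'"
    and lift_vars: "\<And>i. i \<in> vertices t \<Longrightarrow>
      homogeneous_lift D T x Y P \<XX> \<phi> \<iota> Q a (cl t' i) (cl t i)"
    and lift_mut: "\<And>k. k \<in> uf t \<Longrightarrow>
      homogeneous_lift D T x Y P \<XX> \<phi> \<iota> Q a
        (mut_var (function_field \<XX>) t' k) (mut_var (function_field Y) t k)"
    and upper_X: "upper_cluster (function_field \<XX>) (ff_const \<XX>) t' = regular_functions \<XX>"
  shows "seed_eq t' (minimal_lifting D Y P \<XX> \<phi> Xf t) \<and>
    (\<forall>\<sigma>. degree_configuration D t' \<sigma> \<and>
         (\<forall>w\<in>lattice_on D. upper_component (function_field \<XX>) (ff_const \<XX>) t' \<sigma> w =
            ff_of \<XX> ` {f \<in> carrier (glob \<XX>). homogeneous D T x \<XX> Q a w f}) \<longrightarrow>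
       seed_eq t' (minimal_lifting D Y P \<XX> \<phi> Xf t) \<and>
       (\<forall>i\<in>vertices t'. \<sigma> i = lifting_degree D Y P \<XX> \<phi> Xf t i))"
proof -
  interpret lifting_seeds D T x Y P \<XX> \<phi> Xf PP Q QQ a \<iota> t t'
    by (intro lifting_seeds.intro lifting_space.intro lifting_seeds_axioms.intro;
        fact suitable unit_section seed disjoint extension lift_vars lift_mut upper_X)
  show ?thesis
  proof (intro conjI allI impI ballI)
    show "seed_eq t' (minimal_lifting D Y P \<XX> \<phi> Xf t)" by (rule seed_eq_minimal_lifting)
    then show "seed_eq t' (minimal_lifting D Y P \<XX> \<phi> Xf t)" .
    fix \<sigma> i
    assume \<sigma>: "degree_configuration D t' \<sigma> \<and>
         (\<forall>w\<in>lattice_on D. upper_component (function_field \<XX>) (ff_const \<XX>) t' \<sigma> w =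
            ff_of \<XX> ` {f \<in> carrier (glob \<XX>). homogeneous D T x \<XX> Q a w f})" and i: "i \<in> vertices t'"
    show "\<sigma> i = lifting_degree D Y P \<XX> \<phi> Xf t i"
      by (rule degrees_eq_lifting_degree[OF _ _ i]) (use \<sigma> in blast)+
  qed
qed

end
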